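(* Let $R$ be a countable Boolean ring with Stone space $X$, let $P$ be a PO system and let $\{X_{p}\mid p\in P\}$ be a complete $P$-partition of $X$. Then the system $(R,\{I(\overline{X_{p}})\mid p\in P\})$ is $\omega$-categorical if and only if $\{X_{p}\mid p\in P\}$ is finite-crowded.
   Context: Boolean rings need not have an identity. The Stone space $X$ of a Boolean ring $R$ is the locally compact, totally disconnected Hausdorff space whose compact open subsets form a ring isomorphic to $R$; we identify $R$ with the ring of compact open subsets of $X$. For a closed $C\subseteq X$, $I(C)=\{A\in R\mid A\cap C=\emptyset\}$ is the corresponding ideal. A system consisting of $R$ with distinguished ideals is regarded as a structure in the language of Boolean rings with one unary predicate per ideal; a countable structure is $\omega$-categorical if its first-order theory has, up to isomorphism, exactly one countable model. $S^{\prime}$ denotes the derived set (set of limit points) of $S\subseteq X$, $\overline{S}$ its closure; $S$ is crowded if it has no isolated points. A PO system is a set $P$ with an antisymmetric transitive relation $<$ (possibly $p<p$). A partition $\{X_{p}\mid p\in P\}$ of $X$ is a complete $P$-partition if $X_{p}^{\prime}=\bigcup_{q<p}X_{q}$ for all $p\in P$. A partition is finite-crowded if it is finite and each of its elements is either finite or crowded. *)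

theory Defs
  imports "HOL-Analysis.Analysis" "HOL-Library.Disjoint_Sets"
begin

section \<open>First-order logic of rings with distinguished subsets\<close>

text \<open>
  The language has a constant for zero, binary function symbols for addition and
  multiplication, equality, and one unary predicate symbol for each index \<open>p\<close>.
  There is no symbol for a multiplicative identity. Variables are named by natural numbers.
\<close>

datatype rterm = Var nat | Zero | Plus rterm rterm | Times rterm rterm

datatype 'p form =
    Eq rterm rterm
  | Pred 'p rterm
  | Neg "'p form"
  | Conj "'p form" "'p form"
  | Ex nat "'p form"

record ('a, 'p) pstruct =
  univ :: "'a set"
  zer :: "'a"
  add :: "'a \<Rightarrow> 'a \<Rightarrow> 'a"
  mul :: "'a \<Rightarrow> 'a \<Rightarrow> 'a"
  pred :: "'p \<Rightarrow> 'a set"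

fun tvars :: "rterm \<Rightarrow> nat set" where
  "tvars (Var n) = {n}"
| "tvars Zero = {}"
| "tvars (Plus s t) = tvars s \<union> tvars t"
| "tvars (Times s t) = tvars s \<union> tvars t"

fun fvars :: "'p form \<Rightarrow> nat set" where
  "fvars (Eq s t) = tvars s \<union> tvars t"
| "fvars (Pred p t) = tvars t"
| "fvars (Neg f) = fvars f"
| "fvars (Conj f g) = fvars f \<union> fvars g"
| "fvars (Ex n f) = fvars f - {n}"

definition sentence :: "'p set \<Rightarrow> 'p form \<Rightarrow> bool" where
  "sentence P f \<longleftrightarrow> fvars f = {} \<and> set_form f \<subseteq> P"

fun tval :: "('a, 'p) pstruct \<Rightarrow> (nat \<Rightarrow> 'a) \<Rightarrow> rterm \<Rightarrow> 'a" where
  "tval M v (Var n) = v n"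
| "tval M v Zero = zer M"
| "tval M v (Plus s t) = add M (tval M v s) (tval M v t)"
| "tval M v (Times s t) = mul M (tval M v s) (tval M v t)"

fun sat :: "('a, 'p) pstruct \<Rightarrow> (nat \<Rightarrow> 'a) \<Rightarrow> 'p form \<Rightarrow> bool" where
  "sat M v (Eq s t) \<longleftrightarrow> tval M v s = tval M v t"
| "sat M v (Pred p t) \<longleftrightarrow> tval M v t \<in> pred M p"
| "sat M v (Neg f) \<longleftrightarrow> \<not> sat M v f"
| "sat M v (Conj f g) \<longleftrightarrow> sat M v f \<and> sat M v g"
| "sat M v (Ex n f) \<longleftrightarrow> (\<exists>a\<in>univ M. sat M (v(n := a)) f)"

definition holds :: "('a, 'p) pstruct \<Rightarrow> 'p form \<Rightarrow> bool" where
  "holds M f \<longleftrightarrow> (\<forall>v. range v \<subseteq> univ M \<longrightarrow> sat M v f)"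

text \<open>
  A structure for the language with predicate symbols from \<open>P\<close>; the values of \<open>pred M\<close>
  outside \<open>P\<close> are irrelevant throughout.
\<close>

definition is_pstruct :: "'p set \<Rightarrow> ('a, 'p) pstruct \<Rightarrow> bool" where
  "is_pstruct P M \<longleftrightarrow>
     zer M \<in> univ M \<and>
     (\<forall>a\<in>univ M. \<forall>b\<in>univ M. add M a b \<in> univ M \<and> mul M a b \<in> univ M) \<and>
     (\<forall>p\<in>P. pred M p \<subseteq> univ M)"

definition pstruct_iso :: "'p set \<Rightarrow> ('a, 'p) pstruct \<Rightarrow> ('b, 'p) pstruct \<Rightarrow> bool" where
  "pstruct_iso P M N \<longleftrightarrow>
     (\<exists>h. bij_betw h (univ M) (univ N) \<and>
          h (zer M) = zer N \<and>
          (\<forall>a\<in>univ M. \<forall>b\<in>univ M.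
             h (add M a b) = add N (h a) (h b) \<and> h (mul M a b) = mul N (h a) (h b)) \<and>
          (\<forall>p\<in>P. \<forall>a\<in>univ M. a \<in> pred M p \<longleftrightarrow> h a \<in> pred N p))"

definition Th :: "'p set \<Rightarrow> ('a, 'p) pstruct \<Rightarrow> 'p form set" where
  "Th P M = {f. sentence P f \<and> holds M f}"

definition countable_model :: "'p set \<Rightarrow> 'p form set \<Rightarrow> ('a, 'p) pstruct \<Rightarrow> bool" where
  "countable_model P T N \<longleftrightarrow>
     is_pstruct P N \<and> countable (univ N) \<and> (\<forall>f\<in>T. holds N f)"

text \<open>
  Every countable structure is isomorphic to one whose universe is a set of natural numbers,
  so it suffices to let the models range over such structures. Finite models count as
  countable, so that a finite structure is \<open>\<omega>\<close>-categorical.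
\<close>

definition omega_categorical :: "'p set \<Rightarrow> ('a, 'p) pstruct \<Rightarrow> bool" where
  "omega_categorical P M \<longleftrightarrow>
     countable (univ M) \<and>
     (\<exists>N :: (nat, 'p) pstruct. countable_model P (Th P M) N \<and>
        (\<forall>N' :: (nat, 'p) pstruct. countable_model P (Th P M) N' \<longrightarrow> pstruct_iso P N' N))"


section \<open>Boolean rings and their Stone spaces\<close>

text \<open>The class \<open>ring\<close> does not require an identity.\<close>

class boolean_ring = ring +
  assumes mult_idem: "a * a = a"

definition totally_disconnected_space :: "'x topology \<Rightarrow> bool" where
  "totally_disconnected_space X \<longleftrightarrow> (\<forall>S. connectedin X S \<longrightarrow> (\<exists>x. S \<subseteq> {x}))"

text \<open>
  \<open>X\<close> is the Stone space of the ring \<open>'r\<close>, where \<open>\<phi>\<close> identifies ring elements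
  with compact open subsets of \<open>X\<close>.
\<close>

definition stone_space :: "'x topology \<Rightarrow> ('r::boolean_ring \<Rightarrow> 'x set) \<Rightarrow> bool" where
  "stone_space X \<phi> \<longleftrightarrow>
     Hausdorff_space X \<and> locally_compact_space X \<and> totally_disconnected_space X \<and>
     bij_betw \<phi> UNIV {A. openin X A \<and> compactin X A} \<and>
     (\<forall>a b. \<phi> (a + b) = sym_diff (\<phi> a) (\<phi> b)) \<and>
     (\<forall>a b. \<phi> (a * b) = \<phi> a \<inter> \<phi> b)"

definition stone_ideal :: "('r \<Rightarrow> 'x set) \<Rightarrow> 'x set \<Rightarrow> 'r set" where
  "stone_ideal \<phi> C = {a. \<phi> a \<inter> C = {}}"

definition ring_with_ideals :: "('p \<Rightarrow> 'r::boolean_ring set) \<Rightarrow> ('r, 'p) pstruct" where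
  "ring_with_ideals I = \<lparr>univ = UNIV, zer = 0, add = (+), mul = (*), pred = I\<rparr>"


section \<open>Partitions indexed by PO systems\<close>

definition PO_system :: "'p set \<Rightarrow> ('p \<Rightarrow> 'p \<Rightarrow> bool) \<Rightarrow> bool" where
  "PO_system P lt \<longleftrightarrow> antisymp_on P lt \<and> transp_on P lt"

text \<open>
  Blocks of a partition are nonempty (part of \<open>partition_on\<close>), and distinct indices
  denote distinct blocks.
\<close>

definition indexed_partition :: "'x topology \<Rightarrow> 'p set \<Rightarrow> ('p \<Rightarrow> 'x set) \<Rightarrow> bool" where
  "indexed_partition X P B \<longleftrightarrow> partition_on (topspace X) (B ` P) \<and> inj_on B P"

definition complete_partition ::
  "'x topology \<Rightarrow> 'p set \<Rightarrow> ('p \<Rightarrow> 'p \<Rightarrow> bool) \<Rightarrow> ('p \<Rightarrow> 'x set) \<Rightarrow> bool" where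
  "complete_partition X P lt B \<longleftrightarrow>
     indexed_partition X P B \<and>
     (\<forall>p\<in>P. X derived_set_of (B p) = (\<Union>q\<in>{q\<in>P. lt q p}. B q))"

definition crowded :: "'x topology \<Rightarrow> 'x set \<Rightarrow> bool" where
  "crowded X S \<longleftrightarrow> \<not> (\<exists>x\<in>S. \<exists>U. openin X U \<and> U \<inter> S = {x})"

definition finite_crowded :: "'x topology \<Rightarrow> 'x set set \<Rightarrow> bool" where
  "finite_crowded X \<B> \<longleftrightarrow> finite \<B> \<and> (\<forall>S\<in>\<B>. finite S \<or> crowded X S)"

end

theory Submission
  imports Defs
begin

text \<open>
  The ring is identified with the ring of compact open sets, and such structures are compared by
  Ehrenfeucht-Fraisse games in which finite partitions into clopen cells are refined: two cells are
  matched if they have the same trace on a fixed closed set and, up to a threshold, the same number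
  of points of each type outside of it. In the finite-crowded case the type of a tuple is determined
  by the blocks that its cells meet and by the numbers of their points in the finite blocks. Hence
  there are finitely many types, and isolating formulas give a back-and-forth argument.

  For the converse, \<open>P\<close> may be uncountable, so that the theorem of Ryll-Nardzewski does not apply.
  Instead, if the partition is not finite-crowded, an elementarily equivalent countable structure is
  obtained by attaching copies of compact open sets to a new point or to given points, and it is told
  apart from the ring by the sets of blocks that its elements meet. If \<open>P\<close> is finite and some
  infinite block is not crowded, copies of a neighbourhood of one of its points do. If \<open>P\<close> is
  infinite, let \<open>Ost\<close> be the set of points with a neighbourhood that meets finitely many blocks.
  Either infinitely many blocks meet \<open>Ost\<close>, and copies of neighbourhoods of points from infinitely
  many of them are used, or one works near a point outside \<open>Ost\<close> that is a limit of as few of these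
  blocks as possible.
\<close>

section \<open>Elementary equivalence and isomorphism\<close>

text \<open>A sentence mentions only finitely many blocks, whereas an isomorphism preserves, for
  every element, the set of all blocks that it meets. The converse lives in this gap. One structure
  is attached to the ring, but the equivalence is proved sentence by sentence: the closed set that
  is held fixed in the game and the division of the remaining points into types are chosen anew each
  time, so that blocks outside the sentence may be changed or dropped. Copies may lose colours, so
  the new structures need not come from complete partitions of their own; this is why the game is
  set up for arbitrary colours on fields of sets. The obstacle in the game is that small numbers of
  points must be reproduced exactly, while every neighbourhood of a chosen point brings along points
  of other types. This is harmless because a type occurring arbitrarily close to a point has
  infinitely many points there, unless it is the discrete type of the point itself.\<close>

lemma tval_cong:
  assumes "\<And>n. n \<in> tvars t \<Longrightarrow> v n = w n"
  shows "tval M v t = tval M w t"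
  using assms by (induction t) auto

lemma sat_cong:
  assumes "\<And>n. n \<in> fvars f \<Longrightarrow> v n = w n"
  shows "sat M v f = sat M w f"
  using assms
proof (induction f arbitrary: v w)
  case (Eq s t)
  then have "tval M v s = tval M w s" "tval M v t = tval M w t"
    by (auto intro: tval_cong)
  then show ?case by simp
next
  case (Pred p t)
  then have "tval M v t = tval M w t"
    by (auto intro: tval_cong)
  then show ?case by simp
next
  case (Neg f)
  then show ?case by (metis fvars.simps(3) sat.simps(3))
next
  case (Conj f g)
  then show ?case by (metis UnCI fvars.simps(4) sat.simps(4))
next
  case (Ex n f)
  have "sat M (v(n := a)) f = sat M (w(n := a)) f" for a
    using Ex by (intro Ex.IH) auto
  then show ?case by simp
qed

lemma holds_closed:
  assumes "fvars f = {}" "zer M \<in> univ M"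
  shows "holds M f \<longleftrightarrow> sat M v f"
proof -
  have "sat M w f = sat M v f" for w
    using assms by (intro sat_cong) auto
  moreover have "\<exists>w. range w \<subseteq> univ M"
    using assms(2) by (intro exI[of _ "\<lambda>_. zer M"]) auto
  ultimately show ?thesis unfolding holds_def by metis
qed

lemma finite_set_form: "finite (set_form f)"
  by (induction f) auto

lemma finite_fvars: "finite (fvars f)"
proof (induction f)
  have *: "finite (tvars t)" for t by (induction t) auto
  case (Eq s t) then show ?case using * by simp
next
  have *: "finite (tvars t)" for t by (induction t) auto
  case (Pred p t) then show ?case using * by simp
qed auto

definition elem_equiv :: "'p set \<Rightarrow> ('a, 'p) pstruct \<Rightarrow> ('b, 'p) pstruct \<Rightarrow> bool" where
  "elem_equiv P M N \<longleftrightarrow> (\<forall>f. sentence P f \<longrightarrow> holds M f = holds N f)"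

lemma tval_iso:
  assumes "is_pstruct P M" "h (zer M) = zer N"
    "\<And>a b. a \<in> univ M \<Longrightarrow> b \<in> univ M \<Longrightarrow> h (add M a b) = add N (h a) (h b) \<and> h (mul M a b) = mul N (h a) (h b)"
    "range v \<subseteq> univ M"
  shows "tval M v t \<in> univ M \<and> tval N (h \<circ> v) t = h (tval M v t)"
  using assms by (induction t) (auto simp: is_pstruct_def)

lemma sat_iso:
  assumes M: "is_pstruct P M" and h: "bij_betw h (univ M) (univ N)" "h (zer M) = zer N"
    "\<And>a b. a \<in> univ M \<Longrightarrow> b \<in> univ M \<Longrightarrow> h (add M a b) = add N (h a) (h b) \<and> h (mul M a b) = mul N (h a) (h b)"
    "\<And>p a. p \<in> P \<Longrightarrow> a \<in> univ M \<Longrightarrow> a \<in> pred M p \<longleftrightarrow> h a \<in> pred N p"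
  shows "range v \<subseteq> univ M \<Longrightarrow> set_form f \<subseteq> P \<Longrightarrow> sat M v f = sat N (h \<circ> v) f"
proof (induction f arbitrary: v)
  case (Eq s t)
  have *: "tval M v s \<in> univ M \<and> tval N (h \<circ> v) s = h (tval M v s)"
    "tval M v t \<in> univ M \<and> tval N (h \<circ> v) t = h (tval M v t)"
    using tval_iso[OF M h(2,3) Eq.prems(1)] by auto
  have "h (tval M v s) = h (tval M v t) \<longleftrightarrow> tval M v s = tval M v t"
    using inj_on_eq_iff[OF bij_betw_imp_inj_on[OF h(1)]] * by blast
  then show ?case using * by (metis sat.simps(1))
next
  case (Pred p t)
  have *: "tval M v t \<in> univ M \<and> tval N (h \<circ> v) t = h (tval M v t)"
    using tval_iso[OF M h(2,3) Pred.prems(1)] by auto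
  then show ?case using h(4)[of p "tval M v t"] Pred.prems by (simp del: comp_apply)
next
  case (Neg f)
  then show ?case by simp
next
  case (Conj f g)
  then show ?case by simp
next
  case (Ex n f)
  have "sat M (v(n := a)) f = sat N ((h \<circ> v)(n := h a)) f" if "a \<in> univ M" for a
  proof -
    have "range (v(n := a)) \<subseteq> univ M" using Ex.prems that by (auto simp: image_subset_iff)
    then have "sat M (v(n := a)) f = sat N (h \<circ> v(n := a)) f"
      using Ex.prems by (intro Ex.IH) auto
    then show ?thesis by (simp add: fun_upd_comp)
  qed
  moreover have N: "univ N = h ` univ M" using h(1) by (auto simp: bij_betw_def)
  ultimately show ?case unfolding sat.simps N bex_simps by (intro bex_cong) auto
qed

lemma pstruct_iso_imp_elem_equiv:
  assumes "is_pstruct P M" "pstruct_iso P M N"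
  shows "elem_equiv P M N"
  unfolding elem_equiv_def
proof (intro allI impI)
  fix f assume f: "sentence P f"
  obtain h where h: "bij_betw h (univ M) (univ N)" "h (zer M) = zer N"
    "\<And>a b. a \<in> univ M \<Longrightarrow> b \<in> univ M \<Longrightarrow> h (add M a b) = add N (h a) (h b) \<and> h (mul M a b) = mul N (h a) (h b)"
    "\<And>p a. p \<in> P \<Longrightarrow> a \<in> univ M \<Longrightarrow> a \<in> pred M p \<longleftrightarrow> h a \<in> pred N p"
    using assms(2) unfolding pstruct_iso_def by blast
  have z: "zer M \<in> univ M" using assms(1) by (simp add: is_pstruct_def)
  then have z': "zer N \<in> univ N" using h(1,2) by (metis bij_betwE)
  have "sat M (\<lambda>_. zer M) f = sat N (h \<circ> (\<lambda>_. zer M)) f"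
    using z f by (intro sat_iso[OF assms(1) h]) (auto simp: sentence_def)
  then show "holds M f = holds N f"
    using holds_closed[OF _ z] holds_closed[OF _ z'] f by (metis sentence_def)
qed

lemma pstruct_iso_sym:
  assumes "is_pstruct P M" "pstruct_iso P M N"
  shows "pstruct_iso P N M"
proof -
  obtain h where h: "bij_betw h (univ M) (univ N)" "h (zer M) = zer N"
    "\<And>a b. a \<in> univ M \<Longrightarrow> b \<in> univ M \<Longrightarrow> h (add M a b) = add N (h a) (h b) \<and> h (mul M a b) = mul N (h a) (h b)"
    "\<And>p a. p \<in> P \<Longrightarrow> a \<in> univ M \<Longrightarrow> a \<in> pred M p \<longleftrightarrow> h a \<in> pred N p"
    using assms(2) unfolding pstruct_iso_def by blast
  define g where "g = inv_into (univ M) h"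
  have g: "bij_betw g (univ N) (univ M)" unfolding g_def using h(1) by (rule bij_betw_inv_into)
  have gh: "g (h a) = a" if "a \<in> univ M" for a
    unfolding g_def using h(1) that by (rule bij_betw_inv_into_left)
  have hg: "h (g b) = b" "g b \<in> univ M" if "b \<in> univ N" for b
    using g h(1) that unfolding g_def
    by (auto intro: bij_betw_inv_into_right bij_betwE[OF g, unfolded g_def, rule_format])
  have cl: "zer M \<in> univ M" "add M a b \<in> univ M" "mul M a b \<in> univ M"
    if "a \<in> univ M" "b \<in> univ M" for a b
    using assms(1) that by (auto simp: is_pstruct_def)
  have z: "g (zer N) = zer M" using gh[of "zer M"] assms(1) h(2) by (simp add: is_pstruct_def)
  have ops: "g (add N a b) = add M (g a) (g b)" "g (mul N a b) = mul M (g a) (g b)"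
    if "a \<in> univ N" "b \<in> univ N" for a b
    using h(3)[of "g a" "g b"] hg[OF that(1)] hg[OF that(2)] gh cl[of "g a" "g b"] by metis+
  have "a \<in> pred N p \<longleftrightarrow> g a \<in> pred M p" if "p \<in> P" "a \<in> univ N" for p a
    using h(4)[of p "g a"] hg that by metis
  with g z ops show ?thesis unfolding pstruct_iso_def by blast
qed

lemma pstruct_iso_trans:
  assumes "pstruct_iso P M N" "pstruct_iso P N L"
  shows "pstruct_iso P M L"
proof -
  obtain h where h: "bij_betw h (univ M) (univ N)" "h (zer M) = zer N"
    "\<And>a b. a \<in> univ M \<Longrightarrow> b \<in> univ M \<Longrightarrow> h (add M a b) = add N (h a) (h b) \<and> h (mul M a b) = mul N (h a) (h b)"
    "\<And>p a. p \<in> P \<Longrightarrow> a \<in> univ M \<Longrightarrow> a \<in> pred M p \<longleftrightarrow> h a \<in> pred N p"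
    using assms(1) unfolding pstruct_iso_def by blast
  obtain k where k: "bij_betw k (univ N) (univ L)" "k (zer N) = zer L"
    "\<And>a b. a \<in> univ N \<Longrightarrow> b \<in> univ N \<Longrightarrow> k (add N a b) = add L (k a) (k b) \<and> k (mul N a b) = mul L (k a) (k b)"
    "\<And>p a. p \<in> P \<Longrightarrow> a \<in> univ N \<Longrightarrow> a \<in> pred N p \<longleftrightarrow> k a \<in> pred L p"
    using assms(2) unfolding pstruct_iso_def by blast
  have m: "h a \<in> univ N" if "a \<in> univ M" for a using h(1) that by (auto dest: bij_betwE)
  have "bij_betw (k \<circ> h) (univ M) (univ L)" using h(1) k(1) by (rule bij_betw_trans)
  then show ?thesis unfolding pstruct_iso_def
    using h k m by (intro exI[of _ "k \<circ> h"]) auto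
qed

lemma countable_pstruct_copy:
  fixes M :: "('a, 'p) pstruct"
  assumes M: "is_pstruct P M" and "countable (univ M)"
  obtains N :: "(nat, 'p) pstruct" where "is_pstruct P N" "pstruct_iso P M N"
proof -
  define f where "f = to_nat_on (univ M)"
  define g where "g = inv_into (univ M) f"
  have inj: "inj_on f (univ M)" unfolding f_def using assms(2) by (rule inj_on_to_nat_on)
  have gf: "g (f a) = a" if "a \<in> univ M" for a using inj that by (simp add: g_def)
  define N :: "(nat, 'p) pstruct" where
    "N = \<lparr>univ = f ` univ M, zer = f (zer M), add = (\<lambda>a b. f (add M (g a) (g b))),
          mul = (\<lambda>a b. f (mul M (g a) (g b))), pred = (\<lambda>p. f ` (pred M p))\<rparr>"
  have 1: "is_pstruct P N" using M unfolding is_pstruct_def N_def by (auto simp: gf intro!: imageI)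
  have "a \<in> pred M p \<longleftrightarrow> f a \<in> f ` pred M p" if "p \<in> P" "a \<in> univ M" for a p
    using M that inj unfolding is_pstruct_def by (meson inj_on_image_mem_iff)
  then have 2: "pstruct_iso P M N" unfolding pstruct_iso_def using inj M
    by (intro exI[of _ f]) (auto simp: N_def gf bij_betw_def is_pstruct_def)
  from 1 2 that show ?thesis by blast
qed

lemma elem_equiv_trans: "elem_equiv P M N \<Longrightarrow> elem_equiv P N L \<Longrightarrow> elem_equiv P M L"
  by (auto simp: elem_equiv_def)

lemma holds_Th_imp_elem_equiv:
  assumes "is_pstruct P M" "is_pstruct P N" "\<forall>f\<in>Th P M. holds N f"
  shows "elem_equiv P M N"
  unfolding elem_equiv_def
proof (intro allI impI)
  fix f assume f: "sentence P f"
  have z: "zer M \<in> univ M" "zer N \<in> univ N" using assms by (auto simp: is_pstruct_def)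
  have s: "sentence P (Neg f)" using f by (simp add: sentence_def)
  show "holds M f = holds N f"
  proof (cases "holds M f")
    case True then show ?thesis using assms(3) f by (simp add: Th_def)
  next
    case False
    have *: "holds M (Neg f)"
      using holds_closed[OF _ z(1)] f s False by (metis sat.simps(3) sentence_def)
    then have "holds N (Neg f)" using assms(3) s by (simp add: Th_def)
    then show ?thesis using holds_closed[OF _ z(2)] f s False by (metis sat.simps(3) sentence_def)
  qed
qed

lemma elem_equiv_imp_holds_Th: "elem_equiv P M N \<Longrightarrow> \<forall>f\<in>Th P M. holds N f"
  by (auto simp: elem_equiv_def Th_def)

lemma nat_model_of_Th:
  fixes M :: "('a, 'p) pstruct" and L :: "('b, 'p) pstruct"
  assumes "is_pstruct P L" "countable (univ L)" "elem_equiv P M L"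
  obtains L' :: "(nat, 'p) pstruct" where
    "is_pstruct P L'" "pstruct_iso P L L'" "countable_model P (Th P M) L'"
proof -
  obtain L' :: "(nat, 'p) pstruct" where L': "is_pstruct P L'" "pstruct_iso P L L'"
    using countable_pstruct_copy[OF assms(1,2)] by blast
  have "elem_equiv P M L'"
    using elem_equiv_trans[OF assms(3) pstruct_iso_imp_elem_equiv[OF assms(1) L'(2)]] .
  then have "countable_model P (Th P M) L'"
    unfolding countable_model_def using L'(1) elem_equiv_imp_holds_Th by blast
  with L' that show ?thesis by blast
qed

text \<open>The definition only speaks of models over \<open>nat\<close>. Both structures are
  replaced by isomorphic copies there, so that uniqueness applies to the structures on sets of
  points built below.\<close>

lemma omega_categorical_unique:
  fixes M :: "('a, 'p) pstruct" and N :: "('b, 'p) pstruct"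
  assumes oc: "omega_categorical P M" and M: "is_pstruct P M"
    and N: "is_pstruct P N" "countable (univ N)" "elem_equiv P M N"
  shows "pstruct_iso P M N"
proof -
  obtain K :: "(nat, 'p) pstruct" where
    K: "\<And>N' :: (nat, 'p) pstruct. countable_model P (Th P M) N' \<Longrightarrow> pstruct_iso P N' K"
    using oc unfolding omega_categorical_def by blast
  have "countable (univ M)" using oc by (simp add: omega_categorical_def)
  moreover have "elem_equiv P M M" by (simp add: elem_equiv_def)
  ultimately obtain M' :: "(nat, 'p) pstruct" where
    M': "pstruct_iso P M M'" "countable_model P (Th P M) M'"
    using nat_model_of_Th[OF M] by blast
  obtain N' :: "(nat, 'p) pstruct" where
    N': "is_pstruct P N'" "pstruct_iso P N N'" "countable_model P (Th P M) N'"
    using nat_model_of_Th[OF N] by blast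
  have "pstruct_iso P M K" using M' K pstruct_iso_trans by blast
  moreover have "pstruct_iso P N K" using N' K pstruct_iso_trans by blast
  ultimately show ?thesis using pstruct_iso_sym[OF N(1)] pstruct_iso_trans by blast
qed

section \<open>Back-and-forth between fields of sets\<close>

text \<open>
  A ring of sets with coloured points is presented as the sets of a field that avoid a point \<open>e\<close>
  (the point at infinity); the field itself has a unit, which makes complements available.
\<close>

definition ring_struct :: "'y set set \<Rightarrow> 'y \<Rightarrow> ('p \<Rightarrow> 'y set) \<Rightarrow> ('y set, 'p) pstruct" where
  "ring_struct F e C = \<lparr>univ = {A \<in> F. e \<notin> A}, zer = {}, add = sym_diff, mul = (\<inter>),
     pred = (\<lambda>p. {A \<in> F. e \<notin> A \<and> A \<inter> C p = {}})\<rparr>"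

lemma ring_struct_simps [simp]:
  "univ (ring_struct F e C) = {A \<in> F. e \<notin> A}"
  "zer (ring_struct F e C) = {}"
  "add (ring_struct F e C) A B = sym_diff A B"
  "mul (ring_struct F e C) A B = A \<inter> B"
  "pred (ring_struct F e C) p = {A \<in> F. e \<notin> A \<and> A \<inter> C p = {}}"
  by (auto simp: ring_struct_def)

lemma is_pstruct_ring_struct:
  assumes "algebra Y F"
  shows "is_pstruct P (ring_struct F e C)"
proof -
  interpret algebra Y F by fact
  show ?thesis by (auto simp: is_pstruct_def)
qed

fun qdepth :: "'p form \<Rightarrow> nat" where
  "qdepth (Eq s t) = 0"
| "qdepth (Pred p t) = 0"
| "qdepth (Neg f) = qdepth f"
| "qdepth (Conj f g) = max (qdepth f) (qdepth g)"
| "qdepth (Ex n f) = Suc (qdepth f)"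

lemma UN_diff_disjoint_family:
  assumes "disjoint_family_on A K" "J \<subseteq> K" "L \<subseteq> K"
  shows "\<Union>(A ` J) - \<Union>(A ` L) = \<Union>(A ` (J - L))"
  using assms unfolding disjoint_family_on_def by fastforce

lemma UN_Int_disjoint_family:
  assumes "disjoint_family_on A K" "J \<subseteq> K" "L \<subseteq> K"
  shows "\<Union>(A ` J) \<inter> \<Union>(A ` L) = \<Union>(A ` (J \<inter> L))"
  using assms unfolding disjoint_family_on_def by fastforce

text \<open>\<open>rel m A B\<close> is meant to say that the second player survives
  \<open>m\<close> more moves when the game is played inside these two cells. A move splits every
  cell independently of the others, so local strategies combine and only single cells need to be
  compared. Cells may contain the point \<open>e\<close>, although elements of the ring do
  not.\<close>

locale ef_system = F1: algebra Y1 F1 + F2: algebra Y2 F2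
  for Y1 Y2 :: "'y set" and F1 F2 +
  fixes e :: 'y and C1 C2 :: "'p \<Rightarrow> 'y set" and Q :: "'p set"
    and rel :: "nat \<Rightarrow> 'y set \<Rightarrow> 'y set \<Rightarrow> bool"
  assumes rel_sets: "rel m A B \<Longrightarrow> A \<in> F1 \<and> B \<in> F2"
    and rel_empty: "rel m A B \<Longrightarrow> A = {} \<longleftrightarrow> B = {}"
    and rel_pt: "rel m A B \<Longrightarrow> e \<in> A \<longleftrightarrow> e \<in> B"
    and rel_col: "rel m A B \<Longrightarrow> p \<in> Q \<Longrightarrow> A \<inter> C1 p = {} \<longleftrightarrow> B \<inter> C2 p = {}"
    and forth: "rel (Suc m) A B \<Longrightarrow> A1 \<in> F1 \<Longrightarrow> A1 \<subseteq> A \<Longrightarrow>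
      \<exists>B1\<in>F2. B1 \<subseteq> B \<and> rel m A1 B1 \<and> rel m (A - A1) (B - B1)"
    and retro: "rel (Suc m) A B \<Longrightarrow> B1 \<in> F2 \<Longrightarrow> B1 \<subseteq> B \<Longrightarrow>
      \<exists>A1\<in>F1. A1 \<subseteq> A \<and> rel m A1 B1 \<and> rel m (A - A1) (B - B1)"
begin

lemma ef_system_sym: "ef_system Y2 Y1 F2 F1 e C2 C1 Q (\<lambda>m A B. rel m B A)"
proof
  show "\<exists>B1\<in>F1. B1 \<subseteq> B \<and> rel m B1 A1 \<and> rel m (B - B1) (A - A1)"
    if "rel (Suc m) B A" "A1 \<in> F2" "A1 \<subseteq> A" for m B A A1
    using retro[OF that] .
  show "\<exists>A1\<in>F2. A1 \<subseteq> A \<and> rel m B1 A1 \<and> rel m (B - B1) (A - A1)"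
    if "rel (Suc m) B A" "B1 \<in> F1" "B1 \<subseteq> B" for m B A B1
    using forth[OF that] .
next
  fix m B A assume r: "rel m B A"
  show "A \<in> F2 \<and> B \<in> F1" using rel_sets[OF r] by simp
  show "(A = {}) = (B = {})" using rel_empty[OF r] by simp
  show "(e \<in> A) = (e \<in> B)" using rel_pt[OF r] by simp
  show "(A \<inter> C2 p = {}) = (B \<inter> C1 p = {})" if "p \<in> Q" for p
    using rel_col[OF r that] by simp
qed

text \<open>A position of the game: both valuations are read off matching finite partitions.\<close>

definition frame :: "nat \<Rightarrow> nat \<Rightarrow> (nat \<Rightarrow> 'y set) \<Rightarrow> (nat \<Rightarrow> 'y set) \<Rightarrow> bool" where
  "frame m k A B \<longleftrightarrow> (\<forall>i<k. rel m (A i) (B i)) \<and>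
     disjoint_family_on A {..<k} \<and> disjoint_family_on B {..<k} \<and>
     (\<Union>i<k. A i) = Y1 \<and> (\<Union>i<k. B i) = Y2"

definition position :: "nat \<Rightarrow> nat set \<Rightarrow> (nat \<Rightarrow> 'y set) \<Rightarrow> (nat \<Rightarrow> 'y set) \<Rightarrow> bool" where
  "position m V v w \<longleftrightarrow> (\<exists>k A B I. frame m k A B \<and>
     (\<forall>n\<in>V. I n \<subseteq> {..<k} \<and> v n = \<Union>(A ` I n) \<and> w n = \<Union>(B ` I n)))"

lemma positionE:
  assumes "position m V v w"
  obtains k :: nat and A B I where "\<And>i. i < k \<Longrightarrow> rel m (A i) (B i)"
    "disjoint_family_on A {..<k}" "disjoint_family_on B {..<k}"
    "(\<Union>i<k. A i) = Y1" "(\<Union>i<k. B i) = Y2"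
    "\<And>n. n \<in> V \<Longrightarrow> I n \<subseteq> {..<k} \<and> v n = \<Union>(A ` I n) \<and> w n = \<Union>(B ` I n)"
proof -
  obtain k A B I where "frame m k A B"
    and "\<forall>n\<in>V. I n \<subseteq> {..<k} \<and> v n = \<Union>(A ` I n) \<and> w n = \<Union>(B ` I n)"
    using assms unfolding position_def by blast
  with that[of k A B I] show ?thesis unfolding frame_def by simp
qed

lemma positionI:
  fixes k :: nat
  assumes "\<And>i. i < k \<Longrightarrow> rel m (A i) (B i)"
    "disjoint_family_on A {..<k}" "disjoint_family_on B {..<k}"
    "(\<Union>i<k. A i) = Y1" "(\<Union>i<k. B i) = Y2"
    "\<And>n. n \<in> V \<Longrightarrow> I n \<subseteq> {..<k}" "\<And>n. n \<in> V \<Longrightarrow> v n = \<Union>(A ` I n)"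
    "\<And>n. n \<in> V \<Longrightarrow> w n = \<Union>(B ` I n)"
  shows "position m V v w"
proof -
  have "frame m k A B" unfolding frame_def using assms(1-5) by (intro conjI allI impI)
  moreover have "\<forall>n\<in>V. I n \<subseteq> {..<k} \<and> v n = \<Union>(A ` I n) \<and> w n = \<Union>(B ` I n)"
    using assms(6-8) by (intro ballI conjI)
  ultimately have "\<exists>I. frame m k A B \<and> (\<forall>n\<in>V. I n \<subseteq> {..<k} \<and> v n = \<Union>(A ` I n) \<and> w n = \<Union>(B ` I n))"
    by (intro exI[of _ I]) (rule conjI)
  then show ?thesis unfolding position_def
    by (rule_tac exI[of _ k], rule_tac exI[of _ A], rule_tac exI[of _ B])
qed

lemma position_start: "rel m Y1 Y2 \<Longrightarrow> position m {} v w"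
  by (rule positionI[of 1 m "\<lambda>_. Y1" "\<lambda>_. Y2"]) (auto simp: disjoint_family_on_def)

lemma position_pt: "position m V v w \<Longrightarrow> n \<in> V \<Longrightarrow> e \<in> v n \<longleftrightarrow> e \<in> w n"
proof -
  assume p: "position m V v w" and n: "n \<in> V"
  show "e \<in> v n \<longleftrightarrow> e \<in> w n"
  proof (rule positionE[OF p])
    fix k :: nat and A B I assume r: "\<And>i. i < k \<Longrightarrow> rel m (A i) (B i)"
      and I: "\<And>n. n \<in> V \<Longrightarrow> I n \<subseteq> {..<k} \<and> v n = \<Union>(A ` I n) \<and> w n = \<Union>(B ` I n)"
    have "e \<in> A i \<longleftrightarrow> e \<in> B i" if "i \<in> I n" for i using that rel_pt[OF r] I[OF n] by auto
    then show ?thesis using I[OF n] by auto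
  qed
qed

text \<open>Cell \<open>i\<close> is replaced by the cells \<open>2 * i\<close> and
  \<open>2 * i + 1\<close>, its parts inside and outside the new element, which thus becomes the
  union of the even cells; old index sets are pulled back along \<open>div 2\<close>.\<close>

lemma position_forth:
  assumes "position (Suc m) V v w" "a \<in> F1"
  shows "\<exists>b\<in>F2. position m (insert n V) (v(n := a)) (w(n := b))"
proof -
  obtain k A B I where r: "\<And>i. i < k \<Longrightarrow> rel (Suc m) (A i) (B i)"
    and dA: "disjoint_family_on A {..<k}" and dB: "disjoint_family_on B {..<k}"
    and Y: "(\<Union>i<k. A i) = Y1" "(\<Union>i<k. B i) = Y2"
    and I: "\<And>n. n \<in> V \<Longrightarrow> I n \<subseteq> {..<k::nat} \<and> v n = \<Union>(A ` I n) \<and> w n = \<Union>(B ` I n)"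
    using assms(1) by (rule positionE) blast
  have "\<exists>b\<in>F2. b \<subseteq> B i \<and> rel m (A i \<inter> a) b \<and> rel m (A i - A i \<inter> a) (B i - b)" if "i < k" for i
    using forth[OF r[OF that], of "A i \<inter> a"] rel_sets[OF r[OF that]] assms(2) by blast
  then obtain b where b: "\<And>i. i < k \<Longrightarrow> b i \<in> F2 \<and> b i \<subseteq> B i \<and> rel m (A i \<inter> a) (b i) \<and>
      rel m (A i - A i \<inter> a) (B i - b i)"
    by metis
  define A' where "A' j = (if even j then A (j div 2) \<inter> a else A (j div 2) - A (j div 2) \<inter> a)" for j
  define B' where "B' j = (if even j then b (j div 2) else B (j div 2) - b (j div 2))" for j
  define I' where "I' x = (if x = n then {j. even j \<and> j < 2 * k} else {j. j < 2 * k \<and> j div 2 \<in> I x})" for x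
  have lt: "j div 2 < k" if "j < 2 * k" for j using that by auto
  have A'sub: "A' j \<subseteq> A (j div 2)" for j by (auto simp: A'_def)
  have B'sub: "B' j \<subseteq> B (j div 2)" if "j < 2 * k" for j
    using b[OF lt[OF that]] by (auto simp: B'_def)
  have splitA: "A' (2 * i) \<union> A' (Suc (2 * i)) = A i" for i by (auto simp: A'_def)
  have splitB: "B' (2 * i) \<union> B' (Suc (2 * i)) = B i" if "i < k" for i
    using b[OF that] by (auto simp: B'_def)
  have un: "\<Union>(E' ` {j. j < 2 * k \<and> j div 2 \<in> K}) = \<Union>(E ` K)"
    if K: "K \<subseteq> {..<k}" and s: "\<And>i. i < k \<Longrightarrow> E' (2 * i) \<union> E' (Suc (2 * i)) = E i"
      and sub: "\<And>j. j < 2 * k \<Longrightarrow> E' j \<subseteq> E (j div 2)" for E E' :: "nat \<Rightarrow> 'y set" and K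
  proof
    show "\<Union>(E' ` {j. j < 2 * k \<and> j div 2 \<in> K}) \<subseteq> \<Union>(E ` K)" using sub by blast
    show "\<Union>(E ` K) \<subseteq> \<Union>(E' ` {j. j < 2 * k \<and> j div 2 \<in> K})"
    proof (rule UN_least)
      fix i assume i: "i \<in> K"
      then have "i < k" using K by auto
      then have "2 * i \<in> {j. j < 2 * k \<and> j div 2 \<in> K}" "Suc (2 * i) \<in> {j. j < 2 * k \<and> j div 2 \<in> K}"
        using i by auto
      then show "E i \<subseteq> \<Union>(E' ` {j. j < 2 * k \<and> j div 2 \<in> K})"
        using s[OF \<open>i < k\<close>] by blast
    qed
  qed
  have dis: "disjoint_family_on E' {..<2 * k}"
    if d: "disjoint_family_on E {..<k}" and s: "\<And>i. i < k \<Longrightarrow> E' (2 * i) \<inter> E' (Suc (2 * i)) = {}"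
      and sub: "\<And>j. j < 2 * k \<Longrightarrow> E' j \<subseteq> E (j div 2)" for E E' :: "nat \<Rightarrow> 'y set"
    unfolding disjoint_family_on_def
  proof (intro ballI impI)
    fix i j assume ij: "i \<in> {..<2 * k}" "j \<in> {..<2 * k}" "i \<noteq> j"
    show "E' i \<inter> E' j = {}"
    proof (cases "i div 2 = j div 2")
      case True
      then have "(i = 2 * (i div 2) \<and> j = Suc (2 * (i div 2))) \<or> (j = 2 * (i div 2) \<and> i = Suc (2 * (i div 2)))"
        using ij(3) by presburger
      then show ?thesis using s[of "i div 2"] lt[of i] ij by (metis Int_commute lessThan_iff)
    next
      case False
      then have "E (i div 2) \<inter> E (j div 2) = {}"
        using d ij lt unfolding disjoint_family_on_def by simp
      then show ?thesis using sub[of i] sub[of j] ij by auto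
    qed
  qed
  have a: "a = \<Union>(A' ` {j. even j \<and> j < 2 * k})"
  proof
    show "a \<subseteq> \<Union>(A' ` {j. even j \<and> j < 2 * k})"
    proof
      fix y assume y: "y \<in> a"
      then have "y \<in> Y1" using assms(2) F1.sets_into_space by blast
      then obtain i where "i < k" "y \<in> A i" using Y by auto
      then have "y \<in> A' (2 * i)" "2 * i < 2 * k" using y by (auto simp: A'_def)
      then show "y \<in> \<Union>(A' ` {j. even j \<and> j < 2 * k})"
        by (intro UN_I[of "2 * i"]) auto
    qed
  qed (auto simp: A'_def)
  define bb where "bb = \<Union>(B' ` {j. even j \<and> j < 2 * k})"
  have "bb \<in> F2" unfolding bb_def
  proof (rule F2.finite_UN)
    show "\<And>i. i \<in> {j. even j \<and> j < 2 * k} \<Longrightarrow> B' i \<in> F2" using b lt by (auto simp: B'_def)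
  qed simp
  moreover have "position m (insert n V) (v(n := a)) (w(n := bb))"
  proof (rule positionI[of "2 * k" m A' B' _ I'])
    fix j assume "j < 2 * k"
    then show "rel m (A' j) (B' j)" using b[OF lt] by (auto simp: A'_def B'_def)
  next
    show "disjoint_family_on A' {..<2 * k}"
      by (rule dis[OF dA _ A'sub]) (auto simp: A'_def)
    show "disjoint_family_on B' {..<2 * k}"
      by (rule dis[OF dB _ B'sub]) (auto simp: B'_def)
    have all: "{..<2 * k} = {j. j < 2 * k \<and> j div 2 \<in> {..<k}}" by auto
    show "(\<Union>i<2 * k. A' i) = Y1"
      unfolding all Y(1)[symmetric] by (rule un) (use splitA A'sub in auto)
    show "(\<Union>i<2 * k. B' i) = Y2"
      unfolding all Y(2)[symmetric] by (rule un) (use splitB B'sub in auto)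
  next
    fix x assume x: "x \<in> insert n V"
    show "I' x \<subseteq> {..<2 * k}" by (auto simp: I'_def)
    show "(v(n := a)) x = \<Union>(A' ` I' x)"
    proof (cases "x = n")
      case False
      then have "I x \<subseteq> {..<k}" "v x = \<Union>(A ` I x)" using I[of x] x by auto
      then show ?thesis using False un[of "I x" A' A] splitA A'sub by (simp add: I'_def)
    qed (use a in \<open>simp add: I'_def\<close>)
    show "(w(n := bb)) x = \<Union>(B' ` I' x)"
    proof (cases "x = n")
      case False
      then have "I x \<subseteq> {..<k}" "w x = \<Union>(B ` I x)" using I[of x] x by auto
      then show ?thesis using False un[of "I x" B' B] splitB B'sub by (simp add: I'_def)
    qed (simp add: I'_def bb_def)
  qed
  ultimately show ?thesis by blast
qed

lemma position_sym:
  "ef_system.position Y2 Y1 (\<lambda>m A B. rel m B A) m V w v = position m V v w"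
proof -
  interpret s: ef_system Y2 Y1 F2 F1 e C2 C1 Q "\<lambda>m A B. rel m B A" by (rule ef_system_sym)
  show ?thesis
  proof
    assume "s.position m V w v"
    then show "position m V v w"
    proof (rule s.positionE)
      fix k :: nat and A B I assume *: "\<And>i. i < k \<Longrightarrow> rel m (B i) (A i)" "disjoint_family_on A {..<k}"
        "disjoint_family_on B {..<k}" "\<Union> (A ` {..<k}) = Y2" "\<Union> (B ` {..<k}) = Y1"
        "\<And>n. n \<in> V \<Longrightarrow> I n \<subseteq> {..<k} \<and> w n = \<Union> (A ` I n) \<and> v n = \<Union> (B ` I n)"
      show ?thesis by (rule positionI[of k m B A V I]) (simp_all add: *)
    qed
  next
    assume "position m V v w"
    then show "s.position m V w v"
    proof (rule positionE)
      fix k :: nat and A B I assume *: "\<And>i. i < k \<Longrightarrow> rel m (A i) (B i)" "disjoint_family_on A {..<k}"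
        "disjoint_family_on B {..<k}" "\<Union> (A ` {..<k}) = Y1" "\<Union> (B ` {..<k}) = Y2"
        "\<And>n. n \<in> V \<Longrightarrow> I n \<subseteq> {..<k} \<and> v n = \<Union> (A ` I n) \<and> w n = \<Union> (B ` I n)"
      show ?thesis by (rule s.positionI[where k = k and A = B and B = A and I = I]) (simp_all add: *)
    qed
  qed
qed

lemma position_back:
  assumes "position (Suc m) V v w" "b \<in> F2"
  shows "\<exists>a\<in>F1. position m (insert n V) (v(n := a)) (w(n := b))"
proof -
  interpret s: ef_system Y2 Y1 F2 F1 e C2 C1 Q "\<lambda>m A B. rel m B A" by (rule ef_system_sym)
  show ?thesis using s.position_forth[unfolded position_sym, OF assms] .
qed

text \<open>A ring term selects cells by their indices alone, hence selects the same indices on both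
  sides.\<close>

lemma tval_position:
  assumes dA: "disjoint_family_on A {..<k}" and dB: "disjoint_family_on B {..<k}"
    and I: "\<And>n. n \<in> V \<Longrightarrow> I n \<subseteq> {..<k::nat} \<and> v n = \<Union>(A ` I n) \<and> w n = \<Union>(B ` I n)"
  shows "tvars t \<subseteq> V \<Longrightarrow> \<exists>J\<subseteq>{..<k}. tval (ring_struct F1 e C1) v t = \<Union>(A ` J) \<and>
    tval (ring_struct F2 e C2) w t = \<Union>(B ` J)"
proof (induction t)
  case (Var n)
  then show ?case using I[of n] by auto
next
  case Zero
  then show ?case by (intro exI[of _ "{}"]) auto
next
  case (Plus s t)
  then obtain J L where J: "J \<subseteq> {..<k}" "tval (ring_struct F1 e C1) v s = \<Union>(A ` J)"
      "tval (ring_struct F2 e C2) w s = \<Union>(B ` J)"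
    and L: "L \<subseteq> {..<k}" "tval (ring_struct F1 e C1) v t = \<Union>(A ` L)"
      "tval (ring_struct F2 e C2) w t = \<Union>(B ` L)" by auto
  have "(J - L) \<union> (L - J) \<subseteq> {..<k}" using J(1) L(1) by blast
  moreover have "\<Union>(E ` ((J - L) \<union> (L - J))) = sym_diff (\<Union>(E ` J)) (\<Union>(E ` L))"
    if "disjoint_family_on E {..<k}" for E :: "nat \<Rightarrow> 'y set"
    unfolding UN_diff_disjoint_family[OF that J(1) L(1)] UN_diff_disjoint_family[OF that L(1) J(1)]
    by blast
  ultimately show ?case using dA dB J L by (intro exI[of _ "(J - L) \<union> (L - J)"]) simp
next
  case (Times s t)
  then obtain J L where J: "J \<subseteq> {..<k}" "tval (ring_struct F1 e C1) v s = \<Union>(A ` J)"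
      "tval (ring_struct F2 e C2) w s = \<Union>(B ` J)"
    and L: "L \<subseteq> {..<k}" "tval (ring_struct F1 e C1) v t = \<Union>(A ` L)"
      "tval (ring_struct F2 e C2) w t = \<Union>(B ` L)" by auto
  have "J \<inter> L \<subseteq> {..<k}" using J(1) by blast
  moreover have "\<Union>(E ` (J \<inter> L)) = \<Union>(E ` J) \<inter> \<Union>(E ` L)"
    if "disjoint_family_on E {..<k}" for E :: "nat \<Rightarrow> 'y set"
    unfolding UN_Int_disjoint_family[OF that J(1) L(1)] ..
  ultimately show ?case using dA dB J L by (intro exI[of _ "J \<inter> L"]) simp
qed

text \<open>Turns an equation between terms into the emptiness of certain cells, which
  \<open>rel\<close> respects at every level.\<close>

lemma UN_eq_disjoint_family_iff:
  assumes "disjoint_family_on A K" "J \<subseteq> K" "L \<subseteq> K"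
  shows "\<Union>(A ` J) = \<Union>(A ` L) \<longleftrightarrow> (\<forall>i\<in>(J - L) \<union> (L - J). A i = {})"
proof -
  have "\<Union>(A ` J) = \<Union>(A ` L) \<longleftrightarrow> \<Union>(A ` J) - \<Union>(A ` L) = {} \<and> \<Union>(A ` L) - \<Union>(A ` J) = {}" by blast
  also have "\<dots> \<longleftrightarrow> (\<forall>i\<in>(J - L) \<union> (L - J). A i = {})"
    unfolding UN_diff_disjoint_family[OF assms] UN_diff_disjoint_family[OF assms(1,3,2)] by blast
  finally show ?thesis .
qed

lemma sat_position:
  assumes "position m V v w" "qdepth f \<le> m" "fvars f \<subseteq> V" "set_form f \<subseteq> Q"
  shows "sat (ring_struct F1 e C1) v f = sat (ring_struct F2 e C2) w f"
  using assms
proof (induction f arbitrary: m V v w)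
  case (Eq s t)
  obtain k A B I where r: "\<And>i. i < k \<Longrightarrow> rel m (A i) (B i)"
    and dA: "disjoint_family_on A {..<k}" and dB: "disjoint_family_on B {..<k}"
    and I: "\<And>n. n \<in> V \<Longrightarrow> I n \<subseteq> {..<k::nat} \<and> v n = \<Union>(A ` I n) \<and> w n = \<Union>(B ` I n)"
    using Eq.prems(1) by (rule positionE) blast
  obtain J L where J: "J \<subseteq> {..<k}" "tval (ring_struct F1 e C1) v s = \<Union>(A ` J)"
      "tval (ring_struct F2 e C2) w s = \<Union>(B ` J)"
    and L: "L \<subseteq> {..<k}" "tval (ring_struct F1 e C1) v t = \<Union>(A ` L)"
      "tval (ring_struct F2 e C2) w t = \<Union>(B ` L)"
    using that tval_position[OF dA dB, where V = V and I = I and v = v and w = w, OF I] Eq.prems(3)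
    by (metis Un_subset_iff fvars.simps(1))
  have "A i = {} \<longleftrightarrow> B i = {}" if "i \<in> (J - L) \<union> (L - J)" for i
    using rel_empty[OF r[of i]] that J(1) L(1) by auto
  then have "(\<forall>i\<in>(J - L) \<union> (L - J). A i = {}) \<longleftrightarrow> (\<forall>i\<in>(J - L) \<union> (L - J). B i = {})"
    by (intro ball_cong refl)
  then show ?case
    by (simp only: sat.simps J L UN_eq_disjoint_family_iff[OF dA J(1) L(1)] UN_eq_disjoint_family_iff[OF dB J(1) L(1)])
next
  case (Pred p t)
  obtain k A B I where r: "\<And>i. i < k \<Longrightarrow> rel m (A i) (B i)"
    and dA: "disjoint_family_on A {..<k}" and dB: "disjoint_family_on B {..<k}"
    and I: "\<And>n. n \<in> V \<Longrightarrow> I n \<subseteq> {..<k::nat} \<and> v n = \<Union>(A ` I n) \<and> w n = \<Union>(B ` I n)"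
    using Pred.prems(1) by (rule positionE) blast
  obtain J where J: "J \<subseteq> {..<k}" "tval (ring_struct F1 e C1) v t = \<Union>(A ` J)"
      "tval (ring_struct F2 e C2) w t = \<Union>(B ` J)"
    using that tval_position[OF dA dB, where V = V and I = I and v = v and w = w, OF I] Pred.prems(3)
    by (metis fvars.simps(2))
  have fin: "finite J" using J(1) finite_subset by blast
  have "\<Union>(A ` J) \<in> F1" "\<Union>(B ` J) \<in> F2"
    using fin J(1) rel_sets[OF r] by (auto intro!: F1.finite_UN F2.finite_UN)
  moreover have "(e \<in> A i \<longleftrightarrow> e \<in> B i) \<and> (A i \<inter> C1 p = {} \<longleftrightarrow> B i \<inter> C2 p = {})" if "i \<in> J" for i
    using rel_pt[OF r[of i]] rel_col[OF r[of i], of p] Pred.prems that J(1) by auto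
  moreover have "(e \<in> \<Union>(A ` J) \<longleftrightarrow> e \<in> \<Union>(B ` J)) \<and> (\<Union>(A ` J) \<inter> C1 p = {} \<longleftrightarrow> \<Union>(B ` J) \<inter> C2 p = {})"
    using calculation(3) by auto
  ultimately show ?case by (simp only: sat.simps J ring_struct_simps mem_Collect_eq simp_thms)
next
  case (Neg f)
  then show ?case by auto
next
  case (Conj f g)
  then show ?case by auto
next
  case (Ex n f)
  then obtain m' where m': "m = Suc m'" "qdepth f \<le> m'" by (cases m) auto
  have fv: "fvars f \<subseteq> insert n V" "set_form f \<subseteq> Q" using Ex.prems by auto
  have p: "position (Suc m') V v w" using Ex.prems m' by simp
  show ?case
  proof
    assume "sat (ring_struct F1 e C1) v (Ex n f)"
    then obtain a where a: "a \<in> F1" "e \<notin> a" "sat (ring_struct F1 e C1) (v(n := a)) f" by auto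
    obtain b where b: "b \<in> F2" "position m' (insert n V) (v(n := a)) (w(n := b))"
      using position_forth[OF p a(1)] by blast
    \<comment> \<open>Quantifiers range only over sets that avoid \<open>e\<close>. The answer is
      taken from the whole field, but it inherits this property from \<open>a\<close>.\<close>
    have "e \<notin> b" using position_pt[OF b(2), of n] a(2) by simp
    moreover have "sat (ring_struct F2 e C2) (w(n := b)) f"
      using Ex.IH[OF b(2) m'(2) fv] a(3) by blast
    ultimately show "sat (ring_struct F2 e C2) w (Ex n f)"
      unfolding sat.simps ring_struct_simps using b(1) by blast
  next
    assume "sat (ring_struct F2 e C2) w (Ex n f)"
    then obtain b where b: "b \<in> F2" "e \<notin> b" "sat (ring_struct F2 e C2) (w(n := b)) f" by auto
    obtain a where a: "a \<in> F1" "position m' (insert n V) (v(n := a)) (w(n := b))"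
      using position_back[OF p b(1)] by blast
    have "e \<notin> a" using position_pt[OF a(2), of n] b(2) by simp
    moreover have "sat (ring_struct F1 e C1) (v(n := a)) f"
      using Ex.IH[OF a(2) m'(2) fv] b(3) by blast
    ultimately show "sat (ring_struct F1 e C1) v (Ex n f)"
      unfolding sat.simps ring_struct_simps using a(1) by blast
  qed
qed

lemma holds_iff:
  assumes "rel (qdepth f) Y1 Y2" "fvars f = {}" "set_form f \<subseteq> Q"
  shows "holds (ring_struct F1 e C1) f = holds (ring_struct F2 e C2) f"
proof -
  have "sat (ring_struct F1 e C1) (\<lambda>_. {}) f = sat (ring_struct F2 e C2) (\<lambda>_. {}) f"
    using assms by (intro sat_position[OF position_start]) auto
  then show ?thesis
    using holds_closed[OF assms(2), of "ring_struct F1 e C1"] holds_closed[OF assms(2), of "ring_struct F2 e C2"]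
    by (simp add: F1.empty_sets F2.empty_sets)
qed

end

section \<open>Counting up to a threshold\<close>

definition at_least :: "nat \<Rightarrow> 'a set \<Rightarrow> bool" where
  "at_least n S \<longleftrightarrow> infinite S \<or> n \<le> card S"

text \<open>The threshold is what survives \<open>k\<close> halvings: if a move cuts a cell in two
  parts with at least \<open>2 ^ k\<close> points each, the answer needs \<open>2 ^ Suc k\<close>
  points. As it is never below \<open>1\<close>, emptiness is always respected.\<close>

definition same_count :: "nat \<Rightarrow> 'a set \<Rightarrow> 'b set \<Rightarrow> bool" where
  "same_count k S S' \<longleftrightarrow> (\<forall>n\<le>2 ^ k. at_least n S = at_least n S')"

lemma at_least_mono: "at_least n S \<Longrightarrow> m \<le> n \<Longrightarrow> at_least m S"
  by (auto simp: at_least_def)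

lemma at_least_superset: "at_least n S \<Longrightarrow> S \<subseteq> T \<Longrightarrow> at_least n T"
  unfolding at_least_def by (meson card_mono finite_subset le_trans)

lemma at_least_1: "at_least (Suc 0) S \<longleftrightarrow> S \<noteq> {}"
  unfolding at_least_def using card_gt_0_iff Suc_le_eq by fastforce

lemma at_least_pow_nonempty: "at_least (2 ^ k) S \<Longrightarrow> S \<noteq> {}"
  using at_least_mono[of "2 ^ k" S "Suc 0"] at_least_1[of S] by (simp add: Suc_leI)

lemma at_least_Un:
  assumes "at_least m S" "at_least n T" "S \<inter> T = {}"
  shows "at_least (m + n) (S \<union> T)"
proof (cases "finite S \<and> finite T")
  case True
  then show ?thesis using assms by (simp add: at_least_def card_Un_disjoint)
qed (auto simp: at_least_def)

lemma at_least_obtain: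
  assumes "at_least n S" obtains T where "T \<subseteq> S" "finite T" "card T = n"
  using assms unfolding at_least_def
  by (metis infinite_arbitrarily_large obtain_subset_with_card_n)

lemma same_count_nonempty: "same_count k S S' \<Longrightarrow> S = {} \<longleftrightarrow> S' = {}"
  unfolding same_count_def using at_least_1[of S] at_least_1[of S'] by (auto simp: Suc_le_eq)

lemma same_count_sym: "same_count k S S' \<Longrightarrow> same_count k S' S"
  by (auto simp: same_count_def)

lemma same_count_infinite: "infinite S \<Longrightarrow> infinite S' \<Longrightarrow> same_count k S S'"
  by (auto simp: same_count_def at_least_def)

lemma same_count_card: "finite S \<Longrightarrow> finite S' \<Longrightarrow> card S = card S' \<Longrightarrow> same_count k S S'"
  by (auto simp: same_count_def at_least_def)

text \<open>
  How to share out a set \<open>S\<close> like \<open>C True \<union> C False\<close>: finitely many points are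
  earmarked for each side, and the remaining ones go to a side that is already large.
\<close>

lemma share_out:
  fixes C :: "bool \<Rightarrow> 'a set" and S Iso :: "'b set"
  assumes cnt: "same_count (Suc k) (C True \<union> C False) S" and dis: "C True \<inter> C False = {}"
    and Iso: "finite S \<Longrightarrow> Iso = S" "Iso \<subseteq> S"
    and inf: "infinite S \<Longrightarrow> infinite Iso \<or> (\<forall>i. C i = {} \<or> infinite (C i))"
  shows "\<exists>Q s. (\<forall>i. finite (Q i) \<and> Q i \<subseteq> S \<and>
      (if at_least (2 ^ k) (C i) then 2 ^ k \<le> card (Q i) else card (Q i) = card (C i) \<and> Q i \<subseteq> Iso)) \<and>
    Q True \<inter> Q False = {} \<and> (S = Q True \<union> Q False \<or> at_least (2 ^ k) (C s))"
proof -
  have S: "at_least n S" if "at_least n (C True \<union> C False)" "n \<le> 2 ^ Suc k" for n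
    using cnt that unfolding same_count_def by blast
  consider "\<forall>i. \<not> at_least (2 ^ k) (C i)"
    | s where "at_least (2 ^ k) (C s)" "\<not> at_least (2 ^ k) (C (\<not> s))"
    | "\<forall>i. at_least (2 ^ k) (C i)"
  proof -
    assume *: "\<forall>i. \<not> at_least (2 ^ k) (C i) \<Longrightarrow> thesis"
      "\<And>s. at_least (2 ^ k) (C s) \<Longrightarrow> \<not> at_least (2 ^ k) (C (\<not> s)) \<Longrightarrow> thesis"
      "\<forall>i. at_least (2 ^ k) (C i) \<Longrightarrow> thesis"
    show thesis
      by (cases "at_least (2 ^ k) (C True)"; cases "at_least (2 ^ k) (C False)")
         (use *(1,3) *(2)[of True] *(2)[of False] in \<open>simp_all add: all_bool_eq\<close>)
  qed
  then show ?thesis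
  proof cases
    case 1
    then have fin: "finite (C i)" "card (C i) < 2 ^ k" for i
      by (auto simp: at_least_def not_le)
    define n where "n = card (C True) + card (C False)"
    have n: "card (C True \<union> C False) = n" unfolding n_def using fin dis by (simp add: card_Un_disjoint)
    \<comment> \<open>Strict, so that \<open>Suc n\<close> is still in the range where the counts
      agree; hence \<open>S\<close> has exactly \<open>n\<close> points.\<close>
    have lt: "n < 2 ^ Suc k" using fin(2)[of True] fin(2)[of False] by (simp add: n_def)
    have "at_least n S" using n lt by (intro S) (auto simp: at_least_def)
    moreover have "\<not> at_least (Suc n) S"
      using cnt lt n fin unfolding same_count_def at_least_def by (metis Suc_leI finite_UnI not_less_eq_eq order_refl)
    ultimately have Sf: "finite S" "card S = n" by (auto simp: at_least_def)
    then obtain T where T: "T \<subseteq> S" "card T = card (C True)"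
      using obtain_subset_with_card_n[of "card (C True)" S] by (auto simp: n_def)
    have "card (S - T) = card (C False)"
      using T Sf by (simp add: card_Diff_subset finite_subset n_def)
    then show ?thesis
      using 1 T Sf Iso
      by (intro exI[of _ "\<lambda>i. if i then T else S - T"]) (auto intro: finite_subset)
  next
    case (2 s)
    then have fin: "finite (C (\<not> s))" "card (C (\<not> s)) < 2 ^ k" by (auto simp: at_least_def not_le)
    have un: "C (\<not> s) \<union> C s = C True \<union> C False" "C (\<not> s) \<inter> C s = {}"
      using dis by (cases s; auto)+
    have "at_least (card (C (\<not> s)) + 2 ^ k) (C (\<not> s) \<union> C s)"
      using 2(1) un(2) by (intro at_least_Un) (auto simp: at_least_def)
    then have aS: "at_least (card (C (\<not> s)) + 2 ^ k) S" using S fin(2) un(1) by simp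
    \<comment> \<open>The small side takes its points from \<open>Iso\<close>. In the application
      these are the points of \<open>S\<close> that some neighbourhood isolates in \<open>S\<close>,
      so that no further points of \<open>S\<close> come along with them.\<close>
    have "at_least (card (C (\<not> s))) Iso"
    proof (cases "finite S")
      case True
      then show ?thesis using aS Iso(1) by (simp add: at_least_def)
    next
      case False
      then have "infinite Iso \<or> C (\<not> s) = {}" using inf fin(1) by blast
      then show ?thesis by (auto simp: at_least_def)
    qed
    then obtain T where T: "T \<subseteq> Iso" "finite T" "card T = card (C (\<not> s))"
      by (rule at_least_obtain)
    have "at_least (2 ^ k) (S - T)"
    proof (cases "finite S")
      case True
      then have "card (S - T) = card S - card T" using T Iso(2) by (intro card_Diff_subset) auto
      then show ?thesis using aS True T(3) by (simp add: at_least_def)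
    next
      case False
      then show ?thesis using T(2) by (simp add: at_least_def)
    qed
    then obtain U where U: "U \<subseteq> S - T" "finite U" "card U = 2 ^ k" by (rule at_least_obtain)
    have "(\<not> s) = i \<or> s = i" for i by auto
    then show ?thesis
      using 2 T U Iso(2)
      by (intro exI[of _ "\<lambda>i. if i = s then U else T"] exI[of _ s]) (cases s; auto)
  next
    case 3
    have "at_least (2 ^ k + 2 ^ k) (C True \<union> C False)" using 3 dis by (intro at_least_Un) auto
    then have "at_least (2 ^ k + 2 ^ k) S" by (intro S) auto
    then obtain V where V: "V \<subseteq> S" "finite V" "card V = 2 ^ k + 2 ^ k" by (rule at_least_obtain)
    then obtain T where T: "T \<subseteq> V" "card T = 2 ^ k"
      using V(3) by (metis le_add1 obtain_subset_with_card_n)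
    have "card (V - T) = 2 ^ k" using T V by (simp add: card_Diff_subset finite_subset)
    then show ?thesis
      using 3 T V by (intro exI[of _ "\<lambda>i. if i then T else V - T"] exI[of _ True]) (auto intro: finite_subset)
  qed
qed

section \<open>Compact fields of sets with typed points\<close>

locale compact_field = algebra Y F for Y :: "'y set" and F +
  assumes compact: "\<C> \<subseteq> F \<Longrightarrow> Y \<subseteq> \<Union>\<C> \<Longrightarrow> \<exists>\<D>\<subseteq>\<C>. finite \<D> \<and> Y \<subseteq> \<Union>\<D>"
begin

lemma compact_subset:
  assumes "A \<in> F" "\<C> \<subseteq> F" "A \<subseteq> \<Union>\<C>"
  shows "\<exists>\<D>\<subseteq>\<C>. finite \<D> \<and> A \<subseteq> \<Union>\<D>"
proof -
  have "\<exists>\<D>\<subseteq>insert (Y - A) \<C>. finite \<D> \<and> Y \<subseteq> \<Union>\<D>"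
    using assms by (intro compact) auto
  then obtain \<D> where \<D>: "\<D> \<subseteq> insert (Y - A) \<C>" "finite \<D>" "Y \<subseteq> \<Union>\<D>" by blast
  have "A \<subseteq> \<Union>(\<D> - {Y - A})" using \<D>(3) sets_into_space[OF assms(1)] by blast
  with \<D> show ?thesis by (intro exI[of _ "\<D> - {Y - A}"]) auto
qed

end

text \<open>
  Outside a closed set \<open>H\<close> every point \<open>y\<close> has a type \<open>t y\<close>. The order says which types
  occur near a point of a given type; types in \<open>dis\<close> are realised by discrete sets, up to
  finitely many points.
\<close>

locale typed_field = compact_field Y F for Y :: "'y set" and F +
  fixes H :: "'y set" and t :: "'y \<Rightarrow> 't" and le :: "'t \<Rightarrow> 't \<Rightarrow> bool" and dis Types :: "'t set"
  assumes trim: "y \<in> Y \<Longrightarrow> y \<notin> H \<Longrightarrow> \<exists>A\<in>F. y \<in> A \<and> A \<inter> H = {} \<and> (\<forall>z\<in>A. le (t y) (t z))"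
    and accumulate: "A \<in> F \<Longrightarrow> y \<in> A \<Longrightarrow> y \<notin> H \<Longrightarrow> a \<in> Types \<Longrightarrow> le (t y) a \<Longrightarrow>
      a \<noteq> t y \<or> a \<notin> dis \<Longrightarrow> infinite {z \<in> A - H. t z = a}"
    and discrete: "a \<in> Types \<Longrightarrow> a \<in> dis \<Longrightarrow>
      \<exists>E. finite E \<and> (\<forall>y\<in>Y - H - E. t y = a \<longrightarrow> (\<exists>A\<in>F. {z \<in> A - H. t z = a} = {y}))"
    and separated: "y \<in> Y \<Longrightarrow> z \<in> Y \<Longrightarrow> y \<noteq> z \<Longrightarrow> y \<notin> H \<Longrightarrow> z \<notin> H \<Longrightarrow> \<exists>A\<in>F. y \<in> A \<and> z \<notin> A"
    and le_refl: "le a a"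
begin

definition cls :: "'t \<Rightarrow> 'y set" where "cls a = {y \<in> Y - H. t y = a}"

lemma Int_cls: "A \<in> F \<Longrightarrow> A \<inter> cls a = {z \<in> A - H. t z = a}"
  using sets_into_space by (auto simp: cls_def)

lemma finite_INT_mem: "finite I \<Longrightarrow> (\<And>i. i \<in> I \<Longrightarrow> D i \<in> F) \<Longrightarrow> A \<in> F \<Longrightarrow> A \<inter> (\<Inter>i\<in>I. D i) \<in> F"
proof (induction I rule: finite_induct)
  case empty
  then show ?case by simp
next
  case (insert i I)
  have "A \<inter> (\<Inter>i\<in>insert i I. D i) = (A \<inter> (\<Inter>i\<in>I. D i)) \<inter> D i" by blast
  with insert show ?case by (simp add: Int)
qed

lemma separated_finite:
  assumes "finite S" "S \<subseteq> Y - H" "y \<in> Y - H"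
  shows "\<exists>A\<in>F. y \<in> A \<and> A \<inter> S \<subseteq> {y}"
proof -
  have "\<forall>z\<in>S - {y}. \<exists>A\<in>F. y \<in> A \<and> z \<notin> A" using separated assms by blast
  then obtain D where D: "\<And>z. z \<in> S - {y} \<Longrightarrow> D z \<in> F \<and> y \<in> D z \<and> z \<notin> D z" by metis
  have "Y \<inter> (\<Inter>z\<in>S - {y}. D z) \<in> F" using D assms(1) by (intro finite_INT_mem) auto
  moreover have "y \<in> Y \<inter> (\<Inter>z\<in>S - {y}. D z)" using D assms(3) by blast
  moreover have "(Y \<inter> (\<Inter>z\<in>S - {y}. D z)) \<inter> S \<subseteq> {y}" using D by blast
  ultimately show ?thesis by blast
qed

definition isolated :: "'t \<Rightarrow> 'y set" where
  "isolated a = {y. \<exists>A\<in>F. A \<inter> cls a = {y}}"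

lemma isolated_finite:
  assumes B: "B \<in> F" and "finite (B \<inter> cls a)"
  shows "B \<inter> cls a \<subseteq> isolated a"
proof
  fix y assume y: "y \<in> B \<inter> cls a"
  then obtain A where A: "A \<in> F" "y \<in> A" "A \<inter> (B \<inter> cls a) \<subseteq> {y}"
    using separated_finite[OF assms(2), of y] by (auto simp: cls_def)
  then have "(A \<inter> B) \<inter> cls a = {y}" using y by auto
  then show "y \<in> isolated a" unfolding isolated_def using A(1) B by blast
qed

lemma isolated_infinite:
  assumes "B \<in> F" "infinite (B \<inter> cls a)" "a \<in> Types" "a \<in> dis"
  shows "infinite (B \<inter> cls a \<inter> isolated a)"
proof -
  obtain E where E: "finite E" "\<And>y. y \<in> Y - H - E \<Longrightarrow> t y = a \<Longrightarrow> \<exists>A\<in>F. {z \<in> A - H. t z = a} = {y}"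
    using discrete[OF assms(3,4)] by blast
  have "y \<in> isolated a" if "y \<in> B \<inter> cls a - E" for y
    using E(2)[of y] that unfolding isolated_def by (auto simp: cls_def Int_cls)
  then have "B \<inter> cls a - E \<subseteq> B \<inter> cls a \<inter> isolated a" by blast
  moreover have "infinite (B \<inter> cls a - E)" using assms(2) E(1) by simp
  ultimately show ?thesis by (rule infinite_super)
qed

lemma above_infinite:
  assumes "A \<in> F" "y \<in> A" "y \<notin> H" "a \<in> Types" "le (t y) a" "a \<noteq> t y \<or> a \<notin> dis"
  shows "infinite (A \<inter> cls a)"
  using accumulate[OF assms] by (simp add: Int_cls[OF assms(1)])

lemma crowded_or_empty:
  assumes "A \<in> F" "a \<in> Types" "a \<notin> dis"
  shows "A \<inter> cls a = {} \<or> infinite (A \<inter> cls a)"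
  using above_infinite[of A _ a] assms le_refl by (auto simp: cls_def)

lemma trim_inside:
  assumes "B \<in> F" "y \<in> B" "y \<notin> H"
  obtains A where "A \<in> F" "y \<in> A" "A \<subseteq> B" "A \<inter> H = {}" "\<And>z. z \<in> A \<Longrightarrow> le (t y) (t z)"
proof -
  obtain A where A: "A \<in> F" "y \<in> A" "A \<inter> H = {}" "\<forall>z\<in>A. le (t y) (t z)"
    using trim[of y] assms sets_into_space[OF assms(1)] by auto
  then show ?thesis using assms by (intro that[of "A \<inter> B"]) auto
qed

definition near :: "'y \<Rightarrow> 't \<Rightarrow> bool" where
  "near x a \<longleftrightarrow> (\<forall>A\<in>F. x \<in> A \<longrightarrow> A \<inter> cls a \<noteq> {})"

text \<open>Points of the class have neighbourhoods that miss \<open>H\<close>. If there were only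
  finitely many in \<open>B\<close>, removing these neighbourhoods would leave a neighbourhood of
  \<open>x\<close> without points of the class.\<close>

lemma near_infinite:
  assumes "near x a" "x \<in> H" "B \<in> F" "x \<in> B"
  shows "infinite (B \<inter> cls a)"
proof
  assume fin: "finite (B \<inter> cls a)"
  have "\<forall>y\<in>B \<inter> cls a. \<exists>A\<in>F. y \<in> A \<and> A \<inter> H = {}"
  proof
    fix y assume "y \<in> B \<inter> cls a"
    then have "y \<in> Y" "y \<notin> H" by (auto simp: cls_def)
    from trim[OF this] show "\<exists>A\<in>F. y \<in> A \<and> A \<inter> H = {}" by blast
  qed
  then obtain D where D: "\<And>y. y \<in> B \<inter> cls a \<Longrightarrow> D y \<in> F \<and> y \<in> D y \<and> D y \<inter> H = {}" by metis
  have "B - (\<Union>y\<in>B \<inter> cls a. D y) \<in> F" using fin D assms(3) by (intro Diff finite_UN) auto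
  moreover have "x \<in> B - (\<Union>y\<in>B \<inter> cls a. D y)" using assms D by blast
  ultimately have "(B - (\<Union>y\<in>B \<inter> cls a. D y)) \<inter> cls a \<noteq> {}" using assms(1) by (simp add: near_def)
  then show False using D by blast
qed

text \<open>The part of \<open>D\<close> that carries the trace on \<open>H\<close> should bring
  along only unavoidable types. Around a point of \<open>H\<close> the finitely many types of
  \<open>G\<close> that are not near it can be avoided, and by compactness finitely many such
  neighbourhoods suffice.\<close>

lemma shrink_to_core:
  assumes D: "D \<in> F" and G: "finite G"
  shows "\<exists>N\<in>F. N \<subseteq> D \<and> N \<inter> H = D \<inter> H \<and> (\<forall>a\<in>G. N \<inter> cls a \<noteq> {} \<longrightarrow> (\<exists>x\<in>D \<inter> H. near x a))"
proof -
  define ok where "ok N \<longleftrightarrow> N \<in> F \<and> N \<subseteq> D \<and> (\<forall>a\<in>G. N \<inter> cls a \<noteq> {} \<longrightarrow> (\<exists>x\<in>D \<inter> H. near x a))" for N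
  have 1: "\<exists>N. ok N \<and> x \<in> N" if x: "x \<in> D" "x \<in> H" for x
  proof -
    have "\<forall>a\<in>{a\<in>G. \<not> near x a}. \<exists>A\<in>F. x \<in> A \<and> A \<inter> cls a = {}" by (auto simp: near_def)
    then obtain A where A: "\<And>a. a \<in> {a\<in>G. \<not> near x a} \<Longrightarrow> A a \<in> F \<and> x \<in> A a \<and> A a \<inter> cls a = {}"
      by metis
    define N where "N = D \<inter> (\<Inter>a\<in>{a\<in>G. \<not> near x a}. A a)"
    have "N \<in> F" unfolding N_def using G A D by (intro finite_INT_mem) auto
    moreover have "N \<inter> cls a = {}" if "a \<in> G" "\<not> near x a" for a
      using A[of a] that by (auto simp: N_def)
    ultimately have "ok N" using x by (auto simp: ok_def N_def)
    moreover have "x \<in> N" using A x by (auto simp: N_def)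
    ultimately show ?thesis by blast
  qed
  define \<C> where "\<C> = {N. ok N \<or> (N \<in> F \<and> N \<inter> H = {})}"
  have "D \<subseteq> \<Union>\<C>"
  proof
    fix x assume x: "x \<in> D"
    show "x \<in> \<Union>\<C>"
    proof (cases "x \<in> H")
      case True
      then show ?thesis using 1[OF x] by (auto simp: \<C>_def)
    next
      case False
      have "x \<in> Y" using x sets_into_space[OF D] by blast
      from trim[OF this False] obtain A where "A \<in> F" "x \<in> A" "A \<inter> H = {}" by blast
      then show ?thesis by (auto simp: \<C>_def)
    qed
  qed
  moreover have "\<C> \<subseteq> F" by (auto simp: \<C>_def ok_def)
  ultimately have "\<exists>\<D>\<subseteq>\<C>. finite \<D> \<and> D \<subseteq> \<Union>\<D>"
    by (intro compact_subset[OF D])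
  then obtain \<D> where \<D>: "\<D> \<subseteq> \<C>" "finite \<D>" "D \<subseteq> \<Union>\<D>"
    by (elim exE conjE)
  define N where "N = \<Union>{N\<in>\<D>. ok N}"
  have "N \<in> F" unfolding N_def using \<D>(2) by (intro finite_Union) (auto simp: ok_def)
  moreover have "N \<subseteq> D" by (auto simp: N_def ok_def)
  moreover have "D \<inter> H \<subseteq> N"
  proof
    fix x assume x: "x \<in> D \<inter> H"
    then obtain E where E: "E \<in> \<D>" "x \<in> E" using \<D>(3) by blast
    then have "ok E" using \<D>(1) x by (auto simp: \<C>_def)
    then show "x \<in> N" using E by (auto simp: N_def)
  qed
  moreover have nr: "\<exists>x\<in>D \<inter> H. near x a" if a: "a \<in> G" "N \<inter> cls a \<noteq> {}" for a
  proof -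
    obtain E where "ok E" "E \<inter> cls a \<noteq> {}" using a(2) by (auto simp: N_def)
    then show ?thesis using a(1) unfolding ok_def by blast
  qed
  ultimately have "N \<in> F \<and> N \<subseteq> D \<and> N \<inter> H = D \<inter> H" by auto
  then show ?thesis using nr by (intro bexI[of _ N]) auto
qed

end

text \<open>
  Two typed fields sharing the closed set \<open>H\<close>. Sets are compared by their traces on \<open>H\<close> and by
  the number of their points of each type in the finite set \<open>G k\<close>, up to the threshold \<open>2 ^ k\<close>.
\<close>

locale typed_pair = T1: typed_field Y1 F1 H t1 le dis Types + T2: typed_field Y2 F2 H t2 le dis Types
  for Y1 Y2 :: "'y set" and F1 F2 H and t1 t2 :: "'y \<Rightarrow> 't" and le dis Types +
  fixes G :: "nat \<Rightarrow> 't set"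
  assumes G: "finite (G k)" "G k \<subseteq> Types" "G k \<subseteq> G (Suc k)"
    and trace12: "A \<in> F1 \<Longrightarrow> \<exists>B\<in>F2. B \<inter> H = A \<inter> H"
    and trace21: "B \<in> F2 \<Longrightarrow> \<exists>A\<in>F1. A \<inter> H = B \<inter> H"
    and near_iff: "x \<in> H \<Longrightarrow> a \<in> G k \<Longrightarrow> T1.near x a \<longleftrightarrow> T2.near x a"
    and cover1: "y \<in> Y1 \<Longrightarrow> y \<notin> H \<Longrightarrow> \<exists>a\<in>G 0. le (t1 y) a"
    and cover2: "y \<in> Y2 \<Longrightarrow> y \<notin> H \<Longrightarrow> \<exists>a\<in>G 0. le (t2 y) a"
    and outside12: "A \<in> F1 \<Longrightarrow> B \<in> F2 \<Longrightarrow> (\<And>a. a \<in> G (Suc k) \<Longrightarrow> A \<inter> T1.cls a = {} \<longleftrightarrow> B \<inter> T2.cls a = {}) \<Longrightarrow>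
      y \<in> B - H \<Longrightarrow> t2 y \<notin> G k \<Longrightarrow> \<exists>z\<in>A - H. t1 z \<notin> G k \<and> (\<forall>a\<in>G k. le (t2 y) a \<longrightarrow> le (t1 z) a)"
    and outside21: "A \<in> F1 \<Longrightarrow> B \<in> F2 \<Longrightarrow> (\<And>a. a \<in> G (Suc k) \<Longrightarrow> A \<inter> T1.cls a = {} \<longleftrightarrow> B \<inter> T2.cls a = {}) \<Longrightarrow>
      y \<in> A - H \<Longrightarrow> t1 y \<notin> G k \<Longrightarrow> \<exists>z\<in>B - H. t2 z \<notin> G k \<and> (\<forall>a\<in>G k. le (t1 y) a \<longrightarrow> le (t2 z) a)"
begin

lemma typed_pair_sym: "typed_pair Y2 Y1 F2 F1 H t2 t1 le dis Types G"
proof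
  fix A B k y
  assume *: "A \<in> F2" "B \<in> F1" "\<And>a. a \<in> G (Suc k) \<Longrightarrow> A \<inter> T2.cls a = {} \<longleftrightarrow> B \<inter> T1.cls a = {}"
  have c: "B \<inter> T1.cls a = {} \<longleftrightarrow> A \<inter> T2.cls a = {}" if "a \<in> G (Suc k)" for a
    using *(3)[OF that] by simp
  show "\<exists>z\<in>A - H. t2 z \<notin> G k \<and> (\<forall>a\<in>G k. le (t1 y) a \<longrightarrow> le (t2 z) a)"
    if "y \<in> B - H" "t1 y \<notin> G k"
    using outside21[OF *(2,1) c that] .
  show "\<exists>z\<in>B - H. t1 z \<notin> G k \<and> (\<forall>a\<in>G k. le (t2 y) a \<longrightarrow> le (t1 z) a)"
    if "y \<in> A - H" "t2 y \<notin> G k"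
    using outside12[OF *(2,1) c that] .
next
  show "finite (G k)" "G k \<subseteq> Types" "G k \<subseteq> G (Suc k)" for k using G by auto
  show "\<exists>B\<in>F1. B \<inter> H = A \<inter> H" if "A \<in> F2" for A using trace21[OF that] .
  show "\<exists>A\<in>F2. A \<inter> H = B \<inter> H" if "B \<in> F1" for B using trace12[OF that] .
  show "T2.near x a = T1.near x a" if "x \<in> H" "a \<in> G k" for x a k using near_iff[OF that] by simp
  show "\<exists>a\<in>G 0. le (t2 y) a" if "y \<in> Y2" "y \<notin> H" for y using cover2[OF that] .
  show "\<exists>a\<in>G 0. le (t1 y) a" if "y \<in> Y1" "y \<notin> H" for y using cover1[OF that] .
qed

definition rel where
  "rel k A B \<longleftrightarrow> A \<in> F1 \<and> B \<in> F2 \<and> A \<inter> H = B \<inter> H \<and>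
     (\<forall>a\<in>G k. same_count k (A \<inter> T1.cls a) (B \<inter> T2.cls a))"

text \<open>Side \<open>i\<close> of \<open>B\<close> is assembled from disjoint neighbourhoods
  \<open>M i\<close> of chosen points, a set \<open>N i\<close> with the required trace on
  \<open>H\<close>, and pieces of the rest. Large types need only stay large, so the difficulty is
  to keep a type that is small on side \<open>i\<close> from occurring outside the chosen points.
  This works since a type above that of some point of \<open>P i\<close> off \<open>H\<close> is
  large on side \<open>i\<close>, unless it is that very type and discrete.\<close>

lemma rel_forth:
  assumes rel: "rel (Suc k) A B" and A1: "A1 \<in> F1" "A1 \<subseteq> A"
  shows "\<exists>B1\<in>F2. B1 \<subseteq> B \<and> rel k A1 B1 \<and> rel k (A - A1) (B - B1)"
proof -
  have A: "A \<in> F1" and B: "B \<in> F2" and AB: "A \<inter> H = B \<inter> H"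
    and cnt: "\<And>a. a \<in> G (Suc k) \<Longrightarrow> same_count (Suc k) (A \<inter> T1.cls a) (B \<inter> T2.cls a)"
    using rel by (auto simp: rel_def)
  define P where "P i = (if i then A1 else A - A1)" for i
  define C where "C a i = P i \<inter> T1.cls a" for a i
  have P: "P i \<in> F1" for i using A A1 by (simp add: P_def T1.Diff)
  have BY: "B \<subseteq> Y2" using T2.sets_into_space[OF B] .
  have AY: "A \<subseteq> Y1" using T1.sets_into_space[OF A] .
  have big: "at_least (2 ^ k) (C b i)"
    if "b \<in> G k" "z \<in> P i" "z \<notin> H" "le (t1 z) b" "b \<noteq> t1 z \<or> b \<notin> dis" for b i z
    using T1.above_infinite[OF P that(2,3) _ that(4,5)] G(2) that(1)
    by (auto simp: at_least_def C_def)
  have "\<forall>a\<in>G k. \<exists>Q s. (\<forall>i. finite (Q i) \<and> Q i \<subseteq> B \<inter> T2.cls a \<and>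
      (if at_least (2 ^ k) (C a i) then 2 ^ k \<le> card (Q i)
       else card (Q i) = card (C a i) \<and> Q i \<subseteq> B \<inter> T2.cls a \<inter> T2.isolated a)) \<and>
    Q True \<inter> Q False = {} \<and> (B \<inter> T2.cls a = Q True \<union> Q False \<or> at_least (2 ^ k) (C a s))"
  proof
    fix a assume a: "a \<in> G k"
    then have aT: "a \<in> Types" "a \<in> G (Suc k)" using G(2,3) by blast+
    have un: "C a True \<union> C a False = A \<inter> T1.cls a" using A1 by (auto simp: C_def P_def)
    show "\<exists>Q s. (\<forall>i. finite (Q i) \<and> Q i \<subseteq> B \<inter> T2.cls a \<and>
      (if at_least (2 ^ k) (C a i) then 2 ^ k \<le> card (Q i)
       else card (Q i) = card (C a i) \<and> Q i \<subseteq> B \<inter> T2.cls a \<inter> T2.isolated a)) \<and>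
    Q True \<inter> Q False = {} \<and> (B \<inter> T2.cls a = Q True \<union> Q False \<or> at_least (2 ^ k) (C a s))"
    proof (rule share_out)
      show "same_count (Suc k) (C a True \<union> C a False) (B \<inter> T2.cls a)"
        unfolding un using cnt[OF aT(2)] .
      show "C a True \<inter> C a False = {}" by (auto simp: C_def P_def)
      show "B \<inter> T2.cls a \<inter> T2.isolated a = B \<inter> T2.cls a" if "finite (B \<inter> T2.cls a)"
        using T2.isolated_finite[OF B that] by blast
      show "B \<inter> T2.cls a \<inter> T2.isolated a \<subseteq> B \<inter> T2.cls a" by blast
      \<comment> \<open>An infinite class of a type in \<open>dis\<close> has infinitely many
        isolated points; a class of any other type meets each side in an empty or infinite
        set.\<close>
      show "infinite (B \<inter> T2.cls a \<inter> T2.isolated a) \<or> (\<forall>i. C a i = {} \<or> infinite (C a i))"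
        if "infinite (B \<inter> T2.cls a)"
        using T2.isolated_infinite[OF B that aT(1)] T1.crowded_or_empty[OF P aT(1)]
        unfolding C_def by blast
    qed
  qed
  from bchoice[OF this] obtain Q where Q0: "\<forall>a\<in>G k. \<exists>s. (\<forall>i. finite (Q a i) \<and> Q a i \<subseteq> B \<inter> T2.cls a \<and>
      (if at_least (2 ^ k) (C a i) then 2 ^ k \<le> card (Q a i)
       else card (Q a i) = card (C a i) \<and> Q a i \<subseteq> B \<inter> T2.cls a \<inter> T2.isolated a)) \<and>
    Q a True \<inter> Q a False = {} \<and> (B \<inter> T2.cls a = Q a True \<union> Q a False \<or> at_least (2 ^ k) (C a s))" ..
  have Qfin: "finite (Q a i)" and QB: "Q a i \<subseteq> B \<inter> T2.cls a"
    and Qbig: "at_least (2 ^ k) (C a i) \<Longrightarrow> 2 ^ k \<le> card (Q a i)"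
    and Qsmall: "\<not> at_least (2 ^ k) (C a i) \<Longrightarrow> card (Q a i) = card (C a i) \<and> Q a i \<subseteq> T2.isolated a"
    and Qdis: "Q a True \<inter> Q a False = {}"
    and Qrest: "B \<inter> T2.cls a = Q a True \<union> Q a False \<or> (\<exists>s. at_least (2 ^ k) (C a s))"
    if "a \<in> G k" for a i
    using bspec[OF Q0 that] by (auto split: if_splits)
  have Qne: "C a i \<noteq> {}" if "a \<in> G k" "Q a i \<noteq> {}" for a i
  proof (cases "at_least (2 ^ k) (C a i)")
    case True
    then show ?thesis by (rule at_least_pow_nonempty)
  next
    case False
    then have "card (C a i) \<noteq> 0" using Qsmall[OF that(1) False] Qfin[OF that(1)] that(2) by auto
    then show ?thesis by auto
  qed
  define R where "R i = (\<Union>a\<in>G k. Q a i)" for i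
  have Rfin: "finite (R i)" for i unfolding R_def using G(1) Qfin by blast
  have Rcls: "R i \<inter> T2.cls a = Q a i" if a: "a \<in> G k" for a i
  proof
    show "R i \<inter> T2.cls a \<subseteq> Q a i"
    proof
      fix y assume y: "y \<in> R i \<inter> T2.cls a"
      then obtain b where b: "b \<in> G k" "y \<in> Q b i" by (auto simp: R_def)
      then have "y \<in> T2.cls b" using QB[OF b(1), of i] by blast
      then have "a = b" using y by (auto simp: T2.cls_def)
      then show "y \<in> Q a i" using b by simp
    qed
    show "Q a i \<subseteq> R i \<inter> T2.cls a" using QB[OF a, of i] a by (auto simp: R_def)
  qed
  have Rdis: "R True \<inter> R False = {}"
  proof -
    have "y \<notin> R False" if y: "y \<in> R True" for y
    proof
      assume y': "y \<in> R False"
      obtain a where a: "a \<in> G k" "y \<in> Q a True" using y by (auto simp: R_def)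
      then have "y \<in> T2.cls a" using QB[OF a(1), of True] by blast
      then have "y \<in> Q a False" using Rcls[OF a(1), of False] y' by blast
      then show False using Qdis[OF a(1)] a(2) by blast
    qed
    then show ?thesis by blast
  qed
  define RR where "RR = R True \<union> R False"
  have RRfin: "finite RR" using Rfin by (simp add: RR_def)
  have RRB: "RR \<subseteq> B - H" using QB by (fastforce simp: RR_def R_def T2.cls_def)
  have RRi: "y \<in> RR \<Longrightarrow> \<exists>i. y \<in> R i" for y by (auto simp: RR_def)
  have Rsub: "R i \<subseteq> RR" for i by (cases i) (auto simp: RR_def)
  have "\<exists>V. V \<in> F2 \<and> y \<in> V \<and> V \<subseteq> B \<and> V \<inter> H = {} \<and> (\<forall>z\<in>V. le (t2 y) (t2 z)) \<and> V \<inter> RR = {y} \<and>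
      (y \<in> T2.isolated (t2 y) \<longrightarrow> V \<inter> T2.cls (t2 y) = {y})" if y: "y \<in> RR" for y
  proof -
    have yB: "y \<in> B" "y \<notin> H" using RRB y by auto
    obtain D where D: "D \<in> F2" "y \<in> D" "D \<subseteq> B" "D \<inter> H = {}" "\<And>z. z \<in> D \<Longrightarrow> le (t2 y) (t2 z)"
      using T2.trim_inside[OF B yB] by blast
    obtain S where S: "S \<in> F2" "y \<in> S" "S \<inter> RR \<subseteq> {y}"
      using T2.separated_finite[OF RRfin, of y] RRB BY y by blast
    have "\<exists>I\<in>F2. y \<in> I \<and> (y \<in> T2.isolated (t2 y) \<longrightarrow> I \<inter> T2.cls (t2 y) = {y})"
    proof (cases "y \<in> T2.isolated (t2 y)")
      case True
      then obtain I where "I \<in> F2" "I \<inter> T2.cls (t2 y) = {y}" by (auto simp: T2.isolated_def)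
      then show ?thesis by blast
    next
      case False
      then show ?thesis using D by blast
    qed
    then obtain I where I: "I \<in> F2" "y \<in> I" "y \<in> T2.isolated (t2 y) \<longrightarrow> I \<inter> T2.cls (t2 y) = {y}" by blast
    have "y \<in> T2.cls (t2 y)" using yB BY by (auto simp: T2.cls_def)
    then show ?thesis using D S I y by (intro exI[of _ "D \<inter> S \<inter> I"]) auto
  qed
  then obtain V where V: "\<And>y. y \<in> RR \<Longrightarrow> V y \<in> F2 \<and> y \<in> V y \<and> V y \<subseteq> B \<and> V y \<inter> H = {} \<and>
      (\<forall>z\<in>V y. le (t2 y) (t2 z)) \<and> V y \<inter> RR = {y} \<and>
      (y \<in> T2.isolated (t2 y) \<longrightarrow> V y \<inter> T2.cls (t2 y) = {y})" by metis
  have VF: "V y \<in> F2" and Vy: "y \<in> V y" and VB: "V y \<subseteq> B" and VH: "V y \<inter> H = {}"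
    and Vle: "z \<in> V y \<Longrightarrow> le (t2 y) (t2 z)" and VRR: "V y \<inter> RR = {y}"
    and Viso: "y \<in> T2.isolated (t2 y) \<Longrightarrow> V y \<inter> T2.cls (t2 y) = {y}"
    if "y \<in> RR" for y z
    using V[OF that] by simp_all
  define U where "U y = V y - (\<Union>z\<in>RR - {y}. V z)" for y
  have UV: "U y \<subseteq> V y" for y by (auto simp: U_def)
  have U: "U y \<in> F2" if "y \<in> RR" for y
    unfolding U_def using RRfin VF that by (intro T2.Diff T2.finite_UN) auto
  have yU: "y \<in> U y" if y: "y \<in> RR" for y
  proof -
    have "y \<notin> V z" if "z \<in> RR - {y}" for z
      using VRR[of z] that y by auto
    then show ?thesis using Vy[OF y] by (auto simp: U_def)
  qed
  have UB: "U y \<subseteq> B \<and> U y \<inter> H = {}" if "y \<in> RR" for y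
    using VB[OF that] VH[OF that] UV[of y] by blast
  have Udis: "U y \<inter> U z = {}" if "y \<in> RR" "z \<in> RR" "y \<noteq> z" for y z
  proof -
    have "U y \<inter> V z = {}" using that by (auto simp: U_def)
    then show ?thesis using UV[of z] by blast
  qed
  define M where "M i = (\<Union>y\<in>R i. U y)" for i
  have M: "M i \<in> F2" for i unfolding M_def using Rfin U Rsub by (intro T2.finite_UN) auto
  have MB: "M i \<subseteq> B" "M i \<inter> H = {}" for i using UB Rsub[of i] unfolding M_def by blast+
  have RM: "R i \<subseteq> M i" for i using yU Rsub by (auto simp: M_def)
  have Mdis: "M True \<inter> M False = {}"
  proof -
    have "U y \<inter> U z = {}" if "y \<in> R True" "z \<in> R False" for y z
      using Udis[of y z] Rdis Rsub that by blast
    then show ?thesis unfolding M_def by blast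
  qed
  \<comment> \<open>Consider a point of small type \<open>b\<close> near a chosen point
    \<open>y\<close> of type \<open>a\<close>. Side \<open>i\<close> of \<open>A\<close> has points
    of type \<open>a\<close>, so \<open>b\<close> would be large unless \<open>b = a\<close>. In
    that case \<open>y\<close> was chosen isolated, and its neighbourhood has no second point of
    type \<open>b\<close>.\<close>
  have Mcls: "M i \<inter> T2.cls b \<subseteq> Q b i" if b: "b \<in> G k" and small: "\<not> at_least (2 ^ k) (C b i)" for b i
  proof
    fix z assume z: "z \<in> M i \<inter> T2.cls b"
    then obtain y a where y: "a \<in> G k" "y \<in> Q a i" "z \<in> U y" by (auto simp: M_def R_def)
    then have yR: "y \<in> RR" using Rsub[of i] by (auto simp: R_def)
    have ya: "t2 y = a" using QB[OF y(1)] y(2) by (auto simp: T2.cls_def)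
    have zb: "t2 z = b" using z by (auto simp: T2.cls_def)
    have le: "le a b" using Vle[OF yR, of z] UV[of y] y(3) ya zb by blast
    obtain x where x: "x \<in> P i" "x \<notin> H" "t1 x = a"
      using Qne[OF y(1), of i] y(2) by (auto simp: C_def T1.cls_def)
    have "b = a" using big[OF b x(1,2)] le x(3) small by blast
    moreover have "y \<in> T2.isolated a"
      using Qsmall[OF b small] y(2) \<open>b = a\<close> by blast
    ultimately have "V y \<inter> T2.cls a = {y}" using Viso[OF yR] ya by simp
    then have "z = y" using UV[of y] y(3) z \<open>b = a\<close> by blast
    then show "z \<in> Q b i" using y(2) \<open>b = a\<close> by simp
  qed
  \<comment> \<open>Only the trace of \<open>B0\<close> is under control; it serves to divide
    \<open>B \<inter> H\<close> in the same way as \<open>A \<inter> H\<close>.\<close>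
  obtain B0 where B0: "B0 \<in> F2" "B0 \<inter> H = A1 \<inter> H" using trace12[OF A1(1)] by blast
  define D where "D i = (if i then B \<inter> B0 else B - B0) - (M True \<union> M False)" for i
  have D: "D i \<in> F2" for i using B B0(1) M by (auto simp: D_def)
  have DH: "D i \<inter> H = P i \<inter> H" for i
    using AB B0(2) A1(2) MB(2)[of True] MB(2)[of False] by (auto simp: D_def P_def)
  have "\<exists>N\<in>F2. N \<subseteq> D i \<and> N \<inter> H = D i \<inter> H \<and> (\<forall>a\<in>G k. N \<inter> T2.cls a \<noteq> {} \<longrightarrow> (\<exists>x\<in>D i \<inter> H. T2.near x a))" for i
    using T2.shrink_to_core[OF D G(1)] .
  then obtain N where N: "\<And>i. N i \<in> F2" "\<And>i. N i \<subseteq> D i" "\<And>i. N i \<inter> H = D i \<inter> H"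
    and Nnear: "\<And>i a. a \<in> G k \<Longrightarrow> N i \<inter> T2.cls a \<noteq> {} \<Longrightarrow> \<exists>x\<in>D i \<inter> H. T2.near x a" by metis
  have Ncls: "N i \<inter> T2.cls b = {}" if b: "b \<in> G k" and small: "\<not> at_least (2 ^ k) (C b i)" for b i
  proof (rule ccontr)
    assume "N i \<inter> T2.cls b \<noteq> {}"
    then obtain x where x: "x \<in> P i" "x \<in> H" "T2.near x b" using Nnear[OF b] DH[of i] by blast
    then have "T1.near x b" using near_iff[OF x(2) b] by blast
    then have "infinite (P i \<inter> T1.cls b)" using T1.near_infinite[OF _ x(2) P x(1)] by blast
    then show False using small by (simp add: at_least_def C_def)
  qed
  text \<open>The rest avoids \<open>H\<close> and is cut into pieces that may be added to one of the sides.\<close>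
  define E where "E = B - (M True \<union> M False) - (N True \<union> N False)"
  have E: "E \<in> F2" using B M N(1) by (auto simp: E_def)
  have EH: "E \<inter> H = {}"
  proof -
    have "B \<inter> H \<subseteq> N True \<union> N False"
      using N(3)[of True] N(3)[of False] DH[of True] DH[of False] AB by (auto simp: P_def)
    then show ?thesis by (auto simp: E_def)
  qed
  define \<U> where "\<U> i = {W \<in> F2. W \<subseteq> E \<and> (\<forall>a\<in>G k. \<not> at_least (2 ^ k) (C a i) \<longrightarrow> W \<inter> T2.cls a = {})}" for i
  \<comment> \<open>A point \<open>y\<close> left over may join a side on which all types of
    \<open>G k\<close> above its own are large. If its own type is in \<open>G k\<close>, then not
    all points of this type were chosen, so some side is large for it. Otherwise
    \<open>outside12\<close> supplies a point of \<open>A\<close> that has the same types of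
    \<open>G k\<close> above its own.\<close>
  have safe: "\<exists>i. \<forall>b\<in>G k. le (t2 y) b \<longrightarrow> at_least (2 ^ k) (C b i)" if y: "y \<in> E" for y
  proof (cases "t2 y \<in> G k")
    case True
    have yB: "y \<in> B" "y \<in> Y2" "y \<notin> H" using y EH BY by (auto simp: E_def)
    have "y \<notin> R i" for i using y RM[of i] by (cases i) (auto simp: E_def)
    then have "y \<notin> Q (t2 y) i" for i using True by (auto simp: R_def)
    moreover have "y \<in> B \<inter> T2.cls (t2 y)" using yB by (simp add: T2.cls_def)
    ultimately obtain s where s: "at_least (2 ^ k) (C (t2 y) s)" using Qrest[OF True] by blast
    then obtain x where x: "x \<in> P s" "x \<notin> H" "t1 x = t2 y"
      using at_least_pow_nonempty by (fastforce simp: C_def T1.cls_def)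
    have "at_least (2 ^ k) (C b s)" if "b \<in> G k" "le (t2 y) b" for b
      using big[OF that(1) x(1,2)] x(3) that(2) s by (cases "b = t2 y") auto
    then show ?thesis by blast
  next
    case False
    have "y \<in> B - H" using y EH by (auto simp: E_def)
    then obtain z where z: "z \<in> A - H" "t1 z \<notin> G k" "\<forall>a\<in>G k. le (t2 y) a \<longrightarrow> le (t1 z) a"
      using outside12[OF A B _ _ False] same_count_nonempty[OF cnt] by metis
    then obtain i where i: "z \<in> P i" using A1 by (auto simp: P_def) (metis DiffI)
    have "at_least (2 ^ k) (C b i)" if "b \<in> G k" "le (t2 y) b" for b
      using big[OF that(1) i] z that by blast
    then show ?thesis by blast
  qed
  have "E \<subseteq> \<Union>(\<U> True \<union> \<U> False)"
  proof
    fix y assume y: "y \<in> E"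
    then obtain i where i: "\<And>b. b \<in> G k \<Longrightarrow> le (t2 y) b \<Longrightarrow> at_least (2 ^ k) (C b i)"
      using safe by blast
    have "y \<notin> H" using y EH by blast
    then obtain W where W: "W \<in> F2" "y \<in> W" "W \<subseteq> E" "\<And>z. z \<in> W \<Longrightarrow> le (t2 y) (t2 z)"
      using T2.trim_inside[OF E y] by metis
    have "W \<inter> T2.cls a = {}" if "a \<in> G k" "\<not> at_least (2 ^ k) (C a i)" for a
      using i[OF that(1)] that(2) W(4) by (auto simp: T2.cls_def)
    then have "W \<in> \<U> i" using W by (simp add: \<U>_def)
    then show "y \<in> \<Union>(\<U> True \<union> \<U> False)" using W(2) by (cases i) auto
  qed
  then have "\<exists>\<D>\<subseteq>\<U> True \<union> \<U> False. finite \<D> \<and> E \<subseteq> \<Union>\<D>"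
    using E by (intro T2.compact_subset) (auto simp: \<U>_def)
  then obtain \<D> where \<D>: "\<D> \<subseteq> \<U> True \<union> \<U> False" "finite \<D>" "E \<subseteq> \<Union>\<D>" by (elim exE conjE)
  define E1 where "E1 = \<Union>(\<D> \<inter> \<U> True)"
  have E1: "E1 \<in> F2" "E1 \<subseteq> E"
    unfolding E1_def using \<D>(2) by (auto simp: \<U>_def intro!: T2.finite_Union)
  define EE where "EE i = (if i then E1 else E - E1)" for i
  have EE: "EE i \<in> F2" for i using E E1 by (simp add: EE_def T2.Diff)
  have EEcls: "EE i \<inter> T2.cls b = {}" if b: "b \<in> G k" and small: "\<not> at_least (2 ^ k) (C b i)" for b i
  proof -
    have "EE i \<subseteq> \<Union>(\<U> i)"
    proof (cases i)
      case False
      have "E - E1 \<subseteq> \<Union>(\<U> False)" using \<D>(1,3) unfolding E1_def by blast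
      then show ?thesis using False by (simp add: EE_def)
    qed (auto simp: EE_def E1_def)
    moreover have "W \<inter> T2.cls b = {}" if "W \<in> \<U> i" for W using that b small by (auto simp: \<U>_def)
    ultimately show ?thesis by blast
  qed
  define Z where "Z i = N i \<union> M i \<union> EE i" for i
  have Z: "Z i \<in> F2" for i using N(1) M EE by (simp add: Z_def T2.Un)
  have ND: "N i \<subseteq> B - (M True \<union> M False)" for i using N(2)[of i] by (cases i) (auto simp: D_def)
  have Ndis: "N True \<inter> N False = {}" using N(2)[of True] N(2)[of False] by (auto simp: D_def)
  have Z2: "Z False = B - Z True" and Z1: "Z True \<subseteq> B"
    using ND[of True] ND[of False] Ndis Mdis MB(1)[of True] MB(1)[of False] E1(2)
    unfolding Z_def EE_def E_def by auto
  have ZH: "Z i \<inter> H = P i \<inter> H" for i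
    using N(3)[of i] DH[of i] MB(2)[of i] EH E1(2) by (auto simp: Z_def EE_def)
  have Zcnt: "same_count k (C b i) (Z i \<inter> T2.cls b)" if b: "b \<in> G k" for b i
  proof -
    have sub: "Q b i \<subseteq> Z i \<inter> T2.cls b"
      using RM[of i] QB[OF b] b by (auto simp: Z_def R_def)
    show ?thesis
    proof (cases "at_least (2 ^ k) (C b i)")
      case True
      have "at_least (2 ^ k) (Q b i)" using Qbig[OF b True] by (simp add: at_least_def)
      then have "at_least (2 ^ k) (Z i \<inter> T2.cls b)" using sub by (rule at_least_superset)
      then show ?thesis using True at_least_mono unfolding same_count_def by blast
    next
      case False
      then have "Z i \<inter> T2.cls b = Q b i"
        using sub Mcls[OF b False] Ncls[OF b False] EEcls[OF b False] by (auto simp: Z_def)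
      moreover have "finite (C b i)" using False by (simp add: at_least_def)
      ultimately show ?thesis using Qsmall[OF b False] Qfin[OF b] by (simp add: same_count_card)
    qed
  qed
  have "rel k (P i) (Z i)" for i
    using P Z ZH Zcnt by (auto simp: rel_def C_def)
  from this[of True] this[of False] show ?thesis
    using Z Z1 Z2 by (intro bexI[of _ "Z True"]) (auto simp: P_def)
qed

lemma G_mono: "G 0 \<subseteq> G k"
  by (induction k) (use G(3) in auto)

lemma rel_trace: "rel k A B \<Longrightarrow> A \<inter> H = B \<inter> H"
  by (simp add: rel_def)

lemma rel_cls: "rel k A B \<Longrightarrow> a \<in> G k \<Longrightarrow> A \<inter> T1.cls a = {} \<longleftrightarrow> B \<inter> T2.cls a = {}"
  unfolding rel_def using same_count_nonempty by metis

text \<open>A nonempty set without trace on \<open>H\<close> might have no point whose type is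
  counted. The cover condition excludes this: some type of \<open>G 0\<close> lies above that of the
  given point and therefore occurs in the set, too.\<close>

lemma rel_empty_imp:
  assumes r: "rel k A B" and "B = {}"
  shows "A = {}"
proof (rule ccontr)
  assume "A \<noteq> {}"
  then obtain y where y: "y \<in> A" by blast
  have A: "A \<in> F1" using r by (simp add: rel_def)
  have "y \<notin> H" using rel_trace[OF r] y assms(2) by blast
  moreover have "y \<in> Y1" using T1.sets_into_space[OF A] y by blast
  ultimately obtain a where a: "a \<in> G 0" "le (t1 y) a" using cover1 by blast
  then have aG: "a \<in> G k" "a \<in> Types" using G_mono G(2) by blast+
  have "A \<inter> T1.cls a \<noteq> {}"
  proof (cases "a = t1 y")
    case True
    then show ?thesis using y \<open>y \<notin> H\<close> \<open>y \<in> Y1\<close> by (auto simp: T1.cls_def)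
  next
    case False
    then have "infinite (A \<inter> T1.cls a)" using T1.above_infinite[OF A y \<open>y \<notin> H\<close> aG(2) a(2)] by blast
    then show ?thesis by auto
  qed
  then show False using rel_cls[OF r aG(1)] assms(2) by simp
qed

end

text \<open>Off \<open>H\<close> a colour need not be a union of classes. It suffices that the sets
  of the field meet it exactly when they meet one of the classes in \<open>col p\<close>, since the
  ideals cannot tell a set from its closure.\<close>

locale coloured_pair = typed_pair Y1 Y2 F1 F2 H t1 t2 le dis Types G
  for Y1 Y2 :: "'y set" and F1 F2 H and t1 t2 :: "'y \<Rightarrow> 't" and le dis Types G +
  fixes e :: 'y and C1 C2 :: "'p \<Rightarrow> 'y set" and Q :: "'p set" and col :: "'p \<Rightarrow> 't set"
  assumes e: "e \<in> H"
    and colH: "p \<in> Q \<Longrightarrow> C1 p \<inter> H = C2 p \<inter> H"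
    and col: "p \<in> Q \<Longrightarrow> col p \<subseteq> G 0"
    and col1: "p \<in> Q \<Longrightarrow> A \<in> F1 \<Longrightarrow> A \<inter> (C1 p - H) = {} \<longleftrightarrow> (\<forall>a\<in>col p. A \<inter> T1.cls a = {})"
    and col2: "p \<in> Q \<Longrightarrow> B \<in> F2 \<Longrightarrow> B \<inter> (C2 p - H) = {} \<longleftrightarrow> (\<forall>a\<in>col p. B \<inter> T2.cls a = {})"
begin

sublocale ef: ef_system Y1 Y2 F1 F2 e C1 C2 Q rel
proof
  interpret s: typed_pair Y2 Y1 F2 F1 H t2 t1 le dis Types G by (rule typed_pair_sym)
  have s_rel: "s.rel k B A \<longleftrightarrow> rel k A B" for k A B
    unfolding s.rel_def rel_def using same_count_sym by blast
  fix m A B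
  show "A \<in> F1 \<and> B \<in> F2" if "rel m A B" using that by (simp add: rel_def)
  show "A = {} \<longleftrightarrow> B = {}" if "rel m A B"
    using rel_empty_imp[OF that] s.rel_empty_imp[of m B A] that unfolding s_rel by blast
  show "e \<in> A \<longleftrightarrow> e \<in> B" if "rel m A B" using rel_trace[OF that] e by blast
  show "A \<inter> C1 p = {} \<longleftrightarrow> B \<inter> C2 p = {}" if r: "rel m A B" and p: "p \<in> Q" for p
  proof -
    have AB: "A \<in> F1" "B \<in> F2" using r by (auto simp: rel_def)
    have "A \<inter> T1.cls a = {} \<longleftrightarrow> B \<inter> T2.cls a = {}" if "a \<in> col p" for a
      using rel_cls[OF r] that col[OF p] G_mono by blast
    then have off: "A \<inter> (C1 p - H) = {} \<longleftrightarrow> B \<inter> (C2 p - H) = {}"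
      using col1[OF p AB(1)] col2[OF p AB(2)] by blast
    have on: "A \<inter> (C1 p \<inter> H) = B \<inter> (C2 p \<inter> H)"
      using rel_trace[OF r] colH[OF p] by blast
    have "A \<inter> C1 p = A \<inter> (C1 p - H) \<union> A \<inter> (C1 p \<inter> H)" "B \<inter> C2 p = B \<inter> (C2 p - H) \<union> B \<inter> (C2 p \<inter> H)"
      by blast+
    then show ?thesis using off on by simp
  qed
  show "\<exists>B1\<in>F2. B1 \<subseteq> B \<and> rel m A1 B1 \<and> rel m (A - A1) (B - B1)"
    if "rel (Suc m) A B" "A1 \<in> F1" "A1 \<subseteq> A" for A1
    using rel_forth[OF that] .
  show "\<exists>A1\<in>F1. A1 \<subseteq> A \<and> rel m A1 B1 \<and> rel m (A - A1) (B - B1)"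
    if "rel (Suc m) A B" "B1 \<in> F2" "B1 \<subseteq> B" for B1
    using s.rel_forth[of m B A B1] that unfolding s_rel by blast
qed

end

section \<open>Complete partitions of locally compact spaces\<close>

text \<open>The space is given through its ring of compact open sets alone. Note the direction of
  the order: \<open>lt p q\<close> says that the points of \<open>B p\<close> are limits of
  \<open>B q\<close>; in particular \<open>lt p p\<close> says that \<open>B p\<close> is
  crowded.\<close>

locale cpart =
  fixes R :: "'x set set" and X :: "'x set" and P :: "'p set" and lt :: "'p \<Rightarrow> 'p \<Rightarrow> bool"
    and B :: "'p \<Rightarrow> 'x set"
  assumes R_sub: "A \<in> R \<Longrightarrow> A \<subseteq> X"
    and R_empty [simp]: "{} \<in> R"
    and R_Un: "A \<in> R \<Longrightarrow> D \<in> R \<Longrightarrow> A \<union> D \<in> R"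
    and R_Diff: "A \<in> R \<Longrightarrow> D \<in> R \<Longrightarrow> A - D \<in> R"
    and R_compact: "A \<in> R \<Longrightarrow> \<C> \<subseteq> R \<Longrightarrow> A \<subseteq> \<Union>\<C> \<Longrightarrow> \<exists>\<D>\<subseteq>\<C>. finite \<D> \<and> A \<subseteq> \<Union>\<D>"
    and R_cover: "x \<in> X \<Longrightarrow> \<exists>A\<in>R. x \<in> A"
    and R_separated: "x \<in> X \<Longrightarrow> y \<in> X \<Longrightarrow> x \<noteq> y \<Longrightarrow> \<exists>A\<in>R. x \<in> A \<and> y \<notin> A"
    and R_countable: "countable R"
    and block_ex: "x \<in> X \<Longrightarrow> \<exists>p\<in>P. x \<in> B p"
    and block_unique: "p \<in> P \<Longrightarrow> q \<in> P \<Longrightarrow> x \<in> B p \<Longrightarrow> x \<in> B q \<Longrightarrow> p = q"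
    and block_sub: "p \<in> P \<Longrightarrow> B p \<subseteq> X"
    and block_nonempty: "p \<in> P \<Longrightarrow> B p \<noteq> {}"
    and limit_iff: "p \<in> P \<Longrightarrow> q \<in> P \<Longrightarrow> x \<in> B p \<Longrightarrow>
      lt p q \<longleftrightarrow> (\<forall>A\<in>R. x \<in> A \<longrightarrow> A \<inter> B q - {x} \<noteq> {})"
    and lt_trans: "p \<in> P \<Longrightarrow> q \<in> P \<Longrightarrow> r \<in> P \<Longrightarrow> lt p q \<Longrightarrow> lt q r \<Longrightarrow> lt p r"
    and lt_antisym: "p \<in> P \<Longrightarrow> q \<in> P \<Longrightarrow> lt p q \<Longrightarrow> lt q p \<Longrightarrow> p = q"
begin

lemma R_Int: "A \<in> R \<Longrightarrow> D \<in> R \<Longrightarrow> A \<inter> D \<in> R"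
proof -
  assume "A \<in> R" "D \<in> R"
  then have "A - (A - D) \<in> R" by (simp add: R_Diff)
  moreover have "A - (A - D) = A \<inter> D" by blast
  ultimately show ?thesis by simp
qed

lemma R_UN: "finite I \<Longrightarrow> (\<And>i. i \<in> I \<Longrightarrow> A i \<in> R) \<Longrightarrow> (\<Union>i\<in>I. A i) \<in> R"
  by (induction I rule: finite_induct) (auto intro: R_Un)

lemma R_INT: "finite I \<Longrightarrow> (\<And>i. i \<in> I \<Longrightarrow> A i \<in> R) \<Longrightarrow> D \<in> R \<Longrightarrow> D \<inter> (\<Inter>i\<in>I. A i) \<in> R"
proof (induction I rule: finite_induct)
  case (insert i I)
  have "D \<inter> (\<Inter>i\<in>insert i I. A i) = (D \<inter> (\<Inter>i\<in>I. A i)) \<inter> A i" by blast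
  with insert show ?case by (simp add: R_Int)
qed simp

definition blk :: "'x \<Rightarrow> 'p" where "blk x = (THE p. p \<in> P \<and> x \<in> B p)"

lemma blk_eq: "p \<in> P \<Longrightarrow> x \<in> B p \<Longrightarrow> blk x = p"
  unfolding blk_def using block_unique by (intro the_equality) auto

lemma blk: "x \<in> X \<Longrightarrow> blk x \<in> P" "x \<in> X \<Longrightarrow> x \<in> B (blk x)"
  using block_ex blk_eq by metis+

text \<open>These are the blocks that meet every neighbourhood of a point of \<open>B p\<close>,
  that is, those whose closure contains \<open>B p\<close>.\<close>

definition up :: "'p \<Rightarrow> 'p set" where "up p = {q \<in> P. q = p \<or> lt p q}"

definition T :: "'x set \<Rightarrow> 'p set" where "T A = {p \<in> P. A \<inter> B p \<noteq> {}}"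

lemma self_up: "p \<in> P \<Longrightarrow> p \<in> up p"
  by (simp add: up_def)

lemma up_sub: "up p \<subseteq> P"
  by (auto simp: up_def)

lemma up_trans: "p \<in> P \<Longrightarrow> q \<in> up p \<Longrightarrow> up q \<subseteq> up p"
  using lt_trans by (auto simp: up_def)

lemma up_antisym: "p \<in> P \<Longrightarrow> q \<in> up p \<Longrightarrow> p \<in> up q \<Longrightarrow> p = q"
  using lt_antisym by (auto simp: up_def)

lemma up_inj: "p \<in> P \<Longrightarrow> q \<in> P \<Longrightarrow> up p = up q \<Longrightarrow> p = q"
  using up_antisym self_up by metis

lemma in_T_blk: "A \<in> R \<Longrightarrow> x \<in> A \<Longrightarrow> blk x \<in> T A"
  using blk[of x] R_sub[of A] unfolding T_def by blast

lemma T_E: "p \<in> T A \<Longrightarrow> A \<subseteq> X \<Longrightarrow> \<exists>x\<in>A. blk x = p"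
  using blk_eq unfolding T_def by blast

lemma T_mono: "A \<subseteq> D \<Longrightarrow> T A \<subseteq> T D"
  by (auto simp: T_def)

lemma T_sub: "T A \<subseteq> P"
  by (auto simp: T_def)

lemma limit_infinite:
  assumes A: "A \<in> R" "x \<in> A" and q: "q \<in> P" "lt (blk x) q"
  shows "infinite (A \<inter> B q)"
proof
  assume fin: "finite (A \<inter> B q)"
  have x: "x \<in> X" using R_sub A by blast
  have "\<forall>y\<in>A \<inter> B q - {x}. \<exists>D\<in>R. x \<in> D \<and> y \<notin> D"
    using R_separated[OF x] R_sub[OF A(1)] by blast
  then obtain D where D: "\<And>y. y \<in> A \<inter> B q - {x} \<Longrightarrow> D y \<in> R \<and> x \<in> D y \<and> y \<notin> D y" by metis
  have "A \<inter> (\<Inter>y\<in>A \<inter> B q - {x}. D y) \<in> R" using fin D A by (intro R_INT) auto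
  moreover have "x \<in> A \<inter> (\<Inter>y\<in>A \<inter> B q - {x}. D y)" using D A by blast
  ultimately have "A \<inter> (\<Inter>y\<in>A \<inter> B q - {x}. D y) \<inter> B q - {x} \<noteq> {}"
    using limit_iff[OF blk(1)[OF x] q(1) blk(2)[OF x]] q(2) by metis
  then show False using D by blast
qed

lemma T_up: "A \<in> R \<Longrightarrow> p \<in> T A \<Longrightarrow> up p \<subseteq> T A"
proof
  fix q assume A: "A \<in> R" "p \<in> T A" and q: "q \<in> up p"
  obtain x where x: "x \<in> A" "blk x = p" using T_E[OF A(2) R_sub[OF A(1)]] by blast
  show "q \<in> T A"
  proof (cases "q = p")
    case False
    then have "q \<in> P" "lt (blk x) q" using q x by (auto simp: up_def)
    then have "infinite (A \<inter> B q)" using limit_infinite[OF A(1) x(1)] by blast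
    then show ?thesis using \<open>q \<in> P\<close> by (auto simp: T_def)
  qed (use A in simp)
qed

lemma avoid_one:
  assumes "x \<in> X" "q \<in> P" "q \<notin> up (blk x)"
  shows "\<exists>A\<in>R. x \<in> A \<and> A \<inter> B q = {}"
proof -
  have "\<not> lt (blk x) q" "q \<noteq> blk x" using assms by (auto simp: up_def)
  then obtain A where "A \<in> R" "x \<in> A" "A \<inter> B q - {x} = {}"
    using limit_iff[OF blk(1)[OF assms(1)] assms(2) blk(2)[OF assms(1)]] by blast
  moreover have "x \<notin> B q" using \<open>q \<noteq> blk x\<close> blk_eq assms by blast
  ultimately show ?thesis by blast
qed

lemma avoid:
  assumes A: "A \<in> R" "x \<in> A" and F: "finite F" "F \<subseteq> P" "F \<inter> up (blk x) = {}"
  obtains D where "D \<in> R" "x \<in> D" "D \<subseteq> A" "\<And>q. q \<in> F \<Longrightarrow> D \<inter> B q = {}"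
proof -
  have x: "x \<in> X" using R_sub A by blast
  have "\<forall>q\<in>F. \<exists>E\<in>R. x \<in> E \<and> E \<inter> B q = {}" using avoid_one[OF x] F by blast
  then obtain E where E: "\<And>q. q \<in> F \<Longrightarrow> E q \<in> R \<and> x \<in> E q \<and> E q \<inter> B q = {}" by metis
  have "A \<inter> (\<Inter>q\<in>F. E q) \<in> R" using A F E by (intro R_INT) auto
  moreover have "A \<inter> (\<Inter>q\<in>F. E q) \<inter> B q = {}" if "q \<in> F" for q using E[OF that] that by blast
  ultimately show ?thesis using A E by (intro that[of "A \<inter> (\<Inter>q\<in>F. E q)"]) auto
qed

lemma isolate:
  assumes A: "A \<in> R" "x \<in> A" and d: "\<not> lt (blk x) (blk x)"
  obtains D where "D \<in> R" "D \<subseteq> A" "D \<inter> B (blk x) = {x}"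
proof -
  have x: "x \<in> X" using R_sub A by blast
  obtain E where E: "E \<in> R" "x \<in> E" "E \<inter> B (blk x) - {x} = {}"
    using limit_iff[OF blk(1)[OF x] blk(1)[OF x] blk(2)[OF x]] d by blast
  have "(A \<inter> E) \<inter> B (blk x) = {x}" using E(2,3) A(2) blk(2)[OF x] by blast
  then show ?thesis using R_Int[OF A(1) E(1)] that by blast
qed

text \<open>Only finitely many blocks in \<open>T A\<close> lie outside \<open>up (blk x)\<close>,
  and none of them has \<open>x\<close> in its closure.\<close>

lemma trim_exists:
  assumes A: "A \<in> R" "x \<in> A" and fin: "finite (T A)"
  obtains D where "D \<in> R" "x \<in> D" "D \<subseteq> A" "T D = up (blk x)"
proof -
  have "finite (T A - up (blk x))" "T A - up (blk x) \<subseteq> P" "(T A - up (blk x)) \<inter> up (blk x) = {}"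
    using fin T_sub[of A] by auto
  then obtain D where D: "D \<in> R" "x \<in> D" "D \<subseteq> A" "\<And>q. q \<in> T A - up (blk x) \<Longrightarrow> D \<inter> B q = {}"
    using avoid[OF A] by metis
  have "T D \<subseteq> up (blk x)"
  proof
    fix q assume q: "q \<in> T D"
    then have "q \<in> T A" using T_mono[OF D(3)] by blast
    then show "q \<in> up (blk x)" using D(4)[of q] q by (auto simp: T_def)
  qed
  moreover have "up (blk x) \<subseteq> T D" using T_up[OF D(1) in_T_blk[OF D(1,2)]] .
  ultimately show ?thesis using D that by blast
qed

text \<open>Inside \<open>a\<close> the block \<open>B p\<close> is closed: the other blocks that
  meet \<open>a\<close> are strictly above \<open>p\<close>, so by antisymmetry their points are not
  limits of \<open>B p\<close>. A closed discrete subset of a compact set is finite.\<close>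

lemma discrete_finite:
  assumes a: "a \<in> R" "T a \<subseteq> up p" and p: "p \<in> P" "\<not> lt p p"
  shows "finite (a \<inter> B p)"
proof -
  define \<C> where "\<C> = {D \<in> R. finite (D \<inter> B p)}"
  have "a \<subseteq> \<Union>\<C>"
  proof
    fix y assume y: "y \<in> a"
    have yX: "y \<in> X" using R_sub a y by blast
    have yp: "blk y \<in> up p" using in_T_blk[OF a(1) y] a(2) by blast
    show "y \<in> \<Union>\<C>"
    proof (cases "blk y = p")
      case True
      then have "\<not> lt (blk y) (blk y)" using p by simp
      then obtain D where D: "D \<in> R" "D \<subseteq> a" "D \<inter> B (blk y) = {y}" by (rule isolate[OF a(1) y])
      then have "D \<in> \<C>" "y \<in> D" using True by (auto simp: \<C>_def)
      then show ?thesis by blast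
    next
      case False
      then have "p \<notin> up (blk y)" using up_antisym[OF p(1) yp] by blast
      then obtain D where "D \<in> R" "y \<in> D" "D \<inter> B p = {}" using avoid_one[OF yX p(1)] by blast
      then have "D \<in> \<C>" "y \<in> D" by (auto simp: \<C>_def)
      then show ?thesis by blast
    qed
  qed
  moreover have "\<C> \<subseteq> R" by (auto simp: \<C>_def)
  ultimately have "\<exists>\<D>\<subseteq>\<C>. finite \<D> \<and> a \<subseteq> \<Union>\<D>" by (intro R_compact[OF a(1)])
  then obtain \<D> where \<D>: "\<D> \<subseteq> \<C>" "finite \<D>" "a \<subseteq> \<Union>\<D>" by (elim exE conjE)
  have "finite (\<Union>D\<in>\<D>. D \<inter> B p)" using \<D> by (intro finite_UN_I) (auto simp: \<C>_def)
  moreover have "a \<inter> B p \<subseteq> (\<Union>D\<in>\<D>. D \<inter> B p)" using \<D>(3) by blast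
  ultimately show ?thesis using finite_subset by blast
qed

end

section \<open>Attaching compact pieces\<close>

datatype 'x pt = Pt 'x | Infty | Apex | Copy nat 'x

text \<open>
  The one-point compactification of \<open>X - X0\<close> (with \<open>X0\<close> open), possibly with an additional
  point \<open>Apex\<close>, to which copies of the compact open sets \<open>C i\<close> are attached in such a way that
  every neighbourhood of a point \<open>y\<close> contains almost all \<open>C i\<close> with \<open>z i = y\<close>.
\<close>

locale attach = cpart +
  fixes X0 :: "'a set" and ap :: bool and z :: "nat \<Rightarrow> 'a pt" and C :: "nat \<Rightarrow> 'a set"
  assumes X0_open: "x \<in> X0 \<Longrightarrow> \<exists>A\<in>R. x \<in> A \<and> A \<subseteq> X0"
    and C_R: "C i \<in> R"
    and z_pt: "z i = Infty \<or> (\<exists>x\<in>X - X0. z i = Pt x) \<or> (ap \<and> z i = Apex)"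
begin

definition pts where
  "pts = insert Infty (Pt ` (X - X0) \<union> (if ap then {Apex} else {}) \<union> {Copy i x |i x. x \<in> C i})"

definition base where "base A = {x \<in> X - X0. Pt x \<in> A}"

definition part where "part i A = {x \<in> C i. Copy i x \<in> A}"

definition undecided where
  "undecided A = {i. \<not> (if z i \<in> A then part i A = C i else part i A = {})}"

text \<open>The clopen sets of the space. The base is compact open or the complement of such a set,
  according to whether the point at infinity belongs to the set, and almost every copy follows its
  attaching point.\<close>

definition fld where
  "fld = {A. A \<subseteq> pts \<and> (\<exists>D\<in>R. base A = (if Infty \<in> A then X - X0 - D else D - X0)) \<and>
     (\<forall>i. part i A \<in> R) \<and> finite (undecided A)}"

lemma undecided_Un: "undecided (A \<union> D) \<subseteq> undecided A \<union> undecided D"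
  by (auto simp: undecided_def part_def split: if_splits)

lemma z_pts: "z i \<in> pts"
  using z_pt[of i] by (auto simp: pts_def)

sublocale algebra pts fld
  unfolding algebra_iff_Un
proof (intro conjI ballI)
  show "fld \<subseteq> Pow pts" by (auto simp: fld_def)
  show "{} \<in> fld"
    by (auto simp: fld_def base_def part_def undecided_def intro!: bexI[of _ "{}"])
next
  fix A assume A: "A \<in> fld"
  then obtain D where D: "D \<in> R" "base A = (if Infty \<in> A then X - X0 - D else D - X0)"
    by (auto simp: fld_def)
  have "base (pts - A) = X - X0 - base A" by (auto simp: base_def pts_def)
  then have b: "base (pts - A) = (if Infty \<in> pts - A then X - X0 - D else D - X0)"
    using D R_sub[OF D(1)] by (auto simp: pts_def)
  have part: "part i (pts - A) = C i - part i A" for i by (auto simp: part_def pts_def)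
  have pR: "part i (pts - A) \<in> R" for i unfolding part using A by (intro R_Diff C_R) (auto simp: fld_def)
  have "undecided (pts - A) \<subseteq> undecided A"
    using z_pts unfolding undecided_def part by (auto simp: part_def split: if_splits)
  then have "finite (undecided (pts - A))" using A finite_subset by (auto simp: fld_def)
  moreover have "\<exists>D\<in>R. base (pts - A) = (if Infty \<in> pts - A then X - X0 - D else D - X0)"
    using b D(1) by blast
  ultimately show "pts - A \<in> fld"
    unfolding fld_def using pR by blast
next
  fix A A' assume A: "A \<in> fld" and A': "A' \<in> fld"
  obtain D where D: "D \<in> R" "base A = (if Infty \<in> A then X - X0 - D else D - X0)"
    using A by (auto simp: fld_def)
  obtain D' where D': "D' \<in> R" "base A' = (if Infty \<in> A' then X - X0 - D' else D' - X0)"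
    using A' by (auto simp: fld_def)
  have b: "base (A \<union> A') = base A \<union> base A'" by (auto simp: base_def)
  have "\<exists>E\<in>R. base (A \<union> A') = (if Infty \<in> A \<union> A' then X - X0 - E else E - X0)"
  proof (cases "Infty \<in> A"; cases "Infty \<in> A'")
    assume "Infty \<in> A" "Infty \<in> A'"
    then show ?thesis using D D' R_Int[OF D(1) D'(1)] b by (intro bexI[of _ "D \<inter> D'"]) auto
  next
    assume "Infty \<in> A" "Infty \<notin> A'"
    then show ?thesis using D D' R_Diff[OF D(1) D'(1)] b R_sub[OF D'(1)] by (intro bexI[of _ "D - D'"]) auto
  next
    assume "Infty \<notin> A" "Infty \<in> A'"
    then show ?thesis using D D' R_Diff[OF D'(1) D(1)] b R_sub[OF D(1)] by (intro bexI[of _ "D' - D"]) auto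
  next
    assume "Infty \<notin> A" "Infty \<notin> A'"
    then show ?thesis using D D' R_Un[OF D(1) D'(1)] b by (intro bexI[of _ "D \<union> D'"]) auto
  qed
  moreover have "part i (A \<union> A') \<in> R" for i
  proof -
    have "part i (A \<union> A') = part i A \<union> part i A'" by (auto simp: part_def)
    then show ?thesis using A A' R_Un by (simp add: fld_def)
  qed
  moreover have "finite (undecided (A \<union> A'))"
    using undecided_Un A A' by (intro finite_subset[OF undecided_Un]) (auto simp: fld_def)
  moreover have "A \<union> A' \<subseteq> pts" using A A' by (simp add: fld_def)
  ultimately show "A \<union> A' \<in> fld" unfolding fld_def by blast
qed

lemma fld_open:
  assumes "A \<in> fld" "Pt x \<in> A"
  shows "\<exists>D\<in>R. x \<in> D \<and> Pt ` (D - X0) \<subseteq> A"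
proof -
  obtain D where D: "D \<in> R" "base A = (if Infty \<in> A then X - X0 - D else D - X0)"
    using assms(1) by (auto simp: fld_def)
  have "Pt x \<in> pts" using assms by (auto simp: fld_def)
  then have x: "x \<in> X - X0" by (auto simp: pts_def split: if_splits)
  then obtain E where E: "E \<in> R" "x \<in> E" using R_cover by blast
  have xb: "x \<in> base A" using x assms(2) by (simp add: base_def)
  show ?thesis
  proof (cases "Infty \<in> A")
    case True
    have "E - D - X0 \<subseteq> base A" using D(2) True R_sub[OF E(1)] by auto
    then show ?thesis using True D xb E R_Diff[OF E(1) D(1)]
      by (intro bexI[of _ "E - D"]) (auto simp: base_def)
  next
    case False
    then show ?thesis using D xb by (intro bexI[of _ D]) (auto simp: base_def)
  qed
qed

sublocale compact_field pts fld
proof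
  fix \<C> assume \<C>: "\<C> \<subseteq> fld" "pts \<subseteq> \<Union>\<C>"
  obtain A0 where A0: "A0 \<in> \<C>" "Infty \<in> A0" using \<C>(2) by (auto simp: pts_def)
  then obtain D where D: "D \<in> R" "base A0 = X - X0 - D" using \<C>(1) by (auto simp: fld_def)
  define \<E> where "\<E> = {E \<in> R. \<exists>A\<in>\<C>. Pt ` (E - X0) \<subseteq> A}"
  have "D \<subseteq> \<Union>\<E>"
  proof
    fix x assume x: "x \<in> D"
    show "x \<in> \<Union>\<E>"
    proof (cases "x \<in> X0")
      case True
      then obtain E where "E \<in> R" "x \<in> E" "E \<subseteq> X0" using X0_open by blast
      then have "E \<in> \<E>" using A0 by (auto simp: \<E>_def)
      then show ?thesis using \<open>x \<in> E\<close> by blast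
    next
      case False
      then have "Pt x \<in> pts" using x R_sub[OF D(1)] by (auto simp: pts_def)
      then obtain A where A: "A \<in> \<C>" "Pt x \<in> A" using \<C>(2) by blast
      then obtain E where "E \<in> R" "x \<in> E" "Pt ` (E - X0) \<subseteq> A" using fld_open \<C>(1) by blast
      then show ?thesis using A by (auto simp: \<E>_def)
    qed
  qed
  moreover have "\<E> \<subseteq> R" by (auto simp: \<E>_def)
  ultimately have "\<exists>\<E>'\<subseteq>\<E>. finite \<E>' \<and> D \<subseteq> \<Union>\<E>'" by (intro R_compact[OF D(1)])
  then obtain \<E>' where \<E>': "\<E>' \<subseteq> \<E>" "finite \<E>'" "D \<subseteq> \<Union>\<E>'" by (elim exE conjE)
  have "\<forall>E\<in>\<E>'. \<exists>A\<in>\<C>. Pt ` (E - X0) \<subseteq> A" using \<E>'(1) by (auto simp: \<E>_def)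
  then obtain f where f: "\<And>E. E \<in> \<E>' \<Longrightarrow> f E \<in> \<C> \<and> Pt ` (E - X0) \<subseteq> f E" by metis
  have "ap \<Longrightarrow> Apex \<in> pts" unfolding pts_def by simp
  then have "ap \<Longrightarrow> Apex \<in> \<Union>\<C>" using \<C>(2) subsetD by blast
  then have "\<exists>A1\<in>\<C>. ap \<longrightarrow> Apex \<in> A1" using A0(1) by (meson UnionE)
  then obtain A1 where A1: "A1 \<in> \<C>" "ap \<Longrightarrow> Apex \<in> A1" by blast
  define \<D> where "\<D> = insert A0 (insert A1 (f ` \<E>'))"
  have \<D>: "\<D> \<subseteq> \<C>" "finite \<D>" using A0 A1 f \<E>'(2) by (auto simp: \<D>_def)
  have ptcov: "Pt x \<in> \<Union>\<D>" if "x \<in> X - X0" for x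
  proof (cases "x \<in> D")
    case True
    then obtain E where "E \<in> \<E>'" "x \<in> E" using \<E>'(3) by blast
    then show ?thesis using f[of E] that by (auto simp: \<D>_def)
  next
    case False
    then have "x \<in> base A0" using D(2) that by blast
    then show ?thesis by (auto simp: \<D>_def base_def)
  qed
  have zcov: "\<exists>A\<in>\<D>. z i \<in> A" for i
  proof -
    have "z i = Pt x \<Longrightarrow> x \<in> X - X0 \<Longrightarrow> z i \<in> \<Union>\<D>" for x using ptcov by simp
    moreover have "Infty \<in> \<Union>\<D>" "ap \<Longrightarrow> Apex \<in> \<Union>\<D>" using A0 A1 unfolding \<D>_def by blast+
    ultimately have "z i \<in> \<Union>\<D>" using z_pt[of i] by metis
    then show ?thesis by blast
  qed
  \<comment> \<open>\<open>\<D>\<close> covers all attaching points. A copy on which its members are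
    decided is covered together with its attaching point; the finitely many others are
    compact.\<close>
  define J where "J = (\<Union>A\<in>\<D>. undecided A)"
  have J: "finite J" unfolding J_def using \<D> \<C>(1) by (intro finite_UN_I) (auto simp: fld_def)
  have "\<exists>\<K>\<subseteq>\<C>. finite \<K> \<and> Copy i ` C i \<subseteq> \<Union>\<K>" for i
  proof -
    have "C i \<subseteq> \<Union>(part i ` \<C>)"
    proof
      fix x assume x: "x \<in> C i"
      then have "Copy i x \<in> pts" by (auto simp: pts_def)
      then show "x \<in> \<Union>(part i ` \<C>)" using \<C>(2) x by (auto simp: part_def)
    qed
    moreover have "part i ` \<C> \<subseteq> R" using \<C>(1) by (auto simp: fld_def)
    ultimately have "\<exists>\<K>\<subseteq>part i ` \<C>. finite \<K> \<and> C i \<subseteq> \<Union>\<K>" by (intro R_compact[OF C_R])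
    then obtain \<K> where \<K>: "\<K> \<subseteq> part i ` \<C>" "finite \<K>" "C i \<subseteq> \<Union>\<K>" by (elim exE conjE)
    then obtain \<K>' where \<K>': "\<K>' \<subseteq> \<C>" "finite \<K>'" "\<K> = part i ` \<K>'"
      using finite_subset_image[OF \<K>(2,1)] by auto
    have "Copy i ` C i \<subseteq> \<Union>\<K>'" using \<K>(3) unfolding \<K>'(3) by (auto simp: part_def)
    then show ?thesis using \<K>' by blast
  qed
  then obtain K where K: "\<And>i. K i \<subseteq> \<C> \<and> finite (K i) \<and> Copy i ` C i \<subseteq> \<Union>(K i)" by metis
  have "pts \<subseteq> \<Union>(\<D> \<union> (\<Union>i\<in>J. K i))"
  proof
    fix y assume y: "y \<in> pts"
    consider "y = Infty" | x where "y = Pt x" "x \<in> X - X0" | "y = Apex" ap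
      | i x where "y = Copy i x" "x \<in> C i"
      using y by (auto simp: pts_def split: if_splits)
    then show "y \<in> \<Union>(\<D> \<union> (\<Union>i\<in>J. K i))"
    proof cases
      case 1
      then show ?thesis using A0 by (auto simp: \<D>_def)
    next
      case 2
      then show ?thesis using ptcov by blast
    next
      case 3
      then show ?thesis using A1 by (auto simp: \<D>_def)
    next
      case (4 i x)
      show ?thesis
      proof (cases "i \<in> J")
        case True
        then show ?thesis using K[of i] 4 by blast
      next
        case False
        obtain A where A: "A \<in> \<D>" "z i \<in> A" using zcov by blast
        then have "part i A = C i" using False by (auto simp: J_def undecided_def)
        then show ?thesis using A(1) 4 by (auto simp: part_def)
      qed
    qed
  qed
  moreover have "K i \<subseteq> \<C>" "finite (K i)" for i using K[of i] by blast+
  then have "\<D> \<union> (\<Union>i\<in>J. K i) \<subseteq> \<C>" "finite (\<D> \<union> (\<Union>i\<in>J. K i))"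
    using \<D> J by blast+
  ultimately show "\<exists>\<D>\<subseteq>\<C>. finite \<D> \<and> pts \<subseteq> \<Union>\<D>" by blast
qed

end

context attach begin

lemma mem_pts [simp]:
  "Infty \<in> pts" "Pt x \<in> pts \<longleftrightarrow> x \<in> X - X0" "Apex \<in> pts \<longleftrightarrow> ap" "Copy i x \<in> pts \<longleftrightarrow> x \<in> C i"
  by (auto simp: pts_def split: if_splits)

lemma fld_Pt: "Pt x \<in> A \<Longrightarrow> A \<in> fld \<Longrightarrow> x \<in> X - X0"
proof -
  assume "Pt x \<in> A" "A \<in> fld"
  then have "Pt x \<in> pts" using sets_into_space by blast
  then show ?thesis by (auto simp: pts_def split: if_splits)
qed

definition lift where
  "lift D = Pt ` (D - X0) \<union> {Copy i x |i x. x \<in> C i \<and> z i \<in> Pt ` (D - X0)}"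

definition apex_nbhd where
  "apex_nbhd J = insert Apex {Copy i x |i x. x \<in> C i \<and> z i = Apex \<and> i \<notin> J}"

lemma lift_fld: "D \<in> R \<Longrightarrow> lift D \<in> fld"
proof -
  assume D: "D \<in> R"
  have "base (lift D) = D - X0" using R_sub[OF D] by (auto simp: base_def lift_def)
  moreover have "part i (lift D) = (if z i \<in> Pt ` (D - X0) then C i else {})" for i
    by (auto simp: part_def lift_def)
  moreover have "z i \<in> lift D \<longleftrightarrow> z i \<in> Pt ` (D - X0)" for i
    using z_pt[of i] by (auto simp: lift_def)
  moreover have "lift D \<subseteq> pts" using R_sub[OF D] by (auto simp: lift_def pts_def)
  moreover have "Infty \<notin> lift D" by (auto simp: lift_def)
  ultimately show ?thesis using D C_R by (auto simp: fld_def undecided_def)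
qed

lemma apex_nbhd_fld: "ap \<Longrightarrow> finite J \<Longrightarrow> apex_nbhd J \<in> fld"
proof -
  assume ap and J: "finite J"
  have "base (apex_nbhd J) = {}" by (auto simp: base_def apex_nbhd_def)
  moreover have p: "part i (apex_nbhd J) = (if z i = Apex \<and> i \<notin> J then C i else {})" for i
    by (auto simp: part_def apex_nbhd_def)
  moreover have "undecided (apex_nbhd J) \<subseteq> J"
  proof -
    have "z i \<in> apex_nbhd J \<longleftrightarrow> z i = Apex" for i using z_pt[of i] by (auto simp: apex_nbhd_def)
    then show ?thesis unfolding undecided_def p by auto
  qed
  moreover have "{Copy i x |i x. x \<in> C i \<and> z i = Apex \<and> i \<notin> J} \<subseteq> pts" by auto
  then have "apex_nbhd J \<subseteq> pts"
    unfolding apex_nbhd_def insert_subset mem_pts using \<open>ap\<close> by (intro conjI)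
  moreover have "Infty \<notin> apex_nbhd J" by (auto simp: apex_nbhd_def)
  ultimately show ?thesis using C_R J finite_subset by (auto simp: fld_def intro!: bexI[of _ "{}"])
qed

lemma copy_fld: "D \<in> R \<Longrightarrow> D \<subseteq> C i \<Longrightarrow> Copy i ` D \<in> fld"
proof -
  assume D: "D \<in> R" "D \<subseteq> C i"
  have "base (Copy i ` D) = {}" by (auto simp: base_def)
  moreover have p: "part j (Copy i ` D) = (if j = i then D else {})" for j
    using D(2) by (auto simp: part_def)
  moreover have "undecided (Copy i ` D) \<subseteq> {i}"
  proof -
    have "z j \<notin> Copy i ` D" for j using z_pt[of j] by auto
    then show ?thesis unfolding undecided_def p by auto
  qed
  moreover have "Copy i ` D \<subseteq> pts" using D(2) by (auto simp: pts_def)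
  moreover have "Infty \<notin> Copy i ` D" by auto
  ultimately show ?thesis using D(1) finite_subset[of _ "{i}"] by (auto simp: fld_def intro!: bexI[of _ "{}"])
qed

text \<open>From some index on, a set of the field contains a copy or misses it according to the
  attaching point. Hence it is determined by finitely many members of \<open>R\<close> and two truth
  values.\<close>

lemma countable_fld: "countable fld"
proof -
  define f where "f = (\<lambda>(b, D, l, us). let S = Pt ` (if b then X - X0 - D else D - X0) \<union>
      (if b then {Infty} else {}) \<union> (if l then {Apex} else {}) in
    S \<union> {Copy i x |i x. i < length us \<and> x \<in> us ! i} \<union>
    {Copy i x |i x. i \<ge> length us \<and> x \<in> C i \<and> z i \<in> S})"
  have "fld \<subseteq> f ` (UNIV \<times> R \<times> UNIV \<times> lists R)"
  proof
    fix A assume A: "A \<in> fld"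
    then obtain D where D: "D \<in> R" "base A = (if Infty \<in> A then X - X0 - D else D - X0)"
      by (auto simp: fld_def)
    obtain n where n: "undecided A \<subseteq> {..<n}"
      using A finite_nat_bounded[of "undecided A"] by (auto simp: fld_def)
    define us where "us = map (\<lambda>i. part i A) [0..<n]"
    have us: "us \<in> lists R" "length us = n" "\<And>i. i < n \<Longrightarrow> us ! i = part i A"
      using A by (auto simp: us_def fld_def)
    define S where "S = Pt ` base A \<union> (if Infty \<in> A then {Infty} else {}) \<union> (if Apex \<in> A then {Apex} else {})"
    have zS: "z i \<in> S \<longleftrightarrow> z i \<in> A" for i using z_pt[of i] by (auto simp: S_def base_def)
    have sub: "A \<subseteq> pts" using A by (simp add: fld_def)
    have dec: "part i A = (if z i \<in> A then C i else {})" if "i \<ge> n" for i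
    proof -
      have "i \<notin> undecided A" using n that by auto
      then show ?thesis by (simp add: undecided_def split: if_splits)
    qed
    have "A = S \<union> {Copy i x |i x. i < n \<and> x \<in> part i A} \<union> {Copy i x |i x. i \<ge> n \<and> x \<in> C i \<and> z i \<in> S}"
      (is "A = ?A")
    proof (rule set_eqI)
      fix y show "y \<in> A \<longleftrightarrow> y \<in> ?A"
      proof (cases y)
        case (Pt x)
        then show ?thesis using fld_Pt[OF _ A, of x] by (auto simp: S_def base_def)
      next
        case Infty
        then show ?thesis by (auto simp: S_def)
      next
        case Apex
        then show ?thesis by (auto simp: S_def)
      next
        case (Copy i x)
        have "Copy i x \<in> A \<longleftrightarrow> x \<in> part i A" using sub by (auto simp: part_def)
        moreover have "Copy i x \<notin> S" by (auto simp: S_def)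
        ultimately show ?thesis
          using Copy dec[of i] zS[of i] by (cases "i < n") (auto split: if_splits)
      qed
    qed
    also have "\<dots> = f (Infty \<in> A, D, Apex \<in> A, us)"
      using us(2,3) D(2) unfolding f_def S_def by (auto simp: Let_def)
    finally have "A = f (Infty \<in> A, D, Apex \<in> A, us)" .
    moreover have "(Infty \<in> A, D, Apex \<in> A, us) \<in> UNIV \<times> R \<times> UNIV \<times> lists R" using D us by blast
    ultimately show "A \<in> f ` (UNIV \<times> R \<times> UNIV \<times> lists R)" by (rule image_eqI)
  qed
  moreover have "countable (f ` ((UNIV :: bool set) \<times> R \<times> (UNIV :: bool set) \<times> lists R))"
    using R_countable by (intro countable_image countable_SIGMA) auto
  ultimately show ?thesis using countable_subset by blast
qed

lemma fld_separated:
  assumes "y \<in> pts" "w \<in> pts" "y \<noteq> w" "y \<noteq> Infty" "w \<noteq> Infty"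
  shows "\<exists>A\<in>fld. y \<in> A \<and> w \<notin> A"
proof -
  have swap: "\<exists>A\<in>fld. v \<in> A \<and> u \<notin> A" if s: "\<exists>A\<in>fld. u \<in> A \<and> v \<notin> A" "v \<in> pts" for u v
  proof -
    obtain A where A: "A \<in> fld" "u \<in> A" "v \<notin> A" using s(1) by blast
    then show ?thesis using s(2) by (intro bexI[of _ "pts - A"]) auto
  qed
  have copy: "\<exists>A\<in>fld. Copy i x \<in> A \<and> v \<notin> A" if x: "x \<in> C i" "v \<in> pts" "v \<noteq> Copy i x" for i x v
  proof (cases "\<exists>x'. v = Copy i x'")
    case True
    then obtain x' where v: "v = Copy i x'" ..
    have "x' \<in> C i" using x(2) unfolding v by simp
    moreover have "x' \<noteq> x" using x(3) unfolding v by simp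
    ultimately have x': "v = Copy i x'" "x' \<in> C i" "x' \<noteq> x" using v by simp_all
    have "x \<in> X" "x' \<in> X" using x(1) x'(2) R_sub[OF C_R[of i]] by (simp_all add: subset_iff)
    then obtain D where D: "D \<in> R" "x \<in> D" "x' \<notin> D" using R_separated[of x x'] x'(3) by metis
    have "Copy i ` (D \<inter> C i) \<in> fld" using D(1) by (intro copy_fld R_Int C_R) auto
    moreover have "Copy i x \<in> Copy i ` (D \<inter> C i)" "v \<notin> Copy i ` (D \<inter> C i)" using D x x' by auto
    ultimately show ?thesis by (intro bexI[of _ "Copy i ` (D \<inter> C i)"] conjI)
  next
    case False
    have "Copy i ` C i \<in> fld" by (intro copy_fld C_R) auto
    moreover have "v \<notin> Copy i ` C i" "Copy i x \<in> Copy i ` C i" using False x by auto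
    ultimately show ?thesis by (intro bexI[of _ "Copy i ` C i"] conjI)
  qed
  have pt: "\<exists>A\<in>fld. Pt x \<in> A \<and> v \<notin> A"
    if x: "x \<in> X - X0" "v = Apex \<or> (\<exists>x'\<in>X. v = Pt x' \<and> x' \<noteq> x)" for x v
  proof -
    have "\<exists>D\<in>R. x \<in> D \<and> (\<forall>x'. v = Pt x' \<longrightarrow> x' \<notin> D)"
    proof (cases "v = Apex")
      case True
      then show ?thesis using x(1) R_cover[of x] by auto
    next
      case False
      then obtain x' where "x' \<in> X" "v = Pt x'" "x' \<noteq> x" using x(2) by blast
      then show ?thesis using R_separated[of x x'] x(1) by auto
    qed
    then obtain D where D: "D \<in> R" "x \<in> D" "\<And>x'. v = Pt x' \<Longrightarrow> x' \<notin> D" by blast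
    have "Pt x \<in> lift D" using D(2) x(1) by (auto simp: lift_def)
    moreover have "v \<notin> lift D" using D(3) x(2) by (auto simp: lift_def)
    ultimately show ?thesis using lift_fld[OF D(1)] by (intro bexI[of _ "lift D"] conjI)
  qed
  show ?thesis
  proof (cases "\<exists>i x. y = Copy i x \<or> w = Copy i x")
    case True
    then show ?thesis
    proof (elim exE disjE)
      fix i x assume y: "y = Copy i x"
      then have "x \<in> C i" using assms(1) by simp
      then show ?thesis using copy[of x i w] assms y by blast
    next
      fix i x assume w: "w = Copy i x"
      then have "x \<in> C i" using assms(2) by simp
      then have "\<exists>A\<in>fld. w \<in> A \<and> y \<notin> A" using copy[of x i y] assms w by blast
      then show ?thesis using swap assms(1) by blast
    qed
  next
    case False
    then have "(\<exists>x\<in>X - X0. y = Pt x \<and> (w = Apex \<or> (\<exists>x'\<in>X. w = Pt x' \<and> x' \<noteq> x))) \<or>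
        (\<exists>x\<in>X - X0. w = Pt x \<and> (y = Apex \<or> (\<exists>x'\<in>X. y = Pt x' \<and> x' \<noteq> x)))"
      using assms by (auto simp: pts_def split: if_splits)
    then show ?thesis
    proof (elim disjE bexE conjE)
      fix x assume "x \<in> X - X0" "w = Pt x" "y = Apex"
      then show ?thesis using pt[of x y] swap[of w y] assms(1) by blast
    next
      fix x x' assume "x \<in> X - X0" "w = Pt x" "y = Pt x'" "x' \<in> X" "x' \<noteq> x"
      then show ?thesis using pt[of x y] swap[of w y] assms(1) by blast
    qed (use pt in blast)+
  qed
qed

text \<open>All but finitely many of the copies attached at points of \<open>A\<close> are contained
  in \<open>A\<close>, and points of different copies are different.\<close>

lemma decided_infinite:
  assumes A: "A \<in> fld" and I: "infinite {i. z i \<in> A \<and> (\<exists>y\<in>C i. Q i y)}"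
  shows "infinite {w \<in> A. \<exists>i y. w = Copy i y \<and> y \<in> C i \<and> Q i y}"
proof -
  define I' where "I' = {i. z i \<in> A \<and> (\<exists>y\<in>C i. Q i y)} - undecided A"
  have "infinite I'" unfolding I'_def using A I by (auto simp: fld_def)
  have "\<forall>i\<in>I'. \<exists>y. y \<in> C i \<and> Q i y \<and> Copy i y \<in> A"
    by (auto simp: I'_def undecided_def part_def)
  then obtain g where g: "\<And>i. i \<in> I' \<Longrightarrow> g i \<in> C i \<and> Q i (g i) \<and> Copy i (g i) \<in> A" by metis
  have "inj_on (\<lambda>i. Copy i (g i)) I'" by (auto simp: inj_on_def)
  then have "infinite ((\<lambda>i. Copy i (g i)) ` I')" using \<open>infinite I'\<close> finite_image_iff by blast
  moreover have "(\<lambda>i. Copy i (g i)) ` I' \<subseteq> {w \<in> A. \<exists>i y. w = Copy i y \<and> y \<in> C i \<and> Q i y}"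
    using g by auto
  ultimately show ?thesis using infinite_super by blast
qed

text \<open>The hypotheses treat separately the base (\<open>b1\<close>, \<open>b2\<close>), the
  copies (\<open>p1\<close>, \<open>p2\<close>), the new point (\<open>l1\<close>,
  \<open>l2\<close>) and discreteness (\<open>d1\<close>, \<open>d2\<close>), so that only sets from
  \<open>R\<close> remain to be considered. At a base point the copies attached nearby count as
  well; infinitely many of them provide infinitely many points.\<close>

lemma typed_fieldI:
  fixes t :: "'a pt \<Rightarrow> 't"
  assumes H0: "H0 \<subseteq> X - X0"
    and refl: "\<And>a. le a a"
    and b1: "\<And>x. x \<in> X - X0 - H0 \<Longrightarrow> \<exists>A\<in>R. x \<in> A \<and> A \<inter> H0 = {} \<and> (\<forall>y\<in>A - X0. le (t (Pt x)) (t (Pt y))) \<and>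
      (\<forall>i. z i \<in> Pt ` (A - X0) \<longrightarrow> (\<forall>y\<in>C i. le (t (Pt x)) (t (Copy i y))))"
    and b2: "\<And>x A a. A \<in> R \<Longrightarrow> x \<in> A - X0 - H0 \<Longrightarrow> a \<in> Types \<Longrightarrow> le (t (Pt x)) a \<Longrightarrow>
      a \<noteq> t (Pt x) \<or> a \<notin> dis \<Longrightarrow> infinite {y \<in> A - X0 - H0. t (Pt y) = a} \<or>
        infinite {i. z i \<in> Pt ` (A - X0) \<and> (\<exists>y\<in>C i. t (Copy i y) = a)}"
    and p1: "\<And>i x. x \<in> C i \<Longrightarrow> \<exists>A\<in>R. x \<in> A \<and> A \<subseteq> C i \<and> (\<forall>y\<in>A. le (t (Copy i x)) (t (Copy i y)))"
    and p2: "\<And>i x A a. A \<in> R \<Longrightarrow> A \<subseteq> C i \<Longrightarrow> x \<in> A \<Longrightarrow> a \<in> Types \<Longrightarrow> le (t (Copy i x)) a \<Longrightarrow>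
      a \<noteq> t (Copy i x) \<or> a \<notin> dis \<Longrightarrow> infinite {y \<in> A. t (Copy i y) = a}"
    and l1: "ap \<Longrightarrow> finite {i. z i = Apex \<and> \<not> (\<forall>y\<in>C i. le (t Apex) (t (Copy i y)))}"
    and l2: "\<And>a. ap \<Longrightarrow> a \<in> Types \<Longrightarrow> le (t Apex) a \<Longrightarrow> a \<noteq> t Apex \<or> a \<notin> dis \<Longrightarrow>
      infinite {i. z i = Apex \<and> (\<exists>y\<in>C i. t (Copy i y) = a)}"
    and d1: "\<And>x. x \<in> X - X0 - H0 \<Longrightarrow> t (Pt x) \<in> Types \<Longrightarrow> t (Pt x) \<in> dis \<Longrightarrow> \<exists>A\<in>R. x \<in> A \<and>
      {y \<in> A - X0 - H0. t (Pt y) = t (Pt x)} = {x} \<and>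
      (\<forall>i. z i \<in> Pt ` (A - X0) \<longrightarrow> (\<forall>y\<in>C i. t (Copy i y) \<noteq> t (Pt x)))"
    and d2: "\<And>i x. x \<in> C i \<Longrightarrow> t (Copy i x) \<in> Types \<Longrightarrow> t (Copy i x) \<in> dis \<Longrightarrow>
      \<exists>A\<in>R. x \<in> A \<and> A \<subseteq> C i \<and> {y \<in> A. t (Copy i y) = t (Copy i x)} = {x}"
  shows "typed_field pts fld (insert Infty (Pt ` H0)) t le dis Types"
proof
  let ?H = "insert Infty (Pt ` H0)"
  have offcase: thesis if "y \<in> pts" "y \<notin> ?H" "\<And>x. y = Pt x \<Longrightarrow> x \<in> X - X0 - H0 \<Longrightarrow> thesis"
    "y = Apex \<Longrightarrow> ap \<Longrightarrow> thesis" "\<And>i x. y = Copy i x \<Longrightarrow> x \<in> C i \<Longrightarrow> thesis" for y thesis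
    using that by (auto simp: pts_def split: if_splits)
  show "le a a" for a by (rule refl)
  show "\<exists>A\<in>fld. y \<in> A \<and> w \<notin> A" if "y \<in> pts" "w \<in> pts" "y \<noteq> w" "y \<notin> ?H" "w \<notin> ?H" for y w
    using fld_separated[of y w] that by blast
  show "\<exists>A\<in>fld. y \<in> A \<and> A \<inter> ?H = {} \<and> (\<forall>w\<in>A. le (t y) (t w))" if y: "y \<in> pts" "y \<notin> ?H" for y
  proof (rule offcase[OF y])
    fix x assume x: "y = Pt x" "x \<in> X - X0 - H0"
    obtain A where A: "A \<in> R" "x \<in> A" "A \<inter> H0 = {}" "\<And>y. y \<in> A - X0 \<Longrightarrow> le (t (Pt x)) (t (Pt y))"
      "\<And>i y. z i \<in> Pt ` (A - X0) \<Longrightarrow> y \<in> C i \<Longrightarrow> le (t (Pt x)) (t (Copy i y))" using b1[OF x(2)] by blast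
    show ?thesis using A x by (intro bexI[OF _ lift_fld[OF A(1)]]) (auto simp: lift_def)
  next
    assume a: "y = Apex" ap
    define J where "J = {i. z i = Apex \<and> \<not> (\<forall>y\<in>C i. le (t Apex) (t (Copy i y)))}"
    have "finite J" unfolding J_def using l1[OF a(2)] .
    then show ?thesis using a refl
      by (intro bexI[OF _ apex_nbhd_fld[OF a(2), of J]]) (auto simp: apex_nbhd_def J_def)
  next
    fix i x assume x: "y = Copy i x" "x \<in> C i"
    obtain A where A: "A \<in> R" "x \<in> A" "A \<subseteq> C i" "\<And>y. y \<in> A \<Longrightarrow> le (t (Copy i x)) (t (Copy i y))"
      using p1[OF x(2)] by blast
    show ?thesis using A x by (intro bexI[OF _ copy_fld[OF A(1,3)]]) auto
  qed
  show "infinite {w \<in> A - ?H. t w = a}"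
    if A: "A \<in> fld" "y \<in> A" "y \<notin> ?H" and a: "a \<in> Types" "le (t y) a" "a \<noteq> t y \<or> a \<notin> dis" for A y a
  proof -
    have y: "y \<in> pts" using A by (auto simp: fld_def)
    show ?thesis
    proof (rule offcase[OF y A(3)])
      fix x assume x: "y = Pt x" "x \<in> X - X0 - H0"
      obtain D where D: "D \<in> R" "x \<in> D" "Pt ` (D - X0) \<subseteq> A" using fld_open[OF A(1)] A(2) x by blast
      have "infinite {y \<in> D - X0 - H0. t (Pt y) = a} \<or>
        infinite {i. z i \<in> Pt ` (D - X0) \<and> (\<exists>y\<in>C i. t (Copy i y) = a)}"
        using b2[OF D(1), of x a] D(2) x a by auto
      then show ?thesis
      proof
        assume "infinite {y \<in> D - X0 - H0. t (Pt y) = a}"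
        then have "infinite (Pt ` {y \<in> D - X0 - H0. t (Pt y) = a})"
          by (simp add: finite_image_iff inj_on_def)
        moreover have "Pt ` {y \<in> D - X0 - H0. t (Pt y) = a} \<subseteq> {w \<in> A - ?H. t w = a}" using D(3) by auto
        ultimately show ?thesis using infinite_super by blast
      next
        assume "infinite {i. z i \<in> Pt ` (D - X0) \<and> (\<exists>y\<in>C i. t (Copy i y) = a)}"
        moreover have "{i. z i \<in> Pt ` (D - X0) \<and> (\<exists>y\<in>C i. t (Copy i y) = a)} \<subseteq>
            {i. z i \<in> A \<and> (\<exists>y\<in>C i. t (Copy i y) = a)}" using D(3) by blast
        ultimately have "infinite {i. z i \<in> A \<and> (\<exists>y\<in>C i. t (Copy i y) = a)}" using infinite_super by blast
        from decided_infinite[OF A(1) this] show ?thesis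
          by (rule infinite_super[rotated]) auto
      qed
    next
      assume x: "y = Apex" ap
      then have "infinite {i. z i = Apex \<and> (\<exists>y\<in>C i. t (Copy i y) = a)}" using l2[OF x(2) a(1)] a by simp
      moreover have "{i. z i = Apex \<and> (\<exists>y\<in>C i. t (Copy i y) = a)} \<subseteq>
            {i. z i \<in> A \<and> (\<exists>y\<in>C i. t (Copy i y) = a)}" using A(2) x by auto
      ultimately have "infinite {i. z i \<in> A \<and> (\<exists>y\<in>C i. t (Copy i y) = a)}" using infinite_super by blast
      from decided_infinite[OF A(1) this] show ?thesis
        by (rule infinite_super[rotated]) auto
    next
      fix i x assume x: "y = Copy i x" "x \<in> C i"
      have p: "part i A \<in> R" "part i A \<subseteq> C i" "x \<in> part i A"
        using A x by (auto simp: fld_def part_def)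
      have "infinite {y \<in> part i A. t (Copy i y) = a}" using p2[OF p] a x by simp
      then have "infinite (Copy i ` {y \<in> part i A. t (Copy i y) = a})"
        by (simp add: finite_image_iff inj_on_def)
      moreover have "Copy i ` {y \<in> part i A. t (Copy i y) = a} \<subseteq> {w \<in> A - ?H. t w = a}"
        by (auto simp: part_def)
      ultimately show ?thesis using infinite_super by blast
    qed
  qed
  show "\<exists>E. finite E \<and> (\<forall>y\<in>pts - ?H - E. t y = a \<longrightarrow> (\<exists>A\<in>fld. {w \<in> A - ?H. t w = a} = {y}))"
    if a: "a \<in> Types" "a \<in> dis" for a
  \<comment> \<open>The new point is a limit of copies and may share a discrete type with points of
    these copies; it is the one possible exception.\<close>
  proof (intro exI[of _ "{Apex}"] conjI ballI impI)
    fix y assume y: "y \<in> pts - ?H - {Apex}" "t y = a"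
    have y': "y \<in> pts" "y \<notin> ?H" using y by auto
    show "\<exists>A\<in>fld. {w \<in> A - ?H. t w = a} = {y}"
    proof (rule offcase[OF y'])
      fix x assume x: "y = Pt x" "x \<in> X - X0 - H0"
      obtain A where A: "A \<in> R" "x \<in> A" "{y \<in> A - X0 - H0. t (Pt y) = t (Pt x)} = {x}"
        "\<forall>i. z i \<in> Pt ` (A - X0) \<longrightarrow> (\<forall>y\<in>C i. t (Copy i y) \<noteq> t (Pt x))"
        using d1[OF x(2)] a y(2) x(1) by auto
      have "{w \<in> lift A - ?H. t w = a} = {y}"
        using A x y(2) by (auto simp: lift_def)
      then show ?thesis using lift_fld[OF A(1)] by blast
    next
      fix i x assume x: "y = Copy i x" "x \<in> C i"
      obtain A where A: "A \<in> R" "x \<in> A" "A \<subseteq> C i" "{y \<in> A. t (Copy i y) = t (Copy i x)} = {x}"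
        using d2[OF x(2)] a y(2) x(1) by auto
      have "{w \<in> Copy i ` A - ?H. t w = a} = {y}" using A(2,4) x y(2) by auto
      then show ?thesis using copy_fld[OF A(1,3)] by blast
    qed (use y in auto)
  qed simp
qed

end

section \<open>Typing by blocks\<close>

context cpart begin

definition kap :: "'p set \<Rightarrow> 'x \<Rightarrow> 'p option" where
  "kap Own x = (if blk x \<in> Own then Some (blk x) else None)"

text \<open>\<open>None\<close> is the type of the points whose block does not matter; they are near the blocks in \<open>s\<close>.\<close>

fun ple :: "'p set \<Rightarrow> 'p option \<Rightarrow> 'p option \<Rightarrow> bool" where
  "ple s (Some p) (Some q) \<longleftrightarrow> q = p \<or> q \<in> up p"
| "ple s (Some p) None \<longleftrightarrow> False"
| "ple s None (Some q) \<longleftrightarrow> q \<in> s"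
| "ple s None None \<longleftrightarrow> True"

lemma ple_refl: "ple s a a"
  by (cases a) auto

definition dst :: "bool \<Rightarrow> 'p option set" where
  "dst nd = {Some p |p. \<not> lt p p} \<union> (if nd then {None} else {})"

lemma dst_simps [simp]: "Some p \<in> dst nd \<longleftrightarrow> \<not> lt p p" "None \<in> dst nd \<longleftrightarrow> nd"
  by (auto simp: dst_def)

text \<open>An open set whose points can be typed by \<open>kap Own\<close>. Points of blocks in
  \<open>Own\<close> have trim neighbourhoods. Among the blocks in \<open>Own\<close>, the other
  points are limits of exactly those in \<open>s\<close>, so that the single type
  \<open>None\<close> suffices for them. \<open>nd\<close> tells whether they are isolated from each
  other or accumulate at each of them.\<close>

definition region :: "'x set \<Rightarrow> 'p set \<Rightarrow> 'p set \<Rightarrow> bool \<Rightarrow> bool" where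
  "region U Own s nd \<longleftrightarrow> U \<subseteq> X \<and> Own \<subseteq> P \<and> s \<subseteq> Own \<and> (\<forall>p\<in>Own. up p \<subseteq> Own) \<and>
    (\<forall>x\<in>U. \<exists>A\<in>R. x \<in> A \<and> A \<subseteq> U) \<and>
    (\<forall>x\<in>U. blk x \<in> Own \<longrightarrow> (\<exists>A\<in>R. x \<in> A \<and> T A \<subseteq> up (blk x))) \<and>
    (\<forall>x\<in>U. blk x \<notin> Own \<longrightarrow> s \<subseteq> up (blk x) \<and> (\<exists>A\<in>R. x \<in> A \<and> T A \<inter> Own \<subseteq> s)) \<and>
    (\<forall>x\<in>U. \<forall>A\<in>R. blk x \<notin> Own \<longrightarrow> x \<in> A \<longrightarrow>
      (if nd then \<exists>D\<in>R. x \<in> D \<and> {y \<in> D \<inter> U. blk y \<notin> Own} = {x}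
       else infinite {y \<in> A \<inter> U. blk y \<notin> Own}))"

lemma region_empty: "Own \<subseteq> P \<Longrightarrow> s \<subseteq> Own \<Longrightarrow> (\<And>p. p \<in> Own \<Longrightarrow> up p \<subseteq> Own) \<Longrightarrow> region {} Own s nd"
  by (auto simp: region_def)

context
  fixes U Own s nd assumes rg: "region U Own s nd"
begin

lemma region_facts: "U \<subseteq> X" "Own \<subseteq> P" "s \<subseteq> Own" "p \<in> Own \<Longrightarrow> up p \<subseteq> Own"
  using rg by (auto simp: region_def)

lemma region_trim:
  assumes x: "x \<in> U"
  shows "\<exists>A\<in>R. x \<in> A \<and> A \<subseteq> U \<and> (\<forall>y\<in>A. ple s (kap Own x) (kap Own y))"
proof -
  obtain D where D: "D \<in> R" "x \<in> D" "D \<subseteq> U" using rg x unfolding region_def by meson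
  show ?thesis
  proof (cases "blk x \<in> Own")
    case True
    then obtain A where A: "A \<in> R" "x \<in> A" "T A \<subseteq> up (blk x)" using rg x unfolding region_def by meson
    have "ple s (kap Own x) (kap Own y)" if y: "y \<in> A" for y
    proof -
      have "blk y \<in> up (blk x)" using A(3) in_T_blk[OF A(1) y] by blast
      then show ?thesis using True region_facts(4)[OF True] by (auto simp: kap_def)
    qed
    then show ?thesis using A D by (intro bexI[of _ "D \<inter> A"] R_Int) auto
  next
    case False
    then obtain A where A: "A \<in> R" "x \<in> A" "T A \<inter> Own \<subseteq> s" using rg x unfolding region_def by meson
    have "ple s (kap Own x) (kap Own y)" if y: "y \<in> A" for y
      using A(3) in_T_blk[OF A(1) y] False by (auto simp: kap_def)
    then show ?thesis using A D by (intro bexI[of _ "D \<inter> A"] R_Int) auto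
  qed
qed

lemma region_acc:
  assumes A: "A \<in> R" "x \<in> A" "x \<in> U" and a: "ple s (kap Own x) a" "a \<noteq> kap Own x \<or> a \<notin> dst nd"
  shows "infinite {y \<in> A \<inter> U. kap Own y = a}"
proof -
  obtain D where D: "D \<in> R" "x \<in> D" "D \<subseteq> U" using rg A(3) unfolding region_def by meson
  have blkcase: "infinite {y \<in> A \<inter> U. kap Own y = Some q}" if q: "q \<in> Own" "lt (blk x) q" for q
  proof -
    have qP: "q \<in> P" using q region_facts(2) by blast
    have "infinite ((A \<inter> D) \<inter> B q)"
      using limit_infinite[of "A \<inter> D" x q] A D qP q(2) by (auto intro: R_Int)
    moreover have "(A \<inter> D) \<inter> B q \<subseteq> {y \<in> A \<inter> U. kap Own y = Some q}"
      using D(3) blk_eq[OF qP] q(1) by (auto simp: kap_def)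
    ultimately show ?thesis using infinite_super by blast
  qed
  show ?thesis
  proof (cases "blk x \<in> Own")
    case True
    then obtain q where q: "a = Some q" "q = blk x \<or> q \<in> up (blk x)"
      using a(1) by (cases a) (auto simp: kap_def)
    have "q \<in> Own" "lt (blk x) q"
      using q a(2) True region_facts(4)[OF True] by (auto simp: kap_def up_def)
    then show ?thesis using blkcase q(1) by blast
  next
    case False
    show ?thesis
    proof (cases a)
      case None
      then have "\<not> nd" using a(2) False by (simp add: kap_def)
      then have "infinite {y \<in> A \<inter> U. blk y \<notin> Own}" using rg A False unfolding region_def by meson
      moreover have "{y \<in> A \<inter> U. blk y \<notin> Own} \<subseteq> {y \<in> A \<inter> U. kap Own y = a}" using None by (auto simp: kap_def)
      ultimately show ?thesis using infinite_super by blast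
    next
      case (Some q)
      then have "q \<in> s" using a(1) False by (auto simp: kap_def)
      moreover have "s \<subseteq> up (blk x)" using rg A(3) False unfolding region_def by meson
      ultimately have "q \<in> Own" "lt (blk x) q" using region_facts(3) False by (auto simp: up_def)
      then show ?thesis using blkcase Some by blast
    qed
  qed
qed

lemma region_disc:
  assumes x: "x \<in> U" and d: "kap Own x \<in> dst nd"
  shows "\<exists>A\<in>R. x \<in> A \<and> A \<subseteq> U \<and> {y \<in> A. kap Own y = kap Own x} = {x}"
proof -
  obtain D where D: "D \<in> R" "x \<in> D" "D \<subseteq> U" using rg x unfolding region_def by meson
  show ?thesis
  proof (cases "blk x \<in> Own")
    case True
    then have "\<not> lt (blk x) (blk x)" using d by (auto simp: kap_def)
    then obtain A where A: "A \<in> R" "A \<subseteq> D" "A \<inter> B (blk x) = {x}" by (rule isolate[OF D(1,2)])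
    have "y = x" if "y \<in> A" "kap Own y = kap Own x" for y
    proof -
      have "blk y = blk x" using that(2) True by (auto simp: kap_def split: if_splits)
      moreover have "y \<in> X" using that(1) R_sub[OF A(1)] by blast
      ultimately have "y \<in> A \<inter> B (blk x)" using blk(2)[of y] that(1) by simp
      then show ?thesis using A(3) by blast
    qed
    then show ?thesis using A D(3) by (intro bexI[of _ A]) auto
  next
    case False
    then have nd using d by (simp add: kap_def)
    then obtain A where A: "A \<in> R" "x \<in> A" "{y \<in> A \<inter> U. blk y \<notin> Own} = {x}"
      using rg x False D unfolding region_def by meson
    have "{y \<in> D \<inter> A. kap Own y = kap Own x} = {x}"
      using A(2,3) D(2,3) False by (auto simp: kap_def split: if_splits)
    then show ?thesis using A D by (intro bexI[of _ "D \<inter> A"] R_Int) auto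
  qed
qed

end

lemma kap_cases: "kap Own y = Some q \<longleftrightarrow> blk y = q \<and> q \<in> Own" "kap Own y = None \<longleftrightarrow> blk y \<notin> Own"
  by (auto simp: kap_def)

text \<open>All copies are empty, so this is the one-point compactification of the space; its sets
  that avoid \<open>Infty\<close> are the images of the members of \<open>R\<close>.\<close>

sublocale bare: attach R X P lt B "{}" False "\<lambda>_. Infty" "\<lambda>_. {}"
  by unfold_locales auto

end

section \<open>Types and nearness on a space with attached copies\<close>

context attach begin

text \<open>The base and the single copies have separate sets of blocks with a type of their own,
  because a block may keep its colour in one place and lose it in another.\<close>

definition ptyp :: "'b set \<Rightarrow> (nat \<Rightarrow> 'b set) \<Rightarrow> 'a pt \<Rightarrow> 'b option" where
  "ptyp OwnB OwnC w = (case w of Pt x \<Rightarrow> kap OwnB x | Copy i y \<Rightarrow> kap (OwnC i) y | _ \<Rightarrow> None)"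

lemma ptyp_simps [simp]:
  "ptyp OwnB OwnC (Pt x) = kap OwnB x" "ptyp OwnB OwnC (Copy i y) = kap (OwnC i) y"
  "ptyp OwnB OwnC Apex = None" "ptyp OwnB OwnC Infty = None"
  by (auto simp: ptyp_def)

text \<open>By \<open>zH\<close> no copy is attached to a base point outside \<open>H0\<close>, so
  these points keep their neighbourhoods. The new point has type \<open>None\<close>;
  \<open>l1\<close> to \<open>l3\<close> say that the copies converging to it show the types
  expected near a point of this type.\<close>

lemma typed_region:
  assumes X0: "X0 = {}" and H0: "H0 \<subseteq> X" and rB: "region (X - H0) OwnB s nd"
    and rC: "\<And>i. region (C i) (OwnC i) s nd" and zH: "\<And>i x. z i = Pt x \<Longrightarrow> x \<in> H0"
    and l1: "ap \<Longrightarrow> finite {i. z i = Apex \<and> (\<exists>y\<in>C i. blk y \<in> OwnC i - s)}"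
    and l2: "\<And>q. ap \<Longrightarrow> q \<in> s \<Longrightarrow> infinite {i. z i = Apex \<and> (\<exists>y\<in>C i. blk y = q)}"
    and l3: "ap \<Longrightarrow> \<not> nd \<Longrightarrow> infinite {i. z i = Apex \<and> (\<exists>y\<in>C i. blk y \<notin> OwnC i)}"
  shows "typed_field pts fld (insert Infty (Pt ` H0)) (ptyp OwnB OwnC) (ple s) (dst nd) Types"
proof (rule typed_fieldI)
  have zno: "z i \<notin> Pt ` (A - X0)" if "A \<subseteq> X - H0" for A i using zH[of i] that by auto
  show "H0 \<subseteq> X - X0" using H0 X0 by simp
  show "ple s a a" for a by (rule ple_refl)
  show "\<exists>A\<in>R. x \<in> A \<and> A \<inter> H0 = {} \<and> (\<forall>y\<in>A - X0. ple s (ptyp OwnB OwnC (Pt x)) (ptyp OwnB OwnC (Pt y))) \<and>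
      (\<forall>i. z i \<in> Pt ` (A - X0) \<longrightarrow> (\<forall>y\<in>C i. ple s (ptyp OwnB OwnC (Pt x)) (ptyp OwnB OwnC (Copy i y))))"
    if x: "x \<in> X - X0 - H0" for x
  proof -
    obtain A where A: "A \<in> R" "x \<in> A" "A \<subseteq> X - H0" "\<forall>y\<in>A. ple s (kap OwnB x) (kap OwnB y)"
      using region_trim[OF rB, of x] x by blast
    then show ?thesis using zno[OF A(3)] by (intro bexI[of _ A]) auto
  qed
  show "infinite {y \<in> A - X0 - H0. ptyp OwnB OwnC (Pt y) = a} \<or>
        infinite {i. z i \<in> Pt ` (A - X0) \<and> (\<exists>y\<in>C i. ptyp OwnB OwnC (Copy i y) = a)}"
    if "A \<in> R" "x \<in> A - X0 - H0" "a \<in> Types" "ple s (ptyp OwnB OwnC (Pt x)) a"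
      "a \<noteq> ptyp OwnB OwnC (Pt x) \<or> a \<notin> dst nd" for x A a
  proof -
    have "infinite {y \<in> A \<inter> (X - H0). kap OwnB y = a}"
      using region_acc[OF rB that(1), of x a] that R_sub[OF that(1)] by auto
    moreover have "A \<inter> (X - H0) = A - X0 - H0" using R_sub[OF that(1)] X0 by auto
    ultimately show ?thesis by simp
  qed
  show "\<exists>A\<in>R. x \<in> A \<and> A \<subseteq> C i \<and> (\<forall>y\<in>A. ple s (ptyp OwnB OwnC (Copy i x)) (ptyp OwnB OwnC (Copy i y)))"
    if "x \<in> C i" for i x
    using region_trim[OF rC that] by simp
  show "infinite {y \<in> A. ptyp OwnB OwnC (Copy i y) = a}"
    if "A \<in> R" "A \<subseteq> C i" "x \<in> A" "a \<in> Types" "ple s (ptyp OwnB OwnC (Copy i x)) a"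
      "a \<noteq> ptyp OwnB OwnC (Copy i x) \<or> a \<notin> dst nd" for i x A a
  proof -
    have "infinite {y \<in> A \<inter> C i. kap (OwnC i) y = a}"
      using region_acc[OF rC that(1,3), of i a] that by auto
    moreover have "A \<inter> C i = A" using that(2) by blast
    ultimately show ?thesis by simp
  qed
  have "\<not> (\<forall>y\<in>C i. ple s (ptyp OwnB OwnC Apex) (ptyp OwnB OwnC (Copy i y))) \<longleftrightarrow> (\<exists>y\<in>C i. blk y \<in> OwnC i - s)" for i
    by (auto simp: kap_def)
  then show "finite {i. z i = Apex \<and> \<not> (\<forall>y\<in>C i. ple s (ptyp OwnB OwnC Apex) (ptyp OwnB OwnC (Copy i y)))}" if ap
    using l1[OF that] by simp
  show "infinite {i. z i = Apex \<and> (\<exists>y\<in>C i. ptyp OwnB OwnC (Copy i y) = a)}"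
    if a: "ap" "a \<in> Types" "ple s (ptyp OwnB OwnC Apex) a" "a \<noteq> ptyp OwnB OwnC Apex \<or> a \<notin> dst nd" for a
  proof (cases a)
    case None
    then show ?thesis using l3[OF a(1)] a(4) by (simp add: kap_cases)
  next
    case (Some q)
    then have "q \<in> s" using a(3) by simp
    moreover have "q \<in> OwnC i" for i using region_facts(3)[OF rC[of i]] \<open>q \<in> s\<close> by blast
    ultimately show ?thesis using l2[OF a(1), of q] Some by (simp add: kap_cases)
  qed
  show "\<exists>A\<in>R. x \<in> A \<and> {y \<in> A - X0 - H0. ptyp OwnB OwnC (Pt y) = ptyp OwnB OwnC (Pt x)} = {x} \<and>
      (\<forall>i. z i \<in> Pt ` (A - X0) \<longrightarrow> (\<forall>y\<in>C i. ptyp OwnB OwnC (Copy i y) \<noteq> ptyp OwnB OwnC (Pt x)))"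
    if x: "x \<in> X - X0 - H0" "ptyp OwnB OwnC (Pt x) \<in> Types" "ptyp OwnB OwnC (Pt x) \<in> dst nd" for x
  proof -
    obtain A where A: "A \<in> R" "x \<in> A" "A \<subseteq> X - H0" "{y \<in> A. kap OwnB y = kap OwnB x} = {x}"
      using region_disc[OF rB, of x] x by auto
    have "{y \<in> A - X0 - H0. kap OwnB y = kap OwnB x} = {x}" using A(3,4) X0 by blast
    then show ?thesis using A(1,2) zno[OF A(3)] by (intro bexI[of _ A]) auto
  qed
  show "\<exists>A\<in>R. x \<in> A \<and> A \<subseteq> C i \<and> {y \<in> A. ptyp OwnB OwnC (Copy i y) = ptyp OwnB OwnC (Copy i x)} = {x}"
    if "x \<in> C i" "ptyp OwnB OwnC (Copy i x) \<in> Types" "ptyp OwnB OwnC (Copy i x) \<in> dst nd" for i x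
    using region_disc[OF rC, of x i] that by simp
qed

text \<open>Nearness of a type to a fixed point, in terms of \<open>R\<close>. Finitely many copies
  can be removed from a neighbourhood, infinitely many cannot, so copies count only if there are
  infinitely many of them.\<close>

definition near_cond where
  "near_cond H0 t a h \<longleftrightarrow> (\<forall>A\<in>R. h \<in> A \<longrightarrow> (\<exists>y\<in>A - X0 - H0. t (Pt y) = a) \<or>
      infinite {i. z i \<in> Pt ` (A - X0) \<and> (\<exists>y\<in>C i. t (Copy i y) = a)})"

definition near_cond_inf where
  "near_cond_inf H0 t a \<longleftrightarrow> (\<forall>A\<in>R. (\<exists>y\<in>X - X0 - A - H0. t (Pt y) = a) \<or>
      infinite {i. (z i = Infty \<or> z i \<in> Pt ` (X - X0 - A)) \<and> (\<exists>y\<in>C i. t (Copy i y) = a)})"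

lemma meets_class_infinite:
  assumes A: "A \<in> fld" and I: "infinite {i. z i \<in> A \<and> (\<exists>y\<in>C i. t (Copy i y) = a)}"
  shows "\<exists>i y. Copy i y \<in> A \<and> y \<in> C i \<and> t (Copy i y) = a"
proof -
  have "infinite {w \<in> A. \<exists>i y. w = Copy i y \<and> y \<in> C i \<and> t (Copy i y) = a}"
    using decided_infinite[OF A I] .
  then have "{w \<in> A. \<exists>i y. w = Copy i y \<and> y \<in> C i \<and> t (Copy i y) = a} \<noteq> {}"
    by (rule infinite_imp_nonempty)
  then show ?thesis by auto
qed

lemma near_Pt_iff:
  assumes "typed_field pts fld (insert Infty (Pt ` H0)) t le dis Types" and h: "h \<in> X - X0"
  shows "typed_field.near pts fld (insert Infty (Pt ` H0)) t (Pt h) a \<longleftrightarrow> near_cond H0 t a h"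
proof -
  interpret tf: typed_field pts fld "insert Infty (Pt ` H0)" t le dis Types by fact
  show ?thesis
  proof
    assume nr: "tf.near (Pt h) a"
    show "near_cond H0 t a h" unfolding near_cond_def
    proof (intro ballI impI)
      fix A assume A: "A \<in> R" "h \<in> A"
      define I where "I = {i. z i \<in> Pt ` (A - X0) \<and> (\<exists>y\<in>C i. t (Copy i y) = a)}"
      show "(\<exists>y\<in>A - X0 - H0. t (Pt y) = a) \<or> infinite {i. z i \<in> Pt ` (A - X0) \<and> (\<exists>y\<in>C i. t (Copy i y) = a)}"
      proof (rule disjCI, fold I_def)
        assume "\<not> infinite I"
        then have fin: "finite I" by simp
        define W where "W = lift A - (\<Union>i\<in>I. Copy i ` C i)"
        have "W \<in> fld" unfolding W_def using lift_fld[OF A(1)] fin C_R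
          by (intro Diff finite_UN) (auto intro: copy_fld)
        moreover have "Pt h \<in> W" using A(2) h by (auto simp: W_def lift_def)
        ultimately obtain w where w: "w \<in> W" "w \<in> tf.cls a" using nr unfolding tf.near_def by blast
        then show "\<exists>y\<in>A - X0 - H0. t (Pt y) = a"
          by (auto simp: W_def lift_def tf.cls_def I_def)
      qed
    qed
  next
    assume c: "near_cond H0 t a h"
    show "tf.near (Pt h) a" unfolding tf.near_def
    proof (intro ballI impI)
      fix W assume W: "W \<in> fld" "Pt h \<in> W"
      obtain A where A: "A \<in> R" "h \<in> A" "Pt ` (A - X0) \<subseteq> W" using fld_open[OF W] by blast
      from c A(1,2) consider "\<exists>y\<in>A - X0 - H0. t (Pt y) = a"
        | "infinite {i. z i \<in> Pt ` (A - X0) \<and> (\<exists>y\<in>C i. t (Copy i y) = a)}"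
        unfolding near_cond_def by blast
      then show "W \<inter> tf.cls a \<noteq> {}"
      proof cases
        case 1
        then obtain y where "y \<in> A - X0 - H0" "t (Pt y) = a" by blast
        then have "Pt y \<in> W \<inter> tf.cls a" using A R_sub[OF A(1)] by (auto simp: tf.cls_def)
        then show ?thesis by blast
      next
        case 2
        moreover have "{i. z i \<in> Pt ` (A - X0) \<and> (\<exists>y\<in>C i. t (Copy i y) = a)} \<subseteq>
            {i. z i \<in> W \<and> (\<exists>y\<in>C i. t (Copy i y) = a)}" using A(3) by blast
        ultimately have "infinite {i. z i \<in> W \<and> (\<exists>y\<in>C i. t (Copy i y) = a)}"
          by (rule infinite_super[rotated])
        from meets_class_infinite[OF W(1) this]
        obtain i y where "Copy i y \<in> W" "y \<in> C i" "t (Copy i y) = a"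
          by (elim exE conjE)
        then have "Copy i y \<in> W \<inter> tf.cls a" by (auto simp: tf.cls_def)
        then show ?thesis by blast
      qed
    qed
  qed
qed

lemma near_Infty_iff:
  assumes "typed_field pts fld (insert Infty (Pt ` H0)) t le dis Types"
  shows "typed_field.near pts fld (insert Infty (Pt ` H0)) t Infty a \<longleftrightarrow> near_cond_inf H0 t a"
proof -
  interpret tf: typed_field pts fld "insert Infty (Pt ` H0)" t le dis Types by fact
  show ?thesis
  proof
    assume nr: "tf.near Infty a"
    show "near_cond_inf H0 t a" unfolding near_cond_inf_def
    proof (intro ballI)
      fix A assume A: "A \<in> R"
      define I where "I = {i. (z i = Infty \<or> z i \<in> Pt ` (X - X0 - A)) \<and> (\<exists>y\<in>C i. t (Copy i y) = a)}"
      show "(\<exists>y\<in>X - X0 - A - H0. t (Pt y) = a) \<or>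
          infinite {i. (z i = Infty \<or> z i \<in> Pt ` (X - X0 - A)) \<and> (\<exists>y\<in>C i. t (Copy i y) = a)}"
      proof (rule disjCI, fold I_def)
        assume "\<not> infinite I"
        then have fin: "finite I" by simp
        define W where "W = pts - lift A - (if ap then apex_nbhd {} else {}) - (\<Union>i\<in>I. Copy i ` C i)"
        have "(if ap then apex_nbhd {} else {}) \<in> fld"
          by (metis apex_nbhd_fld empty_sets finite.emptyI)
        then have "W \<in> fld" unfolding W_def using lift_fld[OF A(1)] fin C_R
          by (intro Diff finite_UN) (auto intro: copy_fld)
        moreover have "Infty \<in> W" by (auto simp: W_def lift_def apex_nbhd_def)
        ultimately obtain w where w: "w \<in> W" "w \<in> tf.cls a" using nr unfolding tf.near_def by blast
        show "\<exists>y\<in>X - X0 - A - H0. t (Pt y) = a"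
        proof (cases w)
          case (Pt x)
          then show ?thesis using w by (auto simp: W_def lift_def tf.cls_def)
        next
          case (Copy i y)
          then have y: "y \<in> C i" "t (Copy i y) = a" using w by (auto simp: tf.cls_def)
          have "z i \<notin> Pt ` (A - X0)" using w(1) y(1) unfolding Copy by (auto simp: W_def lift_def)
          moreover have "\<not> (ap \<and> z i = Apex)"
            using w(1) y(1) unfolding Copy W_def apex_nbhd_def by (auto split: if_splits)
          ultimately have "i \<in> I" using z_pt[of i] y by (auto simp: I_def)
          then show ?thesis using w(1) y(1) unfolding Copy by (auto simp: W_def)
        next
          case Apex
          then have ap using w(2) by (auto simp: tf.cls_def)
          then show ?thesis using w(1) unfolding Apex W_def apex_nbhd_def by auto
        qed (use w in \<open>auto simp: tf.cls_def\<close>)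
      qed
    qed
  next
    assume c: "near_cond_inf H0 t a"
    show "tf.near Infty a" unfolding tf.near_def
    proof (intro ballI impI)
      fix W assume W: "W \<in> fld" "Infty \<in> W"
      then obtain A where A: "A \<in> R" "base W = X - X0 - A" by (auto simp: fld_def)
      have AW: "Pt ` (X - X0 - A) \<subseteq> W" using A(2) by (auto simp: base_def)
      from c A(1) consider "\<exists>y\<in>X - X0 - A - H0. t (Pt y) = a"
        | "infinite {i. (z i = Infty \<or> z i \<in> Pt ` (X - X0 - A)) \<and> (\<exists>y\<in>C i. t (Copy i y) = a)}"
        unfolding near_cond_inf_def by blast
      then show "W \<inter> tf.cls a \<noteq> {}"
      proof cases
        case 1
        then obtain y where "y \<in> X - X0 - A - H0" "t (Pt y) = a" by blast
        then have "Pt y \<in> W \<inter> tf.cls a" using AW by (auto simp: tf.cls_def)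
        then show ?thesis by blast
      next
        case 2
        moreover have "{i. (z i = Infty \<or> z i \<in> Pt ` (X - X0 - A)) \<and> (\<exists>y\<in>C i. t (Copy i y) = a)} \<subseteq>
            {i. z i \<in> W \<and> (\<exists>y\<in>C i. t (Copy i y) = a)}" using AW W(2) by auto
        ultimately have "infinite {i. z i \<in> W \<and> (\<exists>y\<in>C i. t (Copy i y) = a)}"
          by (rule infinite_super[rotated])
        from meets_class_infinite[OF W(1) this]
        obtain i y where "Copy i y \<in> W" "y \<in> C i" "t (Copy i y) = a"
          by (elim exE conjE)
        then have "Copy i y \<in> W \<inter> tf.cls a" by (auto simp: tf.cls_def)
        then show ?thesis by blast
      qed
    qed
  qed
qed

end

section \<open>Transfer of sentences from the ring to a structure with attached copies\<close>

context attach begin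

text \<open>Both fields share the fixed set, so the two whole spaces form a starting position as
  soon as the counts in \<open>total\<close> agree. The sentence is given in advance:
  \<open>H0\<close>, the types and \<open>G\<close> may depend on it.\<close>

lemma transfer:
  fixes tM tN :: "'a pt \<Rightarrow> 't" and CM :: "'b \<Rightarrow> 'a set" and CN :: "'b \<Rightarrow> 'a pt set"
  assumes TM: "typed_field bare.pts bare.fld (insert Infty (Pt ` H0)) tM le dis Types"
    and TN: "typed_field pts fld (insert Infty (Pt ` H0)) tN le dis Types"
    and H0: "H0 \<subseteq> X - X0"
    and G: "\<And>k. finite (G k)" "\<And>k. G k \<subseteq> Types" "\<And>k. G k \<subseteq> G (Suc k)"
    and coverM: "\<And>x. x \<in> X - H0 \<Longrightarrow> \<exists>a\<in>G 0. le (tM (Pt x)) a"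
    and coverN: "\<And>w. w \<in> pts \<Longrightarrow> w \<notin> insert Infty (Pt ` H0) \<Longrightarrow> \<exists>a\<in>G 0. le (tN w) a"
    and out12: "\<And>A W k w. A \<in> bare.fld \<Longrightarrow> W \<in> fld \<Longrightarrow>
      (\<And>a. a \<in> G (Suc k) \<Longrightarrow> (\<exists>y\<in>A - insert Infty (Pt ` H0). tM y = a) \<longleftrightarrow> (\<exists>y\<in>W - insert Infty (Pt ` H0). tN y = a)) \<Longrightarrow>
      w \<in> W - insert Infty (Pt ` H0) \<Longrightarrow> tN w \<notin> G k \<Longrightarrow>
      \<exists>v\<in>A - insert Infty (Pt ` H0). tM v \<notin> G k \<and> (\<forall>a\<in>G k. le (tN w) a \<longrightarrow> le (tM v) a)"
    and out21: "\<And>A W k w. A \<in> bare.fld \<Longrightarrow> W \<in> fld \<Longrightarrow>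
      (\<And>a. a \<in> G (Suc k) \<Longrightarrow> (\<exists>y\<in>A - insert Infty (Pt ` H0). tM y = a) \<longleftrightarrow> (\<exists>y\<in>W - insert Infty (Pt ` H0). tN y = a)) \<Longrightarrow>
      w \<in> A - insert Infty (Pt ` H0) \<Longrightarrow> tM w \<notin> G k \<Longrightarrow>
      \<exists>v\<in>W - insert Infty (Pt ` H0). tN v \<notin> G k \<and> (\<forall>a\<in>G k. le (tM w) a \<longrightarrow> le (tN v) a)"
    and near: "\<And>h a k. h \<in> H0 \<Longrightarrow> a \<in> G k \<Longrightarrow> bare.near_cond H0 tM a h \<longleftrightarrow> near_cond H0 tN a h"
    and near_inf: "\<And>a k. a \<in> G k \<Longrightarrow> bare.near_cond_inf H0 tM a \<longleftrightarrow> near_cond_inf H0 tN a"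
    and total: "\<And>a k. a \<in> G k \<Longrightarrow> same_count k {x \<in> X - H0. tM (Pt x) = a} {w \<in> pts - insert Infty (Pt ` H0). tN w = a}"
    and colH: "\<And>p. p \<in> Q \<Longrightarrow> CN p \<inter> insert Infty (Pt ` H0) = Pt ` (CM p \<inter> H0)"
    and col: "\<And>p. p \<in> Q \<Longrightarrow> col p \<subseteq> G 0"
    and col1: "\<And>p A. p \<in> Q \<Longrightarrow> A \<in> bare.fld \<Longrightarrow> (\<exists>x\<in>CM p - H0. Pt x \<in> A) \<longleftrightarrow> (\<exists>x\<in>X - H0. Pt x \<in> A \<and> tM (Pt x) \<in> col p)"
    and col2: "\<And>p W. p \<in> Q \<Longrightarrow> W \<in> fld \<Longrightarrow> (\<exists>w\<in>CN p - insert Infty (Pt ` H0). w \<in> W) \<longleftrightarrow>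
      (\<exists>w\<in>pts - insert Infty (Pt ` H0). w \<in> W \<and> tN w \<in> col p)"
    and f: "fvars f = {}" "set_form f \<subseteq> Q"
  shows "holds (ring_struct bare.fld Infty (\<lambda>p. Pt ` CM p)) f = holds (ring_struct fld Infty CN) f"
proof -
  let ?H = "insert Infty (Pt ` H0)"
  interpret t1: typed_field bare.pts bare.fld ?H tM le dis Types by (rule TM)
  interpret t2: typed_field pts fld ?H tN le dis Types by (rule TN)
  have c1: "A \<inter> t1.cls a = {} \<longleftrightarrow> \<not> (\<exists>y\<in>A - ?H. tM y = a)" if "A \<in> bare.fld" for A a
    using t1.Int_cls[OF that, of a] by blast
  have c2: "W \<inter> t2.cls a = {} \<longleftrightarrow> \<not> (\<exists>y\<in>W - ?H. tN y = a)" if "W \<in> fld" for W a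
    using t2.Int_cls[OF that, of a] by blast
  have ppts: "w \<in> bare.pts \<longleftrightarrow> w = Infty \<or> (\<exists>x\<in>X. w = Pt x)" for w
    by (cases w) auto
  interpret tp: typed_pair bare.pts pts bare.fld fld ?H tM tN le dis Types G
  proof
    show "finite (G k)" "G k \<subseteq> Types" "G k \<subseteq> G (Suc k)" for k by (rule G)+
    show "\<exists>W\<in>fld. W \<inter> ?H = A \<inter> ?H" if A: "A \<in> bare.fld" for A
    proof -
      obtain D where D: "D \<in> R" "bare.base A = (if Infty \<in> A then X - D else D)"
        using A by (auto simp: bare.fld_def)
      have "Pt x \<in> A \<longleftrightarrow> x \<in> bare.base A" if "x \<in> H0" for x using that H0 by (auto simp: bare.base_def)
      then have "(if Infty \<in> A then pts - lift D else lift D) \<inter> ?H = A \<inter> ?H"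
        using D(2) H0 by (auto simp: lift_def)
      moreover have "(if Infty \<in> A then pts - lift D else lift D) \<in> fld" using lift_fld[OF D(1)] by auto
      ultimately show ?thesis by blast
    qed
    show "\<exists>A\<in>bare.fld. A \<inter> ?H = W \<inter> ?H" if W: "W \<in> fld" for W
    proof -
      obtain D where D: "D \<in> R" "base W = (if Infty \<in> W then X - X0 - D else D - X0)"
        using W by (auto simp: fld_def)
      have "Pt x \<in> W \<longleftrightarrow> x \<in> base W" if "x \<in> H0" for x using that H0 by (auto simp: base_def)
      then have "(if Infty \<in> W then bare.pts - bare.lift D else bare.lift D) \<inter> ?H = W \<inter> ?H"
        using D(2) H0 by (auto simp: bare.lift_def)
      moreover have "(if Infty \<in> W then bare.pts - bare.lift D else bare.lift D) \<in> bare.fld"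
        using bare.lift_fld[OF D(1)] by auto
      ultimately show ?thesis by blast
    qed
    show "t1.near x a \<longleftrightarrow> t2.near x a" if x: "x \<in> ?H" and a: "a \<in> G k" for x a k
    proof (cases "x = Infty")
      case True
      then show ?thesis
        using bare.near_Infty_iff[OF TM, of a] near_Infty_iff[OF TN, of a] near_inf[OF a] by simp
    next
      case False
      then obtain h where h: "x = Pt h" "h \<in> H0" using x by blast
      then have "h \<in> X - {}" "h \<in> X - X0" using H0 by auto
      then show ?thesis unfolding h(1)
        using bare.near_Pt_iff[OF TM, of h a] near_Pt_iff[OF TN, of h a] near[OF h(2) a] by simp
    qed
    show "\<exists>a\<in>G 0. le (tM y) a" if "y \<in> bare.pts" "y \<notin> ?H" for y
      using that coverM unfolding ppts by auto
    show "\<exists>a\<in>G 0. le (tN y) a" if "y \<in> pts" "y \<notin> ?H" for y using coverN that .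
    fix A W k y assume AW: "A \<in> bare.fld" "W \<in> fld"
      "\<And>a. a \<in> G (Suc k) \<Longrightarrow> A \<inter> t1.cls a = {} \<longleftrightarrow> W \<inter> t2.cls a = {}"
    have same: "(\<exists>y\<in>A - ?H. tM y = a) \<longleftrightarrow> (\<exists>y\<in>W - ?H. tN y = a)" if "a \<in> G (Suc k)" for a
      using AW(3)[OF that] unfolding c1[OF AW(1)] c2[OF AW(2)] by blast
    show "\<exists>v\<in>A - ?H. tM v \<notin> G k \<and> (\<forall>a\<in>G k. le (tN y) a \<longrightarrow> le (tM v) a)"
      if "y \<in> W - ?H" "tN y \<notin> G k" using out12[OF AW(1,2) same that] .
    show "\<exists>v\<in>W - ?H. tN v \<notin> G k \<and> (\<forall>a\<in>G k. le (tM y) a \<longrightarrow> le (tN v) a)"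
      if "y \<in> A - ?H" "tM y \<notin> G k" using out21[OF AW(1,2) same that] .
  qed
  interpret cp: coloured_pair bare.pts pts bare.fld fld ?H tM tN le dis Types G Infty "\<lambda>p. Pt ` CM p" CN Q col
  proof
    show "Infty \<in> ?H" by simp
    show "Pt ` CM p \<inter> ?H = CN p \<inter> ?H" if "p \<in> Q" for p using colH[OF that] by auto
    show "col p \<subseteq> G 0" if "p \<in> Q" for p using col[OF that] .
    show "A \<inter> (Pt ` CM p - ?H) = {} \<longleftrightarrow> (\<forall>a\<in>col p. A \<inter> t1.cls a = {})" if p: "p \<in> Q" and A: "A \<in> bare.fld" for p A
    proof -
      have "A \<inter> (Pt ` CM p - ?H) = {} \<longleftrightarrow> \<not> (\<exists>x\<in>CM p - H0. Pt x \<in> A)" by auto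
      also have "\<dots> \<longleftrightarrow> \<not> (\<exists>x\<in>X - H0. Pt x \<in> A \<and> tM (Pt x) \<in> col p)" using col1[OF p A] by simp
      also have "\<dots> \<longleftrightarrow> (\<forall>a\<in>col p. A \<inter> t1.cls a = {})"
      proof -
        have "\<exists>x\<in>X - H0. y = Pt x" if "y \<in> A - ?H" for y
        proof -
          have "y \<in> bare.pts" using that bare.sets_into_space[OF A] by blast
          then show ?thesis using that ppts[of y] by auto
        qed
        then have E: "(\<exists>y\<in>A - ?H. tM y = a) \<longleftrightarrow> (\<exists>x\<in>X - H0. Pt x \<in> A \<and> tM (Pt x) = a)" for a
          by auto
        show ?thesis unfolding c1[OF A] E by blast
      qed
      finally show ?thesis .
    qed
    show "W \<inter> (CN p - ?H) = {} \<longleftrightarrow> (\<forall>a\<in>col p. W \<inter> t2.cls a = {})" if p: "p \<in> Q" and W: "W \<in> fld" for p W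
    proof -
      have "W \<inter> (CN p - ?H) = {} \<longleftrightarrow> \<not> (\<exists>w\<in>CN p - ?H. w \<in> W)" by auto
      also have "\<dots> \<longleftrightarrow> \<not> (\<exists>w\<in>pts - ?H. w \<in> W \<and> tN w \<in> col p)" using col2[OF p W] by simp
      also have "\<dots> \<longleftrightarrow> (\<forall>a\<in>col p. W \<inter> t2.cls a = {})"
        unfolding t2.cls_def by blast
      finally show ?thesis .
    qed
  qed
  have cl: "t1.cls a = Pt ` {x \<in> X - H0. tM (Pt x) = a}" for a
  proof (rule set_eqI)
    fix y show "y \<in> t1.cls a \<longleftrightarrow> y \<in> Pt ` {x \<in> X - H0. tM (Pt x) = a}"
      using ppts[of y] by (auto simp: t1.cls_def)
  qed
  have "same_count k (t1.cls a) (t2.cls a)" if "a \<in> G k" for a k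
  proof -
    have "at_least n (t1.cls a) = at_least n {x \<in> X - H0. tM (Pt x) = a}" for n
      unfolding cl at_least_def by (simp add: finite_image_iff card_image inj_on_def)
    then show ?thesis using total[OF that] unfolding same_count_def t2.cls_def by simp
  qed
  then have "tp.rel k bare.pts pts" for k
    using t1.cls_def t2.cls_def H0 unfolding tp.rel_def
    by (auto simp: Int_absorb1 subset_iff)
  then show ?thesis using cp.ef.holds_iff f by blast
qed

end

context cpart begin

lemma bare_bij: "bij_betw (\<lambda>D. Pt ` D) R {A \<in> bare.fld. Infty \<notin> A}"
proof -
  have lf: "bare.lift D = Pt ` D" for D by (auto simp: bare.lift_def)
  have PtR: "Pt ` D \<in> bare.fld" if "D \<in> R" for D using bare.lift_fld[OF that] lf by simp
  have RPt: "\<exists>D\<in>R. A = Pt ` D" if A: "A \<in> bare.fld" "Infty \<notin> A" for A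
  proof -
    obtain D where D: "D \<in> R" "bare.base A = D" using A by (auto simp: bare.fld_def)
    have "A = Pt ` bare.base A"
    proof (rule set_eqI)
      fix y show "y \<in> A \<longleftrightarrow> y \<in> Pt ` bare.base A"
        using bare.sets_into_space[OF A(1)] A(2) by (cases y) (auto simp: bare.base_def)
    qed
    then show ?thesis using D by blast
  qed
  show ?thesis
    unfolding bij_betw_def
  proof
    show "inj_on (\<lambda>D. Pt ` D) R" by (auto simp: inj_on_def inj_image_eq_iff)
    show "(\<lambda>D. Pt ` D) ` R = {A \<in> bare.fld. Infty \<notin> A}"
    proof (rule set_eqI)
      fix A show "A \<in> (\<lambda>D. Pt ` D) ` R \<longleftrightarrow> A \<in> {A \<in> bare.fld. Infty \<notin> A}"
        using PtR RPt by (auto simp: image_iff)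
    qed
  qed
qed

end

context attach begin

text \<open>Points may end up without any colour: \<open>D p\<close> is where the colour of
  \<open>p\<close> is erased in the base, and the copies \<open>i\<close> with
  \<open>p \<notin> Col i\<close> have lost it.\<close>

definition colour where
  "colour D Col p = Pt ` (B p - D p - X0) \<union> {Copy i y |i y. y \<in> C i \<inter> B p \<and> p \<in> Col i}"

text \<open>With finitely many types the hierarchy \<open>G\<close> can be constant, and no type
  lies outside of it.\<close>

lemma transfer_const:
  fixes tM tN :: "'a pt \<Rightarrow> 't" and CM :: "'b \<Rightarrow> 'a set" and CN :: "'b \<Rightarrow> 'a pt set"
  assumes TM: "typed_field bare.pts bare.fld (insert Infty (Pt ` H0)) tM le dis S"
    and TN: "typed_field pts fld (insert Infty (Pt ` H0)) tN le dis S"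
    and H0: "H0 \<subseteq> X - X0" and S: "finite S"
    and SM: "\<And>x. x \<in> X - H0 \<Longrightarrow> tM (Pt x) \<in> S"
    and SN: "\<And>w. w \<in> pts \<Longrightarrow> w \<notin> insert Infty (Pt ` H0) \<Longrightarrow> tN w \<in> S"
    and near: "\<And>h a. h \<in> H0 \<Longrightarrow> a \<in> S \<Longrightarrow> bare.near_cond H0 tM a h \<longleftrightarrow> near_cond H0 tN a h"
    and near_inf: "\<And>a. a \<in> S \<Longrightarrow> bare.near_cond_inf H0 tM a \<longleftrightarrow> near_cond_inf H0 tN a"
    and total: "\<And>a k. a \<in> S \<Longrightarrow> same_count k {x \<in> X - H0. tM (Pt x) = a} {w \<in> pts - insert Infty (Pt ` H0). tN w = a}"
    and colH: "\<And>p. p \<in> Q \<Longrightarrow> CN p \<inter> insert Infty (Pt ` H0) = Pt ` (CM p \<inter> H0)"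
    and col: "\<And>p. p \<in> Q \<Longrightarrow> col p \<subseteq> S"
    and col1: "\<And>p A. p \<in> Q \<Longrightarrow> A \<in> bare.fld \<Longrightarrow> (\<exists>x\<in>CM p - H0. Pt x \<in> A) \<longleftrightarrow> (\<exists>x\<in>X - H0. Pt x \<in> A \<and> tM (Pt x) \<in> col p)"
    and col2: "\<And>p W. p \<in> Q \<Longrightarrow> W \<in> fld \<Longrightarrow> (\<exists>w\<in>CN p - insert Infty (Pt ` H0). w \<in> W) \<longleftrightarrow>
      (\<exists>w\<in>pts - insert Infty (Pt ` H0). w \<in> W \<and> tN w \<in> col p)"
    and f: "fvars f = {}" "set_form f \<subseteq> Q"
  shows "holds (ring_struct bare.fld Infty (\<lambda>p. Pt ` CM p)) f = holds (ring_struct fld Infty CN) f"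
proof (rule transfer[where G = "\<lambda>_. S" and col = col and CM = CM, OF TM TN H0 S _ _ _ _ _ _ near near_inf total colH col col1 col2 f])
  interpret t1: typed_field bare.pts bare.fld "insert Infty (Pt ` H0)" tM le dis S by (rule TM)
  show "\<exists>a\<in>S. le (tM (Pt x)) a" if "x \<in> X - H0" for x using SM[OF that] t1.le_refl by blast
  show "\<exists>a\<in>S. le (tN w) a" if "w \<in> pts" "w \<notin> insert Infty (Pt ` H0)" for w
    using SN[OF that] t1.le_refl by blast
  fix A W w assume A: "A \<in> bare.fld" and W: "W \<in> fld"
  show "\<exists>v\<in>A - insert Infty (Pt ` H0). tM v \<notin> S \<and> (\<forall>a\<in>S. le (tN w) a \<longrightarrow> le (tM v) a)"
    if w: "w \<in> W - insert Infty (Pt ` H0)" "tN w \<notin> S"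
    using SN[of w] w sets_into_space[OF W] by blast
  show "\<exists>v\<in>W - insert Infty (Pt ` H0). tN v \<notin> S \<and> (\<forall>a\<in>S. le (tM w) a \<longrightarrow> le (tN v) a)"
    if w: "w \<in> A - insert Infty (Pt ` H0)" "tM w \<notin> S"
  proof -
    have "w \<in> bare.pts" using w(1) bare.sets_into_space[OF A] by blast
    then have "\<exists>x\<in>X - H0. w = Pt x" using w(1) by (cases w) auto
    then show ?thesis using SM w(2) by blast
  qed
qed auto

text \<open>The blocks in \<open>s\<close> have their own types and all other points off
  \<open>H0\<close> share the type \<open>None\<close>. The copies do not change which types are
  near a fixed point: by \<open>nz\<close> points of type \<open>None\<close>, and hence by
  accumulation points of all types, are already present near every attaching point in the base. If
  \<open>sp = Some g\<close> with \<open>g\<close> outside \<open>s\<close>, then \<open>B g\<close>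
  is dense among the points of type \<open>None\<close>, so that its ideal is described by this
  type.\<close>

lemma insert_holds:
  assumes X0: "X0 = {}" and H0: "H0 \<subseteq> X" and rB: "region (X - H0) s s nd"
    and rC: "\<And>i. region (C i) s s nd" and s: "finite s"
    and zH: "\<And>i x. z i = Pt x \<Longrightarrow> x \<in> H0" and zI: "\<And>i. z i \<noteq> Infty"
    and l2: "\<And>q. ap \<Longrightarrow> q \<in> s \<Longrightarrow> infinite {i. z i = Apex \<and> (\<exists>y\<in>C i. blk y = q)}"
    and l3: "ap \<Longrightarrow> infinite {i. z i = Apex \<and> (\<exists>y\<in>C i. blk y \<notin> s)}"
    and ne: "infinite {x \<in> X - H0. blk x \<notin> s}"
    and nz: "\<And>A i. A \<in> R \<Longrightarrow> z i \<in> Pt ` A \<Longrightarrow> \<exists>y\<in>A - H0. blk y \<notin> s"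
    and QP: "Q \<subseteq> P"
    and Q1: "\<And>p i. p \<in> Q \<Longrightarrow> p \<in> s \<Longrightarrow> p \<in> Col i"
    and Q2: "\<And>p. p \<in> Q \<Longrightarrow> p \<notin> s \<Longrightarrow> sp \<noteq> Some p \<Longrightarrow> B p \<subseteq> H0 \<and> (\<forall>i. p \<notin> Col i \<or> C i \<inter> B p = {})"
    and Q3: "\<And>g x A. sp = Some g \<Longrightarrow> A \<in> R \<Longrightarrow> x \<in> A - H0 \<Longrightarrow> blk x \<notin> s \<Longrightarrow> A \<inter> B g - H0 \<noteq> {}"
    and Q4: "\<And>g x A i. sp = Some g \<Longrightarrow> A \<in> R \<Longrightarrow> A \<subseteq> C i \<Longrightarrow> x \<in> A \<Longrightarrow> blk x \<notin> s \<Longrightarrow> A \<inter> B g \<noteq> {}"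
    and Q5: "\<And>g i. sp = Some g \<Longrightarrow> g \<in> Col i"
    and f: "fvars f = {}" "set_form f \<subseteq> Q"
  shows "holds (ring_struct bare.fld Infty (\<lambda>p. Pt ` B p)) f = holds (ring_struct fld Infty (colour (\<lambda>_. {}) Col)) f"
proof -
  let ?H = "insert Infty (Pt ` H0)"
  let ?S = "insert None (Some ` s)"
  let ?tM = "bare.ptyp s (\<lambda>_. s)" and ?tN = "ptyp s (\<lambda>_. s)"
  have sP: "s \<subseteq> P" and sup: "\<And>p. p \<in> s \<Longrightarrow> up p \<subseteq> s" using region_facts[OF rB] by auto
  have TM: "typed_field bare.pts bare.fld ?H ?tM (ple s) (dst nd) ?S"
    by (rule bare.typed_region[OF _ H0 rB]) (auto intro!: region_empty sP sup)
  have TN: "typed_field pts fld ?H ?tN (ple s) (dst nd) ?S"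
    by (rule typed_region[OF X0 H0 rB rC zH]) (use l2 l3 in auto)
  have accS: "infinite (A \<inter> (X - H0) \<inter> {y. kap s y = a})"
    if A: "A \<in> R" "y \<in> A - H0" "blk y \<notin> s" and a: "a \<in> Some ` s" for A y a
  proof -
    have y: "y \<in> A" "y \<in> X - H0" using A R_sub[OF A(1)] by auto
    have k: "kap s y = None" using A(3) by (simp add: kap_def)
    have "a \<noteq> kap s y" "ple s (kap s y) a" using a unfolding k by auto
    then have "infinite {y \<in> A \<inter> (X - H0). kap s y = a}"
      using region_acc[OF rB A(1) y] by blast
    moreover have "{y \<in> A \<inter> (X - H0). kap s y = a} = A \<inter> (X - H0) \<inter> {y. kap s y = a}" by blast
    ultimately show ?thesis by simp
  qed
  have meet: "\<exists>y\<in>A - H0. kap s y = a" if A: "A \<in> R" "\<exists>y\<in>A - H0. blk y \<notin> s" and a: "a \<in> ?S" for A a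
  proof (cases "a = None")
    case True
    then show ?thesis using A by (auto simp: kap_def)
  next
    case False
    then have aS: "a \<in> Some ` s" using a by blast
    obtain y where y: "y \<in> A - H0" "blk y \<notin> s" using A(2) by blast
    then have "A \<inter> (X - H0) \<inter> {y. kap s y = a} \<noteq> {}"
      using accS[OF A(1) y aS] by (metis finite.emptyI)
    then show ?thesis by blast
  qed
  have zR: "\<exists>y\<in>A - H0. kap s y = a" if "A \<in> R" "z i \<in> Pt ` A" "a \<in> ?S" for A i a
    using meet[OF that(1) nz[OF that(1,2)] that(3)] .
  have near: "bare.near_cond H0 ?tM a h \<longleftrightarrow> near_cond H0 ?tN a h" if h: "h \<in> H0" and a: "a \<in> ?S" for h a
  proof
    assume *: "near_cond H0 ?tN a h"
    show "bare.near_cond H0 ?tM a h" unfolding bare.near_cond_def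
    proof (intro ballI impI)
      fix A assume A: "A \<in> R" "h \<in> A"
      have "(\<exists>y\<in>A - X0 - H0. kap s y = a) \<or> infinite {i. z i \<in> Pt ` (A - X0) \<and> (\<exists>y\<in>C i. kap s y = a)}"
        using * A unfolding near_cond_def by simp
      then have "\<exists>y\<in>A - H0. kap s y = a"
      proof
        assume "infinite {i. z i \<in> Pt ` (A - X0) \<and> (\<exists>y\<in>C i. kap s y = a)}"
        then have "{i. z i \<in> Pt ` (A - X0) \<and> (\<exists>y\<in>C i. kap s y = a)} \<noteq> {}" by (metis finite.emptyI)
        then obtain i where "z i \<in> Pt ` A" by blast
        then show ?thesis using zR[OF A(1) _ a] by blast
      qed (use X0 in auto)
      then show "(\<exists>y\<in>A - {} - H0. ?tM (Pt y) = a) \<or>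
          infinite {i. Infty \<in> Pt ` (A - {}) \<and> (\<exists>y\<in>{}. ?tM (Copy i y) = a)}" by simp
    qed
  next
    assume *: "bare.near_cond H0 ?tM a h"
    show "near_cond H0 ?tN a h" unfolding near_cond_def
    proof (intro ballI impI disjI1)
      fix A assume A: "A \<in> R" "h \<in> A"
      have "(\<exists>y\<in>A - {} - H0. ?tM (Pt y) = a) \<or>
          infinite {i. Infty \<in> Pt ` (A - {}) \<and> (\<exists>y\<in>{}. ?tM (Copy i y) = a)}"
        using * A unfolding bare.near_cond_def by blast
      then show "\<exists>y\<in>A - X0 - H0. ?tN (Pt y) = a" using X0 by simp
    qed
  qed
  have near_inf: "bare.near_cond_inf H0 ?tM a \<longleftrightarrow> near_cond_inf H0 ?tN a" if a: "a \<in> ?S" for a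
  proof
    assume *: "near_cond_inf H0 ?tN a"
    show "bare.near_cond_inf H0 ?tM a" unfolding bare.near_cond_inf_def
    proof (intro ballI)
      fix A assume A: "A \<in> R"
      have "(\<exists>y\<in>X - X0 - A - H0. kap s y = a) \<or>
          infinite {i. (z i = Infty \<or> z i \<in> Pt ` (X - X0 - A)) \<and> (\<exists>y\<in>C i. kap s y = a)}"
        using * A unfolding near_cond_inf_def by simp
      then have "\<exists>y\<in>X - A - H0. kap s y = a"
      proof
        assume "infinite {i. (z i = Infty \<or> z i \<in> Pt ` (X - X0 - A)) \<and> (\<exists>y\<in>C i. kap s y = a)}"
        then have "{i. (z i = Infty \<or> z i \<in> Pt ` (X - X0 - A)) \<and> (\<exists>y\<in>C i. kap s y = a)} \<noteq> {}"
          by (metis finite.emptyI)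
        then obtain i where i: "z i = Infty \<or> z i \<in> Pt ` (X - X0 - A)" by blast
        then obtain x where x: "z i = Pt x" "x \<in> X - A" using zI[of i] by blast
        then obtain D where D: "D \<in> R" "x \<in> D" using R_cover by blast
        have "\<exists>y\<in>D - A - H0. kap s y = a" using zR[of "D - A" i a] D A a x R_Diff by auto
        then show ?thesis using R_sub[OF D(1)] by blast
      qed (use X0 in auto)
      then show "(\<exists>y\<in>X - {} - A - H0. ?tM (Pt y) = a) \<or>
          infinite {i. (Infty = Infty \<or> Infty \<in> Pt ` (X - {} - A)) \<and> (\<exists>y\<in>{}. ?tM (Copy i y) = a)}" by simp
    qed
  next
    assume *: "bare.near_cond_inf H0 ?tM a"
    show "near_cond_inf H0 ?tN a" unfolding near_cond_inf_def
    proof (intro ballI disjI1)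
      fix A assume A: "A \<in> R"
      show "\<exists>y\<in>X - X0 - A - H0. ?tN (Pt y) = a"
        using bspec[OF *[unfolded bare.near_cond_inf_def] A] X0 by simp
    qed
  qed
  have infM: "infinite {x \<in> X - H0. kap s x = a}" if a: "a \<in> ?S" for a
  proof (cases "a = None")
    case True
    then show ?thesis using ne by (simp add: kap_cases)
  next
    case False
    then have aS: "a \<in> Some ` s" using a by blast
    have "{x \<in> X - H0. blk x \<notin> s} \<noteq> {}" using ne by (metis finite.emptyI)
    then obtain x where x: "x \<in> X - H0" "blk x \<notin> s" by blast
    then obtain A where A: "A \<in> R" "x \<in> A" using R_cover by blast
    have "infinite (A \<inter> (X - H0) \<inter> {y. kap s y = a})" using accS[OF A(1) _ x(2) aS] A x by blast
    then show ?thesis by (rule infinite_super[rotated]) auto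
  qed
  have CN: "colour (\<lambda>_. {}) Col p = Pt ` B p \<union> {Copy i y |i y. y \<in> C i \<inter> B p \<and> p \<in> Col i}" for p
    unfolding colour_def using X0 by simp
  have Xpts: "Pt x \<in> pts" if "x \<in> X" for x
    by (subst mem_pts) (use that X0 in simp)
  have Bblk: "x \<in> B p \<longleftrightarrow> x \<in> X \<and> blk x = p" if "p \<in> Q" for p x
    using QP that blk_eq[of p x] blk(2)[of x] block_sub[of p] by blast
  have spQ: "x \<in> B p \<Longrightarrow> x \<in> X \<and> blk x = p" if "p \<in> Q" for p x using Bblk[OF that] by blast
  show ?thesis
  proof (rule transfer_const[where CM = B and col = "\<lambda>p. if p \<in> s then {Some p} else if sp = Some p then {None} else {}",
        OF TM TN _ _ _ _ near near_inf _ _ _ _ _ f])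
    show "H0 \<subseteq> X - X0" using H0 X0 by simp
    show "finite ?S" using s by simp
    show "?tM (Pt x) \<in> ?S" for x by (simp add: kap_def)
    show "?tN w \<in> ?S" for w by (cases w) (auto simp: kap_def)
    show "same_count k {x \<in> X - H0. ?tM (Pt x) = a} {w \<in> pts - ?H. ?tN w = a}" if a: "a \<in> ?S" for a k
    proof (rule same_count_infinite)
      show "infinite {x \<in> X - H0. ?tM (Pt x) = a}" using infM[OF a] by simp
      then have "infinite (Pt ` {x \<in> X - H0. kap s x = a})" by (simp add: finite_image_iff inj_on_def)
      then show "infinite {w \<in> pts - ?H. ?tN w = a}"
        by (rule infinite_super[rotated]) (use Xpts in auto)
    qed
    show "colour (\<lambda>_. {}) Col p \<inter> ?H = Pt ` (B p \<inter> H0)" for p unfolding CN by auto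
    show "(if p \<in> s then {Some p} else if sp = Some p then {None} else {}) \<subseteq> ?S" for p by auto
    show "(\<exists>x\<in>B p - H0. Pt x \<in> A) \<longleftrightarrow>
        (\<exists>x\<in>X - H0. Pt x \<in> A \<and> ?tM (Pt x) \<in> (if p \<in> s then {Some p} else if sp = Some p then {None} else {}))"
      if p: "p \<in> Q" and A: "A \<in> bare.fld" for p A
    proof (cases "p \<in> s")
      case True
      then show ?thesis using Bblk[OF p] by (auto simp: kap_cases)
    next
      case False
      show ?thesis
      proof (cases "sp = Some p")
        case True
        have "\<exists>y\<in>B p - H0. Pt y \<in> A" if x: "x \<in> X - H0" "Pt x \<in> A" "blk x \<notin> s" for x
        proof -
          obtain D where D: "D \<in> R" "x \<in> D" "Pt ` (D - {}) \<subseteq> A" using bare.fld_open[OF A x(2)] by blast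
          then show ?thesis using Q3[OF True D(1), of x] x by auto
        qed
        then show ?thesis using True False Bblk[OF p] by (auto simp: kap_cases)
      qed (use False Q2[OF p False] in auto)
    qed
    show "(\<exists>w\<in>colour (\<lambda>_. {}) Col p - ?H. w \<in> W) \<longleftrightarrow>
        (\<exists>w\<in>pts - ?H. w \<in> W \<and> ?tN w \<in> (if p \<in> s then {Some p} else if sp = Some p then {None} else {}))"
      (is "?L \<longleftrightarrow> ?R") if p: "p \<in> Q" and W: "W \<in> fld" for p W
    proof
      assume ?L
      then obtain w where w: "w \<in> colour (\<lambda>_. {}) Col p" "w \<notin> ?H" "w \<in> W" by blast
      have "w \<in> pts" using w(3) sets_into_space[OF W] by blast
      moreover have "?tN w \<in> (if p \<in> s then {Some p} else if sp = Some p then {None} else {})"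
        using w(1,2) unfolding CN
      proof (elim UnE)
        assume "w \<in> Pt ` B p"
        then obtain x where x: "w = Pt x" "x \<in> B p" by blast
        then have "p \<in> s \<or> sp = Some p" using Q2[OF p] w(2) by blast
        then show ?thesis using x spQ[OF p x(2)] by (auto simp: kap_def)
      next
        assume "w \<in> {Copy i y |i y. y \<in> C i \<inter> B p \<and> p \<in> Col i}"
        then obtain i x where x: "w = Copy i x" "x \<in> B p" "x \<in> C i" "p \<in> Col i" by blast
        then have "p \<in> s \<or> sp = Some p" using Q2[OF p] by blast
        then show ?thesis using x spQ[OF p x(2)] by (auto simp: kap_def)
      qed
      ultimately show ?R using w(2,3) by blast
    next
      assume ?R
      then obtain w where w: "w \<in> pts" "w \<notin> ?H" "w \<in> W"
        and t: "?tN w \<in> (if p \<in> s then {Some p} else if sp = Some p then {None} else {})" by blast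
      show ?L
      proof (cases "p \<in> s")
        case True
        then have t': "?tN w = Some p" using t by simp
        show ?thesis
        proof (cases w)
          case (Pt x)
          then have "x \<in> B p" using t' w(1) Bblk[OF p] by (simp add: kap_cases)
          then show ?thesis using Pt w unfolding CN by blast
        next
          case (Copy i x)
          then have "x \<in> B p" "x \<in> C i" using t' w(1) Bblk[OF p] R_sub[OF C_R[of i]] by (auto simp: kap_cases)
          then show ?thesis using Copy w Q1[OF p True, of i] unfolding CN by blast
        qed (use t' in auto)
      next
        case False
        then have g: "sp = Some p" and t': "?tN w = None" using t by (auto split: if_splits)
        have gC: "p \<in> Col i" for i using Q5[OF g] .
        show ?thesis
        proof (cases w)
          case (Pt x)
          then obtain A where A: "A \<in> R" "x \<in> A" "Pt ` (A - X0) \<subseteq> W" using fld_open[OF W] w(3) by blast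
          have "x \<in> A - H0" "blk x \<notin> s" using A(2) w(2) t' Pt by (auto simp: kap_cases)
          then obtain y where "y \<in> A" "y \<in> B p" "y \<notin> H0" using Q3[OF g A(1)] by blast
          then have "Pt y \<in> W" "Pt y \<in> colour (\<lambda>_. {}) Col p" "Pt y \<notin> ?H" using A(3) X0 unfolding CN by auto
          then show ?thesis by blast
        next
          case (Copy i x)
          have pr: "part i W \<in> R" "part i W \<subseteq> C i" using W by (auto simp: fld_def part_def)
          have "x \<in> part i W" using Copy w by (auto simp: part_def)
          then obtain y where "y \<in> part i W" "y \<in> B p"
            using Q4[OF g pr, of x] t' Copy by (auto simp: kap_cases)
          then have "Copy i y \<in> W" "Copy i y \<in> colour (\<lambda>_. {}) Col p" "Copy i y \<notin> ?H"
            using gC unfolding CN by (auto simp: part_def)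
          then show ?thesis by blast
        next
          case Apex
          then have ap using w(1) by simp
          have "\<exists>y\<in>C i. (y \<in> B p) = True" if i: "\<exists>y\<in>C i. blk y \<notin> s" for i
            using Q4[OF g C_R[of i] order_refl] i by blast
          then have "{i. z i = Apex \<and> (\<exists>y\<in>C i. blk y \<notin> s)} \<subseteq>
              {i. z i \<in> W \<and> (\<exists>y\<in>C i. (\<lambda>w. case w of Copy i y \<Rightarrow> y \<in> B p | _ \<Rightarrow> False) (Copy i y) = True)}"
            using w(3) Apex by auto
          then have "infinite {i. z i \<in> W \<and> (\<exists>y\<in>C i. (\<lambda>w. case w of Copy i y \<Rightarrow> y \<in> B p | _ \<Rightarrow> False) (Copy i y) = True)}"
            using l3[OF \<open>ap\<close>] by (rule infinite_super)
          from meets_class_infinite[OF W this] obtain i y where "Copy i y \<in> W" "y \<in> C i" "y \<in> B p" by auto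
          then have "Copy i y \<in> W" "Copy i y \<in> colour (\<lambda>_. {}) Col p" "Copy i y \<notin> ?H"
            using gC unfolding CN by auto
          then show ?thesis by blast
        qed (use w in auto)
      qed
    qed
  qed
qed

section \<open>Isomorphisms and the sets of blocks met by elements\<close>

definition TN where "TN CN W = {p \<in> P. W \<inter> CN p \<noteq> {}}"

text \<open>The consequences of an isomorphism from which the contradictions are drawn. In contrast
  to a single sentence, \<open>TN\<close> refers to all blocks at once.\<close>

definition iso_map where
  "iso_map CN g \<longleftrightarrow> bij_betw g R {W \<in> fld. Infty \<notin> W} \<and> g {} = {} \<and>
     (\<forall>a\<in>R. \<forall>b\<in>R. g (a \<inter> b) = g a \<inter> g b \<and> g (a \<union> b) = g a \<union> g b \<and> (g a \<subseteq> g b \<longrightarrow> a \<subseteq> b)) \<and>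
     (\<forall>a\<in>R. TN CN (g a) = T a)"

lemma iso_mapD:
  assumes "iso_map CN g"
  shows "bij_betw g R {W \<in> fld. Infty \<notin> W}" "g {} = {}"
    "\<And>a b. a \<in> R \<Longrightarrow> b \<in> R \<Longrightarrow> g (a \<inter> b) = g a \<inter> g b"
    "\<And>a b. a \<in> R \<Longrightarrow> b \<in> R \<Longrightarrow> g (a \<union> b) = g a \<union> g b"
    "\<And>a. a \<in> R \<Longrightarrow> TN CN (g a) = T a"
    "\<And>a b. a \<in> R \<Longrightarrow> b \<in> R \<Longrightarrow> g a \<subseteq> g b \<Longrightarrow> a \<subseteq> b"
    "\<And>a. a \<in> R \<Longrightarrow> g a \<in> fld \<and> Infty \<notin> g a"
    "\<And>W. W \<in> fld \<Longrightarrow> Infty \<notin> W \<Longrightarrow> \<exists>a\<in>R. g a = W"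
proof -
  show b: "bij_betw g R {W \<in> fld. Infty \<notin> W}" using assms by (simp add: iso_map_def)
  show "g {} = {}"
    "\<And>a b. a \<in> R \<Longrightarrow> b \<in> R \<Longrightarrow> g (a \<inter> b) = g a \<inter> g b"
    "\<And>a b. a \<in> R \<Longrightarrow> b \<in> R \<Longrightarrow> g (a \<union> b) = g a \<union> g b"
    "\<And>a. a \<in> R \<Longrightarrow> TN CN (g a) = T a"
    "\<And>a b. a \<in> R \<Longrightarrow> b \<in> R \<Longrightarrow> g a \<subseteq> g b \<Longrightarrow> a \<subseteq> b"
    using assms by (simp_all add: iso_map_def)
  show "\<And>a. a \<in> R \<Longrightarrow> g a \<in> fld \<and> Infty \<notin> g a" using bij_betwE[OF b] by simp
  show "\<exists>a\<in>R. g a = W" if "W \<in> fld" "Infty \<notin> W" for W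
  proof -
    have "W \<in> g ` R" using that unfolding bij_betw_imp_surj_on[OF b] by simp
    then obtain a where "W = g a" "a \<in> R" by (rule imageE)
    then show ?thesis by (intro bexI[of _ a]) simp_all
  qed
qed

lemma iso_map_ex:
  assumes oc: "omega_categorical P (ring_struct bare.fld Infty (\<lambda>p. Pt ` B p))"
    and eq: "\<And>f. fvars f = {} \<Longrightarrow> set_form f \<subseteq> P \<Longrightarrow>
      holds (ring_struct bare.fld Infty (\<lambda>p. Pt ` B p)) f = holds (ring_struct fld Infty CN) f"
  shows "\<exists>g. iso_map CN g"
proof -
  let ?M = "ring_struct bare.fld Infty (\<lambda>p. Pt ` B p)" and ?N = "ring_struct fld Infty CN"
  have "pstruct_iso P ?M ?N"
  proof (rule omega_categorical_unique[OF oc])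
    show "is_pstruct P ?M" using is_pstruct_ring_struct bare.algebra_axioms .
    show "is_pstruct P ?N" using is_pstruct_ring_struct algebra_axioms .
    show "countable (pstruct.univ ?N)" using countable_fld countable_subset[of _ fld] by auto
    show "elem_equiv P ?M ?N" unfolding elem_equiv_def sentence_def using eq by blast
  qed
  then obtain h where h: "bij_betw h {A \<in> bare.fld. Infty \<notin> A} {A \<in> fld. Infty \<notin> A}" "h {} = {}"
    "\<And>a b. a \<in> bare.fld \<Longrightarrow> Infty \<notin> a \<Longrightarrow> b \<in> bare.fld \<Longrightarrow> Infty \<notin> b \<Longrightarrow>
       h (sym_diff a b) = sym_diff (h a) (h b) \<and> h (a \<inter> b) = h a \<inter> h b"
    "\<And>p a. p \<in> P \<Longrightarrow> a \<in> bare.fld \<Longrightarrow> Infty \<notin> a \<Longrightarrow> a \<inter> Pt ` B p = {} \<longleftrightarrow> h a \<in> fld \<and> Infty \<notin> h a \<and> h a \<inter> CN p = {}"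
    unfolding pstruct_iso_def by auto
  have PtR: "Pt ` D \<in> bare.fld" if "D \<in> R" for D using bij_betwE[OF bare_bij] that by blast
  define g where "g D = h (Pt ` D)" for D
  have bij: "bij_betw g R {W \<in> fld. Infty \<notin> W}"
    using bij_betw_trans[OF bare_bij h(1)] by (simp add: g_def[abs_def] o_def)
  have int: "g (a \<inter> b) = g a \<inter> g b" if "a \<in> R" "b \<in> R" for a b
  proof -
    have "Pt ` (a \<inter> b) = Pt ` a \<inter> Pt ` b" by auto
    then show ?thesis using h(3)[OF PtR[OF that(1)] _ PtR[OF that(2)]] by (auto simp: g_def)
  qed
  have sd: "g (sym_diff a b) = sym_diff (g a) (g b)" if "a \<in> R" "b \<in> R" for a b
  proof -
    have "Pt ` (sym_diff a b) = sym_diff (Pt ` a) (Pt ` b)" by auto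
    then show ?thesis using h(3)[OF PtR[OF that(1)] _ PtR[OF that(2)]] by (auto simp: g_def)
  qed
  have un: "g (a \<union> b) = g a \<union> g b" if ab: "a \<in> R" "b \<in> R" for a b
  proof -
    have "a \<union> b = sym_diff (sym_diff a b) (a \<inter> b)" by blast
    then have "g (a \<union> b) = sym_diff (g (sym_diff a b)) (g (a \<inter> b))"
      using sd[of "sym_diff a b" "a \<inter> b"] ab R_Diff R_Un R_Int by simp
    then show ?thesis using sd[OF ab] int[OF ab] by auto
  qed
  have gin: "g a \<in> fld" "Infty \<notin> g a" if "a \<in> R" for a using bij that by (auto dest: bij_betwE)
  have T: "TN CN (g a) = T a" if a: "a \<in> R" for a
  proof -
    have "Pt ` a \<inter> Pt ` B p = {} \<longleftrightarrow> g a \<inter> CN p = {}" if "p \<in> P" for p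
      using h(4)[OF that PtR[OF a]] gin[OF a] by (auto simp: g_def)
    moreover have "Pt ` a \<inter> Pt ` B p = {} \<longleftrightarrow> a \<inter> B p = {}" for p by auto
    ultimately show ?thesis unfolding TN_def T_def by blast
  qed
  have sub: "a \<subseteq> b" if ab: "a \<in> R" "b \<in> R" "g a \<subseteq> g b" for a b
  proof -
    have "g (a \<inter> b) = g a" using int[OF ab(1,2)] ab(3) by blast
    then have "a \<inter> b = a" using inj_onD[OF bij_betw_imp_inj_on[OF bij], of "a \<inter> b" a] R_Int[OF ab(1,2)] ab(1) by simp
    then show ?thesis by blast
  qed
  have "g {} = {}" using h(2) by (simp add: g_def)
  then have "iso_map CN g" unfolding iso_map_def using bij int un T sub by simp
  then show ?thesis by blast
qed

end

lemma infinite_if_disjoint_meet: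
  fixes b :: "nat \<Rightarrow> 'a set"
  assumes "\<And>i. b i \<inter> S \<noteq> {}" "\<And>i j. i \<noteq> j \<Longrightarrow> b i \<inter> b j = {}" "\<And>i. b i \<subseteq> a"
  shows "infinite (a \<inter> S)"
proof -
  have "\<forall>i. \<exists>x. x \<in> b i \<inter> S" using assms(1) by blast
  then obtain f where f: "\<And>i. f i \<in> b i \<inter> S" by metis
  have "inj f"
  proof (rule injI)
    fix i j assume "f i = f j"
    then show "i = j" using f[of i] f[of j] assms(2)[of i j] by (cases "i = j") auto
  qed
  then have "infinite (range f)" by (rule range_inj_infinite)
  moreover have "range f \<subseteq> a \<inter> S" using f assms(3) by blast
  ultimately show ?thesis using infinite_super by blast
qed

context cpart begin

lemma region_sub:
  assumes rg: "region U Own s nd" and V: "V \<subseteq> U" "\<And>x. x \<in> V \<Longrightarrow> \<exists>A\<in>R. x \<in> A \<and> A \<subseteq> V"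
  shows "region V Own s nd"
  unfolding region_def
proof (intro conjI ballI impI)
  show "V \<subseteq> X" "Own \<subseteq> P" "s \<subseteq> Own" using region_facts[OF rg] V(1) by blast+
  show "up p \<subseteq> Own" if "p \<in> Own" for p using region_facts(4)[OF rg that] .
  show "\<exists>A\<in>R. x \<in> A \<and> A \<subseteq> V" if "x \<in> V" for x using V(2) that .
  fix x assume x: "x \<in> V"
  then have xU: "x \<in> U" using V(1) by blast
  show "\<exists>A\<in>R. x \<in> A \<and> T A \<subseteq> up (blk x)" if "blk x \<in> Own"
    using rg xU that unfolding region_def by blast
  show "s \<subseteq> up (blk x)" if "blk x \<notin> Own"
    using rg xU that unfolding region_def by blast
  show "\<exists>A\<in>R. x \<in> A \<and> T A \<inter> Own \<subseteq> s" if "blk x \<notin> Own"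
    using rg xU that unfolding region_def by blast
  fix A assume A: "A \<in> R" "blk x \<notin> Own" "x \<in> A"
  show "if nd then \<exists>D\<in>R. x \<in> D \<and> {y \<in> D \<inter> V. blk y \<notin> Own} = {x} else infinite {y \<in> A \<inter> V. blk y \<notin> Own}"
  proof (cases nd)
    case True
    then obtain D where D: "D \<in> R" "x \<in> D" "{y \<in> D \<inter> U. blk y \<notin> Own} = {x}"
      using rg xU A unfolding region_def by meson
    have "{y \<in> D \<inter> V. blk y \<notin> Own} = {x}" using D V(1) x A(2) by blast
    then show ?thesis using True D by auto
  next
    case False
    obtain D where D: "D \<in> R" "x \<in> D" "D \<subseteq> V" using V(2)[OF x] by blast
    have "infinite {y \<in> (A \<inter> D) \<inter> U. blk y \<notin> Own}"
      using rg xU A(2) R_Int[OF A(1) D(1)] IntI[OF A(3) D(2)] False unfolding region_def by meson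
    moreover have "{y \<in> (A \<inter> D) \<inter> U. blk y \<notin> Own} \<subseteq> {y \<in> A \<inter> V. blk y \<notin> Own}" using D(3) by blast
    ultimately show ?thesis using False infinite_super by auto
  qed
qed

lemma region_disjoint_pattern: "region V Own s nd \<Longrightarrow> x \<in> V \<Longrightarrow> blk x \<notin> Own \<Longrightarrow> s \<subseteq> up (blk x)"
  unfolding region_def by blast

text \<open>
  Infinitely many copies of \<open>V\<close> are made to converge to a new point, keeping only the colours in
  \<open>s\<close> and \<open>sp\<close>. As far as the blocks in a finite set \<open>F\<close> are concerned, the new points look like
  those of \<open>U\<close>. The sets \<open>a\<close> and \<open>b i\<close> correspond to a neighbourhood of the new point and to
  the copies in it.
\<close>

lemma insert_copies:
  assumes oc: "omega_categorical P (ring_struct bare.fld Infty (\<lambda>p. Pt ` B p))"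
    and V: "V \<in> R" "region V s s nd" "y0 \<in> V" "blk y0 \<notin> s" and s: "finite s"
    and sp: "\<And>g. sp = Some g \<Longrightarrow> g \<in> P"
    and V4: "\<And>g A x. sp = Some g \<Longrightarrow> A \<in> R \<Longrightarrow> A \<subseteq> V \<Longrightarrow> x \<in> A \<Longrightarrow> blk x \<notin> s \<Longrightarrow> A \<inter> B g \<noteq> {}"
    and U: "\<And>F. finite F \<Longrightarrow> F \<subseteq> P \<Longrightarrow> \<exists>U. region U s s nd \<and> infinite {x \<in> U. blk x \<notin> s} \<and>
      (\<forall>p\<in>F - s - set_option sp. U \<inter> B p = {}) \<and>
      (\<forall>g\<in>set_option sp. \<forall>A\<in>R. \<forall>x\<in>A \<inter> U. blk x \<notin> s \<longrightarrow> A \<inter> U \<inter> B g \<noteq> {})"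
  obtains a and b :: "nat \<Rightarrow> 'x set" where "a \<in> R" "T a = s \<union> set_option sp"
    "\<And>i. b i \<in> R" "\<And>i. b i \<subseteq> a" "\<And>i. T (b i) = s \<union> set_option sp"
    "\<And>i j. i \<noteq> j \<Longrightarrow> b i \<inter> b j = {}"
    "\<And>D. (\<And>q. q \<in> s \<Longrightarrow> D q \<in> R) \<Longrightarrow> a = (\<Union>q\<in>s. D q) \<Longrightarrow> \<exists>q\<in>s. q \<in> T (D q)"
proof -
  let ?K = "s \<union> set_option sp"
  interpret at: attach R X P lt B "{}" True "\<lambda>_. Apex" "\<lambda>_. V" by unfold_locales (use V in auto)
  let ?CN = "at.colour (\<lambda>_. {}) (\<lambda>_. ?K)"
  have sP: "s \<subseteq> P" using region_facts[OF V(2)] by blast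
  then have KP: "?K \<subseteq> P" using sp by (cases sp) auto
  have sV: "s \<subseteq> T V"
    using region_disjoint_pattern[OF V(2-4)] T_up[OF V(1) in_T_blk[OF V(1,3)]] by blast
  have sV': "\<exists>y\<in>V. blk y = q" if "q \<in> s" for q
    using T_E[OF _ R_sub[OF V(1)]] sV that by blast
  have KV: "?K \<subseteq> T V"
    using sV V4[OF _ V(1) order_refl V(3,4)] KP by (cases sp) (auto simp: T_def)
  \<comment> \<open>For one sentence only the blocks in \<open>set_form f\<close> matter: everything
    outside \<open>U\<close> is held fixed, and of these blocks \<open>U\<close> meets at most those
    in \<open>s\<close> and \<open>sp\<close>.\<close>
  have eq: "holds (ring_struct bare.fld Infty (\<lambda>p. Pt ` B p)) f = holds (ring_struct at.fld Infty ?CN) f"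
    if f: "fvars f = {}" "set_form f \<subseteq> P" for f
  proof -
    obtain U where rU: "region U s s nd" and inf: "infinite {x \<in> U. blk x \<notin> s}"
      and UF: "\<And>p. p \<in> set_form f - s - set_option sp \<Longrightarrow> U \<inter> B p = {}"
      and Ug: "\<And>g A x. g \<in> set_option sp \<Longrightarrow> A \<in> R \<Longrightarrow> x \<in> A \<inter> U \<Longrightarrow> blk x \<notin> s \<Longrightarrow> A \<inter> U \<inter> B g \<noteq> {}"
      using U[OF finite_set_form f(2)] by blast
    have UX: "U \<subseteq> X" using region_facts[OF rU] by blast
    then have XU: "X - (X - U) = U" by blast
    show ?thesis
    proof (rule at.insert_holds[where ?H0.0 = "X - U" and s = s and nd = nd and sp = sp and Q = "set_form f"])
      show "region (X - (X - U)) s s nd" unfolding XU by (rule rU)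
      show "region V s s nd" by (rule V)
      show "infinite {i::nat. Apex = Apex \<and> (\<exists>y\<in>V. blk y = q)}" if "q \<in> s" for q
        using sV'[OF that] by (simp add: infinite_UNIV_nat)
      show "infinite {i::nat. Apex = Apex \<and> (\<exists>y\<in>V. blk y \<notin> s)}" using V(3,4) by (auto simp: infinite_UNIV_nat)
      show "infinite {x \<in> X - (X - U). blk x \<notin> s}" unfolding XU by (rule inf)
      show "B p \<subseteq> X - U \<and> (\<forall>i::nat. p \<notin> ?K \<or> V \<inter> B p = {})" if "p \<in> set_form f" "p \<notin> s" "sp \<noteq> Some p" for p
      proof -
        have "p \<in> set_form f - s - set_option sp" using that by (cases sp) auto
        then show ?thesis using UF[of p] block_sub[of p] f(2) that(1) by blast
      qed
      show "A \<inter> B g - (X - U) \<noteq> {}" if "sp = Some g" "A \<in> R" "x \<in> A - (X - U)" "blk x \<notin> s" for g x A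
        using Ug[of g A x] that R_sub[OF that(2)] by auto
      show "A \<inter> B g \<noteq> {}" if "sp = Some g" "A \<in> R" "A \<subseteq> V" "x \<in> A" "blk x \<notin> s" for g x A
        using V4 that .
    qed (use s f in auto)
  qed
  obtain g where "at.iso_map ?CN g" using at.iso_map_ex[OF oc eq] by blast
  note g = at.iso_mapD[OF this]
  define e where "e = at.apex_nbhd {}"
  have e: "e \<in> at.fld" "Infty \<notin> e" "Apex \<in> e" "Copy i ` V \<subseteq> e" for i
  proof -
    show "e \<in> at.fld" unfolding e_def by (rule at.apex_nbhd_fld) simp_all
    show "Infty \<notin> e" "Apex \<in> e" "Copy i ` V \<subseteq> e" by (auto simp: e_def at.apex_nbhd_def)
  qed
  have eK: "\<exists>i y. w = Copy i y \<and> y \<in> V" if "w \<in> e" "w \<noteq> Apex" for w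
    using that by (auto simp: e_def at.apex_nbhd_def)
  have CNK: "Copy i y \<in> ?CN p \<longleftrightarrow> y \<in> V \<inter> B p \<and> p \<in> ?K" for i y p by (auto simp: at.colour_def)
  have noApex: "Apex \<notin> ?CN p" for p by (auto simp: at.colour_def)
  have W: "Copy i ` V \<in> at.fld" "Infty \<notin> Copy i ` V" for i using at.copy_fld[OF V(1) order_refl] by auto
  have TW: "at.TN ?CN (Copy i ` V) = ?K" for i
  proof (rule set_eqI)
    fix p
    have "Copy i ` V \<inter> ?CN p \<noteq> {} \<longleftrightarrow> (\<exists>y\<in>V. Copy i y \<in> ?CN p)" by blast
    also have "\<dots> \<longleftrightarrow> V \<inter> B p \<noteq> {} \<and> p \<in> ?K" unfolding CNK by blast
    finally show "p \<in> at.TN ?CN (Copy i ` V) \<longleftrightarrow> p \<in> ?K"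
      using KV KP unfolding at.TN_def T_def by auto
  qed
  have "at.TN ?CN e \<subseteq> ?K"
  proof
    fix p assume "p \<in> at.TN ?CN e"
    then obtain w where w: "w \<in> e" "w \<in> ?CN p" unfolding at.TN_def by blast
    then have "w \<noteq> Apex" using noApex by metis
    then obtain i y where "w = Copy i y" using eK[OF w(1)] by blast
    then show "p \<in> ?K" using w(2) CNK by simp
  qed
  moreover have "?K \<subseteq> at.TN ?CN e" using TW[of 0] e(4)[of 0] unfolding at.TN_def by blast
  ultimately have Te: "at.TN ?CN e = ?K" by blast
  obtain a where a: "a \<in> R" "g a = e" using g(8) e by blast
  have "\<forall>i. \<exists>a\<in>R. g a = Copy i ` V" using g(8) W by blast
  then obtain b where b: "\<And>i. b i \<in> R \<and> g (b i) = Copy i ` V" by metis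
  have gUN: "finite I \<Longrightarrow> (\<And>q. q \<in> I \<Longrightarrow> D q \<in> R) \<Longrightarrow> g (\<Union>q\<in>I. D q) = (\<Union>q\<in>I. g (D q))"
    for I and D :: "'p \<Rightarrow> 'x set"
    by (induction I rule: finite_induct) (simp_all add: g R_UN)
  show thesis
  proof (rule that[of a b])
    show "a \<in> R" "b i \<in> R" for i using a b by auto
    show "T a = ?K" using g(5)[OF a(1)] a Te by simp
    show "T (b i) = ?K" for i using g(5)[of "b i"] b TW by simp
    show "b i \<subseteq> a" for i using g(6)[of "b i" a] a b e by simp
    show "b i \<inter> b j = {}" if "i \<noteq> j" for i j
    proof -
      have "g (b i \<inter> b j) \<subseteq> g {}" using g(2) g(3)[of "b i" "b j"] b that by auto
      then show ?thesis using g(6)[of "b i \<inter> b j" "{}"] R_Int b by auto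
    qed
    \<comment> \<open>One of the sets \<open>g (D q)\<close> contains the new point, hence almost
      all copies, and every copy meets \<open>q\<close>.\<close>
    show "\<exists>q\<in>s. q \<in> T (D q)" if D: "\<And>q. q \<in> s \<Longrightarrow> D q \<in> R" "a = (\<Union>q\<in>s. D q)" for D
    proof -
      have "e = (\<Union>q\<in>s. g (D q))" using gUN[OF s, of D] D a by simp
      then obtain q where q: "q \<in> s" "Apex \<in> g (D q)" using e(3) by blast
      have "infinite {i::nat. Apex \<in> g (D q) \<and> (\<exists>y\<in>V. (\<lambda>w. case w of Copy i y \<Rightarrow> blk y = q | _ \<Rightarrow> False) (Copy i y) = True)}"
        using sV'[OF q(1)] q(2) by (simp add: infinite_UNIV_nat)
      from at.meets_class_infinite[OF conjunct1[OF g(7)[OF D(1)[OF q(1)]]] this]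
      obtain i y where y: "Copy i y \<in> g (D q)" "y \<in> V" "blk y = q" by auto
      then have "y \<in> B q" using blk(2)[of y] R_sub[OF V(1)] by blast
      then have "Copy i y \<in> ?CN q" using y q CNK by blast
      then have "q \<in> at.TN ?CN (g (D q))" using y(1) q(1) sP unfolding at.TN_def by blast
      then show ?thesis using g(5)[OF D(1)[OF q(1)]] q(1) by blast
    qed
  qed
qed

text \<open>If the discrete block were infinite, copies of a neighbourhood of one of its points
  could be attached to a new point unnoticed. The element corresponding to a neighbourhood of the
  new point meets only blocks in \<open>up p\<close> but has infinitely many points of
  \<open>B p\<close>, against \<open>discrete_finite\<close>.\<close>

lemma discrete_block_finite:
  assumes oc: "omega_categorical P (ring_struct bare.fld Infty (\<lambda>p. Pt ` B p))"
    and fin: "finite P" and p: "p \<in> P" "\<not> lt p p"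
  shows "finite (B p)"
proof (rule ccontr)
  assume inf: "infinite (B p)"
  define U where "U = {x. \<exists>A\<in>R. x \<in> A \<and> T A \<subseteq> up p}"
  define s where "s = up p - {p}"
  have UR: "\<exists>A\<in>R. x \<in> A \<and> A \<subseteq> U \<and> T A \<subseteq> up p" if "x \<in> U" for x using that by (auto simp: U_def)
  have UX: "U \<subseteq> X" using UR R_sub by blast
  have finT: "finite (T A)" for A using fin T_sub finite_subset by blast
  have Ublk: "blk x \<in> up p" if "x \<in> U" for x using UR[OF that] in_T_blk by blast
  have sup: "up q \<subseteq> s" if "q \<in> s" for q
    using that up_trans[OF p(1), of q] up_antisym[OF p(1), of q] unfolding s_def by blast
  have Up: "blk x = p" if "x \<in> U" "blk x \<notin> s" for x using Ublk[OF that(1)] that(2) by (auto simp: s_def)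
  have rU: "region U s s True" unfolding region_def
  proof (intro conjI ballI impI)
    show "U \<subseteq> X" by (rule UX)
    show "s \<subseteq> P" using up_sub by (auto simp: s_def)
    show "s \<subseteq> s" by simp
    show "up q \<subseteq> s" if "q \<in> s" for q using sup that .
    fix x assume x: "x \<in> U"
    then obtain A where A: "A \<in> R" "x \<in> A" "A \<subseteq> U" using UR by blast
    then show "\<exists>A\<in>R. x \<in> A \<and> A \<subseteq> U" by blast
    obtain D where D: "D \<in> R" "x \<in> D" "D \<subseteq> A" "T D = up (blk x)" using trim_exists[OF A(1,2) finT] by blast
    show "\<exists>A\<in>R. x \<in> A \<and> T A \<subseteq> up (blk x)" using D by blast
    assume n: "blk x \<notin> s"
    then show "s \<subseteq> up (blk x)" using Up[OF x n] by (simp add: s_def)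
    show "\<exists>A\<in>R. x \<in> A \<and> T A \<inter> s \<subseteq> s" using A by blast
    fix A' assume "A' \<in> R" "x \<in> A'"
    obtain E where E: "E \<in> R" "E \<subseteq> A" "E \<inter> B (blk x) = {x}" using isolate[OF A(1,2)] Up[OF x n] p(2) by auto
    have "{y \<in> E \<inter> U. blk y \<notin> s} = {x}"
    proof -
      have "y = x" if "y \<in> E" "y \<in> U" "blk y \<notin> s" for y
      proof -
        have "y \<in> X" using that(2) UX by blast
        then have "y \<in> B (blk x)" using blk(2)[of y] Up[OF that(2,3)] Up[OF x n] by simp
        then show ?thesis using E(3) that(1) by blast
      qed
      moreover have "x \<in> E" using E(3) by blast
      ultimately show ?thesis using x n by blast
    qed
    moreover have "x \<in> E" using E(3) by blast
    ultimately have "\<exists>D\<in>R. x \<in> D \<and> {y \<in> D \<inter> U. blk y \<notin> s} = {x}" using E(1) by blast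
    then show "if True then \<exists>D\<in>R. x \<in> D \<and> {y \<in> D \<inter> U. blk y \<notin> s} = {x}
      else infinite {y \<in> A' \<inter> U. blk y \<notin> s}" by (simp only: if_True)
  qed
  have BU: "B p \<subseteq> U"
  proof
    fix x assume x: "x \<in> B p"
    then have "x \<in> X" "blk x = p" using block_sub[OF p(1)] blk_eq[OF p(1)] by auto
    then obtain A where A: "A \<in> R" "x \<in> A" using R_cover by blast
    obtain D where D: "D \<in> R" "x \<in> D" "D \<subseteq> A" "T D = up (blk x)" by (rule trim_exists[OF A finT])
    then have "T D \<subseteq> up p" using \<open>blk x = p\<close> by simp
    then show "x \<in> U" unfolding U_def using D(1,2) by (intro CollectI bexI conjI)
  qed
  obtain x where x: "x \<in> B p" using block_nonempty[OF p(1)] by blast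
  then have xb: "x \<in> U" "blk x = p" using BU blk_eq[OF p(1)] by auto
  obtain V where V: "V \<in> R" "x \<in> V" "V \<subseteq> U" using UR xb(1) by blast
  have ps: "p \<notin> s" by (simp add: s_def)
  have sK: "s \<union> set_option (Some p) = up p" using self_up[OF p(1)] by (auto simp: s_def)
  have inB: "y \<in> B p" if "y \<in> U" "blk y \<notin> s" for y using Up[OF that] blk(2)[of y] that(1) UX by auto
  show False
  proof (rule insert_copies[OF oc V(1) region_sub[OF rU V(3)] V(2), where sp = "Some p"])
    show "\<exists>A\<in>R. x \<in> A \<and> A \<subseteq> V" if "x \<in> V" for x using V that by blast
    show "blk x \<notin> s" using xb ps by simp
    show "finite s" using fin up_sub finite_subset unfolding s_def by blast
    show "g \<in> P" if "Some p = Some g" for g using that p by simp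
    show "A \<inter> B g \<noteq> {}" if "Some p = Some g" "A \<in> R" "A \<subseteq> V" "x \<in> A" "blk x \<notin> s" for g A x
      using inB[of x] that V(3) by blast
    show "\<exists>U. region U s s True \<and> infinite {x \<in> U. blk x \<notin> s} \<and>
      (\<forall>p\<in>F - s - set_option (Some p). U \<inter> B p = {}) \<and>
      (\<forall>g\<in>set_option (Some p). \<forall>A\<in>R. \<forall>x\<in>A \<inter> U. blk x \<notin> s \<longrightarrow> A \<inter> U \<inter> B g \<noteq> {})"
      if F: "F \<subseteq> P" for F
    proof (intro exI[of _ U] conjI rU ballI impI)
      have "B p \<subseteq> {x \<in> U. blk x \<notin> s}" using BU blk_eq[OF p(1)] ps by auto
      then show "infinite {x \<in> U. blk x \<notin> s}" using inf infinite_super by blast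
      show "U \<inter> B q = {}" if q: "q \<in> F - s - set_option (Some p)" for q
      proof -
        have "q \<in> P" "q \<notin> up p" using q F sK by auto
        then show ?thesis using Ublk blk_eq[of q] by blast
      qed
      show "A \<inter> U \<inter> B g \<noteq> {}" if "g \<in> set_option (Some p)" "x \<in> A \<inter> U" "blk x \<notin> s" for g A x
        using inB[of x] that by auto
    qed
  next
    fix a and b :: "nat \<Rightarrow> 'x set"
    assume ab: "a \<in> R" "T a = s \<union> set_option (Some p)" "\<And>i. b i \<subseteq> a" "\<And>i. T (b i) = s \<union> set_option (Some p)"
      "\<And>i j. i \<noteq> j \<Longrightarrow> b i \<inter> b j = {}"
    have "b i \<inter> B p \<noteq> {}" for i
    proof -
      have "p \<in> T (b i)" using ab(4)[of i] by simp
      then show ?thesis by (simp add: T_def)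
    qed
    then have "infinite (a \<inter> B p)" using infinite_if_disjoint_meet[of b "B p" a] ab(3,5) by blast
    moreover have "T a \<subseteq> up p" using ab(2) sK by simp
    ultimately show False using discrete_finite[OF ab(1) _ p] by blast
  qed
qed

section \<open>Points with a neighbourhood meeting finitely many blocks\<close>

definition Ost where "Ost = {x \<in> X. \<exists>A\<in>R. x \<in> A \<and> finite (T A)}"

text \<open>A block in \<open>PO\<close> may also have points outside \<open>Ost\<close>.\<close>

definition PO where "PO = blk ` Ost"

lemma Ost_trim:
  assumes "x \<in> Ost" shows "\<exists>A\<in>R. x \<in> A \<and> T A = up (blk x)"
proof -
  obtain A where "A \<in> R" "x \<in> A" "finite (T A)" using assms by (auto simp: Ost_def)
  then show ?thesis by (rule trim_exists) blast
qed

lemma Ost_sub: "A \<in> R \<Longrightarrow> finite (T A) \<Longrightarrow> A \<subseteq> Ost"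
  using R_sub by (auto simp: Ost_def)

lemma PO_sub: "PO \<subseteq> P"
  using blk(1) by (auto simp: PO_def Ost_def)

lemma Ost_up: "x \<in> Ost \<Longrightarrow> finite (up (blk x))"
proof -
  assume x: "x \<in> Ost"
  obtain A where A: "A \<in> R" "x \<in> A" "finite (T A)" using x by (auto simp: Ost_def)
  show ?thesis using T_up[OF A(1) in_T_blk[OF A(1,2)]] A(3) finite_subset by blast
qed

lemma PO_trim: "p \<in> PO \<Longrightarrow> \<exists>A\<in>R. \<exists>x\<in>A. blk x = p \<and> x \<in> Ost \<and> T A = up p"
  using Ost_trim unfolding PO_def by blast

lemma PO_up_finite: "p \<in> PO \<Longrightarrow> finite (up p)"
  using Ost_up by (auto simp: PO_def)

lemma PO_up: assumes "p \<in> PO" shows "up p \<subseteq> PO"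
proof
  fix q assume q: "q \<in> up p"
  obtain A where A: "A \<in> R" "T A = up p" using PO_trim[OF assms] by blast
  then obtain y where y: "y \<in> A" "blk y = q" using T_E[of q A] R_sub[OF A(1)] q by blast
  have "finite (T A)" using A PO_up_finite[OF assms] by simp
  then have "y \<in> Ost" using Ost_sub[OF A(1)] y by blast
  then show "q \<in> PO" using y by (auto simp: PO_def)
qed

lemma off_open:
  assumes A: "A \<in> R" "x \<in> A" and F: "finite F" "F \<subseteq> P" "up (blk x) \<inter> F = {}"
  shows "\<exists>D\<in>R. x \<in> D \<and> D \<subseteq> A \<and> (\<forall>y\<in>D. up (blk y) \<inter> F = {})"
proof -
  have "F \<inter> up (blk x) = {}" using F(3) by blast
  then obtain D where D: "D \<in> R" "x \<in> D" "D \<subseteq> A" "\<And>q. q \<in> F \<Longrightarrow> D \<inter> B q = {}"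
    using avoid[OF A F(1,2)] by metis
  have "up (blk y) \<inter> F = {}" if "y \<in> D" for y
    using T_up[OF D(1) in_T_blk[OF D(1) that]] D(4) unfolding T_def by blast
  then show ?thesis using D by blast
qed

text \<open>Every neighbourhood of \<open>x\<close> meets infinitely many blocks, of which only
  finitely many are in \<open>PO\<close>; the points of all others lie outside
  \<open>Ost\<close>.\<close>

lemma off_Ost_infinite:
  assumes fin: "finite PO" and A: "A \<in> R" "x \<in> A" "x \<notin> Ost"
  shows "infinite (blk ` (A - Ost) - PO)"
proof
  assume f: "finite (blk ` (A - Ost) - PO)"
  have "T A \<subseteq> PO \<union> (blk ` (A - Ost) - PO)"
  proof
    fix p assume p: "p \<in> T A"
    then obtain y where y: "y \<in> A" "blk y = p" using T_E[OF _ R_sub[OF A(1)]] by blast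
    then show "p \<in> PO \<union> (blk ` (A - Ost) - PO)" unfolding PO_def by blast
  qed
  then have "finite (T A)" using f fin by (meson finite_UnI finite_subset)
  then show False using A R_sub[OF A(1)] by (auto simp: Ost_def)
qed

end

section \<open>The case that only finitely many blocks meet \<open>Ost\<close>\<close>

text \<open>
  Here only finitely many blocks meet \<open>Ost\<close>, and near some point outside \<open>Ost\<close> all points
  outside \<open>Ost\<close> are limits of the same set \<open>s\<close> of such blocks.
\<close>

locale tame = cpart R X P lt B
  for R :: "'x set set" and X and P :: "'p set" and lt and B +
  fixes s :: "'p set"
  assumes PO_finite: "finite PO"
    and s_sub: "s \<subseteq> PO"
    and pattern: "x \<in> X - Ost \<Longrightarrow> up (blk x) \<inter> (PO - s) = {} \<Longrightarrow> up (blk x) \<inter> PO = s"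
    and nonempty: "\<exists>x\<in>X - Ost. up (blk x) \<inter> (PO - s) = {}"
begin

text \<open>The points that are not in the closure of any block of \<open>PO - s\<close>; this set
  is open because \<open>PO\<close> is finite.\<close>

definition VV where "VV = {x \<in> X. up (blk x) \<inter> (PO - s) = {}}"

lemma VV_sub: "VV \<subseteq> X"
  by (auto simp: VV_def)

lemma s_finite: "finite s"
  using s_sub PO_finite finite_subset by blast

lemma s_P: "s \<subseteq> P"
  using s_sub PO_sub by blast

lemma VV_open: "x \<in> VV \<Longrightarrow> A \<in> R \<Longrightarrow> x \<in> A \<Longrightarrow> \<exists>D\<in>R. x \<in> D \<and> D \<subseteq> A \<and> D \<subseteq> VV"
proof -
  assume x: "x \<in> VV" and A: "A \<in> R" "x \<in> A"
  have "finite (PO - s)" "PO - s \<subseteq> P" "up (blk x) \<inter> (PO - s) = {}"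
    using PO_finite PO_sub x by (auto simp: VV_def)
  from off_open[OF A this] obtain D where
    D: "D \<in> R" "x \<in> D" "D \<subseteq> A" "\<forall>y\<in>D. up (blk y) \<inter> (PO - s) = {}" by blast
  have "D \<subseteq> VV" using D(4) R_sub[OF D(1)] unfolding VV_def by auto
  then show ?thesis using D(1-3) by blast
qed

lemma pattern': "x \<in> VV - Ost \<Longrightarrow> up (blk x) \<inter> PO = s"
  using pattern by (auto simp: VV_def)

lemma VV_O: "x \<in> VV \<Longrightarrow> x \<in> Ost \<Longrightarrow> blk x \<in> s"
  using self_up[OF blk(1)[of x]] unfolding VV_def PO_def by blast

lemma s_up: "p \<in> s \<Longrightarrow> up p \<subseteq> s"
proof -
  assume p: "p \<in> s"
  obtain x where x: "x \<in> X - Ost" "up (blk x) \<inter> (PO - s) = {}" using nonempty by blast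
  have "up (blk x) \<inter> PO = s" using pattern x .
  then show ?thesis using p up_trans[OF blk(1)[of x], of p] PO_up[of p] x(1) by blast
qed

lemma crowd:
  assumes "A \<in> R" "x \<in> A" "x \<notin> Ost"
  shows "infinite (A - Ost)"
  using off_Ost_infinite[OF PO_finite assms] finite_imageI by blast

lemma not_Ost: "p \<in> P \<Longrightarrow> p \<notin> PO \<Longrightarrow> x \<in> B p \<Longrightarrow> x \<notin> Ost"
  using blk_eq unfolding PO_def by blast

text \<open>Every neighbourhood of \<open>x\<close> contains points of blocks outside
  \<open>PO\<close>, and these are limits of all blocks in \<open>s\<close>, among them that of
  \<open>x\<close> itself. So that block is crowded, and a block of \<open>s\<close> has points in
  \<open>VV\<close> outside \<open>Ost\<close> only if \<open>s = up g\<close> for a crowded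
  \<open>g\<close>.\<close>

lemma block_in_s:
  assumes x: "x \<in> VV - Ost" and s: "blk x \<in> s"
  shows "lt (blk x) (blk x) \<and> up (blk x) = s"
proof
  have xX: "x \<in> X" using x VV_sub by blast
  show "up (blk x) = s" using pattern'[OF x] PO_up[of "blk x"] s s_sub by blast
  have "\<forall>A\<in>R. x \<in> A \<longrightarrow> A \<inter> B (blk x) - {x} \<noteq> {}"
  proof (intro ballI impI)
    fix A assume A: "A \<in> R" "x \<in> A"
    obtain D where D: "D \<in> R" "x \<in> D" "D \<subseteq> A" "D \<subseteq> VV" using VV_open[OF _ A] x by blast
    have "infinite (blk ` (D - Ost) - PO)" using off_Ost_infinite[OF PO_finite D(1,2)] x by blast
    then have "blk ` (D - Ost) - PO \<noteq> {}" by (metis finite.emptyI)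
    then obtain y where y: "y \<in> D - Ost" "blk y \<notin> PO" by blast
    have "blk x \<in> up (blk y)" using pattern'[of y] y D(4) s by blast
    then have "lt (blk y) (blk x)" using y(2) s s_sub by (auto simp: up_def)
    then have "infinite (D \<inter> B (blk x))" using limit_infinite[OF D(1)] y(1) blk(1)[OF xX] by blast
    then have "infinite (D \<inter> B (blk x) - {x})" by simp
    then have "D \<inter> B (blk x) - {x} \<noteq> {}" by (metis finite.emptyI)
    then show "A \<inter> B (blk x) - {x} \<noteq> {}" using D(3) by blast
  qed
  then show "lt (blk x) (blk x)" using limit_iff[OF blk(1)[OF xX] blk(1)[OF xX] blk(2)[OF xX]] by blast
qed

lemma region_VV:
  assumes U: "U \<subseteq> VV" "\<And>x. x \<in> U \<Longrightarrow> \<exists>A\<in>R. x \<in> A \<and> A \<subseteq> U"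
    and s': "s' \<subseteq> s" "\<And>p. p \<in> s' \<Longrightarrow> up p \<subseteq> s'"
    and notin: "\<And>x. x \<in> U - Ost \<Longrightarrow> blk x \<notin> s'"
    and above: "\<And>x. x \<in> U \<Longrightarrow> blk x \<notin> s' \<Longrightarrow> s' \<subseteq> up (blk x)"
    and inf: "\<And>x A. x \<in> A \<Longrightarrow> A \<in> R \<Longrightarrow> A \<subseteq> U \<Longrightarrow> blk x \<notin> s' \<Longrightarrow> infinite {y \<in> A. blk y \<notin> s'}"
  shows "region U s' s' False"
  unfolding region_def
proof (intro conjI ballI impI)
  show "U \<subseteq> X" using U VV_sub by blast
  show "s' \<subseteq> P" using s' s_P by blast
  show "s' \<subseteq> s'" by simp
  show "up p \<subseteq> s'" if "p \<in> s'" for p using s'(2) that .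
  fix x assume x: "x \<in> U"
  show "\<exists>A\<in>R. x \<in> A \<and> A \<subseteq> U" using U(2) x .
  show "\<exists>A\<in>R. x \<in> A \<and> T A \<subseteq> up (blk x)" if "blk x \<in> s'"
    using Ost_trim[of x] notin[of x] that x by blast
  assume n: "blk x \<notin> s'"
  show "s' \<subseteq> up (blk x)" using above x n .
  show "\<exists>A\<in>R. x \<in> A \<and> T A \<inter> s' \<subseteq> s'" using U(2)[OF x] by blast
  fix A assume A: "A \<in> R" "x \<in> A"
  obtain D where D: "D \<in> R" "x \<in> D" "D \<subseteq> U" using U(2)[OF x] by blast
  have "infinite {y \<in> A \<inter> D. blk y \<notin> s'}" using inf[of x "A \<inter> D"] R_Int[OF A(1) D(1)] A(2) D n by blast
  moreover have "{y \<in> A \<inter> D. blk y \<notin> s'} \<subseteq> {y \<in> A \<inter> U. blk y \<notin> s'}" using D(3) by blast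
  ultimately show "if False then \<exists>D\<in>R. x \<in> D \<and> {y \<in> D \<inter> U. blk y \<notin> s'} = {x}
      else infinite {y \<in> A \<inter> U. blk y \<notin> s'}"
    using infinite_super unfolding if_False by blast
qed

lemma off_sub:
  assumes V: "V \<in> R" and F: "finite F" "F \<subseteq> P" and x: "x \<in> {x \<in> V. up (blk x) \<inter> F = {}}"
  shows "\<exists>A\<in>R. x \<in> A \<and> A \<subseteq> {x \<in> V. up (blk x) \<inter> F = {}}"
proof -
  have "x \<in> V" "up (blk x) \<inter> F = {}" using x by auto
  from off_open[OF V this(1) F this(2)] show ?thesis by blast
qed

text \<open>
  Near a suitable point all points outside \<open>Ost\<close> are limits of a single block \<open>b\<close> that does not
  meet \<open>Ost\<close>. Inserting copies with the colours in \<open>s\<close> and \<open>b\<close> only gives an element that meets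
  finitely many blocks, among them \<open>b\<close>.
\<close>

lemma covered_contradiction:
  assumes oc: "omega_categorical P (ring_struct bare.fld Infty (\<lambda>p. Pt ` B p))"
    and V: "V \<in> R" "V \<subseteq> VV" "V - Ost \<noteq> {}" and F0: "finite F0" "F0 \<subseteq> P - PO"
    and cov: "\<And>x. x \<in> V - Ost \<Longrightarrow> up (blk x) \<inter> F0 \<noteq> {}"
  shows False
proof -
  obtain x1 where "x1 \<in> V - Ost" using V(3) by blast
  \<comment> \<open>Near a point with the fewest blocks of \<open>F0\<close> above it, all points
    outside \<open>Ost\<close> have the same set \<open>E\<close> of such blocks above them.\<close>
  then obtain x where x: "x \<in> V - Ost"
    and xmin: "\<And>y. y \<in> V - Ost \<Longrightarrow> card (up (blk x) \<inter> F0) \<le> card (up (blk y) \<inter> F0)"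
    using ex_has_least_nat[of "\<lambda>x. x \<in> V - Ost" x1 "\<lambda>x. card (up (blk x) \<inter> F0)"] by blast
  define E where "E = up (blk x) \<inter> F0"
  have fin: "finite (F0 - E)" "F0 - E \<subseteq> P" "(F0 - E) \<inter> up (blk x) = {}" using F0 by (auto simp: E_def)
  obtain V' where V': "V' \<in> R" "x \<in> V'" "V' \<subseteq> V" "\<And>q. q \<in> F0 - E \<Longrightarrow> V' \<inter> B q = {}"
    using avoid[OF V(1) _ fin] x by blast
  have E: "up (blk y) \<inter> F0 = E" if y: "y \<in> V' - Ost" for y
  proof (rule card_seteq)
    show "finite E" using F0 by (simp add: E_def)
    show "up (blk y) \<inter> F0 \<subseteq> E"
      using T_up[OF V'(1) in_T_blk[OF V'(1)], of y] V'(4) y unfolding T_def by blast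
    show "card E \<le> card (up (blk y) \<inter> F0)" using xmin[of y] y V'(3) unfolding E_def by blast
  qed
  obtain b where b: "b \<in> up (blk x)" "b \<in> F0" using cov[OF x] by blast
  then have bE: "b \<in> E" by (simp add: E_def)
  have bP: "b \<in> P" "b \<notin> PO" using b F0 by auto
  have meets: "\<exists>y\<in>A. blk y = c" if "A \<in> R" "y \<in> A" "c \<in> up (blk y)" for A y c
    using T_up[OF that(1) in_T_blk[OF that(1,2)]] that(3) T_E[OF _ R_sub[OF that(1)]] by blast
  obtain x' where x': "x' \<in> V'" "blk x' = b" using meets[OF V'(1,2) b(1)] by blast
  have offO: "y \<notin> Ost" if "blk y \<notin> PO" for y using that by (auto simp: PO_def)
  have x'O: "x' \<notin> Ost" using offO x' bP by blast
  \<comment> \<open>A block \<open>c\<close> outside \<open>PO\<close> and above \<open>b\<close>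
    has a point in \<open>V'\<close>. It lies outside \<open>Ost\<close>, so all of
    \<open>E\<close>, in particular \<open>b\<close>, is above \<open>c\<close>, and antisymmetry
    gives \<open>c = b\<close>.\<close>
  have only: "c = b" if c: "c \<in> up b" "c \<notin> PO" for c
  proof -
    obtain y where y: "y \<in> V'" "blk y = c" using meets[OF V'(1) x'(1)] c x' by blast
    then have "b \<in> up c" using E[of y] bE offO[of y] c(2) by blast
    then show ?thesis using up_antisym[OF bP(1) c(1)] by simp
  qed
  have V'V: "V' \<subseteq> VV" using V'(3) V(2) by blast
  have "up b \<inter> PO = s" using pattern'[of x'] x' x'O V'V by blast
  then have upb: "up b = insert b s" using only self_up[OF bP(1)] by blast
  have bs: "b \<notin> s" using bP s_sub by blast
  have below: "b \<in> up (blk y)" if "y \<in> V' - Ost" for y using E[OF that] bE by blast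
  \<comment> \<open>If \<open>x'\<close> were isolated in its block, the infinitely many other
    points outside \<open>Ost\<close> near \<open>x'\<close> would belong to blocks strictly below
    \<open>b\<close>, and \<open>B b\<close> would accumulate at them.\<close>
  have crowded: "lt b b"
  proof (rule ccontr)
    assume "\<not> lt b b"
    then obtain D where D: "D \<in> R" "D \<subseteq> V'" "D \<inter> B b = {x'}" using isolate[OF V'(1) x'(1)] x'(2) by auto
    then have "x' \<in> D" by blast
    then have "infinite (D - Ost - {x'})" using crowd[OF D(1) _ x'O] by simp
    then have "D - Ost - {x'} \<noteq> {}" by (metis finite.emptyI)
    then obtain y where y: "y \<in> D" "y \<notin> Ost" "y \<noteq> x'" by blast
    have "y \<notin> B b" using D(3) y by blast
    then have "blk y \<noteq> b" using blk(2)[of y] R_sub[OF D(1)] y(1) by blast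
    moreover have "b \<in> up (blk y)" using below y D(2) by blast
    ultimately have "lt (blk y) b" by (auto simp: up_def)
    then have "infinite (D \<inter> B b)" using limit_infinite[OF D(1) y(1) bP(1)] by blast
    then show False using D(3) by simp
  qed
  have infb: "infinite (A \<inter> B b)" if "A \<in> R" "y \<in> A" "A \<subseteq> V'" "y \<notin> Ost" for A y
  proof -
    have "b \<in> up (blk y)" using below that by blast
    then have "lt (blk y) b" using crowded by (auto simp: up_def)
    then show ?thesis using limit_infinite[OF that(1,2) bP(1)] by blast
  qed
  have nots: "blk y \<notin> s" if y: "y \<in> V' - Ost" for y
    using below[OF y] s_up[of "blk y"] bs by blast
  have inO: "y \<notin> Ost" if "y \<in> V'" "blk y \<notin> s" for y using VV_O V'V that by blast
  have Bb: "A \<inter> B b \<subseteq> {y \<in> A. blk y \<notin> s}" for A using blk_eq[OF bP(1)] bs by auto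
  have rV: "region V' s s False"
  proof (rule region_VV[OF V'V _ order_refl s_up])
    show "\<exists>A\<in>R. x \<in> A \<and> A \<subseteq> V'" if "x \<in> V'" for x using V' that by blast
    show "blk y \<notin> s" if "y \<in> V' - Ost" for y using nots that .
    show "s \<subseteq> up (blk y)" if "y \<in> V'" "blk y \<notin> s" for y
      using pattern'[of y] V'V inO[OF that] that(1) by blast
    show "infinite {y \<in> A. blk y \<notin> s}" if "y \<in> A" "A \<in> R" "A \<subseteq> V'" "blk y \<notin> s" for y A
      using infb[OF that(2,1,3)] inO[of y] that Bb[of A] infinite_super by blast
  qed
  show False
  proof (rule insert_copies[OF oc V'(1) rV x'(1), where sp = "Some b"])
    show "blk x' \<notin> s" using x' bs by simp
    show "finite s" by (rule s_finite)
    show "g \<in> P" if "Some b = Some g" for g using that bP by simp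
    show "A \<inter> B g \<noteq> {}" if "Some b = Some g" "A \<in> R" "A \<subseteq> V'" "x \<in> A" "blk x \<notin> s" for g A x
    proof -
      have "infinite (A \<inter> B b)" using infb[OF that(2,4,3)] inO[of x] that by blast
      then show ?thesis using that(1) by (metis finite.emptyI option.inject)
    qed
    show "\<exists>U. region U s s False \<and> infinite {x \<in> U. blk x \<notin> s} \<and>
      (\<forall>p\<in>F - s - set_option (Some b). U \<inter> B p = {}) \<and>
      (\<forall>g\<in>set_option (Some b). \<forall>A\<in>R. \<forall>x\<in>A \<inter> U. blk x \<notin> s \<longrightarrow> A \<inter> U \<inter> B g \<noteq> {})"
      if F: "finite F" "F \<subseteq> P" for F
    proof -
      define F' where "F' = F - s - {b}"
      have F': "finite F'" "F' \<subseteq> P" using F by (auto simp: F'_def)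
      define U where "U = {x \<in> V'. up (blk x) \<inter> F' = {}}"
      have Uop: "\<exists>A\<in>R. x \<in> A \<and> A \<subseteq> U" if "x \<in> U" for x using off_sub[OF V'(1) F'] that unfolding U_def .
      have UV: "U \<subseteq> V'" by (auto simp: U_def)
      have "V' \<inter> B b \<subseteq> U" using blk_eq[OF bP(1)] upb by (auto simp: U_def F'_def)
      then have bU: "V' \<inter> B b \<subseteq> {x \<in> U. blk x \<notin> s}" using Bb[of V'] by blast
      have "infinite (V' \<inter> B b)" using infb[OF V'(1,2) order_refl] x by blast
      then have 1: "infinite {x \<in> U. blk x \<notin> s}" using bU infinite_super by blast
      have 2: "U \<inter> B p = {}" if p: "p \<in> F - s - set_option (Some b)" for p
      proof -
        have "p \<in> F'" "p \<in> P" using p F by (auto simp: F'_def)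
        then show ?thesis using self_up[of p] blk_eq[of p] unfolding U_def by blast
      qed
      have 3: "A \<inter> U \<inter> B b \<noteq> {}" if A: "A \<in> R" "y \<in> A \<inter> U" "blk y \<notin> s" for A y
      proof -
        obtain D where D: "D \<in> R" "y \<in> D" "D \<subseteq> U" using Uop A by blast
        have "infinite ((A \<inter> D) \<inter> B b)"
          using infb[of "A \<inter> D" y] R_Int[OF A(1) D(1)] A D UV inO[of y] by blast
        then have "(A \<inter> D) \<inter> B b \<noteq> {}" by (metis finite.emptyI)
        then show ?thesis using D(3) by blast
      qed
      show ?thesis using region_sub[OF rV UV Uop] 1 2 3 by (intro exI[of _ U] conjI ballI impI) auto
    qed
  next
    \<comment> \<open>Such an element meets finitely many blocks and is therefore contained in
      \<open>Ost\<close>, which is disjoint from \<open>B b\<close>.\<close>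
    fix a assume a: "a \<in> R" "T a = s \<union> set_option (Some b)"
    then have "finite (T a)" "b \<in> T a" using s_finite by auto
    then obtain y where y: "y \<in> a" "blk y = b" using T_E[OF _ R_sub[OF a(1)]] by blast
    have "y \<in> Ost" using Ost_sub[OF a(1) \<open>finite (T a)\<close>] y(1) by blast
    then show False using offO[of y] bP(2) y(2) by simp
  qed
qed

text \<open>Under this condition the further blocks of a sentence can be avoided near every point of
  \<open>VV\<close> outside \<open>Ost\<close>, without leaving the complement of
  \<open>Ost\<close>.\<close>

definition no_cover where
  "no_cover \<longleftrightarrow> (\<forall>V F. V \<in> R \<longrightarrow> V \<subseteq> VV \<longrightarrow> V - Ost \<noteq> {} \<longrightarrow> finite F \<longrightarrow> F \<subseteq> P - PO \<longrightarrow>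
     (\<exists>x\<in>V - Ost. up (blk x) \<inter> F = {}))"

lemma no_cover:
  assumes nc: no_cover and V: "V \<in> R" "x \<in> V" "x \<in> VV - Ost" and F: "finite F" "F \<subseteq> P"
  shows "\<exists>y\<in>V - Ost. y \<in> VV \<and> up (blk y) \<inter> (F - s) = {}"
proof -
  obtain D where D: "D \<in> R" "x \<in> D" "D \<subseteq> V" "D \<subseteq> VV" using VV_open[OF _ V(1,2)] V(3) by blast
  have h: "D - Ost \<noteq> {}" "finite (F - PO)" "F - PO \<subseteq> P - PO" using D V F by auto
  have "\<exists>x\<in>D - Ost. up (blk x) \<inter> (F - PO) = {}"
    using nc[unfolded no_cover_def, rule_format, OF D(1,4) h] .
  then obtain y where y: "y \<in> D - Ost" "up (blk y) \<inter> (F - PO) = {}" by blast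
  have "up (blk y) \<inter> PO = s" using pattern'[of y] y(1) D(4) by blast
  then have "up (blk y) \<inter> (F - s) = {}" using y(2) by blast
  then show ?thesis using y(1) D(3,4) by (intro bexI[of _ y] conjI) auto
qed

text \<open>
  Copies that keep only the colours in \<open>s\<close> give an element \<open>a\<close> with \<open>T a = s\<close>. By compactness
  some block meeting \<open>a\<close> lies below all of \<open>s\<close>; it is not crowded, but meets every copy.
\<close>

lemma uncovered_contradiction:
  assumes oc: "omega_categorical P (ring_struct bare.fld Infty (\<lambda>p. Pt ` B p))"
    and nc: no_cover and nog: "\<And>g. g \<in> P \<Longrightarrow> lt g g \<Longrightarrow> s \<noteq> up g"
  shows False
proof -
  obtain x where x: "x \<in> VV - Ost" using nonempty unfolding VV_def by blast
  obtain A where "A \<in> R" "x \<in> A" using R_cover x VV_sub by blast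
  then obtain V where V: "V \<in> R" "x \<in> V" "V \<subseteq> VV" using VV_open x by blast
  have nots: "blk y \<notin> s" if "y \<in> V - Ost" for y
    using block_in_s[of y] nog[of "blk y"] blk(1)[of y] that V VV_sub by blast
  have inO: "y \<notin> Ost" if "y \<in> V" "blk y \<notin> s" for y using VV_O V that by blast
  have many: "infinite {y \<in> A. blk y \<notin> s}" if "y \<in> A" "A \<in> R" "A \<subseteq> V" "y \<notin> Ost" for y A
  proof -
    have "infinite (A - Ost)" using crowd that by blast
    moreover have "A - Ost \<subseteq> {y \<in> A. blk y \<notin> s}" using nots that(3) by blast
    ultimately show ?thesis using infinite_super by blast
  qed
  have rV: "region V s s False"
  proof (rule region_VV[OF V(3) _ order_refl s_up])
    show "\<exists>A\<in>R. x \<in> A \<and> A \<subseteq> V" if "x \<in> V" for x using V that by blast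
    show "blk y \<notin> s" if "y \<in> V - Ost" for y using nots that .
    show "s \<subseteq> up (blk y)" if "y \<in> V" "blk y \<notin> s" for y
      using pattern'[of y] V inO[OF that] that(1) by blast
    show "infinite {y \<in> A. blk y \<notin> s}" if "y \<in> A" "A \<in> R" "A \<subseteq> V" "blk y \<notin> s" for y A
      using many[OF that(1-3)] inO[of y] that by blast
  qed
  show False
  proof (rule insert_copies[OF oc V(1) rV V(2), where sp = None])
    show "blk x \<notin> s" using nots x V by blast
    show "finite s" by (rule s_finite)
    show "g \<in> P" if "None = Some g" for g using that by simp
    show "A \<inter> B g \<noteq> {}" if "None = Some g" for g A using that by simp
    show "\<exists>U. region U s s False \<and> infinite {x \<in> U. blk x \<notin> s} \<and>
      (\<forall>p\<in>F - s - set_option None. U \<inter> B p = {}) \<and>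
      (\<forall>g\<in>set_option None. \<forall>A\<in>R. \<forall>x\<in>A \<inter> U. blk x \<notin> s \<longrightarrow> A \<inter> U \<inter> B g \<noteq> {})"
      if F: "finite F" "F \<subseteq> P" for F
    proof -
      have F': "finite (F - s)" "F - s \<subseteq> P" using F by auto
      define U where "U = {x \<in> V. up (blk x) \<inter> (F - s) = {}}"
      have Uop: "\<exists>A\<in>R. x \<in> A \<and> A \<subseteq> U" if "x \<in> U" for x using off_sub[OF V(1) F'] that unfolding U_def .
      have UV: "U \<subseteq> V" by (auto simp: U_def)
      obtain y where y: "y \<in> V - Ost" "up (blk y) \<inter> (F - s) = {}"
        using no_cover[OF nc V(1,2) x F] by blast
      then have "y \<in> U" by (simp add: U_def)
      then obtain A where A: "A \<in> R" "y \<in> A" "A \<subseteq> U" using Uop by blast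
      have "infinite {y \<in> A. blk y \<notin> s}" using many[of y A] A UV y by blast
      then have 1: "infinite {x \<in> U. blk x \<notin> s}" using A(3) by (elim infinite_super[rotated]) blast
      have 2: "U \<inter> B p = {}" if p: "p \<in> F - s - set_option None" for p
      proof -
        have "p \<in> F - s" "p \<in> P" using p F by auto
        then show ?thesis using self_up[of p] blk_eq[of p] unfolding U_def by blast
      qed
      show ?thesis using region_sub[OF rV UV Uop] 1 2 by (intro exI[of _ U] conjI ballI impI) auto
    qed
  next
    fix a and b :: "nat \<Rightarrow> 'x set"
    assume "a \<in> R" "T a = s \<union> set_option None" "\<And>i. b i \<subseteq> a" "\<And>i. T (b i) = s \<union> set_option None"
      and dis: "\<And>i j. i \<noteq> j \<Longrightarrow> b i \<inter> b j = {}"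
      and cov: "\<And>D. (\<And>q. q \<in> s \<Longrightarrow> D q \<in> R) \<Longrightarrow> a = (\<Union>q\<in>s. D q) \<Longrightarrow> \<exists>q\<in>s. q \<in> T (D q)"
    then have a: "a \<in> R" "T a = s" "\<And>i. b i \<subseteq> a" "\<And>i. T (b i) = s" by auto
    \<comment> \<open>Otherwise each point of \<open>a\<close> has a neighbourhood missing some
      block of \<open>s\<close>, and \<open>a\<close> is a union of elements \<open>D q\<close>
      disjoint from \<open>B q\<close>. But one of them corresponds to a set containing the new
      point and hence meets \<open>B q\<close>.\<close>
    have "\<exists>y\<in>a. up (blk y) = s"
    proof (rule ccontr)
      assume n: "\<not> (\<exists>y\<in>a. up (blk y) = s)"
      define \<C> where "\<C> = {D \<in> R. D \<subseteq> a \<and> (\<exists>q\<in>s. D \<inter> B q = {})}"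
      have "a \<subseteq> \<Union>\<C>"
      proof
        fix y assume y: "y \<in> a"
        have "up (blk y) \<subseteq> s" using T_up[OF a(1) in_T_blk[OF a(1) y]] a(2) by simp
        then obtain q where q: "q \<in> s" "q \<notin> up (blk y)" using n y by blast
        then obtain D where D: "D \<in> R" "y \<in> D" "D \<inter> B q = {}"
          using avoid_one[of y q] R_sub[OF a(1)] y s_P by blast
        then have "a \<inter> D \<in> \<C>" using q R_Int[OF a(1) D(1)] by (auto simp: \<C>_def)
        then show "y \<in> \<Union>\<C>" using y D by blast
      qed
      moreover have "\<C> \<subseteq> R" by (auto simp: \<C>_def)
      ultimately have "\<exists>\<D>\<subseteq>\<C>. finite \<D> \<and> a \<subseteq> \<Union>\<D>" by (intro R_compact[OF a(1)])
      then obtain \<D> where \<D>: "\<D> \<subseteq> \<C>" "finite \<D>" "a \<subseteq> \<Union>\<D>" by (elim exE conjE)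
      define D where "D q = \<Union>{E \<in> \<D>. E \<inter> B q = {}}" for q
      have DR: "D q \<in> R" for q
      proof -
        have "(\<Union>E\<in>{E \<in> \<D>. E \<inter> B q = {}}. E) \<in> R" using \<D> by (intro R_UN) (auto simp: \<C>_def)
        then show ?thesis by (simp add: D_def)
      qed
      have "a \<subseteq> (\<Union>q\<in>s. D q)"
      proof
        fix y assume "y \<in> a"
        then obtain E where E: "E \<in> \<D>" "y \<in> E" using \<D>(3) by blast
        then obtain q where "q \<in> s" "E \<inter> B q = {}" using \<D>(1) by (auto simp: \<C>_def)
        then show "y \<in> (\<Union>q\<in>s. D q)" using E unfolding D_def by blast
      qed
      moreover have "(\<Union>q\<in>s. D q) \<subseteq> a" using \<D>(1) unfolding D_def \<C>_def by blast
      ultimately have "\<exists>q\<in>s. q \<in> T (D q)" using cov[of D] DR by blast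
      then obtain q where "q \<in> s" "D q \<inter> B q \<noteq> {}" by (auto simp: T_def)
      then show False by (auto simp: D_def)
    qed
    then obtain y where y: "y \<in> a" "up (blk y) = s" by blast
    have yP: "blk y \<in> P" using R_sub[OF a(1)] y(1) blk(1) by blast
    then have d: "\<not> lt (blk y) (blk y)" using nog[OF yP] y(2) by blast
    have "blk y \<in> s" using self_up[OF yP] y(2) by simp
    then have "b i \<inter> B (blk y) \<noteq> {}" for i using a(4)[of i] by (auto simp: T_def)
    then have "infinite (a \<inter> B (blk y))" using infinite_if_disjoint_meet[of b "B (blk y)" a] a(3) dis by blast
    then show False using discrete_finite[OF a(1) _ yP d] a(2) y(2) by blast
  qed
qed

end

lemma infinite_fst_index:
  assumes "range en = S \<times> (UNIV :: nat set)" "A \<in> S"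
  shows "infinite {i :: nat. fst (en i) = A}"
proof
  assume fin: "finite {i. fst (en i) = A}"
  have "UNIV \<subseteq> (snd \<circ> en) ` {i. fst (en i) = A}"
  proof
    fix n :: nat
    have "(A, n) \<in> range en" unfolding assms(1) using assms(2) by simp
    then obtain i where "(A, n) = en i" by (rule rangeE)
    then have "n = (snd \<circ> en) i" "i \<in> {i. fst (en i) = A}" by (metis comp_apply snd_conv, metis fst_conv mem_Collect_eq)
    then show "n \<in> (snd \<circ> en) ` {i. fst (en i) = A}" by (rule image_eqI)
  qed
  then show False using finite_surj[OF fin] infinite_UNIV_nat by blast
qed

text \<open>
  Now \<open>s\<close> is the set of blocks above a crowded block \<open>g\<close>. Points outside \<open>Ost\<close>
  cannot be distinguished from points of \<open>g\<close> by finitely many blocks.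
\<close>

locale tame_crowded = tame +
  fixes g :: 'b
  assumes g: "up g = s" "g \<in> s" "lt g g"
begin

text \<open>\<open>g\<close> is deprived of its type on purpose: its points share the type
  \<open>None\<close> with the points of \<open>VV\<close> outside \<open>Ost\<close>, which are
  limits of the same blocks of \<open>s\<close>.\<close>

definition s' where "s' = s - {g}"

text \<open>The part of \<open>VV\<close> that is left free in the game for a sentence with blocks
  in \<open>F\<close>; everything else is held fixed.\<close>

definition off where "off F = {x \<in> VV. up (blk x) \<inter> (F - s) = {}}"

lemma g_P: "g \<in> P"
  using g(2) s_P by blast

lemma s'_up: "p \<in> s' \<Longrightarrow> up p \<subseteq> s'"
proof -
  assume p: "p \<in> s'"
  then have "up p \<subseteq> s" using s_up by (simp add: s'_def)
  moreover have "g \<notin> up p" using p up_antisym[OF g_P, of p] g(1) by (auto simp: s'_def)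
  ultimately show ?thesis by (auto simp: s'_def)
qed

lemma above: "x \<in> VV \<Longrightarrow> blk x \<notin> s' \<Longrightarrow> s \<subseteq> up (blk x)"
proof (cases "x \<in> Ost")
  case True
  assume "x \<in> VV" "blk x \<notin> s'"
  then have "blk x = g" using VV_O[OF _ True] by (simp add: s'_def)
  then show ?thesis using g(1) by simp
next
  case False
  assume "x \<in> VV"
  then show ?thesis using pattern'[of x] False by blast
qed

lemma lt_g: "x \<in> VV \<Longrightarrow> blk x \<notin> s' \<Longrightarrow> lt (blk x) g"
  using above[of x] g by (auto simp: up_def)

lemma notin: "x \<in> VV \<Longrightarrow> x \<notin> Ost \<Longrightarrow> blk x \<notin> s'"
  using pattern'[of x] s'_up[of "blk x"] g(2) by (auto simp: s'_def)

lemma g_infinite: "A \<in> R \<Longrightarrow> x \<in> A \<Longrightarrow> x \<in> VV \<Longrightarrow> blk x \<notin> s' \<Longrightarrow> infinite (A \<inter> B g)"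
  using limit_infinite[OF _ _ g_P lt_g] by blast

lemma region_open_VV:
  assumes U: "U \<subseteq> VV" "\<And>x. x \<in> U \<Longrightarrow> \<exists>A\<in>R. x \<in> A \<and> A \<subseteq> U"
  shows "region U s' s' False"
proof (rule region_VV[OF U])
  show "s' \<subseteq> s" by (auto simp: s'_def)
  show "up p \<subseteq> s'" if "p \<in> s'" for p using s'_up that .
  show "blk x \<notin> s'" if "x \<in> U - Ost" for x using notin that U(1) by blast
  show "s' \<subseteq> up (blk x)" if "x \<in> U" "blk x \<notin> s'" for x
    using above[of x] that U(1) by (auto simp: s'_def)
  show "infinite {y \<in> A. blk y \<notin> s'}" if "x \<in> A" "A \<in> R" "A \<subseteq> U" "blk x \<notin> s'" for x A
  proof -
    have "infinite (A \<inter> B g)" using g_infinite[OF that(2,1) _ that(4)] that U(1) by blast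
    moreover have "A \<inter> B g \<subseteq> {y \<in> A. blk y \<notin> s'}" using blk_eq[OF g_P] by (auto simp: s'_def)
    ultimately show ?thesis using infinite_super by blast
  qed
qed

lemma off_VV: "off F \<subseteq> VV"
  by (auto simp: off_def)

lemma off_nbhd:
  assumes F: "finite F" "F \<subseteq> P" and x: "x \<in> off F" and A: "A \<in> R" "x \<in> A"
  shows "\<exists>D\<in>R. x \<in> D \<and> D \<subseteq> A \<and> D \<subseteq> off F"
proof -
  obtain E where E: "E \<in> R" "x \<in> E" "E \<subseteq> A" "E \<subseteq> VV" using VV_open[OF _ A] x off_VV by blast
  have F': "finite (F - s)" "F - s \<subseteq> P" "up (blk x) \<inter> (F - s) = {}" using F x by (auto simp: off_def)
  obtain D where D: "D \<in> R" "x \<in> D" "D \<subseteq> E" "\<forall>y\<in>D. up (blk y) \<inter> (F - s) = {}"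
    using off_open[OF E(1,2) F'] by blast
  have "D \<subseteq> off F" using D(3,4) E(4) unfolding off_def by auto
  then show ?thesis using D E(3) by blast
qed

lemma off_region: "finite F \<Longrightarrow> F \<subseteq> P \<Longrightarrow> region (off F) s' s' False"
proof (rule region_open_VV[OF off_VV])
  fix x assume F: "finite F" "F \<subseteq> P" and x: "x \<in> off F"
  then have "x \<in> X" using off_VV VV_sub by blast
  then obtain A where "A \<in> R" "x \<in> A" using R_cover by blast
  from off_nbhd[OF F x this] show "\<exists>A\<in>R. x \<in> A \<and> A \<subseteq> off F" by blast
qed

lemma tr:
  assumes "q \<in> s"
  shows "\<exists>A\<in>R. A \<subseteq> VV \<inter> Ost \<and> T A = up q \<and> (\<exists>x\<in>A. blk x = q)"
proof -
  have q: "q \<in> PO" using assms s_sub by blast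
  obtain A x where A: "A \<in> R" "x \<in> A" "blk x = q" "T A = up q" using PO_trim[OF q] by blast
  have "y \<in> VV" if y: "y \<in> A" for y
  proof -
    have "up (blk y) \<subseteq> s" using T_up[OF A(1) in_T_blk[OF A(1) y]] A(4) s_up[OF assms] by simp
    then show ?thesis using R_sub[OF A(1)] y unfolding VV_def by blast
  qed
  moreover have "A \<subseteq> Ost" using Ost_sub[OF A(1)] A(4) PO_up_finite[OF q] by simp
  ultimately show ?thesis using A by blast
qed

lemma meet_off:
  assumes nc: no_cover and F: "finite F" "F \<subseteq> P" and A: "A \<in> R" "x \<in> A" "x \<in> VV" "x \<notin> Ost"
  shows "\<exists>y\<in>A - Ost. y \<in> off F \<and> blk y \<notin> s'"
    and "a \<in> insert None (Some ` s') \<Longrightarrow> infinite {y \<in> A \<inter> off F. kap s' y = a}"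
proof -
  obtain y where y: "y \<in> A" "y \<notin> Ost" "y \<in> off F"
    using no_cover[OF nc A(1,2) _ F] A(3,4) unfolding off_def by blast
  have n: "blk y \<notin> s'" using notin[of y] y off_VV by blast
  then show "\<exists>y\<in>A - Ost. y \<in> off F \<and> blk y \<notin> s'" using y by blast
  assume a: "a \<in> insert None (Some ` s')"
  have k: "kap s' y = None" using n by (simp add: kap_def)
  have "ple s' (kap s' y) a" "a \<noteq> kap s' y \<or> a \<notin> dst False" using a unfolding k by auto
  then show "infinite {y \<in> A \<inter> off F. kap s' y = a}"
    by (rule region_acc[OF off_region[OF F] A(1) y(1,3)])
qed

text \<open>
  Attaching a neighbourhood \<open>Ag\<close> of a point of \<open>g\<close> to a dense set of points of \<open>b\<close>, infinitely
  often at each of them, yields an equivalent structure in which every element meeting \<open>b\<close> is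
  above one that meets exactly the blocks in \<open>s\<close>.
\<close>

lemma poor_contradiction:
  assumes oc: "omega_categorical P (ring_struct bare.fld Infty (\<lambda>p. Pt ` B p))"
    and nc: no_cover and b: "b \<in> P" "b \<notin> PO" "B b \<subseteq> VV"
    and v: "v \<in> R" "v \<inter> B b \<noteq> {}" "\<And>a. a \<in> R \<Longrightarrow> a \<subseteq> v \<Longrightarrow> T a \<noteq> s"
  shows False
proof -
  obtain Ag xg where Ag: "Ag \<in> R" "Ag \<subseteq> VV \<inter> Ost" "T Ag = s" "xg \<in> Ag" "blk xg = g"
    using tr[OF g(2)] g(1) by blast
  \<comment> \<open>Every element of \<open>R\<close> is listed infinitely often. Choosing a point
    of \<open>B b\<close> in each element that has one gives dense attaching points, each with
    infinitely many copies; all other indices are sent to the new point.\<close>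
  define en where "en = from_nat_into (R \<times> (UNIV :: nat set))"
  have "R \<times> (UNIV :: nat set) \<noteq> {}" using R_empty by blast
  then have en: "range en = R \<times> UNIV" unfolding en_def using R_countable by (intro range_from_nat_into) auto
  define z where "z i = (if fst (en i) \<inter> B b \<noteq> {} then Pt (SOME x. x \<in> fst (en i) \<inter> B b) else Apex)" for i
  have zP: "\<exists>x\<in>fst (en i) \<inter> B b. z i = Pt x" if "fst (en i) \<inter> B b \<noteq> {}" for i
    using that someI_ex[of "\<lambda>x. x \<in> fst (en i) \<inter> B b"] unfolding z_def by auto
  have zc: "z i = Apex \<or> (\<exists>x\<in>B b. z i = Pt x)" for i using zP[of i] by (auto simp: z_def)
  have z_in: "x \<in> B b" if "z i = Pt x" for i x using zc[of i] that by auto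
  have bX: "B b \<subseteq> X" using block_sub[OF b(1)] .
  interpret at: attach R X P lt B "{}" True z "\<lambda>_. Ag"
  proof
    show "z i = Infty \<or> (\<exists>x\<in>X - {}. z i = Pt x) \<or> True \<and> z i = Apex" for i using zc[of i] bX by blast
  qed (use Ag in auto)
  have bO: "x \<in> VV" "x \<notin> Ost" "blk x = b" if "x \<in> B b" for x
    using that b not_Ost[OF b(1,2)] blk_eq[OF b(1)] by auto
  have bs: "b \<notin> s" using b(2) s_sub by blast
  have zA: "infinite {i. z i = Apex}"
    by (rule infinite_super[OF _ infinite_fst_index[OF en R_empty]]) (auto simp: z_def)
  have rC: "region Ag s' s' False" by (rule region_open_VV) (use Ag in auto)
  have inAg: "\<exists>y\<in>Ag. blk y = q" if "q \<in> s" for q using T_E[of q Ag] Ag(3) R_sub[OF Ag(1)] that by blast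
  let ?CN = "at.colour (\<lambda>_. {}) (\<lambda>_. s)"
  have eq: "holds (ring_struct bare.fld Infty (\<lambda>p. Pt ` B p)) f = holds (ring_struct at.fld Infty ?CN) f"
    if f: "fvars f = {}" "set_form f \<subseteq> P" for f
  proof -
    \<comment> \<open>\<open>b\<close> is added so that the attaching points in the base, which
      belong to \<open>B b\<close>, are among the fixed points.\<close>
    define F where "F = insert b (set_form f)"
    have F: "finite F" "F \<subseteq> P" unfolding F_def using finite_set_form f b(1) by auto
    let ?U = "off F"
    have UX: "?U \<subseteq> X" using off_VV VV_sub by blast
    then have XU: "X - (X - ?U) = ?U" by blast
    have offp: "p \<notin> F - s" if "x \<in> ?U" "x \<in> B p" "p \<in> P" for x p
      using that self_up[of p] blk_eq[of p x] unfolding off_def by blast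
    obtain xb where xb: "xb \<in> B b" using block_nonempty[OF b(1)] by blast
    obtain Ab where Ab: "Ab \<in> R" "xb \<in> Ab" using R_cover xb bX by blast
    show ?thesis
    proof (rule at.insert_holds[where ?H0.0 = "X - ?U" and s = s' and nd = False and sp = "Some g" and Q = "set_form f"])
      show "region (X - (X - ?U)) s' s' False" unfolding XU by (rule off_region[OF F])
      show "region Ag s' s' False" by (rule rC)
      show "finite s'" using s_finite by (simp add: s'_def)
      show "x \<in> X - ?U" if "z i = Pt x" for i x
        using offp[of x b] z_in[OF that] b(1) bs bX unfolding F_def by blast
      show "z i \<noteq> Infty" for i using zc[of i] by auto
      show "infinite {i. z i = Apex \<and> (\<exists>y\<in>Ag. blk y = q)}" if "q \<in> s'" for q
        using zA inAg[of q] that by (simp add: s'_def)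
      show "infinite {i. z i = Apex \<and> (\<exists>y\<in>Ag. blk y \<notin> s')}"
      proof -
        have "\<exists>y\<in>Ag. blk y \<notin> s'" using Ag(4,5) by (intro bexI[of _ xg]) (auto simp: s'_def)
        then show ?thesis using zA by simp
      qed
      have "infinite {y \<in> Ab \<inter> ?U. kap s' y = None}" using meet_off(2)[OF nc F Ab bO(1,2)[OF xb]] by blast
      then show "infinite {x \<in> X - (X - ?U). blk x \<notin> s'}" unfolding XU
        by (rule infinite_super[rotated]) (auto simp: kap_cases)
      show "\<exists>y\<in>A - (X - ?U). blk y \<notin> s'" if A: "A \<in> R" "z i \<in> Pt ` A" for A i
      proof -
        obtain x where x: "x \<in> A" "x \<in> B b" using A(2) z_in[of i] by auto
        show ?thesis using meet_off(1)[OF nc F A(1) x(1) bO(1,2)[OF x(2)]] by blast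
      qed
      show "p \<in> s" if "p \<in> s'" for p using that by (simp add: s'_def)
      show "B p \<subseteq> X - ?U \<and> (\<forall>i::nat. p \<notin> s \<or> Ag \<inter> B p = {})" if "p \<in> set_form f" "p \<notin> s'" "Some g \<noteq> Some p" for p
      proof -
        have p: "p \<notin> s" "p \<in> P" "p \<in> F" using that f(2) by (auto simp: s'_def F_def)
        then show ?thesis using offp[of _ p] block_sub[OF p(2)] by blast
      qed
      show "A \<inter> B h - (X - ?U) \<noteq> {}" if hA: "Some g = Some h" "A \<in> R" "x \<in> A - (X - ?U)" "blk x \<notin> s'" for h x A
      proof -
        have x: "x \<in> A" "x \<in> ?U" using hA R_sub[OF hA(2)] by auto
        obtain D where D: "D \<in> R" "x \<in> D" "D \<subseteq> A" "D \<subseteq> ?U" using off_nbhd[OF F x(2) hA(2) x(1)] by blast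
        have "infinite (D \<inter> B g)" using g_infinite[OF D(1,2) _ hA(4)] x(2) off_VV by blast
        then have "D \<inter> B g \<noteq> {}" by (metis finite.emptyI)
        then show ?thesis using D(3,4) hA(1) by blast
      qed
      show "A \<inter> B h \<noteq> {}" if "Some g = Some h" "A \<in> R" "A \<subseteq> Ag" "x \<in> A" "blk x \<notin> s'" for h A x
      proof -
        have "infinite (A \<inter> B g)" using g_infinite[OF that(2,4) _ that(5)] that(3,4) Ag(2) by blast
        then show ?thesis using that(1) by (metis finite.emptyI option.inject)
      qed
      show "h \<in> s" if "Some g = Some h" for h using that g(2) by simp
    qed (use f in auto)
  qed
  obtain m where "at.iso_map ?CN m" using at.iso_map_ex[OF oc eq] by blast
  note m = at.iso_mapD[OF this]
  have CNb: "\<exists>x\<in>B b. w = Pt x" if "w \<in> ?CN b" for w using that bs by (auto simp: at.colour_def)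
  have CNK: "Copy i y \<in> ?CN p \<longleftrightarrow> y \<in> Ag \<inter> B p \<and> p \<in> s" for i y p by (auto simp: at.colour_def)
  have "b \<in> at.TN ?CN (m v)" using m(5)[OF v(1)] v(2) b(1) by (simp add: T_def)
  then obtain x where x: "x \<in> B b" "Pt x \<in> m v" using CNb unfolding at.TN_def by blast
  have mv: "m v \<in> at.fld" using m(7)[OF v(1)] by simp
  obtain A where A: "A \<in> R" "x \<in> A" "Pt ` (A - {}) \<subseteq> m v" using at.fld_open[OF mv x(2)] by blast
  \<comment> \<open>Infinitely many copies are attached at the point chosen in \<open>A\<close>,
    which belongs to \<open>m v\<close>. One of them is decided and hence contained in
    \<open>m v\<close>; the element of \<open>R\<close> corresponding to it meets exactly the blocks
    in \<open>s\<close>.\<close>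
  have "infinite {i. fst (en i) = A}" using infinite_fst_index[OF en A(1)] .
  moreover have "finite (at.undecided (m v))" using mv by (simp add: at.fld_def)
  ultimately have "{i. fst (en i) = A} - at.undecided (m v) \<noteq> {}" by (metis Diff_infinite_finite finite.emptyI)
  then obtain i where i: "fst (en i) = A" "i \<notin> at.undecided (m v)" by blast
  have "z i \<in> m v" using zP[of i] A x i(1) by auto
  then have "at.part i (m v) = Ag" using i(2) by (auto simp: at.undecided_def)
  then have W: "Copy i ` Ag \<subseteq> m v" by (auto simp: at.part_def)
  have Wf: "Copy i ` Ag \<in> at.fld" by (rule at.copy_fld[OF Ag(1) order_refl])
  moreover have "Infty \<notin> Copy i ` Ag" by auto
  ultimately obtain a where a: "a \<in> R" "m a = Copy i ` Ag" using m(8) by blast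
  have "at.TN ?CN (Copy i ` Ag) = s"
  proof (rule set_eqI)
    fix p
    have "Copy i ` Ag \<inter> ?CN p \<noteq> {} \<longleftrightarrow> (\<exists>y\<in>Ag. Copy i y \<in> ?CN p)" by blast
    also have "\<dots> \<longleftrightarrow> Ag \<inter> B p \<noteq> {} \<and> p \<in> s" unfolding CNK by blast
    finally show "p \<in> at.TN ?CN (Copy i ` Ag) \<longleftrightarrow> p \<in> s"
      using Ag(3) s_P unfolding at.TN_def T_def by auto
  qed
  then have "T a = s" using m(5)[OF a(1)] a(2) by simp
  moreover have "a \<subseteq> v" using m(6)[OF a(1) v(1)] a(2) W by simp
  ultimately show False using v(3)[OF a(1)] by blast
qed

text \<open>
  The converse situation: the points of \<open>Ost\<close> are removed from \<open>V\<close>, and attached copies make the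
  blocks in \<open>s\<close> other than \<open>g\<close> reappear. Blocks are replaced by their closures, which define the
  same ideals, so that the remaining points of \<open>V\<close> still count as points of \<open>g\<close>.
\<close>

lemma rich_contradiction:
  assumes oc: "omega_categorical P (ring_struct bare.fld Infty (\<lambda>p. Pt ` B p))"
    and nc: no_cover and b: "b \<in> P" "b \<notin> PO" "B b \<subseteq> VV"
    and rich: "\<And>v. v \<in> R \<Longrightarrow> v \<inter> B b \<noteq> {} \<Longrightarrow> \<exists>a\<in>R. a \<subseteq> v \<and> T a = s"
  shows False
proof -
  obtain xb where xb: "xb \<in> B b" using block_nonempty[OF b(1)] by blast
  have bX: "B b \<subseteq> X" using block_sub[OF b(1)] .
  have xbV: "xb \<in> VV" "xb \<notin> Ost" "blk xb = b"
    using xb b not_Ost[OF b(1,2)] blk_eq[OF b(1)] by auto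
  obtain Ab where Ab: "Ab \<in> R" "xb \<in> Ab" using R_cover xb bX by blast
  obtain V where V: "V \<in> R" "xb \<in> V" "V \<subseteq> VV" using VV_open[OF xbV(1) Ab] by blast
  have "\<forall>q\<in>s. \<exists>A. A \<in> R \<and> A \<subseteq> VV \<inter> Ost \<and> T A = up q \<and> (\<exists>x\<in>A. blk x = q)" using tr by blast
  then obtain t where t: "\<And>q. q \<in> s \<Longrightarrow> t q \<in> R \<and> t q \<subseteq> VV \<inter> Ost \<and> T (t q) = up q \<and> (\<exists>x\<in>t q. blk x = q)"
    by metis
  \<comment> \<open>Every pair of an element of \<open>R\<close> and a block of \<open>s\<close> is
    listed infinitely often, so that copies of each \<open>t r\<close> with
    \<open>r \<noteq> g\<close> accumulate at all points of \<open>V\<close> outside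
    \<open>Ost\<close>.\<close>
  define en where "en = from_nat_into ((R \<times> s) \<times> (UNIV :: nat set))"
  have "(R \<times> s) \<times> (UNIV :: nat set) \<noteq> {}" using R_empty g(2) by blast
  then have en: "range en = (R \<times> s) \<times> UNIV" unfolding en_def
    using R_countable s_finite by (intro range_from_nat_into) (auto intro: countable_finite)
  define A where "A i = fst (fst (en i))" for i
  define q where "q i = snd (fst (en i))" for i
  have qs: "q i \<in> s" for i
  proof -
    have "en i \<in> (R \<times> s) \<times> UNIV" using en by blast
    then show ?thesis unfolding q_def by (auto simp: mem_Times_iff)
  qed
  have idx: "infinite {i. A i = D \<and> q i = r}" if "D \<in> R" "r \<in> s" for D r
  proof -
    have "infinite {i. fst (en i) = (D, r)}" using that by (intro infinite_fst_index[OF en]) simp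
    then show ?thesis by (rule infinite_super[rotated]) (auto simp: A_def q_def)
  qed
  \<comment> \<open>Indices failing \<open>c\<close> are used up at the new point, away from
    \<open>V\<close>. The copies of \<open>t g\<close> there supply infinitely many points of every
    type, so that the totals agree.\<close>
  define c where "c i \<longleftrightarrow> A i \<inter> (V - Ost) \<noteq> {} \<and> q i \<noteq> g" for i
  define z where "z i = (if c i then Pt (SOME x. x \<in> A i \<inter> (V - Ost)) else Apex)" for i
  define C where "C i = (if c i then t (q i) else t g)" for i
  define X0 where "X0 = V \<inter> Ost"
  have z1: "\<exists>x\<in>A i \<inter> (V - Ost). z i = Pt x" if "c i" for i
    using that someI_ex[of "\<lambda>x. x \<in> A i \<inter> (V - Ost)"] unfolding z_def c_def by auto
  have z2: "z i = Apex \<and> C i = t g" if "\<not> c i" for i using that by (simp add: z_def C_def)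
  have zPt: "x \<in> A i \<inter> (V - Ost) \<and> c i" if "z i = Pt x" for i x
    using z1[of i] z2[of i] that by (cases "c i") auto
  have zne: "z i \<noteq> Infty" for i using z1[of i] z2[of i] by (cases "c i") auto
  have Ct: "\<exists>r\<in>s. C i = t r" for i using qs[of i] g(2) by (auto simp: C_def)
  have CR: "C i \<in> R" "C i \<subseteq> VV" "C i \<subseteq> Ost" for i
  proof -
    obtain r where r: "r \<in> s" "C i = t r" using Ct[of i] by blast
    show "C i \<in> R" "C i \<subseteq> VV" "C i \<subseteq> Ost" using t[OF r(1)] unfolding r(2) by simp_all
  qed
  have VX: "V \<subseteq> X" using R_sub[OF V(1)] .
  interpret at: attach R X P lt B X0 True z C
  proof
    show "\<exists>A\<in>R. x \<in> A \<and> A \<subseteq> X0" if x: "x \<in> X0" for x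
    proof -
      obtain D where D: "D \<in> R" "x \<in> D" "finite (T D)" using x by (auto simp: X0_def Ost_def)
      have "D \<inter> V \<subseteq> X0" using Ost_sub[OF D(1,3)] by (auto simp: X0_def)
      then show ?thesis using R_Int[OF D(1) V(1)] D(2) x by (intro bexI[of _ "D \<inter> V"]) (auto simp: X0_def)
    qed
    show "z i = Infty \<or> (\<exists>x\<in>X - X0. z i = Pt x) \<or> True \<and> z i = Apex" for i
      using z1[of i] z2[of i] VX by (cases "c i") (auto simp: X0_def)
    show "C i \<in> R" for i by (rule CR)
  qed
  define CM where "CM p = (if p \<in> P then {x \<in> X. p \<in> up (blk x)} else B p)" for p
  define CN where "CN p = Pt ` (CM p - X0) \<union> {Copy i y |i y. y \<in> C i \<and> p \<in> up (blk y)}" for p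
  have upO: "up (blk x) \<subseteq> s" if "x \<in> VV" "x \<in> Ost" for x using VV_O[OF that] s_up by blast
  have struct: "ring_struct bare.fld Infty (\<lambda>p. Pt ` B p) = ring_struct bare.fld Infty (\<lambda>p. Pt ` CM p)"
  proof -
    have k: "W \<inter> Pt ` B p = {} \<longleftrightarrow> W \<inter> Pt ` CM p = {}" if W: "W \<in> bare.fld" for W p
    proof (cases "p \<in> P")
      case True
      have "B p \<subseteq> CM p" using blk_eq[OF True] self_up[OF True] block_sub[OF True] True by (auto simp: CM_def)
      moreover have "W \<inter> Pt ` B p \<noteq> {}" if x: "Pt x \<in> W" "x \<in> CM p" for x
      proof -
        obtain D where D: "D \<in> R" "x \<in> D" "Pt ` (D - {}) \<subseteq> W" using bare.fld_open[OF W x(1)] by blast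
        have "p \<in> T D" using T_up[OF D(1) in_T_blk[OF D(1,2)]] x(2) True by (auto simp: CM_def)
        then show ?thesis using D(3) by (auto simp: T_def)
      qed
      ultimately show ?thesis by blast
    qed (simp add: CM_def)
    have "{W \<in> bare.fld. Infty \<notin> W \<and> W \<inter> Pt ` B p = {}} = {W \<in> bare.fld. Infty \<notin> W \<and> W \<inter> Pt ` CM p = {}}" for p
      using k[of _ p] by (intro Collect_cong conj_cong refl) simp_all
    then show ?thesis unfolding ring_struct_def by simp
  qed
  have rC: "region (C i) s' s' False" for i by (rule region_open_VV) (use CR in auto)
  have zA: "infinite {i. z i = Apex \<and> C i = t g}"
    by (rule infinite_super[OF _ idx[OF R_empty g(2)]]) (auto simp: z_def C_def c_def)
  have gT: "\<exists>y\<in>t g. kap s' y = a" if "a \<in> insert None (Some ` s')" for a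
  proof (cases a)
    case None
    then show ?thesis using t[OF g(2)] by (auto simp: kap_def s'_def)
  next
    case (Some r)
    then have r: "r \<in> s'" using that by auto
    then have "r \<in> T (t g)" using t[OF g(2)] g(1) by (simp add: s'_def)
    then obtain y where "y \<in> t g" "blk y = r" using T_E[of r "t g"] t[OF g(2)] R_sub by blast
    then show ?thesis using r Some by (auto simp: kap_def)
  qed
  have zAa: "infinite {i. z i = Apex \<and> (\<exists>y\<in>C i. kap s' y = a)}" if "a \<in> insert None (Some ` s')" for a
    by (rule infinite_super[OF _ zA]) (use gT[OF that] in auto)
  have Ccop: "kap s' y \<in> Some ` s'" if "c i" "y \<in> C i" for i y
  proof -
    have "q i \<in> s'" using that(1) qs[of i] by (auto simp: c_def s'_def)
    moreover have "blk y \<in> up (q i)" using t[OF qs[of i]] in_T_blk[of "t (q i)" y] that by (auto simp: C_def)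
    ultimately have "blk y \<in> s'" using s'_up by blast
    then show ?thesis by (simp add: kap_def)
  qed
  have dense: "infinite {i. z i \<in> Pt ` (D - X0) \<and> (\<exists>y\<in>C i. kap s' y = Some r)}"
    if D: "D \<in> R" "x \<in> D" "x \<in> V" "x \<notin> Ost" and r: "r \<in> s'" for D x r
  proof (rule infinite_super[OF _ idx[of "D \<inter> V" r]])
    show "D \<inter> V \<in> R" "r \<in> s" using R_Int D V r by (auto simp: s'_def)
    show "{i. A i = D \<inter> V \<and> q i = r} \<subseteq> {i. z i \<in> Pt ` (D - X0) \<and> (\<exists>y\<in>C i. kap s' y = Some r)}"
    proof (intro subsetI CollectI, elim CollectE conjE)
      fix i assume i: "A i = D \<inter> V" "q i = r"
      then have c: "c i" using D r by (auto simp: c_def s'_def)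
      then obtain y where "y \<in> C i" "blk y = r" using t[OF qs[of i]] i(2) by (auto simp: C_def)
      then have "\<exists>y\<in>C i. kap s' y = Some r" using r by (auto simp: kap_def)
      moreover have "z i \<in> Pt ` (D - X0)" using z1[OF c] i(1) by (auto simp: X0_def)
      ultimately show "z i \<in> Pt ` (D - X0) \<and> (\<exists>y\<in>C i. kap s' y = Some r)" by simp
    qed
  qed
  have eq: "holds (ring_struct bare.fld Infty (\<lambda>p. Pt ` B p)) f = holds (ring_struct at.fld Infty CN) f"
    if f: "fvars f = {}" "set_form f \<subseteq> P" for f
  proof -
    define F where "F = set_form f"
    have F: "finite F" "F \<subseteq> P" unfolding F_def using finite_set_form f by auto
    define U where "U = off F"
    define H0 where "H0 = X - U"
    let ?H = "insert Infty (Pt ` H0)"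
    let ?S = "insert None (Some ` s')"
    let ?tM = "bare.ptyp s' (\<lambda>_. s')" and ?tN = "at.ptyp s' (\<lambda>_. s')"
    have UV: "U \<subseteq> VV" and UX: "U \<subseteq> X" using off_VV VV_sub by (auto simp: U_def)
    then have XU: "X - H0 = U" by (auto simp: H0_def)
    have OU: "x \<in> U" if "x \<in> VV" "x \<in> Ost" for x using upO[OF that] that(1) by (auto simp: U_def off_def)
    have X0U: "X0 \<subseteq> U" using OU V(3) by (auto simp: X0_def)
    have H0X: "H0 \<subseteq> X - X0" "H0 \<subseteq> X" using X0U by (auto simp: H0_def)
    have rU: "region U s' s' False" unfolding U_def by (rule off_region[OF F])
    then have rB: "region (X - H0) s' s' False" unfolding XU .
    have s'P: "s' \<subseteq> P" using s_P by (auto simp: s'_def)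
    have off1: "x \<in> U" if "x \<in> X - X0 - H0" for x using that XU by blast
    have TM: "typed_field bare.pts bare.fld ?H ?tM (ple s') (dst False) ?S"
      by (rule bare.typed_region[OF _ H0X(2) rB]) (auto intro!: region_empty s'P s'_up)
    have sO: "x \<in> Ost \<and> x \<notin> V" if "x \<in> U" "x \<notin> X0" "blk x \<in> s'" for x
      using notin[of x] that UV by (auto simp: X0_def)
    \<comment> \<open>Nothing is attached outside \<open>V\<close>, so neighbourhoods there can be
      taken from the original space.\<close>
    have zV: "z i \<notin> Pt ` (D - V - X0)" for i D using zPt[of i] by auto
    have TN: "typed_field at.pts at.fld ?H ?tN (ple s') (dst False) ?S"
    proof (rule at.typed_fieldI)
      show "H0 \<subseteq> X - X0" by (rule H0X)
      show "ple s' a a" for a by (rule ple_refl)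
      fix x assume x: "x \<in> X - X0 - H0"
      have xU: "x \<in> U" using off1[OF x] .
      show "\<exists>A\<in>R. x \<in> A \<and> A \<inter> H0 = {} \<and> (\<forall>y\<in>A - X0. ple s' (?tN (Pt x)) (?tN (Pt y))) \<and>
          (\<forall>i. z i \<in> Pt ` (A - X0) \<longrightarrow> (\<forall>y\<in>C i. ple s' (?tN (Pt x)) (?tN (Copy i y))))"
      proof -
        obtain D where D: "D \<in> R" "x \<in> D" "D \<subseteq> U" "\<forall>y\<in>D. ple s' (kap s' x) (kap s' y)"
          using region_trim[OF rU xU] by blast
        have DH: "D \<inter> H0 = {}" using D(3) by (auto simp: H0_def)
        show ?thesis
        proof (cases "blk x \<in> s'")
          case True
          then have "x \<in> D - V" using sO[OF xU] x D(2) by blast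
          then show ?thesis using D(4) DH zV R_Diff[OF D(1) V(1)]
            by (intro bexI[of _ "D - V"]) auto
        next
          case False
          have "ple s' (kap s' x) (kap s' y)" if zi: "z i \<in> Pt ` (D - X0)" "y \<in> C i" for i y
          proof -
            have "c i" using zi(1) zPt[of i] by auto
            then show ?thesis using Ccop[OF _ zi(2)] False by (auto simp: kap_def)
          qed
          then show ?thesis using D DH by (intro bexI[of _ D]) auto
        qed
      qed
      show "\<exists>A\<in>R. x \<in> A \<and> {y \<in> A - X0 - H0. ?tN (Pt y) = ?tN (Pt x)} = {x} \<and>
          (\<forall>i. z i \<in> Pt ` (A - X0) \<longrightarrow> (\<forall>y\<in>C i. ?tN (Copy i y) \<noteq> ?tN (Pt x)))"
        if d: "?tN (Pt x) \<in> dst False"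
      proof -
        have xs: "blk x \<in> s'" using d by (auto simp: kap_def dst_def split: if_splits)
        obtain D where D: "D \<in> R" "x \<in> D" "D \<subseteq> U" "{y \<in> D. kap s' y = kap s' x} = {x}"
          using region_disc[OF rU xU] d by auto
        have "x \<in> D - V" using sO[OF xU _ xs] x D(2) by blast
        moreover have "{y \<in> D - V - X0 - H0. kap s' y = kap s' x} = {x}"
          using D(4) x calculation by blast
        ultimately show ?thesis using zV R_Diff[OF D(1) V(1)] by (intro bexI[of _ "D - V"]) auto
      qed
    next
      fix D x a assume D: "D \<in> R" "x \<in> D - X0 - H0" and a: "a \<in> ?S" "ple s' (?tN (Pt x)) a"
        "a \<noteq> ?tN (Pt x) \<or> a \<notin> dst False"
      have xU: "x \<in> U" using off1 D R_sub by blast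
      show "infinite {y \<in> D - X0 - H0. ?tN (Pt y) = a} \<or>
          infinite {i. z i \<in> Pt ` (D - X0) \<and> (\<exists>y\<in>C i. ?tN (Copy i y) = a)}"
      proof (cases "x \<in> V")
        case False
        have "infinite {y \<in> (D - V) \<inter> U. kap s' y = a}"
          using region_acc[OF rU R_Diff[OF D(1) V(1)] _ xU, of a] a D(2) False by auto
        moreover have "{y \<in> (D - V) \<inter> U. kap s' y = a} \<subseteq> {y \<in> D - X0 - H0. kap s' y = a}"
          by (auto simp: X0_def H0_def)
        ultimately have "infinite {y \<in> D - X0 - H0. kap s' y = a}" using infinite_super by blast
        then show ?thesis by simp
      next
        case True
        then have xO: "x \<notin> Ost" using D(2) by (auto simp: X0_def)
        show ?thesis
        proof (cases a)
          case (Some r)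
          then have "r \<in> s'" using a(1) by auto
          then show ?thesis using dense[OF D(1) _ True xO] D(2) Some by simp
        next
          case None
          obtain E where E: "E \<in> R" "x \<in> E" "E \<subseteq> D" "E \<subseteq> U"
            using off_nbhd[OF F _ D(1)] xU D(2) unfolding U_def by blast
          have "infinite (E - Ost)" by (rule crowd[OF E(1,2) xO])
          moreover have "E - Ost \<subseteq> {y \<in> D - X0 - H0. kap s' y = None}"
            using E(3,4) notin UV by (auto simp: X0_def H0_def kap_def)
          ultimately have "infinite {y \<in> D - X0 - H0. kap s' y = None}" using infinite_super by blast
          then show ?thesis using None by simp
        qed
      qed
    next
      show "\<exists>A\<in>R. x \<in> A \<and> A \<subseteq> C i \<and> (\<forall>y\<in>A. ple s' (?tN (Copy i x)) (?tN (Copy i y)))" if "x \<in> C i" for i x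
        using region_trim[OF rC that] by simp
      show "infinite {y \<in> A. ?tN (Copy i y) = a}" if "A \<in> R" "A \<subseteq> C i" "x \<in> A" "a \<in> ?S"
        "ple s' (?tN (Copy i x)) a" "a \<noteq> ?tN (Copy i x) \<or> a \<notin> dst False" for i x A a
      proof -
        have "infinite {y \<in> A \<inter> C i. kap s' y = a}" using region_acc[OF rC that(1,3), of i a] that by auto
        moreover have "A \<inter> C i = A" using that(2) by blast
        ultimately show ?thesis by simp
      qed
      have "ple s' None (kap s' y)" for y by (simp add: kap_def)
      then show "finite {i. z i = Apex \<and> \<not> (\<forall>y\<in>C i. ple s' (?tN Apex) (?tN (Copy i y)))}" by simp
      show "infinite {i. z i = Apex \<and> (\<exists>y\<in>C i. ?tN (Copy i y) = a)}" if "a \<in> ?S" for a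
        using zAa[OF that] by simp
      show "\<exists>A\<in>R. x \<in> A \<and> A \<subseteq> C i \<and> {y \<in> A. ?tN (Copy i y) = ?tN (Copy i x)} = {x}"
        if "x \<in> C i" "?tN (Copy i x) \<in> dst False" for i x
        using region_disc[OF rC that(1)] that(2) by simp
    qed
    have meetU: "\<exists>y\<in>D. y \<in> U \<and> kap s' y = a" if "D \<in> R" "x \<in> D" "x \<in> V" "x \<notin> Ost" "a \<in> ?S" for D x a
    proof -
      have "infinite {y \<in> D \<inter> off F. kap s' y = a}" using meet_off(2)[OF nc F that(1,2) _ that(4,5)] that(3) V(3) by blast
      then have "{y \<in> D \<inter> off F. kap s' y = a} \<noteq> {}" by (metis finite.emptyI)
      then show ?thesis unfolding U_def by blast
    qed
    have meetN: "\<exists>y\<in>D - X0 - H0. kap s' y = None" if x: "D \<in> R" "x \<in> D" "x \<in> V" "x \<notin> Ost" for D x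
    proof -
      obtain y where "y \<in> D - Ost" "y \<in> off F" "blk y \<notin> s'" using meet_off(1)[OF nc F x(1,2) _ x(4)] x(3) V(3) by blast
      then show ?thesis by (intro bexI[of _ y]) (auto simp: kap_def X0_def H0_def U_def)
    qed
    have near: "bare.near_cond H0 ?tM a h \<longleftrightarrow> at.near_cond H0 ?tN a h" if h: "h \<in> H0" and a: "a \<in> ?S" for h a
    proof
      assume *: "at.near_cond H0 ?tN a h"
      show "bare.near_cond H0 ?tM a h" unfolding bare.near_cond_def
      proof (intro ballI impI disjI1)
        fix D assume D: "D \<in> R" "h \<in> D"
        have "(\<exists>y\<in>D - X0 - H0. ?tN (Pt y) = a) \<or> infinite {i. z i \<in> Pt ` (D - X0) \<and> (\<exists>y\<in>C i. ?tN (Copy i y) = a)}"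
          using *[unfolded at.near_cond_def, rule_format, OF D] .
        then show "\<exists>y\<in>D - {} - H0. ?tM (Pt y) = a"
        proof
          assume "\<exists>y\<in>D - X0 - H0. ?tN (Pt y) = a"
          then show ?thesis by auto
        next
          assume "infinite {i. z i \<in> Pt ` (D - X0) \<and> (\<exists>y\<in>C i. ?tN (Copy i y) = a)}"
          then have "{i. z i \<in> Pt ` (D - X0) \<and> (\<exists>y\<in>C i. ?tN (Copy i y) = a)} \<noteq> {}" by (metis finite.emptyI)
          then obtain i where "z i \<in> Pt ` (D - X0)" by blast
          then obtain x where "z i = Pt x" "x \<in> D" by blast
          then have "x \<in> D" "x \<in> V" "x \<notin> Ost" using zPt[of i x] by auto
          then obtain y where "y \<in> D" "y \<in> U" "kap s' y = a" using meetU[OF D(1) _ _ _ a] by blast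
          then show ?thesis by (auto simp: H0_def)
        qed
      qed
    next
      assume *: "bare.near_cond H0 ?tM a h"
      show "at.near_cond H0 ?tN a h" unfolding at.near_cond_def
      proof (intro ballI impI)
        fix D assume D: "D \<in> R" "h \<in> D"
        show "(\<exists>y\<in>D - X0 - H0. ?tN (Pt y) = a) \<or> infinite {i. z i \<in> Pt ` (D - X0) \<and> (\<exists>y\<in>C i. ?tN (Copy i y) = a)}"
        proof (cases "h \<in> V")
          case True
          have hO: "h \<notin> Ost" using h True H0X by (auto simp: X0_def)
          show ?thesis
          proof (cases a)
            case None
            then show ?thesis using meetN[OF D True hO] by simp
          next
            case (Some r)
            then have "r \<in> s'" using a by auto
            then show ?thesis using dense[OF D True hO] Some by simp
          qed
        next
          case False
          have D': "D - V \<in> R" "h \<in> D - V" using R_Diff[OF D(1) V(1)] D(2) False by auto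
          have "\<exists>y\<in>D - V - {} - H0. ?tM (Pt y) = a"
            using *[unfolded bare.near_cond_def, rule_format, OF D'] by simp
          then show ?thesis by (auto simp: X0_def)
        qed
      qed
    qed
    have near_inf: "bare.near_cond_inf H0 ?tM a \<longleftrightarrow> at.near_cond_inf H0 ?tN a" if a: "a \<in> ?S" for a
    proof
      assume *: "at.near_cond_inf H0 ?tN a"
      show "bare.near_cond_inf H0 ?tM a" unfolding bare.near_cond_inf_def
      proof (intro ballI disjI1)
        fix D assume D: "D \<in> R"
        have "(\<exists>y\<in>X - X0 - D - H0. ?tN (Pt y) = a) \<or>
            infinite {i. (z i = Infty \<or> z i \<in> Pt ` (X - X0 - D)) \<and> (\<exists>y\<in>C i. ?tN (Copy i y) = a)}"
          using *[unfolded at.near_cond_inf_def, rule_format, OF D] .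
        then show "\<exists>y\<in>X - {} - D - H0. ?tM (Pt y) = a"
        proof
          assume "\<exists>y\<in>X - X0 - D - H0. ?tN (Pt y) = a"
          then show ?thesis by auto
        next
          assume "infinite {i. (z i = Infty \<or> z i \<in> Pt ` (X - X0 - D)) \<and> (\<exists>y\<in>C i. ?tN (Copy i y) = a)}"
          then have "{i. (z i = Infty \<or> z i \<in> Pt ` (X - X0 - D)) \<and> (\<exists>y\<in>C i. ?tN (Copy i y) = a)} \<noteq> {}"
            by (metis finite.emptyI)
          then obtain i where "z i \<in> Pt ` (X - X0 - D)" using zne by blast
          then obtain x where "z i = Pt x" "x \<notin> D" by blast
          then have "x \<in> V - D" "x \<in> V" "x \<notin> Ost" using zPt[of i x] by auto
          then obtain y where "y \<in> V - D" "y \<in> U" "kap s' y = a" using meetU[OF R_Diff[OF V(1) D] _ _ _ a] by blast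
          then show ?thesis using UX by (auto simp: H0_def)
        qed
      qed
    next
      assume *: "bare.near_cond_inf H0 ?tM a"
      show "at.near_cond_inf H0 ?tN a" unfolding at.near_cond_inf_def
      proof (intro ballI disjI1)
        fix D assume D: "D \<in> R"
        have "\<exists>y\<in>X - {} - (D \<union> V) - H0. ?tM (Pt y) = a"
          using *[unfolded bare.near_cond_inf_def, rule_format, OF R_Un[OF D V(1)]] by simp
        then show "\<exists>y\<in>X - X0 - D - H0. ?tN (Pt y) = a" by (auto simp: X0_def)
      qed
    qed
    \<comment> \<open>The types whose points lie in the closure of \<open>p\<close>. Points of type
      \<open>None\<close> are in the closure of every block in \<open>s\<close>.\<close>
    define col where "col p = (if p \<in> s then insert None {Some r |r. r \<in> s' \<and> p \<in> up r} else {})" for p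
    have colpt: "p \<in> up (blk x) \<longleftrightarrow> kap s' x \<in> col p" if "x \<in> U" "p \<in> F" for x p
    proof (cases "p \<in> s")
      case True
      then show ?thesis using above[of x] that(1) UV by (auto simp: col_def kap_def)
    next
      case False
      then show ?thesis using that by (auto simp: col_def U_def off_def)
    qed
    have CU: "C i \<subseteq> U" for i using CR[of i] OU by blast
    have CMp: "CM p = {x \<in> X. p \<in> up (blk x)}" if "p \<in> F" for p using that F by (auto simp: CM_def)
    have Q: "set_form f = F" by (simp add: F_def)
    show ?thesis unfolding struct
    proof (rule at.transfer_const[OF TM TN H0X(1) _ _ _ near near_inf])
      show "finite ?S" using s_finite by (simp add: s'_def)
      show "?tM (Pt x) \<in> ?S" for x by (simp add: kap_def)
      show "?tN w \<in> ?S" for w by (cases w) (auto simp: kap_def)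
      show "same_count k {x \<in> X - H0. ?tM (Pt x) = a} {w \<in> at.pts - ?H. ?tN w = a}" if a: "a \<in> ?S" for a k
      proof (rule same_count_infinite)
        have "infinite {y \<in> V \<inter> off F. kap s' y = a}" using meet_off(2)[OF nc F V(1,2) xbV(1,2) a] .
        then show "infinite {x \<in> X - H0. ?tM (Pt x) = a}" unfolding XU
          by (rule infinite_super[rotated]) (auto simp: U_def)
        have "infinite {i. z i \<in> at.pts \<and> (\<exists>y\<in>C i. kap s' y = a)}"
          using zAa[OF a] by (rule infinite_super[rotated]) (use at.z_pts in blast)
        from at.decided_infinite[OF at.top this]
        show "infinite {w \<in> at.pts - ?H. ?tN w = a}" by (rule infinite_super[rotated]) auto
      qed
      show "CN p \<inter> ?H = Pt ` (CM p \<inter> H0)" for p using H0X(1) by (auto simp: CN_def)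
      show "col p \<subseteq> ?S" for p by (auto simp: col_def)
      show "(\<exists>x\<in>CM p - H0. Pt x \<in> W) \<longleftrightarrow> (\<exists>x\<in>X - H0. Pt x \<in> W \<and> ?tM (Pt x) \<in> col p)"
        if p: "p \<in> F" for p W
      proof -
        have "x \<in> CM p - H0 \<longleftrightarrow> x \<in> X - H0 \<and> kap s' x \<in> col p" for x
          using colpt[OF _ p, of x] unfolding CMp[OF p] XU[symmetric] by blast
        then show ?thesis by auto
      qed
      show "(\<exists>w\<in>CN p - ?H. w \<in> W) \<longleftrightarrow> (\<exists>w\<in>at.pts - ?H. w \<in> W \<and> ?tN w \<in> col p)"
        (is "?L \<longleftrightarrow> ?R") if p: "p \<in> F" and W: "W \<in> at.fld" for p W
      proof
        assume ?L
        then obtain w where w: "w \<in> CN p" "w \<notin> ?H" "w \<in> W" by blast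
        have "w \<in> at.pts" using w(3) at.sets_into_space[OF W] by blast
        moreover have "?tN w \<in> col p" using w(1) unfolding CN_def
        proof (elim UnE)
          assume "w \<in> Pt ` (CM p - X0)"
          then obtain x where x: "w = Pt x" "x \<in> CM p" by blast
          then have "x \<in> U" "p \<in> up (blk x)" using w(2) CMp[OF p] XU by auto
          then show ?thesis using colpt[OF _ p] x by simp
        next
          assume "w \<in> {Copy i y |i y. y \<in> C i \<and> p \<in> up (blk y)}"
          then obtain i y where x: "w = Copy i y" "y \<in> C i" "p \<in> up (blk y)" by blast
          then show ?thesis using colpt[OF _ p, of y] CU[of i] by auto
        qed
        ultimately show ?R using w by blast
      next
        assume ?R
        then obtain w where w: "w \<in> at.pts" "w \<notin> ?H" "w \<in> W" and tw: "?tN w \<in> col p" by blast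
        show ?L
        proof (cases w)
          case (Pt x)
          then have "x \<in> U" "x \<notin> X0" using w XU by auto
          then have "Pt x \<in> CN p" using colpt[OF _ p, of x] tw Pt UX by (auto simp: CN_def CMp[OF p])
          then show ?thesis using w Pt by blast
        next
          case (Copy i y)
          then have "Copy i y \<in> CN p" using w(1) tw colpt[OF _ p, of y] CU[of i] by (auto simp: CN_def)
          then show ?thesis using w Copy by blast
        next
          case Apex
          have "infinite {i. z i \<in> W \<and> (\<exists>y\<in>C i. ?tN (Copy i y) = None)}"
            by (rule infinite_super[OF _ zAa[of None]]) (use w(3) Apex in auto)
          from at.meets_class_infinite[OF W this] obtain i y where
            y: "Copy i y \<in> W" "y \<in> C i" "?tN (Copy i y) = None" by blast
          have "kap s' y \<in> col p" using tw y(3) Apex by simp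
          then have "Copy i y \<in> CN p" using colpt[OF _ p, of y] CU[of i] y(2) by (auto simp: CN_def)
          then show ?thesis using y(1) by blast
        qed (use w in auto)
      qed
      show "fvars f = {}" "set_form f \<subseteq> F" using f by (auto simp: F_def)
    qed
  qed
  obtain m where "at.iso_map CN m" using at.iso_map_ex[OF oc eq] by blast
  note m = at.iso_mapD[OF this]
  have "at.lift V \<in> at.fld" "Infty \<notin> at.lift V" using at.lift_fld[OF V(1)] by (auto simp: at.lift_def)
  then obtain v where v: "v \<in> R" "m v = at.lift V" using m(8) by blast
  have "xb \<in> V - X0" using V(2) xbV(2) by (simp add: X0_def)
  then have "Pt xb \<in> at.lift V" unfolding at.lift_def by blast
  moreover have "Pt xb \<in> CN b" using xbV self_up[OF b(1)] b(1) xb bX by (auto simp: CN_def CM_def X0_def)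
  ultimately have "b \<in> at.TN CN (m v)" unfolding at.TN_def v(2) using b(1) by blast
  then have "v \<inter> B b \<noteq> {}" using m(5)[OF v(1)] by (simp add: T_def)
  \<comment> \<open>\<open>m a\<close> lies in \<open>lift V\<close> and meets the colour of
    \<open>g\<close>. It cannot do so in a base point, which is outside \<open>Ost\<close> and would
    bring along blocks outside \<open>PO\<close>, hence outside \<open>s\<close>; and the copies
    attached inside \<open>V\<close> avoid the closure of \<open>g\<close>.\<close>
  then obtain a where a: "a \<in> R" "a \<subseteq> v" "T a = s" using rich[OF v(1)] by blast
  have "m (a \<inter> v) = m a \<inter> m v" by (rule m(3)[OF a(1) v(1)])
  moreover have "a \<inter> v = a" using a(2) by blast
  ultimately have sub: "m a \<subseteq> at.lift V" using v(2) by auto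
  have Ta: "at.TN CN (m a) = s" using m(5)[OF a(1)] a(3) by simp
  have ma: "m a \<in> at.fld" using m(7)[OF a(1)] by simp
  obtain w where w: "w \<in> m a" "w \<in> CN g" using Ta g(2) unfolding at.TN_def by blast
  then have "w \<in> at.lift V" using sub by blast
  then consider x where "w = Pt x" "x \<in> V - X0" | i y where "w = Copy i y" "y \<in> C i" "z i \<in> Pt ` (V - X0)"
    unfolding at.lift_def by blast
  then show False
  proof cases
    case 1
    then have xO: "x \<notin> Ost" by (auto simp: X0_def)
    obtain D where D: "D \<in> R" "x \<in> D" "Pt ` (D - X0) \<subseteq> m a" using at.fld_open[OF ma] w(1) 1 by blast
    have "infinite (blk ` (D - Ost) - PO)" by (rule off_Ost_infinite[OF PO_finite D(1,2) xO])
    then have "blk ` (D - Ost) - PO \<noteq> {}" by (metis finite.emptyI)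
    then obtain y where y: "y \<in> D" "y \<notin> Ost" "blk y \<notin> PO" by blast
    then have yX: "y \<in> X" using R_sub[OF D(1)] by blast
    have "Pt y \<in> m a" using D(3) y by (auto simp: X0_def)
    moreover have "Pt y \<in> CN (blk y)" using yX y(2) blk(1)[OF yX] self_up[OF blk(1)[OF yX]]
      by (auto simp: CN_def CM_def X0_def)
    ultimately have "blk y \<in> at.TN CN (m a)" using blk(1)[OF yX] unfolding at.TN_def by blast
    then show False using Ta y(3) s_sub by blast
  next
    case (2 i y)
    then have "c i" using zPt[of i] by auto
    then have "kap s' y \<in> Some ` s'" using Ccop 2(2) by blast
    then have "blk y \<in> s'" by (auto simp: kap_def split: if_splits)
    then have "g \<notin> up (blk y)" using s'_up[of "blk y"] by (auto simp: s'_def)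
    then show False using w(2) 2(1) by (auto simp: CN_def)
  qed
qed

end

section \<open>The case that infinitely many blocks meet \<open>Ost\<close>\<close>

lemma same_count_image: "inj_on c S \<Longrightarrow> same_count k S (c ` S)"
  by (simp add: same_count_def at_least_def finite_image_iff card_image)

lemma infinite_diff_nonempty: "infinite S \<Longrightarrow> finite K \<Longrightarrow> S - K \<noteq> {}"
  by (rule infinite_imp_nonempty) simp

context cpart begin

text \<open>
  Neighbourhoods of points from infinitely many blocks in \<open>S\<close> are made to converge to a new point.
  Its neighbourhood meets exactly the blocks in \<open>S\<close>, and by compactness no element of \<open>R\<close> does.
  In the proof, \<open>K (Suc k)\<close> adds to \<open>K k\<close> a block of \<open>S\<close> below all of \<open>K k\<close> and the finitely
  many blocks of \<open>S\<close> that are not below it, so types outside \<open>K (Suc k)\<close> need not be told apart.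
\<close>

lemma narrow_contradiction:
  assumes oc: "omega_categorical P (ring_struct bare.fld Infty (\<lambda>p. Pt ` B p))"
    and S: "S \<subseteq> PO" "infinite S" "\<And>p. p \<in> S \<Longrightarrow> up p \<subseteq> S"
    and cof: "\<And>q. q \<in> S \<Longrightarrow> finite {u \<in> S. q \<notin> up u}"
  shows False
proof -
  have SP: "S \<subseteq> P" using S(1) PO_sub by blast
  obtain p :: "nat \<Rightarrow> 'p" where p: "inj p" "range p \<subseteq> S" using infinite_countable_subset[OF S(2)] by blast
  have pS: "p i \<in> S" for i using p(2) by blast
  have "\<forall>i. \<exists>A. A \<in> R \<and> (\<exists>x\<in>A. blk x = p i) \<and> T A = up (p i)" using PO_trim pS S(1) by blast
  then obtain A where A: "\<And>i. A i \<in> R \<and> (\<exists>x\<in>A i. blk x = p i) \<and> T (A i) = up (p i)" by metis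
  have AR: "A i \<in> R" for i using A by blast
  have finT: "finite (T (A i))" for i using A[of i] PO_up_finite[of "p i"] pS S(1) by auto
  define U where "U = (\<Union>i. A i)"
  define H0 where "H0 = X - U"
  have UX: "U \<subseteq> X" using R_sub[OF AR] by (auto simp: U_def)
  then have XU: "X - H0 = U" by (auto simp: H0_def)
  have H0X: "H0 \<subseteq> X" by (auto simp: H0_def)
  have blkA: "blk x \<in> S" if "x \<in> A i" for x i
    using in_T_blk[OF AR that] A[of i] S(3)[OF pS[of i]] by auto
  then have blkU: "blk x \<in> S" if "x \<in> U" for x using that by (auto simp: U_def)
  have many: "infinite {i. q \<in> up (p i)}" if q: "q \<in> S" for q
  proof -
    have "finite (p -` {u \<in> S. q \<notin> up u})" using cof[OF q] p(1) by (intro finite_vimageI)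
    then have "finite {i. q \<notin> up (p i)}" using pS by (simp add: vimage_def)
    moreover have "{i. q \<in> up (p i)} = UNIV - {i. q \<notin> up (p i)}" by auto
    ultimately show ?thesis using infinite_UNIV_nat by simp
  qed
  have manyA: "infinite {i. \<exists>y\<in>A i. blk y = q}" if q: "q \<in> S" for q
  proof (rule infinite_super[OF _ many[OF q]])
    show "{i. q \<in> up (p i)} \<subseteq> {i. \<exists>y\<in>A i. blk y = q}"
      using A T_E[OF _ R_sub[OF AR]] by auto
  qed
  have rU: "region U S S True" unfolding region_def
  proof (intro conjI ballI impI)
    show "U \<subseteq> X" "S \<subseteq> P" "S \<subseteq> S" using UX SP by auto
    show "up p \<subseteq> S" if "p \<in> S" for p using S(3) that .
    fix x assume x: "x \<in> U"
    then obtain i where i: "x \<in> A i" by (auto simp: U_def)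
    then show "\<exists>A\<in>R. x \<in> A \<and> A \<subseteq> U" using AR by (auto simp: U_def)
    obtain D where "D \<in> R" "x \<in> D" "D \<subseteq> A i" "T D = up (blk x)" by (rule trim_exists[OF AR i finT])
    then show "\<exists>A\<in>R. x \<in> A \<and> T A \<subseteq> up (blk x)" by blast
  qed (simp_all add: blkU)
  have rB: "region (X - H0) S S True" unfolding XU by (rule rU)
  have rC: "region (A i) S S True" for i using AR by (intro region_sub[OF rU]) (auto simp: U_def)
  interpret at: attach R X P lt B "{}" True "\<lambda>_. Apex" A by unfold_locales (use AR in auto)
  define CN where "CN r = Pt ` B r \<union> {Copy i y |i y. y \<in> A i \<inter> B r}" for r
  have dom: "\<exists>v\<in>S - K. K \<subseteq> up v" if K: "finite K" "K \<subseteq> S" for K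
  proof -
    have "finite (K \<union> (\<Union>q\<in>K. {u \<in> S. q \<notin> up u}))" using K cof by blast
    then have "S - (K \<union> (\<Union>q\<in>K. {u \<in> S. q \<notin> up u})) \<noteq> {}" using infinite_diff_nonempty[OF S(2)] by blast
    then show ?thesis by blast
  qed
  define v where "v K = (SOME v. v \<in> S - K \<and> K \<subseteq> up v)" for K
  have v: "v K \<in> S - K \<and> K \<subseteq> up (v K)" if "finite K" "K \<subseteq> S" for K
    unfolding v_def by (rule someI_ex) (use dom[OF that] in blast)
  define step where "step K = K \<union> insert (v K) {u \<in> S. v K \<notin> up u}" for K
  obtain q0 where q0: "q0 \<in> S" using S(2) by (metis all_not_in_conv finite.emptyI)
  let ?tM = "bare.ptyp S (\<lambda>_. S)" and ?tN = "at.ptyp S (\<lambda>_. S)"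
  let ?H = "insert Infty (Pt ` H0)"
  have TM: "typed_field bare.pts bare.fld ?H ?tM (ple S) (dst True) (Some ` S)"
    by (rule bare.typed_region[OF _ H0X rB]) (auto intro!: region_empty SP S(3))
  have TN: "typed_field at.pts at.fld ?H ?tN (ple S) (dst True) (Some ` S)"
    by (rule at.typed_region[OF refl H0X rB rC]) (use manyA in auto)
  have eq: "holds (ring_struct bare.fld Infty (\<lambda>p. Pt ` B p)) f = holds (ring_struct at.fld Infty CN) f"
    if f: "fvars f = {}" "set_form f \<subseteq> P" for f
  proof -
    define K0 where "K0 = (set_form f \<inter> S) \<union> insert q0 {u \<in> S. q0 \<notin> up u}"
    define K where "K k = (step ^^ k) K0" for k
    have K: "finite (K k) \<and> K k \<subseteq> S" for k
    proof (induction k)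
      case 0
      then show ?case using finite_set_form[of f] cof[OF q0] q0 by (auto simp: K_def K0_def)
    next
      case (Suc k)
      then have "v (K k) \<in> S" using v by blast
      then show ?case using Suc cof[of "v (K k)"] by (auto simp: K_def step_def)
    qed
    have vK: "v (K k) \<in> S" "v (K k) \<notin> K k" "K k \<subseteq> up (v (K k))" for k using v[of "K k"] K[of k] by auto
    have Ksuc: "K k \<subseteq> K (Suc k)" "v (K k) \<in> K (Suc k)" "{u \<in> S. v (K k) \<notin> up u} \<subseteq> K (Suc k)" for k
      by (auto simp: K_def step_def)
    have K00: "set_form f \<inter> S \<subseteq> K 0" "q0 \<in> K 0" "{u \<in> S. q0 \<notin> up u} \<subseteq> K 0" by (auto simp: K_def K0_def)
    \<comment> \<open>A type outside \<open>K (Suc k)\<close> is \<open>None\<close> or a block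
      below \<open>v (K k)\<close>, because the blocks of \<open>S\<close> not below
      \<open>v (K k)\<close> belong to \<open>K (Suc k)\<close>. So \<open>v (K k)\<close> occurs in
      the set; being below all of \<open>K k\<close>, it can stand in for the type at level
      \<open>k\<close>.\<close>
    have fallback: "\<exists>y\<in>W - ?H. t y = Some (v (K k))"
      if tf: "typed_field Y Fl ?H t (ple S) (dst True) (Some ` S)" and W: "W \<in> Fl" "w \<in> W - ?H"
        and tw: "t w = None \<or> t w \<in> Some ` S" "t w \<notin> Some ` K (Suc k)"
      for Y Fl and t :: "'x pt \<Rightarrow> 'p option" and W w k
    proof -
      interpret tf: typed_field Y Fl ?H t "ple S" "dst True" "Some ` S" by (rule tf)
      have "ple S (t w) (Some (v (K k)))"
      proof (cases "t w")
        case None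
        then show ?thesis using vK(1) by simp
      next
        case (Some u)
        then have "u \<in> S" "u \<notin> K (Suc k)" using tw by auto
        then show ?thesis using Some Ksuc(3)[of k] by auto
      qed
      moreover have "Some (v (K k)) \<noteq> t w" using tw(2) Ksuc(2)[of k] by force
      ultimately have "infinite {y \<in> W - ?H. t y = Some (v (K k))}"
        using tf.accumulate[OF W(1), of w "Some (v (K k))"] W(2) vK(1)[of k] by blast
      then have "{y \<in> W - ?H. t y = Some (v (K k))} \<noteq> {}" by (metis finite.emptyI)
      then show ?thesis by blast
    qed
    have out: "\<exists>y\<in>A' - ?H. t' y \<notin> Some ` K k \<and> (\<forall>a\<in>Some ` K k. ple S (t w) a \<longrightarrow> ple S (t' y) a)"
      if tf: "typed_field Y Fl ?H t (ple S) (dst True) (Some ` S)" and W: "W \<in> Fl" "w \<in> W - ?H"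
        and tw: "t w = None \<or> t w \<in> Some ` S" "t w \<notin> Some ` K k"
        and same: "\<And>a. a \<in> Some ` K (Suc k) \<Longrightarrow> (\<exists>y\<in>W - ?H. t y = a) \<Longrightarrow> (\<exists>y\<in>A' - ?H. t' y = a)"
      for Y Fl and t t' :: "'x pt \<Rightarrow> 'p option" and W A' w k
    proof (cases "t w \<in> Some ` K (Suc k)")
      case True
      then obtain y where "y \<in> A' - ?H" "t' y = t w" using same W(2) by blast
      then show ?thesis using tw(2) by (intro bexI[of _ y]) auto
    next
      case False
      obtain y where y: "y \<in> A' - ?H" "t' y = Some (v (K k))"
        using same[OF _ fallback[OF tf W tw(1) False]] Ksuc(2)[of k] by blast
      have "\<forall>a\<in>Some ` K k. ple S (Some (v (K k))) a" using vK(3)[of k] by auto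
      then show ?thesis using y vK(2)[of k] by (intro bexI[of _ y]) auto
    qed
    have tyM: "?tM w = None \<or> ?tM w \<in> Some ` S" for w by (cases w) (auto simp: kap_def)
    have tyN: "?tN w = None \<or> ?tN w \<in> Some ` S" for w by (cases w) (auto simp: kap_def)
    show ?thesis
    proof (rule at.transfer[where G = "\<lambda>k. Some ` K k" and CM = B and col = "\<lambda>p. if p \<in> S then {Some p} else {}", OF TM TN])
      show "H0 \<subseteq> X - {}" using H0X by simp
      show "finite (Some ` K k)" "Some ` K k \<subseteq> Some ` S" "Some ` K k \<subseteq> Some ` K (Suc k)" for k
        using K[of k] Ksuc(1)[of k] by auto
      have cov: "\<exists>a\<in>Some ` K 0. ple S (kap S x) a" if "blk x \<in> S" for x
      proof (cases "q0 \<in> up (blk x)")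
        case True
        then have "ple S (kap S x) (Some q0)" using that by (simp add: kap_def)
        then show ?thesis using K00(2) by blast
      next
        case False
        then have "blk x \<in> K 0" using K00(3) that by blast
        moreover have "ple S (kap S x) (Some (blk x))" using that by (simp add: kap_def)
        ultimately show ?thesis by blast
      qed
      then show "\<exists>a\<in>Some ` K 0. ple S (?tM (Pt x)) a" if "x \<in> X - H0" for x
        using blkU that unfolding XU by simp
      show "\<exists>a\<in>Some ` K 0. ple S (?tN w) a" if w: "w \<in> at.pts" "w \<notin> ?H" for w
      proof (cases w)
        case (Pt x)
        then have "blk x \<in> S" using blkU w XU by auto
        then show ?thesis using cov Pt by simp
      next
        case (Copy i x)
        then have "blk x \<in> S" using blkA w by auto
        then show ?thesis using cov Copy by simp
      next
        case Apex
        have "ple S None (Some q0)" using q0 by simp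
        then show ?thesis using K00(2) Apex by (intro bexI[of _ "Some q0"]) auto
      qed (use w in auto)
      show "\<exists>y\<in>A' - ?H. ?tM y \<notin> Some ` K k \<and> (\<forall>a\<in>Some ` K k. ple S (?tN w) a \<longrightarrow> ple S (?tM y) a)"
        if "A' \<in> bare.fld" "W \<in> at.fld"
          "\<And>a. a \<in> Some ` K (Suc k) \<Longrightarrow> (\<exists>y\<in>A' - ?H. ?tM y = a) \<longleftrightarrow> (\<exists>y\<in>W - ?H. ?tN y = a)"
          "w \<in> W - ?H" "?tN w \<notin> Some ` K k" for A' W k w
        using out[OF TN that(2,4) tyN that(5)] that(3) by blast
      show "\<exists>y\<in>W - ?H. ?tN y \<notin> Some ` K k \<and> (\<forall>a\<in>Some ` K k. ple S (?tM w) a \<longrightarrow> ple S (?tN y) a)"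
        if "A' \<in> bare.fld" "W \<in> at.fld"
          "\<And>a. a \<in> Some ` K (Suc k) \<Longrightarrow> (\<exists>y\<in>A' - ?H. ?tM y = a) \<longleftrightarrow> (\<exists>y\<in>W - ?H. ?tN y = a)"
          "w \<in> A' - ?H" "?tM w \<notin> Some ` K k" for A' W k w
        using out[OF TM that(1,4) tyM that(5)] that(3) by blast
      show "bare.near_cond H0 ?tM a h \<longleftrightarrow> at.near_cond H0 ?tN a h" for a h
        by (simp add: bare.near_cond_def at.near_cond_def image_iff)
      show "bare.near_cond_inf H0 ?tM a \<longleftrightarrow> at.near_cond_inf H0 ?tN a" for a
        by (simp add: bare.near_cond_inf_def at.near_cond_inf_def image_iff)
      show "same_count k {x \<in> X - H0. ?tM (Pt x) = a} {w \<in> at.pts - ?H. ?tN w = a}" if a: "a \<in> Some ` K k" for a k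
      proof (rule same_count_infinite)
        obtain q where q: "a = Some q" "q \<in> S" using a K[of k] by blast
        have "infinite ({i. q \<in> up (p i)} - p -` {q})" using many[OF q(2)] finite_vimageI[OF _ p(1), of "{q}"] by simp
        then have "{i. q \<in> up (p i)} - p -` {q} \<noteq> {}" by (metis finite.emptyI)
        then obtain i where i: "q \<in> up (p i)" "p i \<noteq> q" by auto
        obtain x where x: "x \<in> A i" "blk x = p i" using A by blast
        have "infinite (A i \<inter> B q)" using limit_infinite[OF AR x(1), of q] i x(2) by (auto simp: up_def)
        moreover have "A i \<inter> B q \<subseteq> {x \<in> U. kap S x = a}"
          using blk_eq[of q] q SP by (auto simp: U_def kap_def)
        ultimately have inf: "infinite {x \<in> U. kap S x = a}" using infinite_super by blast
        then show "infinite {x \<in> X - H0. ?tM (Pt x) = a}" unfolding XU by simp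
        have "infinite (Pt ` {x \<in> U. kap S x = a})" using inf by (simp add: finite_image_iff inj_on_def)
        then show "infinite {w \<in> at.pts - ?H. ?tN w = a}"
          by (rule infinite_super[rotated]) (use XU UX in auto)
      qed
      show "CN r \<inter> ?H = Pt ` (B r \<inter> H0)" for r by (auto simp: CN_def)
      have Bb: "x \<in> B r \<longleftrightarrow> x \<in> X \<and> blk x = r" if "r \<in> set_form f" for r x
        using that f(2) blk_eq[of r x] blk(2)[of x] block_sub[of r] by blast
      show "(if r \<in> S then {Some r} else {}) \<subseteq> Some ` K 0" if "r \<in> set_form f" for r using K00(1) that by auto
      show "(\<exists>x\<in>B r - H0. Pt x \<in> W) \<longleftrightarrow>
          (\<exists>x\<in>X - H0. Pt x \<in> W \<and> ?tM (Pt x) \<in> (if r \<in> S then {Some r} else {}))" if r: "r \<in> set_form f" for r W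
      proof -
        have "x \<in> B r - H0 \<longleftrightarrow> x \<in> X - H0 \<and> ?tM (Pt x) \<in> (if r \<in> S then {Some r} else {})" for x
          using Bb[OF r, of x] blkU[of x] unfolding XU[symmetric] by (auto simp: kap_def)
        then show ?thesis by blast
      qed
      show "(\<exists>w\<in>CN r - ?H. w \<in> W) \<longleftrightarrow>
          (\<exists>w\<in>at.pts - ?H. w \<in> W \<and> ?tN w \<in> (if r \<in> S then {Some r} else {}))"
        if r: "r \<in> set_form f" for r W
      proof -
        have "w \<in> CN r - ?H \<longleftrightarrow> w \<in> at.pts - ?H \<and> ?tN w \<in> (if r \<in> S then {Some r} else {})" for w
        proof (cases w)
          case (Pt x)
          then show ?thesis using Bb[OF r, of x] blkU[of x] XU by (auto simp: kap_def CN_def)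
        next
          case (Copy i y)
          have "y \<in> A i \<Longrightarrow> y \<in> X" using R_sub[OF AR] by blast
          then show ?thesis using Copy Bb[OF r, of y] blkA[of y i] by (auto simp: kap_def CN_def)
        qed (auto simp: CN_def)
        then show ?thesis by blast
      qed
      show "fvars f = {}" "set_form f \<subseteq> set_form f" using f by auto
    qed
  qed
  obtain m where "at.iso_map CN m" using at.iso_map_ex[OF oc eq] by blast
  note m = at.iso_mapD[OF this]
  define e where "e = at.apex_nbhd {}"
  have "e \<in> at.fld" unfolding e_def by (rule at.apex_nbhd_fld) simp_all
  moreover have "Infty \<notin> e" by (auto simp: e_def at.apex_nbhd_def)
  ultimately obtain a where a: "a \<in> R" "m a = e" using m(8) by blast
  have "at.TN CN e = S"
  proof (intro set_eqI iffI)
    fix q assume "q \<in> at.TN CN e"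
    then obtain w where w: "w \<in> e" "w \<in> CN q" "q \<in> P" unfolding at.TN_def by blast
    then obtain i y where "y \<in> A i" "y \<in> B q" by (auto simp: e_def at.apex_nbhd_def CN_def)
    then show "q \<in> S" using blkA blk_eq[OF w(3)] by blast
  next
    fix q assume q: "q \<in> S"
    then have "{i. \<exists>y\<in>A i. blk y = q} \<noteq> {}" using manyA[OF q] by (metis finite.emptyI)
    then obtain i y where y: "y \<in> A i" "blk y = q" by blast
    then have "y \<in> B q" using blk(2)[of y] R_sub[OF AR] by blast
    then have "Copy i y \<in> e \<inter> CN q" using y by (auto simp: e_def at.apex_nbhd_def CN_def)
    then show "q \<in> at.TN CN e" using q SP unfolding at.TN_def by blast
  qed
  then have Ta: "T a = S" using m(5)[OF a(1)] a(2) by simp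
  \<comment> \<open>Near each point of \<open>a\<close> some block of \<open>S\<close> is missing,
    because \<open>up\<close> of a block in \<open>PO\<close> is finite and \<open>S\<close> is not.
    The blocks missing from the members of a finite subcover, however, all lie above a single
    \<open>u \<in> S\<close>, and a member containing a point of \<open>u\<close> meets them
    all.\<close>
  define \<C> where "\<C> = {D \<in> R. \<exists>q\<in>S. D \<inter> B q = {}}"
  have "a \<subseteq> \<Union>\<C>"
  proof
    fix y assume y: "y \<in> a"
    have "blk y \<in> S" using in_T_blk[OF a(1) y] Ta by simp
    then have "finite (up (blk y))" using PO_up_finite[of "blk y"] S(1) by blast
    then have "S - up (blk y) \<noteq> {}" by (rule infinite_diff_nonempty[OF S(2)])
    then obtain q where q: "q \<in> S" "q \<notin> up (blk y)" by blast
    then obtain D where "D \<in> R" "y \<in> D" "D \<inter> B q = {}" using avoid_one[of y q] R_sub[OF a(1)] y SP by blast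
    then show "y \<in> \<Union>\<C>" using q unfolding \<C>_def by blast
  qed
  moreover have "\<C> \<subseteq> R" by (auto simp: \<C>_def)
  ultimately have "\<exists>\<D>\<subseteq>\<C>. finite \<D> \<and> a \<subseteq> \<Union>\<D>" by (intro R_compact[OF a(1)])
  then obtain \<D> where \<D>: "\<D> \<subseteq> \<C>" "finite \<D>" "a \<subseteq> \<Union>\<D>" by (elim exE conjE)
  have "\<forall>D\<in>\<D>. \<exists>q. q \<in> S \<and> D \<inter> B q = {}" using \<D>(1) by (auto simp: \<C>_def)
  then obtain d where d: "\<And>D. D \<in> \<D> \<Longrightarrow> d D \<in> S \<and> D \<inter> B (d D) = {}" by metis
  have "finite (d ` \<D>)" "d ` \<D> \<subseteq> S" using d \<D>(2) by auto
  from dom[OF this] obtain u where u: "u \<in> S" "d ` \<D> \<subseteq> up u" by blast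
  obtain y where y: "y \<in> a" "blk y = u" using T_E[of u a] Ta u(1) R_sub[OF a(1)] by blast
  then obtain D where D: "D \<in> \<D>" "y \<in> D" using \<D>(3) by blast
  have "D \<in> R" using D(1) \<D>(1) by (auto simp: \<C>_def)
  then have "up u \<subseteq> T D" using T_up in_T_blk D(2) y(2) by blast
  then have "d D \<in> T D" using u(2) D(1) by blast
  then show False using d[OF D(1)] by (simp add: T_def)
qed

text \<open>
  For a set \<open>J\<close> of indices the blocks \<open>t i\<close> with \<open>i \<in> J\<close> are moved to copies that converge to
  a new point. The latter has a neighbourhood that meets, of all \<open>t i\<close>, exactly those with
  \<open>i \<in> J\<close>; as \<open>R\<close> is countable, this is not true of any element of \<open>R\<close> for suitable \<open>J\<close>.
\<close>

lemma wide_contradiction: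
  assumes oc: "omega_categorical P (ring_struct bare.fld Infty (\<lambda>p. Pt ` B p))"
    and t: "inj (t :: nat \<Rightarrow> 'p)" "\<And>i. t i \<in> PO" "\<And>i. up (t i) = insert (t i) s" "\<And>i. t i \<notin> s"
    and nd: "\<And>i. lt (t i) (t i) \<longleftrightarrow> \<not> nd"
  shows False
proof -
  have tP: "t i \<in> P" for i using t(2) PO_sub by blast
  have sP: "s \<subseteq> P" using up_sub[of "t 0"] t(3)[of 0] by blast
  have fs: "finite s" using PO_up_finite[OF t(2)[of 0]] t(3)[of 0] by simp
  have s_up: "up q \<subseteq> s" if "q \<in> s" for q
  proof -
    have "q \<in> up (t 0)" using that t(3) by simp
    then have "up q \<subseteq> insert (t 0) s" using up_trans[OF tP] t(3) by blast
    moreover have "t 0 \<notin> up q" using up_antisym[OF tP \<open>q \<in> up (t 0)\<close>] that t(4)[of 0] by auto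
    ultimately show ?thesis by blast
  qed
  have teq: "t i = t j \<longleftrightarrow> i = j" for i j using t(1) by (auto simp: inj_def)
  have "\<forall>i. \<exists>A. \<exists>x. A \<in> R \<and> x \<in> A \<and> blk x = t i \<and> T A = insert (t i) s \<and> (nd \<longrightarrow> A \<inter> B (t i) = {x})"
  proof
    fix i
    obtain A x where A: "A \<in> R" "x \<in> A" "blk x = t i" "T A = up (t i)" using PO_trim[OF t(2)[of i]] by blast
    show "\<exists>A. \<exists>x. A \<in> R \<and> x \<in> A \<and> blk x = t i \<and> T A = insert (t i) s \<and> (nd \<longrightarrow> A \<inter> B (t i) = {x})"
    proof (cases nd)
      case True
      then have "\<not> lt (blk x) (blk x)" using nd[of i] A(3) by simp
      then obtain E where E: "E \<in> R" "E \<subseteq> A" "E \<inter> B (blk x) = {x}" by (rule isolate[OF A(1,2)])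
      then have xE: "x \<in> E" by blast
      have "T E = up (t i)" using T_mono[OF E(2)] T_up[OF E(1) in_T_blk[OF E(1) xE]] A(3,4) by auto
      then show ?thesis using E xE A(3) t(3)[of i] by (intro exI[of _ E] exI[of _ x]) auto
    next
      case False
      then show ?thesis using A t(3)[of i] by (intro exI[of _ A] exI[of _ x]) auto
    qed
  qed
  then obtain E x where E: "\<And>i. E i \<in> R" "\<And>i. x i \<in> E i" "\<And>i. blk (x i) = t i" "\<And>i. T (E i) = insert (t i) s"
    "\<And>i. nd \<Longrightarrow> E i \<inter> B (t i) = {x i}" by metis
  \<comment> \<open>Disjointness assigns each point of \<open>U\<close> to one index. The point
    \<open>x i\<close> is not lost, since \<open>E j\<close> meets only \<open>t j\<close> and the
    blocks in \<open>s\<close>.\<close>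
  define A where "A i = E i - (\<Union>j<i. E j)" for i
  have AR: "A i \<in> R" for i unfolding A_def using E(1) by (intro R_Diff R_UN) auto
  have xX: "x i \<in> X" for i using E(2) R_sub[OF E(1)] by blast
  have xA: "x i \<in> A i" for i
  proof -
    have "x i \<notin> E j" if "j < i" for j
      using in_T_blk[OF E(1), of "x i" j] E(3,4) teq[of i j] t(4)[of i] that by auto
    then show ?thesis using E(2) by (auto simp: A_def)
  qed
  have AE: "A i \<subseteq> E i" for i by (auto simp: A_def)
  have xB: "x i \<in> B (t i)" for i using blk(2)[OF xX] E(3) by metis
  have TA: "T (A i) = insert (t i) s" for i
    using T_mono[OF AE[of i]] E(4)[of i] T_up[OF AR in_T_blk[OF AR xA], of i] E(3)[of i] t(3)[of i] by auto
  have And: "A i \<inter> B (t i) = {x i}" if nd for i using E(5)[OF that, of i] AE[of i] xA[of i] by blast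
  have dis: "i = j" if "y \<in> A i" "y \<in> A j" for i j y
    using that by (cases i j rule: linorder_cases) (auto simp: A_def)
  have AX: "y \<in> X" if "y \<in> A i" for y i using that R_sub[OF AR] by blast
  have Ablk: "blk y = t i \<or> blk y \<in> s" if "y \<in> A i" for y i using in_T_blk[OF AR that] TA by auto
  have Atj: "i = j" if "y \<in> A i" "blk y = t j" for y i j using Ablk[OF that(1)] that(2) teq t(4)[of j] by auto
  define U where "U = (\<Union>i. A i)"
  define H0 where "H0 = X - U"
  have UX: "U \<subseteq> X" using R_sub[OF AR] by (auto simp: U_def)
  then have XU: "X - H0 = U" by (auto simp: H0_def)
  have H0X: "H0 \<subseteq> X" by (auto simp: H0_def)
  have rU: "region U (s \<union> V) s nd" if V: "V \<subseteq> range t" for V unfolding region_def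
  proof (intro conjI ballI impI)
    show "U \<subseteq> X" "s \<union> V \<subseteq> P" "s \<subseteq> s \<union> V" using UX sP tP V by auto
    show "up q \<subseteq> s \<union> V" if "q \<in> s \<union> V" for q
    proof (cases "q \<in> s")
      case True
      then show ?thesis using s_up by blast
    next
      case False
      then obtain i where "q = t i" "q \<in> V" using \<open>q \<in> s \<union> V\<close> V by blast
      then show ?thesis using t(3)[of i] by auto
    qed
    fix y assume y: "y \<in> U"
    then obtain i where i: "y \<in> A i" by (auto simp: U_def)
    then show "\<exists>A\<in>R. y \<in> A \<and> A \<subseteq> U" using AR by (auto simp: U_def)
    have "finite (T (A i))" using TA fs by simp
    then obtain D where "D \<in> R" "y \<in> D" "D \<subseteq> A i" "T D = up (blk y)" by (rule trim_exists[OF AR i])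
    then show "\<exists>A\<in>R. y \<in> A \<and> T A \<subseteq> up (blk y)" by blast
    assume n: "blk y \<notin> s \<union> V"
    then have yt: "blk y = t i" using Ablk[OF i] by blast
    then show "s \<subseteq> up (blk y)" using t(3)[of i] by auto
    have "T (A i) \<inter> (s \<union> V) \<subseteq> s" using TA[of i] n yt by auto
    then show "\<exists>A\<in>R. y \<in> A \<and> T A \<inter> (s \<union> V) \<subseteq> s" using AR i by blast
    fix D assume D: "D \<in> R" "y \<in> D"
    have yB: "y \<in> B (t i)" using blk(2)[of y] yt UX y by auto
    show "if nd then \<exists>D\<in>R. y \<in> D \<and> {w \<in> D \<inter> U. blk w \<notin> s \<union> V} = {y}
        else infinite {w \<in> D \<inter> U. blk w \<notin> s \<union> V}"
    proof (cases nd)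
      case True
      have "w = y" if w: "w \<in> A i" "blk w \<notin> s \<union> V" for w
      proof -
        have "blk w = t i" using Ablk[OF w(1)] w(2) by blast
        then have "w \<in> B (t i)" using blk(2)[of w] R_sub[OF AR] w(1) by (metis subsetD)
        then have "w \<in> {x i}" "y \<in> {x i}" using And[OF True, of i] w(1) i yB by auto
        then show ?thesis by simp
      qed
      then have "{w \<in> A i \<inter> U. blk w \<notin> s \<union> V} = {y}" using i y n by blast
      then show ?thesis using True AR i by auto
    next
      case False
      then have "lt (blk y) (t i)" using nd[of i] yt by simp
      then have "infinite ((D \<inter> A i) \<inter> B (t i))"
        using limit_infinite[OF R_Int[OF D(1) AR] _ tP] D(2) i by blast
      moreover have "(D \<inter> A i) \<inter> B (t i) \<subseteq> {w \<in> D \<inter> U. blk w \<notin> s \<union> V}"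
        using blk_eq[OF tP] n yt by (auto simp: U_def)
      ultimately show ?thesis using False infinite_super by auto
    qed
  qed
  \<comment> \<open>By Cantor's theorem the countably many elements of \<open>R\<close> do not
    realise all sets of indices.\<close>
  have "\<exists>J. \<forall>a\<in>R. {i. t i \<in> T a} \<noteq> J"
  proof (rule ccontr)
    assume *: "\<nexists>J. \<forall>a\<in>R. {i. t i \<in> T a} \<noteq> J"
    have "R \<noteq> {}" using R_empty by blast
    then have r: "range (from_nat_into R) = R" using R_countable by (intro range_from_nat_into)
    have "(\<lambda>n. {i. t i \<in> T (from_nat_into R n)}) ` UNIV = Pow UNIV"
    proof (intro set_eqI iffI)
      fix J assume "J \<in> Pow (UNIV :: nat set)"
      have "\<not> (\<forall>a\<in>R. {i. t i \<in> T a} \<noteq> J)" using spec[OF *[unfolded not_ex], of J] .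
      then obtain a where "a \<in> R" "J = {i. t i \<in> T a}" by blast
      moreover from this r have "a \<in> range (from_nat_into R)" by simp
      then obtain n where "a = from_nat_into R n" by (rule rangeE)
      ultimately have "J = (\<lambda>n. {i. t i \<in> T (from_nat_into R n)}) n" by simp
      then show "J \<in> (\<lambda>n. {i. t i \<in> T (from_nat_into R n)}) ` UNIV" by (rule image_eqI) simp
    qed simp
    then show False using Cantors_theorem[of "UNIV :: nat set"] by blast
  qed
  then obtain J where J: "\<And>a. a \<in> R \<Longrightarrow> {i. t i \<in> T a} \<noteq> J" by blast
  define Rem where "Rem r = {y. \<exists>i\<in>J. r = t i \<and> y \<in> A i}" for r
  define Col where "Col i = s \<union> (if i \<in> J then {t i} else {})" for i
  interpret at: attach R X P lt B "{}" True "\<lambda>_. Apex" A by unfold_locales (use AR in auto)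
  let ?CN = "at.colour Rem Col"
  have CN: "?CN r = Pt ` (B r - Rem r) \<union> {Copy i y |i y. y \<in> A i \<inter> B r \<and> r \<in> Col i}" for r
    by (simp add: at.colour_def)
  have sA: "\<exists>y\<in>A i. blk y = q" if "q \<in> s" for q i using T_E[of q "A i"] TA[of i] R_sub[OF AR] that by auto
  let ?H = "insert Infty (Pt ` H0)"
  have eq: "holds (ring_struct bare.fld Infty (\<lambda>p. Pt ` B p)) f = holds (ring_struct at.fld Infty ?CN) f"
    if f: "fvars f = {}" "set_form f \<subseteq> P" for f
  proof -
    define F where "F = set_form f"
    have F: "finite F" "F \<subseteq> P" unfolding F_def using finite_set_form f by auto
    define V where "V = F \<inter> range t"
    \<comment> \<open>A block \<open>t i\<close> occurring in the sentence has its own type in one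
      place only: in copy \<open>i\<close> if \<open>i \<in> J\<close>, and in the base otherwise.
      Where its colour is erased, its points have type \<open>None\<close>.\<close>
    define VB where "VB = {t i |i. t i \<in> F \<and> i \<notin> J}"
    define VC where "VC i = (if i \<in> J \<and> t i \<in> F then {t i} else {})" for i
    define I where "I = {i \<in> J. t i \<in> F}"
    have finI: "finite {i. t i \<in> F}" using finite_vimageI[OF F(1) t(1)] by (simp add: vimage_def)
    then have I: "finite I" unfolding I_def by simp
    let ?tM = "bare.ptyp (s \<union> V) (\<lambda>_. s \<union> V)" and ?tN = "at.ptyp (s \<union> VB) (\<lambda>i. s \<union> VC i)"
    let ?S = "insert None (Some ` (s \<union> V))"
    have V: "V \<subseteq> range t" "VB \<subseteq> range t" "VC i \<subseteq> range t" for i by (auto simp: V_def VB_def VC_def)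
    have rB: "region (X - H0) (s \<union> W) s nd" if "W \<subseteq> range t" for W unfolding XU by (rule rU[OF that])
    have rC: "region (A i) (s \<union> VC i) s nd" for i
      by (rule region_sub[OF rU[OF V(3)]]) (use AR in \<open>auto simp: U_def\<close>)
    have TM: "typed_field bare.pts bare.fld ?H ?tM (ple s) (dst nd) ?S"
    proof (rule bare.typed_region[OF _ H0X rB[OF V(1)]])
      show "region {} (s \<union> V) s nd" using region_facts[OF rU[OF V(1)]] by (intro region_empty)
    qed auto
    have TN: "typed_field at.pts at.fld ?H ?tN (ple s) (dst nd) ?S"
    proof (rule at.typed_region[OF refl H0X rB[OF V(2)] rC])
      show "x \<in> H0" if "Apex = Pt x" for x using that by simp
      show "finite {i. Apex = Apex \<and> (\<exists>y\<in>A i. blk y \<in> s \<union> VC i - s)}"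
        using finI by (rule rev_finite_subset) (auto simp: VC_def split: if_splits)
      show "infinite {i::nat. Apex = Apex \<and> (\<exists>y\<in>A i. blk y = q)}" if "q \<in> s" for q
        using sA[OF that] by (simp add: infinite_UNIV_nat)
      have "infinite (UNIV - {i. t i \<in> F})" using finI infinite_UNIV_nat by simp
      then show "infinite {i. Apex = Apex \<and> (\<exists>y\<in>A i. blk y \<notin> s \<union> VC i)}"
      proof (rule infinite_super[rotated])
        show "UNIV - {i. t i \<in> F} \<subseteq> {i. Apex = Apex \<and> (\<exists>y\<in>A i. blk y \<notin> s \<union> VC i)}"
        proof
          fix i assume "i \<in> UNIV - {i. t i \<in> F}"
          then have "blk (x i) \<notin> s \<union> VC i" using E(3)[of i] t(4)[of i] by (auto simp: VC_def)
          then show "i \<in> {i. Apex = Apex \<and> (\<exists>y\<in>A i. blk y \<notin> s \<union> VC i)}" using xA by blast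
        qed
      qed
    qed
    have inVB: "t i \<in> VB \<longleftrightarrow> t i \<in> F \<and> i \<notin> J" for i using teq by (auto simp: VB_def)
    have inV: "t i \<in> V \<longleftrightarrow> t i \<in> F" for i by (auto simp: V_def)
    \<comment> \<open>The two typings of the base differ on finitely many sets \<open>A i\<close>
      only. Their union belongs to \<open>R\<close> and misses \<open>H0\<close>, so it can be
      removed from the neighbourhoods of fixed points.\<close>
    have same: "kap (s \<union> V) y = kap (s \<union> VB) y" if y: "y \<in> U" "y \<notin> (\<Union>i\<in>I. A i)" for y
    proof -
      obtain i where i: "y \<in> A i" using y(1) by (auto simp: U_def)
      then have "i \<notin> I" using y(2) by blast
      then show ?thesis using Ablk[OF i] inVB[of i] inV[of i] by (auto simp: kap_def I_def)
    qed
    have IR: "(\<Union>i\<in>I. A i) \<in> R" using I AR by (intro R_UN) auto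
    have near: "bare.near_cond H0 ?tM a h \<longleftrightarrow> at.near_cond H0 ?tN a h" if h: "h \<in> H0" for h a
    proof -
      have N: "at.near_cond H0 ?tN a h \<longleftrightarrow> (\<forall>D\<in>R. h \<in> D \<longrightarrow> (\<exists>y\<in>D - H0. kap (s \<union> VB) y = a))"
        by (simp add: at.near_cond_def image_iff)
      have M: "bare.near_cond H0 ?tM a h \<longleftrightarrow> (\<forall>D\<in>R. h \<in> D \<longrightarrow> (\<exists>y\<in>D - H0. kap (s \<union> V) y = a))"
        by (simp add: bare.near_cond_def image_iff)
      have sub: "\<forall>D\<in>R. h \<in> D \<longrightarrow> (\<exists>y\<in>D - H0. t' y = a)"
        if *: "\<forall>D\<in>R. h \<in> D \<longrightarrow> (\<exists>y\<in>D - H0. t y = a)"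
          and tt: "\<And>y. y \<in> U \<Longrightarrow> y \<notin> (\<Union>i\<in>I. A i) \<Longrightarrow> t y = t' y" for t t' :: "'x \<Rightarrow> 'p option"
      proof (intro ballI impI)
        fix D assume D: "D \<in> R" "h \<in> D"
        have "h \<notin> (\<Union>i\<in>I. A i)" using h by (auto simp: H0_def U_def)
        then obtain y where y: "y \<in> D" "y \<notin> (\<Union>i\<in>I. A i)" "y \<notin> H0" "t y = a"
          using *[rule_format, OF R_Diff[OF D(1) IR]] D(2) by blast
        then have "y \<in> U" using R_sub[OF D(1)] by (auto simp: H0_def)
        then show "\<exists>y\<in>D - H0. t' y = a" using tt[of y] y by (intro bexI[of _ y]) auto
      qed
      have "(\<forall>D\<in>R. h \<in> D \<longrightarrow> (\<exists>y\<in>D - H0. kap (s \<union> V) y = a)) \<longleftrightarrow> (\<forall>D\<in>R. h \<in> D \<longrightarrow> (\<exists>y\<in>D - H0. kap (s \<union> VB) y = a))" (is "?A \<longleftrightarrow> ?B")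
      proof
        show "?B" if "?A" using sub[OF that same] .
        show "?A" if "?B" using sub[OF that same[symmetric]] .
      qed
      then show ?thesis unfolding M N .
    qed
    have near_inf: "bare.near_cond_inf H0 ?tM a \<longleftrightarrow> at.near_cond_inf H0 ?tN a" for a
    proof -
      have N: "at.near_cond_inf H0 ?tN a \<longleftrightarrow> (\<forall>D\<in>R. \<exists>y\<in>X - D - H0. kap (s \<union> VB) y = a)"
        by (simp add: at.near_cond_inf_def image_iff)
      have M: "bare.near_cond_inf H0 ?tM a \<longleftrightarrow> (\<forall>D\<in>R. \<exists>y\<in>X - D - H0. kap (s \<union> V) y = a)"
        by (simp add: bare.near_cond_inf_def image_iff)
      have sub: "\<forall>D\<in>R. \<exists>y\<in>X - D - H0. t' y = a"
        if *: "\<forall>D\<in>R. \<exists>y\<in>X - D - H0. t y = a"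
          and tt: "\<And>y. y \<in> U \<Longrightarrow> y \<notin> (\<Union>i\<in>I. A i) \<Longrightarrow> t y = t' y" for t t' :: "'x \<Rightarrow> 'p option"
      proof (intro ballI)
        fix D assume D: "D \<in> R"
        obtain y where y: "y \<in> X - D - H0" "y \<notin> (\<Union>i\<in>I. A i)" "t y = a"
          using *[rule_format, OF R_Un[OF D IR]] by blast
        then have "y \<in> U" by (auto simp: H0_def)
        then show "\<exists>y\<in>X - D - H0. t' y = a" using tt[of y] y by (intro bexI[of _ y]) auto
      qed
      have "(\<forall>D\<in>R. \<exists>y\<in>X - D - H0. kap (s \<union> V) y = a) \<longleftrightarrow> (\<forall>D\<in>R. \<exists>y\<in>X - D - H0. kap (s \<union> VB) y = a)" (is "?A \<longleftrightarrow> ?B")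
      proof
        show "?B" if "?A" using sub[OF that same] .
        show "?A" if "?B" using sub[OF that same[symmetric]] .
      qed
      then show ?thesis unfolding M N .
    qed
    have Bb: "y \<in> B r \<longleftrightarrow> y \<in> X \<and> blk y = r" if "r \<in> P" for r y
      using that blk_eq[of r y] blk(2)[of y] block_sub[of r] by blast
    show ?thesis
    proof (rule at.transfer_const[where CM = B and col = "\<lambda>r. if r \<in> s \<union> V then {Some r} else {}", OF TM TN _ _ _ _ near near_inf])
      show "H0 \<subseteq> X - {}" using H0X by simp
      show "finite ?S" using fs F(1) by (simp add: V_def)
      show "?tM (Pt y) \<in> ?S" for y by (simp add: kap_def)
      show "?tN w \<in> ?S" for w by (cases w) (auto simp: kap_def V_def VB_def VC_def)
      show "same_count k {y \<in> X - H0. ?tM (Pt y) = a} {w \<in> at.pts - ?H. ?tN w = a}" if a: "a \<in> ?S" for a k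
      proof -
        have Ptinf: "infinite {w \<in> at.pts - ?H. ?tN w = a}" if inf: "infinite Z" "Z \<subseteq> U" "\<And>y. y \<in> Z \<Longrightarrow> kap (s \<union> VB) y = a" for Z
        proof (rule infinite_super)
          show "infinite (Pt ` Z)" using inf(1) by (simp add: finite_image_iff inj_on_def)
          show "Pt ` Z \<subseteq> {w \<in> at.pts - ?H. ?tN w = a}" using inf(2,3) XU UX by auto
        qed
        have Minf: "infinite {y \<in> X - H0. ?tM (Pt y) = a}" if inf: "infinite Z" "Z \<subseteq> U" "\<And>y. y \<in> Z \<Longrightarrow> kap (s \<union> V) y = a" for Z
          by (rule infinite_super[OF _ inf(1)]) (use inf(2,3) XU in auto)
        consider "a = None" | q where "a = Some q" "q \<in> s" | i where "a = Some (t i)" "t i \<in> F"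
          using a by (auto simp: V_def)
        then show ?thesis
        proof cases
          case 1
          define Z where "Z = x ` (UNIV - {i. t i \<in> F})"
          have "inj x" using E(3) t(1) by (metis injD injI)
          then have "infinite Z" unfolding Z_def using finI infinite_UNIV_nat
            by (simp add: finite_image_iff inj_on_subset)
          moreover have "Z \<subseteq> U" using xA by (auto simp: Z_def U_def)
          moreover have "kap (s \<union> V) y = a" "kap (s \<union> VB) y = a" if "y \<in> Z" for y
            using that E(3) t(4) inV inVB 1 by (auto simp: Z_def kap_def)
          ultimately show ?thesis by (intro same_count_infinite Minf Ptinf)
        next
          case (2 q)
          have "q \<in> up (t 0)" "q \<noteq> t 0" using t(3)[of 0] t(4)[of 0] 2(2) by auto
          then have "lt (blk (x 0)) q" unfolding E(3) by (simp add: up_def)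
          then have "infinite (A 0 \<inter> B q)" using limit_infinite[OF AR xA] sP 2(2) by blast
          moreover have "A 0 \<inter> B q \<subseteq> U" by (auto simp: U_def)
          moreover have "kap (s \<union> V) y = a" "kap (s \<union> VB) y = a" if "y \<in> A 0 \<inter> B q" for y
            using that 2 blk_eq[of q y] sP by (auto simp: kap_def)
          ultimately show ?thesis by (intro same_count_infinite Minf Ptinf)
        next
          \<comment> \<open>This class may consist of a single point, so the counts must agree
            exactly: the points of \<open>t i\<close> in \<open>A i\<close> are carried over
            bijectively, to copy \<open>i\<close> or to the base.\<close>
          case (3 i)
          have M: "{y \<in> X - H0. ?tM (Pt y) = a} = A i \<inter> B (t i)"
            using 3 Atj Bb[OF tP] unfolding XU by (auto simp: U_def kap_cases inV dest: AX)
          define c :: "'x \<Rightarrow> 'x pt" where "c = (if i \<in> J then Copy i else Pt)"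
          have N: "{w \<in> at.pts - ?H. ?tN w = a} = c ` (A i \<inter> B (t i))"
          proof (rule set_eqI)
            fix w show "w \<in> {w \<in> at.pts - ?H. ?tN w = a} \<longleftrightarrow> w \<in> c ` (A i \<inter> B (t i))"
            proof (cases w)
              case (Pt y)
              have "y \<in> U \<and> blk y = t i \<longleftrightarrow> y \<in> A i \<inter> B (t i)"
                using Atj Bb[OF tP] by (auto simp: U_def dest: AX)
              moreover have "y \<in> X \<and> y \<notin> H0 \<longleftrightarrow> y \<in> U" using XU by blast
              ultimately show ?thesis using Pt 3 t(4)[of i] inVB[of i] by (auto simp: c_def kap_cases)
            next
              case (Copy j y)
              have "y \<in> A j \<and> blk y = t i \<longleftrightarrow> j = i \<and> y \<in> A i \<inter> B (t i)"
                using Atj Bb[OF tP] R_sub[OF AR] by blast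
              moreover have "t i \<in> VC i \<longleftrightarrow> i \<in> J" using 3 by (auto simp: VC_def)
              ultimately show ?thesis using Copy 3 t(4)[of i] by (auto simp: c_def kap_cases)
            qed (auto simp: 3 c_def)
          qed
          have "inj_on c (A i \<inter> B (t i))" by (auto simp: c_def inj_on_def)
          then show ?thesis unfolding M N by (rule same_count_image)
        qed
      qed
      show "?CN r \<inter> ?H = Pt ` (B r \<inter> H0)" for r unfolding CN by (auto simp: Rem_def H0_def U_def)
      show "(if r \<in> s \<union> V then {Some r} else {}) \<subseteq> ?S" for r by auto
      have own: "r \<in> s \<union> V" if "y \<in> U" "blk y = r" "r \<in> F" for r y
        using that Ablk by (auto simp: U_def V_def)
      show "(\<exists>y\<in>B r - H0. Pt y \<in> W) \<longleftrightarrow>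
          (\<exists>y\<in>X - H0. Pt y \<in> W \<and> ?tM (Pt y) \<in> (if r \<in> s \<union> V then {Some r} else {}))" if r: "r \<in> F" for r W
      proof -
        have "y \<in> B r - H0 \<longleftrightarrow> y \<in> X - H0 \<and> ?tM (Pt y) \<in> (if r \<in> s \<union> V then {Some r} else {})" for y
          using Bb[of r y] r F(2) own[of y r] unfolding XU[symmetric] by (auto simp: kap_def)
        then show ?thesis by blast
      qed
      show "(\<exists>w\<in>?CN r - ?H. w \<in> W) \<longleftrightarrow>
          (\<exists>w\<in>at.pts - ?H. w \<in> W \<and> ?tN w \<in> (if r \<in> s \<union> V then {Some r} else {}))" if r: "r \<in> F" for r W
      proof -
        have rP: "r \<in> P" using r F by blast
        have "w \<in> ?CN r - ?H \<longleftrightarrow> w \<in> at.pts - ?H \<and> ?tN w \<in> (if r \<in> s \<union> V then {Some r} else {})" for w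
        proof (cases w)
          case (Pt y)
          have "y \<in> B r - Rem r - H0 \<longleftrightarrow> y \<in> U \<and> blk y = r \<and> r \<in> s \<union> VB"
          proof (cases "y \<in> U \<and> blk y = r")
            case True
            then obtain i where i: "y \<in> A i" by (auto simp: U_def)
            have "y \<in> B r" "y \<notin> H0" using True Bb[OF rP] UX by (auto simp: H0_def)
            moreover have "y \<in> Rem r \<longleftrightarrow> i \<in> J \<and> r = t i" using dis i by (auto simp: Rem_def)
            moreover have "r = t i \<or> r \<in> s" using Ablk[OF i] True by auto
            ultimately show ?thesis using True inVB[of i] t(4)[of i] r by auto
          next
            case False
            then show ?thesis using Bb[OF rP, of y] by (auto simp: H0_def)
          qed
          moreover have "s \<union> VB \<subseteq> s \<union> V" by (auto simp: VB_def V_def)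
          ultimately show ?thesis using Pt XU UX unfolding CN by (auto simp: kap_def)
        next
          case (Copy i y)
          have "y \<in> A i \<Longrightarrow> y \<in> B r \<longleftrightarrow> blk y = r" using Bb[OF rP, of y] R_sub[OF AR] by blast
          moreover have "r \<in> Col i \<longleftrightarrow> r \<in> s \<union> VC i" using r by (auto simp: Col_def VC_def)
          moreover have "s \<union> VC i \<subseteq> s \<union> V" by (auto simp: VC_def V_def)
          ultimately show ?thesis using Copy unfolding CN by (auto simp: kap_def)
        qed (auto simp: CN)
        then show ?thesis by blast
      qed
      show "fvars f = {}" "set_form f \<subseteq> F" using f by (auto simp: F_def)
    qed
  qed
  obtain m where "at.iso_map ?CN m" using at.iso_map_ex[OF oc eq] by blast
  note m = at.iso_mapD[OF this]
  define e where "e = at.apex_nbhd {}"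
  have "e \<in> at.fld" unfolding e_def by (rule at.apex_nbhd_fld) simp_all
  moreover have "Infty \<notin> e" by (auto simp: e_def at.apex_nbhd_def)
  ultimately obtain a where a: "a \<in> R" "m a = e" using m(8) by blast
  have "t i \<in> at.TN ?CN e \<longleftrightarrow> i \<in> J" for i
  proof
    assume "t i \<in> at.TN ?CN e"
    then obtain w where w: "w \<in> e" "w \<in> ?CN (t i)" unfolding at.TN_def by blast
    then obtain j where "t i \<in> Col j" by (auto simp: e_def at.apex_nbhd_def CN)
    then show "i \<in> J" using teq t(4)[of i] by (auto simp: Col_def split: if_splits)
  next
    assume "i \<in> J"
    then have "Copy i (x i) \<in> e \<inter> ?CN (t i)" using xA xB unfolding CN by (auto simp: e_def at.apex_nbhd_def Col_def)
    then show "t i \<in> at.TN ?CN e" using tP unfolding at.TN_def by blast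
  qed
  then have "{i. t i \<in> T a} = J" using m(5)[OF a(1)] a(2) by simp
  then show False using J[OF a(1)] by blast
qed

text \<open>
  Let \<open>S\<close> be minimal such that for every finite \<open>F\<close> there are infinitely many blocks \<open>p\<close> with
  \<open>up p \<inter> F \<subseteq> S\<close>. If \<open>S\<close> is infinite, each of its members is above almost all others; if it is
  finite, infinitely many blocks lie immediately below members of \<open>S\<close>.
\<close>

lemma PO_finite_if:
  assumes oc: "omega_categorical P (ring_struct bare.fld Infty (\<lambda>p. Pt ` B p))"
  shows "finite PO"
proof (rule ccontr)
  assume inf: "infinite PO"
  define Q where "Q S \<longleftrightarrow> (\<forall>F. finite F \<longrightarrow> F \<subseteq> PO \<longrightarrow> infinite {p \<in> PO. up p \<inter> F \<subseteq> S})" for S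
  \<comment> \<open>Complements are used since Zorn's lemma yields maximal sets. The union of a
    chain of complements is again admissible, because a finite \<open>F\<close> meets it inside a
    single member.\<close>
  define \<A> where "\<A> = {Z. Z \<subseteq> PO \<and> Q (PO - Z)}"
  have "{p \<in> PO. up p \<inter> F \<subseteq> PO} = PO" if "F \<subseteq> PO" for F using that by blast
  then have "{} \<in> \<A>" using inf by (simp add: \<A>_def Q_def)
  then have "\<exists>M\<in>\<A>. \<forall>Z\<in>\<A>. M \<subseteq> Z \<longrightarrow> Z = M"
  proof (intro subset_Zorn_nonempty)
    fix \<K> assume K: "\<K> \<noteq> {}" "subset.chain \<A> \<K>"
    have KA: "\<K> \<subseteq> \<A>" using K(2) by (simp add: subset.chain_def)
    have "infinite {p \<in> PO. up p \<inter> F \<subseteq> PO - \<Union>\<K>}" if F: "finite F" "F \<subseteq> PO" for F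
    proof -
      obtain C where C: "C \<in> \<K>" "F \<inter> \<Union>\<K> \<subseteq> C"
        using finite_subset_Union_chain[of "F \<inter> \<Union>\<K>" \<K> \<A>] F(1) K by blast
      have "infinite {p \<in> PO. up p \<inter> F \<subseteq> PO - C}" using C(1) KA F by (auto simp: \<A>_def Q_def)
      moreover have "{p \<in> PO. up p \<inter> F \<subseteq> PO - C} \<subseteq> {p \<in> PO. up p \<inter> F \<subseteq> PO - \<Union>\<K>}" using C(2) by blast
      ultimately show ?thesis using infinite_super by blast
    qed
    then show "\<Union>\<K> \<in> \<A>" using KA by (auto simp: \<A>_def Q_def)
  qed blast
  then obtain Z where Z: "Z \<in> \<A>" "\<And>Z'. Z' \<in> \<A> \<Longrightarrow> Z \<subseteq> Z' \<Longrightarrow> Z' = Z" by blast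
  define S where "S = PO - Z"
  have S: "S \<subseteq> PO" "Q S" using Z(1) by (auto simp: S_def \<A>_def)
  have Smin: "S' = S" if "S' \<subseteq> S" "Q S'" for S'
  proof -
    have "PO - (PO - S') = S'" using that(1) S(1) by blast
    then have "PO - S' \<in> \<A>" using that(2) by (simp add: \<A>_def)
    moreover have "Z \<subseteq> PO - S'" using that(1) Z(1) by (auto simp: S_def \<A>_def)
    ultimately have "PO - S' = Z" using Z(2) by blast
    then show ?thesis using that(1) S(1) unfolding S_def by blast
  qed
  have Qinf: "infinite {p \<in> PO. up p \<inter> F \<subseteq> S}" if "finite F" "F \<subseteq> PO" for F using S(2) that by (simp add: Q_def)
  \<comment> \<open>The members \<open>u\<close> of \<open>S\<close> with
    \<open>up u \<subseteq> S\<close> form a set that satisfies \<open>Q\<close>, too, since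
    \<open>F\<close> may be enlarged to the finite set of all blocks above its members. By
    minimality they are all of \<open>S\<close>.\<close>
  have Sup: "up p \<subseteq> S" if p: "p \<in> S" for p
  proof -
    define S' where "S' = {u \<in> S. up u \<subseteq> S}"
    have "Q S'" unfolding Q_def
    proof (intro allI impI)
      fix F assume F: "finite F" "F \<subseteq> PO"
      define F' where "F' = (\<Union>q\<in>F. up q)"
      have "finite F'" "F' \<subseteq> PO" unfolding F'_def using F PO_up_finite PO_up by blast+
      then have "infinite {p \<in> PO. up p \<inter> F' \<subseteq> S}" by (rule Qinf)
      moreover have "{p \<in> PO. up p \<inter> F' \<subseteq> S} \<subseteq> {p \<in> PO. up p \<inter> F \<subseteq> S'}"
      proof (intro subsetI CollectI conjI)
        fix p q assume p: "p \<in> {p \<in> PO. up p \<inter> F' \<subseteq> S}"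
        then show "p \<in> PO" by blast
        assume q: "q \<in> up p \<inter> F"
        have pP: "p \<in> P" using p PO_sub by blast
        have "up q \<subseteq> up p" using up_trans[OF pP] q by blast
        moreover have "up q \<subseteq> F'" using q by (auto simp: F'_def)
        ultimately have "up q \<subseteq> S" using p by blast
        moreover have "q \<in> up q" using self_up[of q] q up_sub by blast
        ultimately show "q \<in> S'" by (auto simp: S'_def)
      qed
      ultimately show "infinite {p \<in> PO. up p \<inter> F \<subseteq> S'}" using infinite_super by blast
    qed
    then have "S' = S" by (intro Smin) (auto simp: S'_def)
    then show ?thesis using p unfolding S'_def by blast
  qed
  show False
  proof (cases "finite S")
    case False
    have "finite {u \<in> S. q \<notin> up u}" if q: "q \<in> S" for q
    proof (rule ccontr)
      assume inf: "infinite {u \<in> S. q \<notin> up u}"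
      have "Q (S - {q})" unfolding Q_def
      proof (intro allI impI)
        fix F
        have "{u \<in> S. q \<notin> up u} \<subseteq> {p \<in> PO. up p \<inter> F \<subseteq> S - {q}}" using Sup S(1) by blast
        then show "infinite {p \<in> PO. up p \<inter> F \<subseteq> S - {q}}" using inf infinite_super by blast
      qed
      then have "S - {q} = S" by (intro Smin) auto
      then show False using q by blast
    qed
    then show ?thesis using narrow_contradiction[OF oc S(1) False Sup] by blast
  next
    case True
    define W where "W = {u \<in> PO - S. up u \<subseteq> insert u S}"
    have "infinite W"
    proof
      assume W: "finite W"
      then have "infinite {p \<in> PO. up p \<inter> W \<subseteq> S}" by (intro Qinf) (auto simp: W_def)
      then have "{p \<in> PO. up p \<inter> W \<subseteq> S} - S \<noteq> {}" using True by (rule infinite_diff_nonempty)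
      then obtain p where p: "p \<in> PO" "up p \<inter> W \<subseteq> S" "p \<notin> S" by blast
      have pP: "p \<in> P" using p PO_sub by blast
      then have "p \<in> up p - S" using self_up p by blast
      \<comment> \<open>With the fewest blocks above it, \<open>u\<close> has no other block outside
        \<open>S\<close> above it; thus it is a member of \<open>W\<close> above
        \<open>p\<close>.\<close>
      then obtain u where u: "u \<in> up p - S" "\<And>w. w \<in> up p - S \<Longrightarrow> card (up u) \<le> card (up w)"
        using ex_has_least_nat[of "\<lambda>u. u \<in> up p - S" p "\<lambda>u. card (up u)"] by blast
      have uPO: "u \<in> PO" using PO_up[OF p(1)] u by blast
      have "up u \<subseteq> insert u S"
      proof
        fix w assume w: "w \<in> up u"
        show "w \<in> insert u S"
        proof (rule ccontr)
          assume n: "w \<notin> insert u S"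
          have uP: "u \<in> P" using uPO PO_sub by blast
          have "w \<in> up p - S" using w n up_trans[OF pP, of u] u by blast
          then have "card (up u) \<le> card (up w)" using u(2) by blast
          moreover have "up w \<subseteq> up u" using up_trans[OF uP w] .
          ultimately have "up w = up u" using PO_up_finite[OF uPO] by (metis card_seteq)
          then have "w = u" using up_inj[of w u] w up_sub uP by blast
          then show False using n by blast
        qed
      qed
      then have "u \<in> W" using u uPO by (auto simp: W_def)
      then show False using p(2) u by blast
    qed
    \<comment> \<open>Pigeonhole: infinitely many members of \<open>W\<close> have the same blocks
      of \<open>S\<close> above them and are all crowded or all discrete, as
      \<open>wide_contradiction\<close> requires.\<close>
    moreover have "finite ((\<lambda>u. (up u \<inter> S, lt u u)) ` W)"
      by (rule finite_subset[of _ "Pow S \<times> UNIV"]) (use True in auto)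
    ultimately obtain u0 where u0: "u0 \<in> W" "infinite {u \<in> W. (up u \<inter> S, lt u u) = (up u0 \<inter> S, lt u0 u0)}"
      using pigeonhole_infinite by blast
    obtain t :: "nat \<Rightarrow> 'p" where t: "inj t"
      "range t \<subseteq> {u \<in> W. (up u \<inter> S, lt u u) = (up u0 \<inter> S, lt u0 u0)}"
      using infinite_countable_subset[OF u0(2)] by blast
    have ti: "t i \<in> W" "up (t i) \<inter> S = up u0 \<inter> S" "lt (t i) (t i) = lt u0 u0" for i
      using t(2) by auto
    show False
    proof (rule wide_contradiction[OF oc t(1), where s = "up u0 \<inter> S" and nd = "\<not> lt u0 u0"])
      show "t i \<in> PO" "t i \<notin> up u0 \<inter> S" for i using ti(1)[of i] by (auto simp: W_def)
      show "up (t i) = insert (t i) (up u0 \<inter> S)" for i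
      proof -
        have "t i \<in> P" using ti(1)[of i] PO_sub by (auto simp: W_def)
        then show ?thesis using self_up[of "t i"] ti(1,2)[of i] unfolding W_def by blast
      qed
      show "lt (t i) (t i) \<longleftrightarrow> \<not> \<not> lt u0 u0" for i using ti(3) by simp
    qed
  qed
qed

end

section \<open>Finitely many types\<close>

text \<open>The complete type of the tuple \<open>v 0\<close>, ..., \<open>v (n - 1)\<close> in the
  structure.\<close>

definition tp :: "'p set \<Rightarrow> ('a, 'p) pstruct \<Rightarrow> nat \<Rightarrow> (nat \<Rightarrow> 'a) \<Rightarrow> 'p form set" where
  "tp P M n v = {f. fvars f \<subseteq> {..<n} \<and> set_form f \<subseteq> P \<and> sat M v f}"

lemma holds_all: "holds M f \<longleftrightarrow> holds M (Neg (Ex n (Neg f)))"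
proof
  assume h: "holds M f"
  have "sat M (v(n := a)) f" if "range v \<subseteq> univ M" "a \<in> univ M" for v a
  proof -
    have "range (v(n := a)) \<subseteq> univ M" using that by auto
    then show ?thesis using h unfolding holds_def by blast
  qed
  then show "holds M (Neg (Ex n (Neg f)))" unfolding holds_def by simp
next
  assume h: "holds M (Neg (Ex n (Neg f)))"
  show "holds M f" unfolding holds_def
  proof (intro allI impI)
    fix v :: "nat \<Rightarrow> 'a" assume v: "range v \<subseteq> univ M"
    then have "v n \<in> univ M" by blast
    moreover have "\<forall>a\<in>univ M. sat M (v(n := a)) f" using h v unfolding holds_def by simp
    ultimately have "sat M (v(n := v n)) f" by blast
    then show "sat M v f" by simp
  qed
qed

lemma elem_equiv_open:
  assumes "elem_equiv P M N"
  shows "fvars f \<subseteq> {..<n} \<Longrightarrow> set_form f \<subseteq> P \<Longrightarrow> holds M f = holds N f"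
proof (induction n arbitrary: f)
  case 0
  then show ?case using assms by (simp add: elem_equiv_def sentence_def)
next
  case (Suc n)
  have "holds M (Neg (Ex n (Neg f))) = holds N (Neg (Ex n (Neg f)))"
    using Suc.prems by (intro Suc.IH) (auto simp: less_Suc_eq)
  then show ?case using holds_all[of M f n] holds_all[of N f n] by simp
qed

fun conjs :: "'p form list \<Rightarrow> 'p form" where
  "conjs [] = Eq Zero Zero"
| "conjs (f # fs) = Conj f (conjs fs)"

lemma sat_conjs [simp]: "sat M v (conjs fs) \<longleftrightarrow> (\<forall>f\<in>set fs. sat M v f)"
  by (induction fs) auto

lemma fvars_conjs [simp]: "fvars (conjs fs) = (\<Union>f\<in>set fs. fvars f)"
  by (induction fs) auto

lemma set_form_conjs [simp]: "set_form (conjs fs) = (\<Union>f\<in>set fs. set_form f)"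
  by (induction fs) auto

text \<open>Distinct types are told apart by a single formula, so one of finitely many types is
  isolated by a finite conjunction, whatever the cardinality of the language.\<close>

lemma isolating_formulas:
  fixes M :: "('a, 'p) pstruct"
  assumes fin: "finite (tp P M n ` {v. range v \<subseteq> univ M})"
  shows "\<exists>\<theta>. \<forall>v. range v \<subseteq> univ M \<longrightarrow> fvars (\<theta> (tp P M n v)) \<subseteq> {..<n} \<and> set_form (\<theta> (tp P M n v)) \<subseteq> P \<and>
    (\<forall>w. range w \<subseteq> univ M \<longrightarrow> (sat M w (\<theta> (tp P M n v)) \<longleftrightarrow> tp P M n w = tp P M n v))"
proof -
  define TT where "TT = tp P M n ` {v. range v \<subseteq> univ M}"
  obtain ts where ts: "set ts = TT" using finite_list[OF fin] unfolding TT_def by blast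
  have "\<exists>f. \<tau> \<noteq> \<tau>' \<longrightarrow> f \<in> \<tau> \<and> f \<notin> \<tau>'" if tt: "\<tau> \<in> TT" "\<tau>' \<in> TT" for \<tau> \<tau>'
  proof (cases "\<tau> = \<tau>'")
    case False
    obtain v w where vw: "\<tau> = tp P M n v" "\<tau>' = tp P M n w" using tt by (auto simp: TT_def)
    from False consider f where "f \<in> \<tau>" "f \<notin> \<tau>'" | f where "f \<in> \<tau>'" "f \<notin> \<tau>" by blast
    then show ?thesis
    proof cases
      case (2 f)
      then have "Neg f \<in> \<tau>" "Neg f \<notin> \<tau>'" unfolding vw by (auto simp: tp_def)
      then show ?thesis by blast
    qed blast
  qed simp
  then have "\<forall>\<tau>\<in>TT. \<forall>\<tau>'\<in>TT. \<exists>f. \<tau> \<noteq> \<tau>' \<longrightarrow> f \<in> \<tau> \<and> f \<notin> \<tau>'" by blast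
  then obtain F where F: "\<And>\<tau> \<tau>'. \<tau> \<in> TT \<Longrightarrow> \<tau>' \<in> TT \<Longrightarrow> \<tau> \<noteq> \<tau>' \<Longrightarrow> F \<tau> \<tau>' \<in> \<tau> \<and> F \<tau> \<tau>' \<notin> \<tau>'" by metis
  define \<theta> where "\<theta> \<tau> = conjs (map (F \<tau>) (filter (\<lambda>\<tau>'. \<tau>' \<noteq> \<tau>) ts))" for \<tau>
  show ?thesis
  proof (intro exI[of _ \<theta>] allI impI conjI)
    fix v :: "nat \<Rightarrow> 'a" assume v: "range v \<subseteq> univ M"
    define \<tau> where "\<tau> = tp P M n v"
    have \<tau>: "\<tau> \<in> TT" using v by (auto simp: \<tau>_def TT_def)
    have mem: "fvars f \<subseteq> {..<n} \<and> set_form f \<subseteq> P" if "f \<in> \<tau>" for f using that by (auto simp: \<tau>_def tp_def)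
    have "fvars (\<theta> \<tau>) \<subseteq> {..<n}" "set_form (\<theta> \<tau>) \<subseteq> P"
      unfolding \<theta>_def using F[OF \<tau>] mem ts by fastforce+
    then show "fvars (\<theta> (tp P M n v)) \<subseteq> {..<n}" "set_form (\<theta> (tp P M n v)) \<subseteq> P" by (simp_all add: \<tau>_def)
    fix w :: "nat \<Rightarrow> 'a" assume w: "range w \<subseteq> univ M"
    have s: "sat M w (\<theta> \<tau>) \<longleftrightarrow> (\<forall>\<tau>'\<in>TT. \<tau>' \<noteq> \<tau> \<longrightarrow> sat M w (F \<tau> \<tau>'))"
      unfolding \<theta>_def using ts by auto
    have "sat M w (\<theta> \<tau>) \<longleftrightarrow> tp P M n w = \<tau>"
    proof
      assume "sat M w (\<theta> \<tau>)"
      then have *: "\<forall>\<tau>'\<in>TT. \<tau>' \<noteq> \<tau> \<longrightarrow> sat M w (F \<tau> \<tau>')" using s by simp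
      have wT: "tp P M n w \<in> TT" using w by (auto simp: TT_def)
      show "tp P M n w = \<tau>"
      proof (rule ccontr)
        assume n: "tp P M n w \<noteq> \<tau>"
        then have "F \<tau> (tp P M n w) \<in> \<tau>" "F \<tau> (tp P M n w) \<notin> tp P M n w" using F[OF \<tau> wT] by auto
        then show False using mem * wT n by (auto simp: tp_def)
      qed
    next
      assume e: "tp P M n w = \<tau>"
      have "sat M w f" if "f \<in> \<tau>" for f using that e by (auto simp: tp_def)
      then show "sat M w (\<theta> \<tau>)" using s F[OF \<tau>] by metis
    qed
    then show "sat M w (\<theta> (tp P M n v)) \<longleftrightarrow> tp P M n w = tp P M n v" by (simp add: \<tau>_def)
  qed
qed

text \<open>A back-and-forth between tuples of the same type. That \<open>N\<close> has no other
  types than \<open>M\<close> follows from formulas valid in \<open>M\<close>: an isolating formula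
  implies every formula of its type, and the finitely many isolating formulas exhaust all
  tuples.\<close>

lemma finite_types_iso:
  fixes M :: "('a, 'p) pstruct" and N :: "('b, 'p) pstruct"
  assumes M: "is_pstruct P M" "countable (univ M)" and N: "is_pstruct P N" "countable (univ N)"
    and eq: "elem_equiv P M N" and fin: "\<And>n. finite (tp P M n ` {v. range v \<subseteq> univ M})"
  shows "pstruct_iso P M N"
proof -
  have zM: "zer M \<in> univ M" and zN: "zer N \<in> univ N" using M N by (auto simp: is_pstruct_def)
  define st where "st n v w \<longleftrightarrow> range v \<subseteq> univ M \<and> range w \<subseteq> univ N \<and> tp P M n v = tp P N n w"
    for n and v :: "nat \<Rightarrow> 'a" and w :: "nat \<Rightarrow> 'b"
  obtain \<theta> where \<theta>: "\<And>n v. range v \<subseteq> univ M \<Longrightarrow> fvars (\<theta> n (tp P M n v)) \<subseteq> {..<n} \<and> set_form (\<theta> n (tp P M n v)) \<subseteq> P \<and>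
    (\<forall>w. range w \<subseteq> univ M \<longrightarrow> (sat M w (\<theta> n (tp P M n v)) \<longleftrightarrow> tp P M n w = tp P M n v))"
  proof -
    have "\<forall>n. \<exists>\<theta>. \<forall>v. range v \<subseteq> univ M \<longrightarrow> fvars (\<theta> (tp P M n v)) \<subseteq> {..<n} \<and> set_form (\<theta> (tp P M n v)) \<subseteq> P \<and>
      (\<forall>w. range w \<subseteq> univ M \<longrightarrow> (sat M w (\<theta> (tp P M n v)) \<longleftrightarrow> tp P M n w = tp P M n v))"
      using isolating_formulas[OF fin] by blast
    from choice[OF this] show ?thesis using that by blast
  qed
  have \<theta>w: "sat M w (\<theta> n (tp P M n v)) \<longleftrightarrow> tp P M n w = tp P M n v"
    if "range v \<subseteq> univ M" "range w \<subseteq> univ M" for v w n using \<theta>[OF that(1), of n] that(2) by blast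
  have key: "tp P M n v = tp P N n w"
    if v: "range v \<subseteq> univ M" and w: "range w \<subseteq> univ N" and s: "sat N w (\<theta> n (tp P M n v))" for n v w
  proof -
    have sub: "f \<in> tp P N n w" if f: "f \<in> tp P M n v" for f
    proof -
      define g where "g = Neg (Conj (\<theta> n (tp P M n v)) (Neg f))"
      have fv: "fvars g \<subseteq> {..<n}" "set_form g \<subseteq> P" using \<theta>[OF v, of n] f by (auto simp: g_def tp_def)
      have "sat M u g" if "range u \<subseteq> univ M" for u
      proof (cases "tp P M n u = tp P M n v")
        case True
        then have "f \<in> tp P M n u" using f by simp
        then show ?thesis by (simp add: g_def tp_def)
      next
        case False
        then show ?thesis using \<theta>w[OF v that] by (simp add: g_def)
      qed
      then have "holds N g" using elem_equiv_open[OF eq fv] by (auto simp: holds_def)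
      then have "sat N w g" using w by (auto simp: holds_def)
      then show ?thesis using s f by (auto simp: g_def tp_def)
    qed
    moreover have "f \<in> tp P M n v" if f: "f \<in> tp P N n w" for f
    proof (rule ccontr)
      assume "f \<notin> tp P M n v"
      then have "Neg f \<in> tp P M n v" using f by (auto simp: tp_def)
      then have "Neg f \<in> tp P N n w" by (rule sub)
      then show False using f by (auto simp: tp_def)
    qed
    ultimately show ?thesis by blast
  qed
  have st0: "st 0 (\<lambda>_. zer M) (\<lambda>_. zer N)"
  proof -
    have "sat M (\<lambda>_. zer M) f = sat N (\<lambda>_. zer N) f" if "fvars f = {}" "set_form f \<subseteq> P" for f
      using eq that holds_closed[OF that(1) zM] holds_closed[OF that(1) zN]
      unfolding elem_equiv_def sentence_def by blast
    then show ?thesis using zM zN by (auto simp: st_def tp_def)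
  qed
  have rngM: "range (u(n := a)) \<subseteq> univ M" if "range u \<subseteq> univ M" "a \<in> univ M" for u and n :: nat and a using that by auto
  have rngN: "range (u(n := a)) \<subseteq> univ N" if "range u \<subseteq> univ N" "a \<in> univ N" for u and n :: nat and a using that by auto
  have forth: "\<exists>b\<in>univ N. st (Suc n) (v(n := a)) (w(n := b))" if st: "st n v w" and a: "a \<in> univ M" for n v w a
  proof -
    have v: "range v \<subseteq> univ M" and w: "range w \<subseteq> univ N" and t: "tp P M n v = tp P N n w" using st by (auto simp: st_def)
    let ?v = "v(n := a)"
    let ?\<theta> = "\<theta> (Suc n) (tp P M (Suc n) ?v)"
    have v': "range ?v \<subseteq> univ M" using rngM[OF v a] .
    have "sat M v (Ex n ?\<theta>)" using a \<theta>w[OF v' v', of "Suc n"] by auto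
    moreover have "fvars (Ex n ?\<theta>) \<subseteq> {..<n}" "set_form (Ex n ?\<theta>) \<subseteq> P"
      using \<theta>[OF v', of "Suc n"] by (auto simp: less_Suc_eq)
    ultimately have "Ex n ?\<theta> \<in> tp P N n w" unfolding t[symmetric] by (simp add: tp_def)
    then obtain b where b: "b \<in> univ N" "sat N (w(n := b)) ?\<theta>" by (auto simp: tp_def)
    have "tp P M (Suc n) ?v = tp P N (Suc n) (w(n := b))" using key[OF v' rngN[OF w b(1)] b(2)] .
    then show ?thesis unfolding st_def using b(1) v' rngN[OF w b(1)] by (intro bexI[of _ b] conjI)
  qed
  have retro: "\<exists>a\<in>univ M. st (Suc n) (v(n := a)) (w(n := b))" if st: "st n v w" and b: "b \<in> univ N" for n v w b
  proof -
    have v: "range v \<subseteq> univ M" and w: "range w \<subseteq> univ N" and t: "tp P M n v = tp P N n w" using st by (auto simp: st_def)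
    let ?w = "w(n := b)"
    have w': "range ?w \<subseteq> univ N" using rngN[OF w b] .
    define TT where "TT = tp P M (Suc n) ` {v. range v \<subseteq> univ M}"
    obtain ts where ts: "set ts = TT" using finite_list[OF fin] unfolding TT_def by blast
    define g where "g = Neg (conjs (map (\<lambda>\<tau>. Neg (\<theta> (Suc n) \<tau>)) ts))"
    have "fvars (\<theta> (Suc n) \<tau>) \<subseteq> {..<Suc n} \<and> set_form (\<theta> (Suc n) \<tau>) \<subseteq> P" if "\<tau> \<in> TT" for \<tau>
      using that \<theta>[of _ "Suc n"] unfolding TT_def by blast
    then have fv: "fvars g \<subseteq> {..<Suc n}" "set_form g \<subseteq> P" using ts by (auto simp: g_def)
    have "sat M u g" if u: "range u \<subseteq> univ M" for u
    proof -
      have "tp P M (Suc n) u \<in> TT" "sat M u (\<theta> (Suc n) (tp P M (Suc n) u))" using u \<theta>w[OF u u] by (auto simp: TT_def)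
      then show ?thesis using ts by (auto simp: g_def)
    qed
    then have "holds N g" using elem_equiv_open[OF eq fv] by (auto simp: holds_def)
    then have "sat N ?w g" using w' unfolding holds_def by blast
    then obtain \<tau> where \<tau>: "\<tau> \<in> TT" "sat N ?w (\<theta> (Suc n) \<tau>)" using ts by (auto simp: g_def)
    then obtain v0 where v0: "range v0 \<subseteq> univ M" "\<tau> = tp P M (Suc n) v0" by (auto simp: TT_def)
    let ?\<theta> = "\<theta> (Suc n) (tp P M (Suc n) v0)"
    have "sat N w (Ex n ?\<theta>)" using b \<tau>(2) v0(2) by auto
    moreover have "fvars (Ex n ?\<theta>) \<subseteq> {..<n}" "set_form (Ex n ?\<theta>) \<subseteq> P"
      using \<theta>[OF v0(1), of "Suc n"] by (auto simp: less_Suc_eq)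
    ultimately have "Ex n ?\<theta> \<in> tp P M n v" unfolding t by (simp add: tp_def)
    then obtain a where a: "a \<in> univ M" "sat M (v(n := a)) ?\<theta>" by (auto simp: tp_def)
    have v': "range (v(n := a)) \<subseteq> univ M" using rngM[OF v a(1)] .
    have "tp P M (Suc n) (v(n := a)) = tp P M (Suc n) v0" using \<theta>w[OF v0(1) v'] a(2) by simp
    also have "\<dots> = tp P N (Suc n) ?w" using key[OF v0(1) w'] \<tau>(2) v0(2) by simp
    finally show ?thesis unfolding st_def using a(1) v' w' by (intro bexI[of _ a] conjI)
  qed
  define eM where "eM = from_nat_into (univ M)"
  define eN where "eN = from_nat_into (univ N)"
  have eM: "range eM = univ M" unfolding eM_def using zM M(2) by (intro range_from_nat_into) auto
  have eN: "range eN = univ N" unfolding eN_def using zN N(2) by (intro range_from_nat_into) auto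
  \<comment> \<open>Each step adds one entry to both tuples; it is prescribed in \<open>M\<close> at
    even and in \<open>N\<close> at odd stages.\<close>
  define Q where "Q n x y \<longleftrightarrow> (\<forall>i<n. fst y i = fst x i \<and> snd y i = snd x i) \<and>
    (even n \<longrightarrow> fst y n = eM (n div 2)) \<and> (odd n \<longrightarrow> snd y n = eN (n div 2))" for n x y
  have "\<exists>F. \<forall>n. st n (fst (F n)) (snd (F n)) \<and> Q n (F n) (F (Suc n))"
  proof (rule dependent_nat_choice)
    show "\<exists>x. st 0 (fst x) (snd x)" using st0 by (intro exI[of _ "(\<lambda>_. zer M, \<lambda>_. zer N)"]) simp
    fix x n assume x: "st n (fst x) (snd x)"
    show "\<exists>y. st (Suc n) (fst y) (snd y) \<and> Q n x y"
    proof (cases "even n")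
      case True
      have "eM (n div 2) \<in> univ M" using eM by blast
      from forth[OF x this] obtain b where "st (Suc n) ((fst x)(n := eM (n div 2))) ((snd x)(n := b))" by blast
      then show ?thesis using True
        by (intro exI[of _ "((fst x)(n := eM (n div 2)), (snd x)(n := b))"]) (auto simp: Q_def)
    next
      case False
      have "eN (n div 2) \<in> univ N" using eN by blast
      from retro[OF x this] obtain a where "st (Suc n) ((fst x)(n := a)) ((snd x)(n := eN (n div 2)))" by blast
      then show ?thesis using False
        by (intro exI[of _ "((fst x)(n := a), (snd x)(n := eN (n div 2)))"]) (auto simp: Q_def)
    qed
  qed
  then obtain F where F: "\<And>n. st n (fst (F n)) (snd (F n))" "\<And>n. Q n (F n) (F (Suc n))" by blast
  define V where "V i = fst (F (Suc i)) i" for i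
  define W where "W i = snd (F (Suc i)) i" for i
  have agree: "\<forall>i<n. fst (F n) i = V i \<and> snd (F n) i = W i" for n
  proof (induction n)
    case (Suc n)
    then show ?case using F(2)[of n] by (auto simp: Q_def V_def W_def less_Suc_eq)
  qed simp
  have VM: "V i \<in> univ M" and WN: "W i \<in> univ N" for i using F(1)[of "Suc i"] by (auto simp: st_def V_def W_def)
  have VW: "sat M V f = sat N W f" if f: "set_form f \<subseteq> P" for f
  proof -
    obtain n where n: "fvars f \<subseteq> {..<n}" using finite_fvars[of f] finite_nat_iff_bounded by blast
    have "sat M V f = sat M (fst (F n)) f" using agree[of n] n by (intro sat_cong) auto
    also have "\<dots> = sat N (snd (F n)) f"
    proof -
      have "f \<in> tp P M n (fst (F n)) \<longleftrightarrow> f \<in> tp P N n (snd (F n))" using F(1)[of n] by (simp add: st_def)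
      then show ?thesis using n f by (simp add: tp_def)
    qed
    also have "\<dots> = sat N W f" using agree[of n] n by (intro sat_cong) auto
    finally show ?thesis .
  qed
  have surjM: "\<exists>i. a = V i" if a: "a \<in> univ M" for a
  proof -
    obtain k where "a = eM k" using a eM by blast
    then have "a = V (2 * k)" using F(2)[of "2 * k"] by (simp add: Q_def V_def)
    then show ?thesis by blast
  qed
  have surjN: "\<exists>i. b = W i" if b: "b \<in> univ N" for b
  proof -
    obtain k where "b = eN k" using b eN by blast
    then have "b = W (Suc (2 * k))" using F(2)[of "Suc (2 * k)"] by (simp add: Q_def W_def)
    then show ?thesis by blast
  qed
  have veq: "V i = V j \<longleftrightarrow> W i = W j" for i j using VW[of "Eq (Var i) (Var j)"] by simp
  define h where "h a = W (SOME i. a = V i)" for a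
  have h: "h (V i) = W i" for i
  proof -
    have "V i = V (SOME j. V i = V j)" by (rule someI_ex) blast
    then show ?thesis using veq by (simp add: h_def)
  qed
  show ?thesis unfolding pstruct_iso_def
  proof (intro exI[of _ h] conjI ballI)
    show "bij_betw h (univ M) (univ N)" unfolding bij_betw_def
    proof
      show "inj_on h (univ M)"
      proof (rule inj_onI)
        fix a b assume ab: "a \<in> univ M" "b \<in> univ M" "h a = h b"
        obtain i j where "a = V i" "b = V j" using surjM ab by blast
        then show "a = b" using ab(3) h veq by simp
      qed
      show "h ` univ M = univ N"
      proof (intro set_eqI iffI)
        fix b assume "b \<in> h ` univ M"
        then obtain a where "a \<in> univ M" "b = h a" by blast
        moreover from this obtain i where "a = V i" using surjM by blast
        ultimately show "b \<in> univ N" using h WN by simp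
      next
        fix b assume "b \<in> univ N"
        then obtain i where "b = W i" using surjN by blast
        then have "b = h (V i)" using h by simp
        then show "b \<in> h ` univ M" using VM by blast
      qed
    qed
    obtain i where i: "zer M = V i" using surjM zM by blast
    then show "h (zer M) = zer N" using h VW[of "Eq (Var i) Zero"] by simp
  next
    fix a b assume ab: "a \<in> univ M" "b \<in> univ M"
    obtain i j where ij: "a = V i" "b = V j" using surjM ab by blast
    have "add M a b \<in> univ M" "mul M a b \<in> univ M" using M(1) ab by (auto simp: is_pstruct_def)
    then obtain k l where kl: "add M a b = V k" "mul M a b = V l" using surjM by blast
    show "h (add M a b) = add N (h a) (h b)"
      using VW[of "Eq (Plus (Var i) (Var j)) (Var k)"] kl(1) h ij by simp
    show "h (mul M a b) = mul N (h a) (h b)"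
      using VW[of "Eq (Times (Var i) (Var j)) (Var l)"] kl(2) h ij by simp
  next
    fix p a assume pa: "p \<in> P" "a \<in> univ M"
    obtain i where i: "a = V i" using surjM pa by blast
    show "a \<in> pred M p \<longleftrightarrow> h a \<in> pred N p" using VW[of "Pred p (Var i)"] pa(1) h i by simp
  qed
qed

lemma finite_types_omega_categorical:
  fixes M :: "('a, 'p) pstruct"
  assumes M: "is_pstruct P M" "countable (univ M)"
    and fin: "\<And>n. finite (tp P M n ` {v. range v \<subseteq> univ M})"
  shows "omega_categorical P M"
proof -
  obtain N :: "(nat, 'p) pstruct" where N: "is_pstruct P N" "pstruct_iso P M N"
    using countable_pstruct_copy[OF M] by blast
  have "countable_model P (Th P M) N" unfolding countable_model_def
    using N(1) elem_equiv_imp_holds_Th[OF pstruct_iso_imp_elem_equiv[OF M(1) N(2)]] by auto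
  moreover have "pstruct_iso P N' N" if N': "countable_model P (Th P M) N'" for N' :: "(nat, 'p) pstruct"
  proof -
    have "is_pstruct P N'" "\<forall>f\<in>Th P M. holds N' f" using N' by (auto simp: countable_model_def)
    then have "pstruct_iso P M N'"
      using holds_Th_imp_elem_equiv[OF M(1)] by (intro finite_types_iso[OF M _ _ _ fin]) auto
    then show ?thesis using pstruct_iso_sym[OF M(1)] pstruct_iso_trans N(2) by blast
  qed
  ultimately show ?thesis unfolding omega_categorical_def using M(2) by blast
qed

section \<open>The finite-crowded case, and the case distinction for the converse\<close>

context cpart begin

text \<open>The structure is played against itself, every block having its own type and
  \<open>Infty\<close> being the only fixed point. Tuples with equal \<open>data\<close> are in
  matching positions for every number of moves, so \<open>data\<close> determines the complete
  type.\<close>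

lemma omega_categorical_if:
  assumes fP: "finite P" and fB: "\<And>p. p \<in> P \<Longrightarrow> \<not> lt p p \<Longrightarrow> finite (B p)"
  shows "omega_categorical P (ring_struct bare.fld Infty (\<lambda>p. Pt ` B p))"
proof -
  let ?M = "ring_struct bare.fld Infty (\<lambda>p. Pt ` B p)"
  let ?H = "insert Infty (Pt ` ({} :: 'x set))"
  let ?t = "bare.ptyp P (\<lambda>_. P)"
  have finT: "finite (T A)" for A using fP T_sub finite_subset by blast
  have rX: "region X P P True" unfolding region_def
  proof (intro conjI ballI impI)
    show "X \<subseteq> X" "P \<subseteq> P" "P \<subseteq> P" by auto
    show "up p \<subseteq> P" for p by (rule up_sub)
    fix x assume x: "x \<in> X"
    obtain A where A: "A \<in> R" "x \<in> A" using R_cover[OF x] by blast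
    then show "\<exists>A\<in>R. x \<in> A \<and> A \<subseteq> X" using R_sub by blast
    obtain D where "D \<in> R" "x \<in> D" "D \<subseteq> A" "T D = up (blk x)" by (rule trim_exists[OF A finT])
    then show "\<exists>A\<in>R. x \<in> A \<and> T A \<subseteq> up (blk x)" by blast
  qed (simp_all add: blk(1))
  have TF: "typed_field bare.pts bare.fld ?H ?t (ple P) (dst True) (Some ` P)"
    by (rule bare.typed_region) (use rX in \<open>auto intro!: region_empty up_sub simp: subset_iff up_def\<close>)
  interpret tf: typed_field bare.pts bare.fld ?H ?t "ple P" "dst True" "Some ` P" by (rule TF)
  have ppts: "w \<in> bare.pts - ?H \<longleftrightarrow> (\<exists>x\<in>X. w = Pt x)" for w by (cases w) auto
  have tP: "?t w \<in> Some ` P" if w: "w \<in> bare.pts - ?H" for w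
  proof -
    obtain x where "x \<in> X" "w = Pt x" using w unfolding ppts by blast
    then show ?thesis using blk(1) by (simp add: kap_def)
  qed
  have cls: "tf.cls (Some p) = Pt ` B p" if p: "p \<in> P" for p
  proof (rule set_eqI)
    fix w
    have "w \<in> tf.cls (Some p) \<longleftrightarrow> (\<exists>x\<in>X. w = Pt x \<and> blk x = p)"
      using ppts[of w] p unfolding tf.cls_def by (auto simp: kap_cases)
    also have "\<dots> \<longleftrightarrow> w \<in> Pt ` B p" using blk_eq[OF p] blk(2) block_sub[OF p] by blast
    finally show "w \<in> tf.cls (Some p) \<longleftrightarrow> w \<in> Pt ` B p" .
  qed
  interpret tp: typed_pair bare.pts bare.pts bare.fld bare.fld ?H ?t ?t "ple P" "dst True" "Some ` P" "\<lambda>_. Some ` P"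
  proof
    show "finite (Some ` P)" using fP by simp
    show "\<exists>a\<in>Some ` P. ple P (?t y) a" if "y \<in> bare.pts" "y \<notin> ?H" for y
      using tP[of y] that ple_refl by blast
    show "\<exists>z\<in>A - ?H. ?t z \<notin> Some ` P \<and> (\<forall>a\<in>Some ` P. ple P (?t y) a \<longrightarrow> ple P (?t z) a)"
      if "W \<in> bare.fld" "y \<in> W - ?H" "?t y \<notin> Some ` P" for A W y
      using tP[of y] that bare.sets_into_space[OF that(1)] by blast
    then show "\<exists>z\<in>A - ?H. ?t z \<notin> Some ` P \<and> (\<forall>a\<in>Some ` P. ple P (?t y) a \<longrightarrow> ple P (?t z) a)"
      if "W \<in> bare.fld" "y \<in> W - ?H" "?t y \<notin> Some ` P" for A W y using that .
  qed (rule order_refl | rule refl | (rule bexI, rule refl, assumption))+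
  interpret cp: coloured_pair bare.pts bare.pts bare.fld bare.fld ?H ?t ?t "ple P" "dst True" "Some ` P" "\<lambda>_. Some ` P"
    Infty "\<lambda>p. Pt ` B p" "\<lambda>p. Pt ` B p" P "\<lambda>p. {Some p}"
  proof
    show "Infty \<in> ?H" by simp
    show "{Some p} \<subseteq> Some ` P" if "p \<in> P" for p using that by simp
    fix p A assume p: "p \<in> P"
    have "Pt ` B p - ?H = Pt ` B p" by auto
    then show "A \<inter> (Pt ` B p - ?H) = {} \<longleftrightarrow> (\<forall>a\<in>{Some p}. A \<inter> tf.cls a = {})"
      using cls[OF p] by simp
  qed (rule refl)
  define cnt where "cnt S = (if finite S then Some (card S) else None)" for S :: "'x pt set"
  define cell where "cell n v \<sigma> = {y \<in> bare.pts. \<forall>i<n. y \<in> v i \<longleftrightarrow> i \<in> \<sigma>}" for n :: nat and v :: "nat \<Rightarrow> 'x pt set" and \<sigma>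
  define data where "data n v = (\<lambda>\<sigma>\<in>Pow {..<n}. (Infty \<in> cell n v \<sigma>, \<lambda>p\<in>P. cnt (cell n v \<sigma> \<inter> Pt ` B p)))" for n v
  have cell_fld: "cell n v \<sigma> \<in> bare.fld" if v: "range v \<subseteq> univ ?M" for n v \<sigma>
  proof (induction n)
    case 0
    then show ?case by (simp add: cell_def bare.top)
  next
    case (Suc n)
    have "cell (Suc n) v \<sigma> = (if n \<in> \<sigma> then cell n v \<sigma> \<inter> v n else cell n v \<sigma> - v n)"
      by (auto simp: cell_def less_Suc_eq)
    moreover have "v n \<in> bare.fld" using v by auto
    ultimately show ?case using Suc by auto
  qed
  have same: "tp P ?M n v = tp P ?M n w"
    if vw: "range v \<subseteq> univ ?M" "range w \<subseteq> univ ?M" "data n v = data n w" for n v w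
  proof -
    have rel: "tp.rel m (cell n v \<sigma>) (cell n w \<sigma>)" if \<sigma>: "\<sigma> \<subseteq> {..<n}" for m \<sigma>
    proof -
      have d: "(Infty \<in> cell n v \<sigma>, \<lambda>p\<in>P. cnt (cell n v \<sigma> \<inter> Pt ` B p)) =
          (Infty \<in> cell n w \<sigma>, \<lambda>p\<in>P. cnt (cell n w \<sigma> \<inter> Pt ` B p))"
        using fun_cong[OF vw(3), of \<sigma>] \<sigma> by (simp add: data_def)
      have "same_count k (cell n v \<sigma> \<inter> tf.cls a) (cell n w \<sigma> \<inter> tf.cls a)" if a: "a \<in> Some ` P" for a k
      proof -
        obtain p where p: "p \<in> P" "a = Some p" using a by blast
        have "(\<lambda>p\<in>P. cnt (cell n v \<sigma> \<inter> Pt ` B p)) p = (\<lambda>p\<in>P. cnt (cell n w \<sigma> \<inter> Pt ` B p)) p" using d by simp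
        then have "cnt (cell n v \<sigma> \<inter> tf.cls a) = cnt (cell n w \<sigma> \<inter> tf.cls a)" using p cls by simp
        then show ?thesis unfolding cnt_def
          by (cases "finite (cell n v \<sigma> \<inter> tf.cls a)"; cases "finite (cell n w \<sigma> \<inter> tf.cls a)")
            (auto intro: same_count_card same_count_infinite)
      qed
      then show ?thesis unfolding tp.rel_def using cell_fld vw d by auto
    qed
    have "\<exists>h. bij_betw h {0..<card (Pow {..<n})} (Pow {..<n})" by (rule ex_bij_betw_nat_finite) simp
    then obtain h where h0: "bij_betw h {0..<card (Pow {..<n})} (Pow {..<n})" by blast
    define k where "k = card (Pow {..<n})"
    have h: "bij_betw h {..<k} (Pow {..<n})" using h0 by (simp add: k_def lessThan_atLeast0)
    have hP: "h i \<subseteq> {..<n}" if "i < k" for i using bij_betwE[OF h] that by blast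
    have pos: "cp.ef.position m {..<n} v w" for m
    proof (rule cp.ef.positionI[where k = k and A = "\<lambda>i. cell n v (h i)" and B = "\<lambda>i. cell n w (h i)" and I = "\<lambda>j. {i \<in> {..<k}. j \<in> h i}"])
      show "tp.rel m (cell n v (h i)) (cell n w (h i))" if "i < k" for i using rel hP[OF that] .
      have dj: "disjoint_family_on (\<lambda>i. cell n u (h i)) {..<k}" for u unfolding disjoint_family_on_def
      proof (intro ballI impI)
        fix i j assume ij: "i \<in> {..<k}" "j \<in> {..<k}" "i \<noteq> j"
        then have "h i \<noteq> h j" using bij_betw_imp_inj_on[OF h] by (auto simp: inj_on_def)
        then obtain l where l: "l < n" "l \<in> h i \<longleftrightarrow> l \<notin> h j" using hP[of i] hP[of j] ij by blast
        then show "cell n u (h i) \<inter> cell n u (h j) = {}" by (auto simp: cell_def)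
      qed
      show "disjoint_family_on (\<lambda>i. cell n v (h i)) {..<k}" "disjoint_family_on (\<lambda>i. cell n w (h i)) {..<k}"
        by (rule dj)+
      have incell: "\<exists>i<k. y \<in> cell n u (h i)" if y: "y \<in> bare.pts" for u y
      proof -
        have "{i. i < n \<and> y \<in> u i} \<in> h ` {..<k}" using bij_betw_imp_surj_on[OF h] by auto
        then obtain i where i: "i < k" "{i. i < n \<and> y \<in> u i} = h i" by auto
        then have "y \<in> cell n u (h i)" using y by (auto simp: cell_def)
        then show ?thesis using i by blast
      qed
      have un: "(\<Union>i<k. cell n u (h i)) = bare.pts" for u
      proof
        show "(\<Union>i<k. cell n u (h i)) \<subseteq> bare.pts" by (auto simp: cell_def)
        show "bare.pts \<subseteq> (\<Union>i<k. cell n u (h i))" using incell[of _ u] by blast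
      qed
      show "(\<Union>i<k. cell n v (h i)) = bare.pts" "(\<Union>i<k. cell n w (h i)) = bare.pts" by (rule un)+
      show "{i \<in> {..<k}. j \<in> h i} \<subseteq> {..<k}" for j by blast
      have cov: "u j = (\<Union>i\<in>{i \<in> {..<k}. j \<in> h i}. cell n u (h i))" if u: "range u \<subseteq> univ ?M" and j: "j \<in> {..<n}" for u j
      proof -
        have "u j \<in> bare.fld" using u by auto
        then have "u j \<subseteq> bare.pts" by (rule bare.sets_into_space)
        then have "y \<in> (\<Union>i\<in>{i \<in> {..<k}. j \<in> h i}. cell n u (h i))" if y: "y \<in> u j" for y
        proof -
          obtain i where i: "i < k" "y \<in> cell n u (h i)" using incell[of y u] y \<open>u j \<subseteq> bare.pts\<close> by blast
          then have "j \<in> h i" using y j by (simp add: cell_def)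
          then show ?thesis using i by blast
        qed
        moreover have "y \<in> u j" if "y \<in> cell n u (h i)" "j \<in> h i" for y i
          using that j by (simp add: cell_def)
        ultimately show ?thesis by blast
      qed
      show "v j = (\<Union>i\<in>{i \<in> {..<k}. j \<in> h i}. cell n v (h i))" if "j \<in> {..<n}" for j using cov[OF vw(1) that] .
      show "w j = (\<Union>i\<in>{i \<in> {..<k}. j \<in> h i}. cell n w (h i))" if "j \<in> {..<n}" for j using cov[OF vw(2) that] .
    qed
    have "sat ?M v f = sat ?M w f" if "fvars f \<subseteq> {..<n}" "set_form f \<subseteq> P" for f
      using cp.ef.sat_position[OF pos order_refl that] .
    then show ?thesis by (auto simp: tp_def)
  qed
  have fin: "finite (tp P ?M n ` {v. range v \<subseteq> univ ?M})" for n
  proof -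
    let ?V = "{v. range v \<subseteq> univ ?M}"
    let ?Z = "PiE (Pow {..<n}) (\<lambda>_. (UNIV :: bool set) \<times> PiE P (\<lambda>p. insert None (Some ` {..card (B p)})))"
    have "data n ` ?V \<subseteq> ?Z"
    proof
      fix d assume "d \<in> data n ` ?V"
      then obtain v where v: "range v \<subseteq> univ ?M" "d = data n v" by blast
      \<comment> \<open>A crowded block meets a set of the field in no or in infinitely many points
        and so admits two counts only; a discrete block is finite by assumption. Hence
        \<open>data\<close> has finitely many values.\<close>
      have "cnt (A \<inter> Pt ` B p) \<in> insert None (Some ` {..card (B p)})" if A: "A \<in> bare.fld" and p: "p \<in> P" for A p
      proof (cases "lt p p")
        case True
        then have "A \<inter> tf.cls (Some p) = {} \<or> infinite (A \<inter> tf.cls (Some p))"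
          using tf.crowded_or_empty[OF A, of "Some p"] p by auto
        then show ?thesis unfolding cls[OF p] by (auto simp: cnt_def)
      next
        case False
        then have f: "finite (Pt ` B p)" using fB[OF p] by simp
        then have "card (A \<inter> Pt ` B p) \<le> card (B p)"
          by (metis card_image_le card_mono fB[OF p False] inf_le2 le_trans)
        then show ?thesis using f by (auto simp: cnt_def)
      qed
      then show "d \<in> ?Z" unfolding v(2) data_def using cell_fld[OF v(1)] by (auto intro!: restrict_PiE_iff[THEN iffD2])
    qed
    moreover have "finite ?Z" using fP by (intro finite_PiE finite_cartesian_product) auto
    ultimately have fd: "finite (data n ` ?V)" using finite_subset by blast
    have "tp P ?M n ` ?V \<subseteq> (\<lambda>d. tp P ?M n (SOME v. v \<in> ?V \<and> data n v = d)) ` (data n ` ?V)"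
    proof
      fix \<tau> assume "\<tau> \<in> tp P ?M n ` ?V"
      then obtain v where v: "v \<in> ?V" "\<tau> = tp P ?M n v" by blast
      define w where "w = (SOME w. w \<in> ?V \<and> data n w = data n v)"
      have "w \<in> ?V \<and> data n w = data n v" unfolding w_def by (rule someI[of _ v]) (use v in simp)
      then have "\<tau> = tp P ?M n w" using same[of w v n] v by auto
      then show "\<tau> \<in> (\<lambda>d. tp P ?M n (SOME v. v \<in> ?V \<and> data n v = d)) ` (data n ` ?V)"
        unfolding w_def using v(1) by blast
    qed
    then show ?thesis using fd finite_subset by blast
  qed
  have c: "countable (univ ?M)" using bare.countable_fld countable_subset[of _ bare.fld] by auto
  show ?thesis by (rule finite_types_omega_categorical[OF is_pstruct_ring_struct[OF bare.algebra_axioms] c fin])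
qed

text \<open>If \<open>PO\<close> is finite and \<open>P\<close> is not, a point outside
  \<open>Ost\<close> with the fewest blocks of \<open>PO\<close> above it leads to
  \<open>tame\<close>: the set \<open>s\<close> of these blocks is constant nearby. If
  \<open>no_cover\<close> holds and \<open>s = up g\<close> for a crowded \<open>g\<close>, the
  question is whether every element meeting some \<open>B b\<close> contains one that meets exactly
  \<open>s\<close>; whatever the answer for the ring, an equivalent structure gives the opposite
  one.\<close>

lemma finite_blocks_if_omega_categorical:
  assumes oc: "omega_categorical P (ring_struct bare.fld Infty (\<lambda>p. Pt ` B p))"
  shows "finite P"
proof (rule ccontr)
  assume inf: "infinite P"
  have PO: "finite PO" by (rule PO_finite_if[OF oc])
  then have "P - PO \<noteq> {}" by (rule infinite_diff_nonempty[OF inf])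
  then obtain p where p: "p \<in> P" "p \<notin> PO" by blast
  obtain x0 where "x0 \<in> B p" using block_nonempty[OF p(1)] by blast
  then have "x0 \<in> X - Ost" using block_sub[OF p(1)] blk_eq[OF p(1)] p(2) by (auto simp: PO_def)
  then obtain x where x: "x \<in> X - Ost"
    and xmin: "\<And>y. y \<in> X - Ost \<Longrightarrow> card (up (blk x) \<inter> PO) \<le> card (up (blk y) \<inter> PO)"
    using ex_has_least_nat[of "\<lambda>x. x \<in> X - Ost" x0 "\<lambda>x. card (up (blk x) \<inter> PO)"] by blast
  define s where "s = up (blk x) \<inter> PO"
  interpret t: tame R X P lt B s
  proof
    show "finite PO" by (rule PO)
    show "s \<subseteq> PO" by (simp add: s_def)
    show "up (blk y) \<inter> PO = s" if y: "y \<in> X - Ost" "up (blk y) \<inter> (PO - s) = {}" for y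
    proof (rule card_seteq)
      show "finite s" using PO by (simp add: s_def)
      show "up (blk y) \<inter> PO \<subseteq> s" using y(2) by blast
      show "card s \<le> card (up (blk y) \<inter> PO)" using xmin[OF y(1)] by (simp add: s_def)
    qed
    show "\<exists>x\<in>X - Ost. up (blk x) \<inter> (PO - s) = {}" using x by (intro bexI[of _ x]) (auto simp: s_def)
  qed
  show False
  proof (cases t.no_cover)
    case False
    then obtain V F where V: "V \<in> R" "V \<subseteq> t.VV" "V - Ost \<noteq> {}" "finite F" "F \<subseteq> P - PO"
      "\<not> (\<exists>x\<in>V - Ost. up (blk x) \<inter> F = {})" unfolding t.no_cover_def by blast
    show ?thesis by (rule t.covered_contradiction[OF oc V(1-5)]) (use V(6) in blast)
  next
    case nc: True
    show ?thesis
    proof (cases "\<exists>g\<in>P. lt g g \<and> s = up g")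
      case False
      then show ?thesis using t.uncovered_contradiction[OF oc nc] by blast
    next
      case True
      then obtain g where g: "g \<in> P" "lt g g" "s = up g" by blast
      interpret tg: tame_crowded R X P lt B s g
        by unfold_locales (use g self_up in auto)
      have "x \<in> t.VV" unfolding t.VV_def using x by (auto simp: s_def)
      moreover obtain A where "A \<in> R" "x \<in> A" using R_cover x by blast
      ultimately obtain V where V: "V \<in> R" "x \<in> V" "V \<subseteq> t.VV" using t.VV_open by blast
      have "infinite (blk ` (V - Ost) - PO)" using off_Ost_infinite[OF PO V(1,2)] x by blast
      then have "blk ` (V - Ost) - PO \<noteq> {}" by (rule infinite_imp_nonempty)
      then obtain y where y: "y \<in> V" "blk y \<notin> PO" by blast
      define b where "b = blk y"
      have yX: "y \<in> X" using R_sub[OF V(1)] y(1) by blast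
      have bP: "b \<in> P" "b \<notin> PO" using blk(1)[OF yX] y(2) by (auto simp: b_def)
      have "up b \<inter> (PO - s) = {}" using y(1) V(3) by (auto simp: t.VV_def b_def)
      then have bV: "B b \<subseteq> t.VV" using blk_eq[OF bP(1)] block_sub[OF bP(1)] by (auto simp: t.VV_def)
      show ?thesis
      proof (cases "\<exists>v\<in>R. v \<inter> B b \<noteq> {} \<and> (\<forall>a\<in>R. a \<subseteq> v \<longrightarrow> T a \<noteq> s)")
        case True
        then obtain v where v: "v \<in> R" "v \<inter> B b \<noteq> {}" "\<forall>a\<in>R. a \<subseteq> v \<longrightarrow> T a \<noteq> s" by blast
        show ?thesis by (rule tg.poor_contradiction[OF oc nc bP bV v(1,2)]) (use v(3) in blast)
      next
        case False
        show ?thesis by (rule tg.rich_contradiction[OF oc nc bP bV]) (use False in blast)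
      qed
    qed
  qed
qed

theorem omega_categorical_iff:
  "omega_categorical P (ring_struct bare.fld Infty (\<lambda>p. Pt ` B p)) \<longleftrightarrow>
     finite P \<and> (\<forall>p\<in>P. \<not> lt p p \<longrightarrow> finite (B p))"
  using omega_categorical_if finite_blocks_if_omega_categorical discrete_block_finite by blast

end

section \<open>Stone spaces\<close>

text \<open>In a compact neighbourhood \<open>K\<close> of \<open>x\<close> quasi-components are
  components, hence that of \<open>x\<close> is a single point. So \<open>x\<close> is separated
  from the compact set \<open>K - V\<close> by a clopen subset of \<open>K\<close>, which lies in
  the open set \<open>V\<close> and is therefore open in the whole space.\<close>

lemma compact_open_base:
  assumes H: "Hausdorff_space X" and L: "locally_compact_space X" and D: "totally_disconnected_space X"
    and W: "openin X W" "x \<in> W"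
  shows "\<exists>U. openin X U \<and> compactin X U \<and> x \<in> U \<and> U \<subseteq> W"
proof -
  obtain V K where V: "openin X V" "compactin X K" "x \<in> V" "V \<subseteq> K" "K \<subseteq> W"
    using locally_compact_space_neighbourhood_base[of X] H L W unfolding neighbourhood_base_of by blast
  have KX: "K \<subseteq> topspace X" by (rule compactin_subset_topspace[OF V(2)])
  let ?K = "subtopology X K"
  have tK: "topspace ?K = K" using KX by auto
  have xK: "x \<in> topspace ?K" using V tK by blast
  have cK: "compact_space ?K" by (rule compact_space_subtopology[OF V(2)])
  have hK: "Hausdorff_space ?K" by (rule Hausdorff_space_subtopology[OF H])
  let ?C = "quasi_component_of_set ?K x"
  have C: "?C \<in> quasi_components_of ?K" using xK by (auto simp: quasi_components_of_def)
  have "compactin ?K ?C" by (rule closedin_compact_space[OF cK closedin_quasi_component_of])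
  then have "?C \<in> connected_components_of ?K"
    using compact_quasi_eq_connected_components_of[OF compact_imp_locally_compact_space[OF cK] hK] C by blast
  then have "connectedin ?K ?C" by (rule connectedin_connected_components_of)
  then have "connectedin X ?C" by (simp add: connectedin_subtopology)
  then obtain y where "?C \<subseteq> {y}" using D unfolding totally_disconnected_space_def by blast
  moreover have xC: "x \<in> ?C" using xK by (simp add: quasi_component_of_refl)
  ultimately have Cx: "?C = {x}" by blast
  have "closedin X (K - V)" using compactin_imp_closedin[OF H V(2)] V(1) by (rule closedin_diff)
  then have "compactin X (K - V)" using closed_compactin[OF V(2)] by blast
  then have "compactin ?K (K - V)" by (simp add: compactin_subtopology)
  moreover have "disjnt ?C (K - V)" using Cx V(3) by (simp add: disjnt_def)
  ultimately have "separated_between ?K ?C (K - V)"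
    using separated_between_quasi_component_compact[OF C] by blast
  then obtain U U' where U: "openin ?K U" "openin ?K U'" "U \<union> U' = K" "U \<inter> U' = {}" "?C \<subseteq> U" "K - V \<subseteq> U'"
    unfolding separated_between_def tK disjnt_def by blast
  have UV: "U \<subseteq> V" using U(3,4,6) by blast
  obtain O' where O': "openin X O'" "U = O' \<inter> K" using U(1) unfolding openin_subtopology by blast
  have "U = O' \<inter> V" using O'(2) UV V(4) by blast
  then have "openin X U" using O'(1) V(1) by (simp add: openin_Int)
  moreover have "compactin X U"
  proof -
    have "U = topspace ?K - U'" using U(3,4) tK by blast
    then have "closedin ?K U" using closedin_diff[OF closedin_topspace U(2)] by (simp only:)
    then have "compactin ?K U" by (rule closedin_compact_space[OF cK])
    then show ?thesis by (simp add: compactin_subtopology)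
  qed
  moreover have "x \<in> U" "U \<subseteq> W" using U(5) xC UV V(4,5) by blast+
  ultimately show ?thesis by blast
qed

locale stone_partition =
  fixes X :: "'x topology" and \<phi> :: "'r::boolean_ring \<Rightarrow> 'x set" and P :: "'p set" and lt B
  assumes count: "countable (UNIV :: 'r set)"
    and stone: "stone_space X \<phi>"
    and PO_sys: "PO_system P lt"
    and part: "complete_partition X P lt B"
begin

definition CO where "CO = {A. openin X A \<and> compactin X A}"

lemma haus: "Hausdorff_space X" and bij: "bij_betw \<phi> UNIV CO"
  and phi_add: "\<phi> (a + b) = sym_diff (\<phi> a) (\<phi> b)" and phi_mult: "\<phi> (a * b) = \<phi> a \<inter> \<phi> b"
  using stone unfolding stone_space_def CO_def by auto

lemma base: "openin X W \<Longrightarrow> x \<in> W \<Longrightarrow> \<exists>A\<in>CO. x \<in> A \<and> A \<subseteq> W"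
proof -
  assume W: "openin X W" "x \<in> W"
  have "Hausdorff_space X" "locally_compact_space X" "totally_disconnected_space X"
    using stone by (auto simp: stone_space_def)
  from compact_open_base[OF this W] show ?thesis by (auto simp: CO_def)
qed

lemma indexed: "partition_on (topspace X) (B ` P)" "inj_on B P"
  using part by (auto simp: complete_partition_def indexed_partition_def)

lemma derived: "p \<in> P \<Longrightarrow> X derived_set_of (B p) = (\<Union>q\<in>{q\<in>P. lt q p}. B q)"
  using part by (auto simp: complete_partition_def)

lemma disjoint_blocks: "p \<in> P \<Longrightarrow> q \<in> P \<Longrightarrow> x \<in> B p \<Longrightarrow> x \<in> B q \<Longrightarrow> p = q"
proof (rule ccontr)
  assume pq: "p \<in> P" "q \<in> P" "x \<in> B p" "x \<in> B q" "p \<noteq> q"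
  then have "B p \<noteq> B q" using indexed(2) by (auto simp: inj_on_def)
  then have "B p \<inter> B q = {}" using partition_onD2[OF indexed(1)] pq(1,2) unfolding disjoint_def by blast
  then show False using pq by blast
qed

sublocale cpart CO "topspace X" P lt B
proof
  show "A \<subseteq> topspace X" if "A \<in> CO" for A using that by (auto simp: CO_def dest: openin_subset)
  show "{} \<in> CO" by (simp add: CO_def)
  show "A \<union> D \<in> CO" if "A \<in> CO" "D \<in> CO" for A D using that by (simp add: CO_def openin_Un compactin_Un)
  show "A - D \<in> CO" if AD: "A \<in> CO" "D \<in> CO" for A D
  proof -
    have "closedin X A" "closedin X D" using AD compactin_imp_closedin[OF haus] by (auto simp: CO_def)
    then have "openin X (A - D)" "closedin X (A - D)" using AD by (auto simp: CO_def openin_diff closedin_diff)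
    then show ?thesis using AD closed_compactin[of X A "A - D"] by (auto simp: CO_def)
  qed
  show "\<exists>\<D>\<subseteq>\<C>. finite \<D> \<and> A \<subseteq> \<Union>\<D>" if A: "A \<in> CO" "\<C> \<subseteq> CO" "A \<subseteq> \<Union>\<C>" for A \<C>
  proof -
    have "compactin X A" "\<forall>U\<in>\<C>. openin X U" using A by (auto simp: CO_def)
    then show ?thesis using A(3) unfolding compactin_def by blast
  qed
  show "\<exists>A\<in>CO. x \<in> A" if "x \<in> topspace X" for x using base[OF openin_topspace that] by blast
  show "\<exists>A\<in>CO. x \<in> A \<and> y \<notin> A" if xy: "x \<in> topspace X" "y \<in> topspace X" "x \<noteq> y" for x y
  proof -
    obtain U V where "openin X U" "x \<in> U" "y \<in> V" "disjnt U V" using haus xy unfolding Hausdorff_space_def by blast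
    then have "openin X U" "x \<in> U" "y \<notin> U" by (auto simp: disjnt_def)
    then show ?thesis using base by blast
  qed
  show "countable CO" using bij count by (metis bij_betw_imp_surj_on countable_image)
  show "\<exists>p\<in>P. x \<in> B p" if "x \<in> topspace X" for x using that partition_onD1[OF indexed(1)] by auto
  show "p = q" if "p \<in> P" "q \<in> P" "x \<in> B p" "x \<in> B q" for p q x using disjoint_blocks that .
  show "B p \<subseteq> topspace X" if "p \<in> P" for p using that partition_onD1[OF indexed(1)] by auto
  show "B p \<noteq> {}" if "p \<in> P" for p
  proof -
    have "B p \<in> B ` P" using that by blast
    then show ?thesis using partition_onD3[OF indexed(1)] by metis
  qed
  show "lt p q \<longleftrightarrow> (\<forall>A\<in>CO. x \<in> A \<longrightarrow> A \<inter> B q - {x} \<noteq> {})" if p: "p \<in> P" "q \<in> P" "x \<in> B p" for p q x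
  proof -
    have xX: "x \<in> topspace X" using p partition_onD1[OF indexed(1)] by auto
    have "x \<in> X derived_set_of (B q) \<longleftrightarrow> (\<exists>r\<in>P. lt r q \<and> x \<in> B r)" unfolding derived[OF p(2)] by blast
    also have "\<dots> \<longleftrightarrow> lt p q" using disjoint_blocks p by blast
    finally have "lt p q \<longleftrightarrow> (\<forall>U. x \<in> U \<and> openin X U \<longrightarrow> (\<exists>y\<noteq>x. y \<in> B q \<and> y \<in> U))"
      unfolding in_derived_set_of using xX by blast
    also have "\<dots> \<longleftrightarrow> (\<forall>A\<in>CO. x \<in> A \<longrightarrow> A \<inter> B q - {x} \<noteq> {})"
    proof (intro iffI allI ballI impI)
      fix A assume h: "\<forall>U. x \<in> U \<and> openin X U \<longrightarrow> (\<exists>y\<noteq>x. y \<in> B q \<and> y \<in> U)" and A: "A \<in> CO" "x \<in> A"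
      have "openin X A" using A(1) by (simp add: CO_def)
      then obtain y where "y \<noteq> x" "y \<in> B q" "y \<in> A" using h A(2) by blast
      then show "A \<inter> B q - {x} \<noteq> {}" by blast
    next
      fix U assume h: "\<forall>A\<in>CO. x \<in> A \<longrightarrow> A \<inter> B q - {x} \<noteq> {}" and U: "x \<in> U \<and> openin X U"
      obtain A where A: "A \<in> CO" "x \<in> A" "A \<subseteq> U" using base U by blast
      then have "A \<inter> B q - {x} \<noteq> {}" using h by blast
      then show "\<exists>y\<noteq>x. y \<in> B q \<and> y \<in> U" using A(3) by blast
    qed
    finally show ?thesis .
  qed
  show "lt p r" if "p \<in> P" "q \<in> P" "r \<in> P" "lt p q" "lt q r" for p q r
    using PO_sys that unfolding PO_system_def transp_on_def by blast
  show "p = q" if "p \<in> P" "q \<in> P" "lt p q" "lt q p" for p q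
    using PO_sys that unfolding PO_system_def antisymp_on_def by blast
qed

text \<open>In a complete partition, whether a point of a block is a limit of that block depends on
  the block only. So a block is either crowded or consists of isolated points, and
  \<open>lt p p\<close> distinguishes these cases.\<close>

lemma finite_crowded_iff: "finite_crowded X (B ` P) \<longleftrightarrow> finite P \<and> (\<forall>p\<in>P. \<not> lt p p \<longrightarrow> finite (B p))"
proof -
  have "crowded X (B p) \<longleftrightarrow> lt p p" if p: "p \<in> P" for p
  proof
    assume c: "crowded X (B p)"
    show "lt p p"
    proof (rule ccontr)
      assume n: "\<not> lt p p"
      obtain x where x: "x \<in> B p" using block_nonempty[OF p] by blast
      obtain A where A: "A \<in> CO" "x \<in> A" "A \<inter> B p - {x} = {}" using limit_iff[OF p p x] n by blast
      then have "openin X A" "A \<inter> B p = {x}" using x by (auto simp: CO_def)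
      then show False using c x unfolding crowded_def by blast
    qed
  next
    assume l: "lt p p"
    show "crowded X (B p)" unfolding crowded_def
    proof (intro notI, elim bexE exE conjE)
      fix x U assume x: "x \<in> B p" and U: "openin X U" "U \<inter> B p = {x}"
      then obtain A where A: "A \<in> CO" "x \<in> A" "A \<subseteq> U" using base[OF U(1), of x] by blast
      then have "A \<inter> B p - {x} \<noteq> {}" using limit_iff[OF p p x] l by blast
      then show False using A(3) U(2) by blast
    qed
  qed
  moreover have "finite (B ` P) \<longleftrightarrow> finite P" using indexed(2) by (rule finite_image_iff)
  ultimately show ?thesis unfolding finite_crowded_def by blast
qed

lemma ring_iso:
  "pstruct_iso P (ring_with_ideals (\<lambda>p. stone_ideal \<phi> (X closure_of B p))) (ring_struct bare.fld Infty (\<lambda>p. Pt ` B p))"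
  unfolding pstruct_iso_def
proof (intro exI[of _ "\<lambda>a. Pt ` \<phi> a"] conjI ballI)
  have z: "\<phi> 0 = {}" using phi_add[of 0 0] by simp
  have b: "bij_betw (\<lambda>a. Pt ` \<phi> a) UNIV {A \<in> bare.fld. Infty \<notin> A}"
    using bij_betw_trans[OF bij bare_bij] by (simp add: o_def)
  then show "bij_betw (\<lambda>a. Pt ` \<phi> a) (univ (ring_with_ideals (\<lambda>p. stone_ideal \<phi> (X closure_of B p))))
      (univ (ring_struct bare.fld Infty (\<lambda>p. Pt ` B p)))" by (simp add: ring_with_ideals_def)
  show "Pt ` \<phi> (zer (ring_with_ideals (\<lambda>p. stone_ideal \<phi> (X closure_of B p)))) =
      zer (ring_struct bare.fld Infty (\<lambda>p. Pt ` B p))" by (simp add: ring_with_ideals_def z)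
  have inj: "inj Pt" by (simp add: inj_def)
  fix a c :: 'r
  show "Pt ` \<phi> (add (ring_with_ideals (\<lambda>p. stone_ideal \<phi> (X closure_of B p))) a c) =
      add (ring_struct bare.fld Infty (\<lambda>p. Pt ` B p)) (Pt ` \<phi> a) (Pt ` \<phi> c)"
    by (simp add: ring_with_ideals_def phi_add image_Un image_set_diff[OF inj])
  show "Pt ` \<phi> (mul (ring_with_ideals (\<lambda>p. stone_ideal \<phi> (X closure_of B p))) a c) =
      mul (ring_struct bare.fld Infty (\<lambda>p. Pt ` B p)) (Pt ` \<phi> a) (Pt ` \<phi> c)"
    by (simp add: ring_with_ideals_def phi_mult image_Int[OF inj])
next
  fix p a assume p: "p \<in> P"
  have "\<phi> a \<in> CO" using bij_betwE[OF bij] by blast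
  then have "openin X (\<phi> a)" "Pt ` \<phi> a \<in> bare.fld" "Infty \<notin> Pt ` \<phi> a"
    using bij_betwE[OF bare_bij] by (auto simp: CO_def)
  moreover have "Pt ` \<phi> a \<inter> Pt ` B p = {} \<longleftrightarrow> \<phi> a \<inter> B p = {}" by auto
  ultimately show "a \<in> pred (ring_with_ideals (\<lambda>p. stone_ideal \<phi> (X closure_of B p))) p \<longleftrightarrow>
      Pt ` \<phi> a \<in> pred (ring_struct bare.fld Infty (\<lambda>p. Pt ` B p)) p"
    by (simp add: ring_with_ideals_def stone_ideal_def openin_Int_closure_of_eq_empty)
qed

end

lemma omega_categorical_iso:
  assumes M: "is_pstruct P M" and iso: "pstruct_iso P M N" and oc: "omega_categorical P M"
  shows "omega_categorical P N"
proof -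
  have "Th P N = Th P M" using pstruct_iso_imp_elem_equiv[OF M iso] by (auto simp: elem_equiv_def Th_def)
  moreover have "countable (univ N)"
  proof -
    obtain h where "bij_betw h (univ M) (univ N)" using iso unfolding pstruct_iso_def by blast
    then have "univ N = h ` univ M" by (simp add: bij_betw_imp_surj_on)
    then show ?thesis using oc by (simp add: omega_categorical_def)
  qed
  ultimately show ?thesis using oc unfolding omega_categorical_def by simp
qed

theorem theorem2:
  fixes X :: "'x topology"
    and \<phi> :: "'r::boolean_ring \<Rightarrow> 'x set"
    and P :: "'p set"
    and lt :: "'p \<Rightarrow> 'p \<Rightarrow> bool"
    and B :: "'p \<Rightarrow> 'x set"
  assumes "countable (UNIV :: 'r set)"
    and "stone_space X \<phi>"
    and "PO_system P lt"
    and "complete_partition X P lt B"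
  shows "omega_categorical P (ring_with_ideals (\<lambda>p. stone_ideal \<phi> (X closure_of B p)))
         \<longleftrightarrow> finite_crowded X (B ` P)"
proof -
  interpret stone_partition X \<phi> P lt B using assms by unfold_locales
  let ?M = "ring_with_ideals (\<lambda>p. stone_ideal \<phi> (X closure_of B p))"
  let ?N = "ring_struct bare.fld Infty (\<lambda>p. Pt ` B p)"
  have M: "is_pstruct P ?M" by (simp add: is_pstruct_def ring_with_ideals_def)
  have N: "is_pstruct P ?N" using is_pstruct_ring_struct bare.algebra_axioms .
  have "omega_categorical P ?M \<longleftrightarrow> omega_categorical P ?N"
    using omega_categorical_iso[OF M ring_iso] omega_categorical_iso[OF N pstruct_iso_sym[OF M ring_iso]] by blast
  then show ?thesis using omega_categorical_iff finite_crowded_iff by simp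
qed

end
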